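(* Let $(\mathcal{A},\mathcal{G},\alpha)$ be a discrete dynamical system and assume that $\mathcal{A}$ has a contractive approximate unit $\{e_i\}_{i\in\mathbb{I}}$ consisting of selfadjoint operators. Then $$\mathrm{C}^*_{\text{env}}(\mathcal{A}\rtimes_\alpha^r\mathcal{G})\;\simeq\;\mathrm{C}^*_{\text{env}}(\mathcal{A})\rtimes_\alpha^r\mathcal{G}.$$ In particular, if $\mathcal{G}$ is discrete and amenable, then $$\mathrm{C}^*_{\text{env}}(\mathcal{A}\rtimes_\alpha\mathcal{G})\;\simeq\;\mathrm{C}^*_{\text{env}}(\mathcal{A})\rtimes_\alpha\mathcal{G}.$$
   Context: All operator algebras (not necessarily selfadjoint) are assumed to be approximately unital, i.e. to have a contractive approximate unit. All groups are discrete. The symbol $\simeq$ denotes $*$-isomorphism of $\mathrm{C}^*$-algebras. A $\mathrm{C}^*$-cover $(\mathcal{C},j)$ of an operator algebra $\mathcal{A}$ is a $\mathrm{C}^*$-algebra $\mathcal{C}$ with a completely isometric homomorphism $j:\mathcal{A}\to\mathcal{C}$ such that $\mathcal{C}=\mathrm{C}^*(j(\mathcal{A}))$. The $\mathrm{C}^*$-envelope $\mathrm{C}^*_{\text{env}}(\mathcal{A})=(\mathrm{C}^*_{\text{env}}(\mathcal{A}),j)$ is the $\mathrm{C}^*$-cover such that for any $\mathrm{C}^*$-cover $(\mathcal{C},i)$ of $\mathcal{A}$ there is a $*$-epimorphism $\varphi:\mathcal{C}\to\mathrm{C}^*_{\text{env}}(\mathcal{A})$ with $\varphi\circ i=j$.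 The maximal $\mathrm{C}^*$-algebra $\mathrm{C}^*_{\text{max}}(\mathcal{A})=(\mathrm{C}^*_{\text{max}}(\mathcal{A}),j)$ is the $\mathrm{C}^*$-cover such that every completely contractive homomorphism $\pi:\mathcal{A}\to\mathcal{C}$ into a $\mathrm{C}^*$-algebra factors as $\pi=\varphi\circ j$ for a $*$-homomorphism $\varphi:\mathrm{C}^*_{\text{max}}(\mathcal{A})\to\mathcal{C}$. A discrete dynamical system $(\mathcal{A},\mathcal{G},\alpha)$ consists of an approximately unital operator algebra $\mathcal{A}$, a discrete group $\mathcal{G}$, and a group homomorphism $\alpha:\mathcal{G}\to\operatorname{Aut}\mathcal{A}$ into the completely isometric automorphisms of $\mathcal{A}$. A $\mathrm{C}^*$-cover $(\mathcal{C},j)$ is $\alpha$-admissible if there is a group homomorphism $\mathcal{G}\to\operatorname{Aut}(\mathcal{C})$, again denoted $\alpha$, extending $s\mapsto j\circ\alpha_s\circ j^{-1}\in\operatorname{Aut}(j(\mathcal{A}))$. Both $\mathrm{C}^*_{\text{env}}(\mathcal{A})$ and $\mathrm{C}^*_{\text{max}}(\mathcal{A})$ are $\alpha$-admissible. For an $\alpha$-admissible cover $(\mathcal{C},j)$, the relative crossed products $\mathcal{A}\rtimes_{\mathcal{C},j,\alpha}\mathcal{G}$ and $\mathcal{A}\rtimes^r_{\mathcal{C},j,\alpha}\mathcal{G}$ are the norm-closed subalgebras of the full and reduced $\mathrm{C}^*$-crossed products $\mathcal{C}\rtimes_\alpha\mathcal{G}$ and $\mathcal{C}\rtimes_\alpha^r\mathcal{G}$,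 respectively, generated by all finite sums $\sum_{g\in\mathcal{G}}a_gu_g$, with $a_g\in\mathcal{A}$ (identified with $j(\mathcal{A})$) and $u_g$ the universal unitaries implementing $\alpha_g$. The reduced relative crossed products for all $\alpha$-admissible covers coincide canonically (via completely isometric isomorphisms), and the common algebra is denoted $\mathcal{A}\rtimes_\alpha^r\mathcal{G}$. The full crossed product is $\mathcal{A}\rtimes_\alpha\mathcal{G}:=\mathcal{A}\rtimes_{\mathrm{C}^*_{\text{max}}(\mathcal{A}),\alpha}\mathcal{G}$. *)

theory Defs
  imports "HOL-Analysis.Analysis"
begin

section \<open>Complex Hilbert spaces\<close>

class complex_vector = real_vector +
  fixes scaleC :: "complex \<Rightarrow> 'a \<Rightarrow> 'a" (infixr \<open>*\<^sub>C\<close> 75)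
  assumes scaleC_add_right: "c *\<^sub>C (x + y) = c *\<^sub>C x + c *\<^sub>C y"
    and scaleC_add_left: "(c + d) *\<^sub>C x = c *\<^sub>C x + d *\<^sub>C x"
    and scaleC_scaleC: "c *\<^sub>C d *\<^sub>C x = (c * d) *\<^sub>C x"
    and scaleC_of_real: "complex_of_real r *\<^sub>C x = r *\<^sub>R x"

text \<open>The norm is the one of the underlying real inner product; the complex inner product is
  linear in the first argument.\<close>

class complex_hilbert = complex_vector + real_inner + complete_space +
  fixes cinner :: "'a \<Rightarrow> 'a \<Rightarrow> complex"
  assumes cinner_commute: "cinner x y = cnj (cinner y x)"
    and cinner_add_left: "cinner (x + y) z = cinner x z + cinner y z"
    and cinner_scaleC_left: "cinner (c *\<^sub>C x) y = c * cinner x y"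
    and Re_cinner: "Re (cinner x y) = inner x y"

subclass (in complex_hilbert) banach ..

lemma cinner_scaleC_right: "cinner x (c *\<^sub>C y) = cnj c * cinner x y"
  for x y :: "'a::complex_hilbert"
  by (metis cinner_commute cinner_scaleC_left complex_cnj_mult)

lemma norm_scaleC: "norm (c *\<^sub>C x) = cmod c * norm x" for x :: "'a::complex_hilbert"
proof -
  have "(norm (c *\<^sub>C x))\<^sup>2 = Re (cinner (c *\<^sub>C x) (c *\<^sub>C x))"
    by (simp add: Re_cinner dot_square_norm)
  also have "cinner (c *\<^sub>C x) (c *\<^sub>C x) = of_real ((cmod c)\<^sup>2) * cinner x x"
    by (simp add: cinner_scaleC_left cinner_scaleC_right complex_norm_square
        flip: mult.assoc del: of_real_power)
  also have "Re \<dots> = (cmod c)\<^sup>2 * (norm x)\<^sup>2"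
    by (simp add: Re_cinner dot_square_norm del: of_real_power)
  finally show ?thesis
    by (metis norm_ge_zero power2_eq_imp_eq power_mult_distrib zero_le_mult_iff)
qed

lemma scaleC_scaleR: "c *\<^sub>C r *\<^sub>R x = r *\<^sub>R c *\<^sub>C x" for x :: "'a::complex_vector"
proof -
  have "c *\<^sub>C r *\<^sub>R x = (c * complex_of_real r) *\<^sub>C x"
    by (simp only: scaleC_of_real[symmetric] scaleC_scaleC)
  also have "\<dots> = (complex_of_real r * c) *\<^sub>C x" by (simp only: mult.commute)
  also have "\<dots> = r *\<^sub>R c *\<^sub>C x"
    by (simp only: scaleC_of_real[symmetric] scaleC_scaleC)
  finally show ?thesis .
qed

lemma scaleC_zero_right [simp]: "c *\<^sub>C 0 = (0 :: 'a::complex_vector)"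
  using scaleC_scaleR[of c 0 0] by simp

lemma scaleC_minus_right: "c *\<^sub>C (- x) = - (c *\<^sub>C x)" for x :: "'a::complex_vector"
  using scaleC_scaleR[of c "- 1" x] by simp

lemma scaleC_diff_right: "c *\<^sub>C (x - y) = c *\<^sub>C x - c *\<^sub>C y" for x y :: "'a::complex_vector"
  using scaleC_add_right[of c x "- y"] by (simp add: scaleC_minus_right)

lemma bounded_linear_scaleC: "bounded_linear (\<lambda>x. c *\<^sub>C (x::'a::complex_hilbert))"
proof (rule bounded_linear_intro[where K="cmod c"])
qed (simp_all add: scaleC_add_right norm_scaleC scaleC_scaleR)

instantiation complex :: complex_hilbert
begin

definition "scaleC = (\<lambda>(c::complex) x. c * x)"
definition "cinner = (\<lambda>(x::complex) y. x * cnj y)"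

instance
  by standard (auto simp: scaleC_complex_def cinner_complex_def algebra_simps inner_complex_def
      scaleR_conv_of_real)

end

subsection \<open>Hilbert direct sums of copies of a Hilbert space\<close>

typedef (overloaded) ('g, 'h::complex_hilbert) l2 =
  "{f :: 'g \<Rightarrow> 'h. (\<lambda>t. (norm (f t))\<^sup>2) summable_on UNIV}"
  by (rule exI[of _ "\<lambda>_. 0"]) simp

setup_lifting type_definition_l2

lemma square_summable_add:
  fixes f h :: "'g \<Rightarrow> 'h::real_normed_vector"
  assumes "(\<lambda>t. (norm (f t))\<^sup>2) summable_on UNIV" "(\<lambda>t. (norm (h t))\<^sup>2) summable_on UNIV"
  shows "(\<lambda>t. (norm (f t + h t))\<^sup>2) summable_on UNIV"
proof (rule summable_on_comparison_test)
  show "(\<lambda>t. 2 * (norm (f t))\<^sup>2 + 2 * (norm (h t))\<^sup>2) summable_on UNIV"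
    by (intro summable_on_add summable_on_cmult_right assms)
  fix t
  have "(norm (f t + h t))\<^sup>2 \<le> (norm (f t) + norm (h t))\<^sup>2"
    by (intro power_mono norm_triangle_ineq) auto
  also have "\<dots> \<le> 2 * (norm (f t))\<^sup>2 + 2 * (norm (h t))\<^sup>2"
    using sum_squares_bound[of "norm (f t)" "norm (h t)"] by (simp add: power2_sum)
  finally show "(norm (f t + h t))\<^sup>2 \<le> 2 * (norm (f t))\<^sup>2 + 2 * (norm (h t))\<^sup>2" .
qed auto

lemma square_summable_bound:
  fixes f :: "'g \<Rightarrow> 'h::real_normed_vector" and h :: "'g \<Rightarrow> 'k::real_normed_vector"
  assumes "(\<lambda>t. (norm (f t))\<^sup>2) summable_on UNIV" "\<And>t. norm (h t) \<le> K * norm (f t)"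
  shows "(\<lambda>t. (norm (h t))\<^sup>2) summable_on UNIV"
proof (rule summable_on_comparison_test)
  show "(\<lambda>t. K\<^sup>2 * (norm (f t))\<^sup>2) summable_on UNIV"
    by (intro summable_on_cmult_right assms)
  show "(norm (h t))\<^sup>2 \<le> K\<^sup>2 * (norm (f t))\<^sup>2" for t
    using power_mono[OF assms(2)[of t], of 2] by (simp add: power_mult_distrib)
qed auto

lemma square_summable_product:
  fixes f h :: "'g \<Rightarrow> 'h::real_normed_vector"
  assumes "(\<lambda>t. (norm (f t))\<^sup>2) summable_on UNIV" "(\<lambda>t. (norm (h t))\<^sup>2) summable_on UNIV"
  shows "(\<lambda>t. norm (f t) * norm (h t)) summable_on UNIV"
proof (rule summable_on_comparison_test)
  show "(\<lambda>t. (norm (f t))\<^sup>2 + (norm (h t))\<^sup>2) summable_on UNIV"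
    by (intro summable_on_add assms)
  show "norm (f t) * norm (h t) \<le> (norm (f t))\<^sup>2 + (norm (h t))\<^sup>2" for t
    using sum_squares_bound[of "norm (f t)" "norm (h t)"]
      mult_nonneg_nonneg[OF norm_ge_zero norm_ge_zero, of "f t" "h t"] by linarith
qed auto

instantiation l2 :: (type, complex_hilbert) complex_vector
begin

lift_definition zero_l2 :: "('a, 'b) l2" is "\<lambda>_. 0" by simp
lift_definition plus_l2 :: "('a, 'b) l2 \<Rightarrow> ('a, 'b) l2 \<Rightarrow> ('a, 'b) l2"
  is "\<lambda>f h t. f t + h t" by (rule square_summable_add)
lift_definition uminus_l2 :: "('a, 'b) l2 \<Rightarrow> ('a, 'b) l2" is "\<lambda>f t. - f t" by simp
lift_definition minus_l2 :: "('a, 'b) l2 \<Rightarrow> ('a, 'b) l2 \<Rightarrow> ('a, 'b) l2"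
  is "\<lambda>f h t. f t - h t"
  subgoal for f h using square_summable_add[of f "\<lambda>t. - h t"] by simp
  done
lift_definition scaleR_l2 :: "real \<Rightarrow> ('a, 'b) l2 \<Rightarrow> ('a, 'b) l2" is "\<lambda>r f t. r *\<^sub>R f t"
  subgoal for r f by (rule square_summable_bound[of f _ "\<bar>r\<bar>"]) auto
  done
lift_definition scaleC_l2 :: "complex \<Rightarrow> ('a, 'b) l2 \<Rightarrow> ('a, 'b) l2" is "\<lambda>c f t. c *\<^sub>C f t"
  subgoal for c f by (rule square_summable_bound[of f _ "cmod c"]) (auto simp: norm_scaleC)
  done

instance
  by standard
    (transfer; simp add: fun_eq_iff add.assoc add.left_commute add.commute scaleR_add_left scaleR_add_right
      scaleC_add_right scaleC_add_left scaleC_scaleC scaleC_of_real)+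

end

lemma summable_on_inner:
  fixes f h :: "'g \<Rightarrow> 'h::real_inner"
  assumes "(\<lambda>t. (norm (f t))\<^sup>2) summable_on UNIV" "(\<lambda>t. (norm (h t))\<^sup>2) summable_on UNIV"
  shows "(\<lambda>t. inner (f t) (h t)) summable_on UNIV"
  by (rule abs_summable_summable, rule summable_on_comparison_test[OF square_summable_product[OF assms]])
     (auto intro: Cauchy_Schwarz_ineq2)

lemma norm_cinner_le: "cmod (cinner x y) \<le> norm x * norm y" for x y :: "'a::complex_hilbert"
proof (cases "cinner x y = 0")
  case False
  define c where "c = cnj (cinner x y) / of_real (cmod (cinner x y))"
  have c: "cmod c = 1" using False by (simp add: c_def norm_divide)
  have "cinner (c *\<^sub>C x) y = of_real ((cmod (cinner x y))\<^sup>2) / of_real (cmod (cinner x y))"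
    unfolding cinner_scaleC_left c_def complex_norm_square by simp
  also have "\<dots> = of_real (cmod (cinner x y))"
    by (simp add: power2_eq_square)
  finally have "cinner (c *\<^sub>C x) y = of_real (cmod (cinner x y))" .
  hence "cmod (cinner x y) = inner (c *\<^sub>C x) y"
    by (metis Re_cinner Re_complex_of_real)
  also have "\<dots> \<le> norm (c *\<^sub>C x) * norm y" by (rule norm_cauchy_schwarz)
  finally show ?thesis by (simp add: norm_scaleC c)
qed simp

lemma summable_on_cinner:
  fixes f h :: "'g \<Rightarrow> 'h::complex_hilbert"
  assumes "(\<lambda>t. (norm (f t))\<^sup>2) summable_on UNIV" "(\<lambda>t. (norm (h t))\<^sup>2) summable_on UNIV"
  shows "(\<lambda>t. cinner (f t) (h t)) summable_on UNIV"
  by (rule abs_summable_summable, rule summable_on_comparison_test[OF square_summable_product[OF assms]])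
     (auto intro: norm_cinner_le)

instantiation l2 :: (type, complex_hilbert) real_inner
begin

lift_definition inner_l2 :: "('a, 'b) l2 \<Rightarrow> ('a, 'b) l2 \<Rightarrow> real"
  is "\<lambda>f h. infsum (\<lambda>t. inner (f t) (h t)) UNIV" .
definition norm_l2 :: "('a, 'b) l2 \<Rightarrow> real" where "norm_l2 x = sqrt (inner x x)"
definition sgn_l2 :: "('a, 'b) l2 \<Rightarrow> ('a, 'b) l2" where "sgn_l2 x = x /\<^sub>R norm x"
definition dist_l2 :: "('a, 'b) l2 \<Rightarrow> ('a, 'b) l2 \<Rightarrow> real" where "dist_l2 x y = norm (x - y)"
definition uniformity_l2 :: "(('a, 'b) l2 \<times> ('a, 'b) l2) filter"
  where "uniformity_l2 = (INF e\<in>{0<..}. principal {(x, y). dist x y < e})"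
definition open_l2 :: "('a, 'b) l2 set \<Rightarrow> bool"
  where "open_l2 U \<longleftrightarrow> (\<forall>x\<in>U. \<forall>\<^sub>F (x', y) in uniformity. x' = x \<longrightarrow> y \<in> U)"

instance
proof
  fix x y z :: "('a, 'b) l2" and r :: real
  show "inner x y = inner y x"
    by transfer (simp add: inner_commute)
  show "inner (x + y) z = inner x z + inner y z"
    by transfer (auto simp: inner_add_left intro!: infsum_add summable_on_inner)
  show "inner (r *\<^sub>R x) y = r * inner x y"
    by transfer (simp add: infsum_cmult_right')
  show "0 \<le> inner x x"
    by transfer (auto intro: infsum_nonneg)
  show "inner x x = 0 \<longleftrightarrow> x = 0"
  proof transfer
    fix f :: "'a \<Rightarrow> 'b"
    assume f: "(\<lambda>t. (norm (f t))\<^sup>2) summable_on UNIV"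
    have s: "(\<lambda>t. inner (f t) (f t)) summable_on UNIV" using f f by (rule summable_on_inner)
    show "infsum (\<lambda>t. inner (f t) (f t)) UNIV = 0 \<longleftrightarrow> f = (\<lambda>_. 0)"
    proof
      assume "infsum (\<lambda>t. inner (f t) (f t)) UNIV = 0"
      hence "inner (f t) (f t) = 0" for t
        using nonneg_infsum_le_0D[of "\<lambda>t. inner (f t) (f t)" UNIV t] s by simp
      thus "f = (\<lambda>_. 0)" by (simp add: fun_eq_iff)
    qed simp
  qed
qed (rule norm_l2_def sgn_l2_def dist_l2_def uniformity_l2_def open_l2_def)+

end

lemma norm_l2_square: "(norm x)\<^sup>2 = infsum (\<lambda>t. (norm (Rep_l2 x t))\<^sup>2) UNIV"
proof -
  have "(norm x)\<^sup>2 = inner x x" by (simp add: dot_square_norm)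
  thus ?thesis by (simp add: inner_l2.rep_eq dot_square_norm)
qed

lemma Rep_l2_summable: "(\<lambda>t. (norm (Rep_l2 x t))\<^sup>2) summable_on UNIV"
  using Rep_l2 by blast

lemma sum_le_norm_l2: "finite S \<Longrightarrow> (\<Sum>t\<in>S. (norm (Rep_l2 x t))\<^sup>2) \<le> (norm x)\<^sup>2"
  unfolding norm_l2_square by (intro finite_sum_le_infsum Rep_l2_summable) auto

lemma norm_Rep_l2_le: "norm (Rep_l2 x t) \<le> norm x"
  by (rule power2_le_imp_le) (use sum_le_norm_l2[of "{t}" x] in auto)

instance l2 :: (type, complex_hilbert) complete_space
proof
  fix X :: "nat \<Rightarrow> ('a, 'b) l2"
  assume X: "Cauchy X"
  have "Cauchy (\<lambda>n. Rep_l2 (X n) t)" for t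
  proof (rule metric_CauchyI)
    fix e :: real assume "e > 0"
    then obtain N where N: "\<forall>m\<ge>N. \<forall>n\<ge>N. dist (X m) (X n) < e"
      using X unfolding Cauchy_def by blast
    have "dist (Rep_l2 (X m) t) (Rep_l2 (X n) t) \<le> dist (X m) (X n)" for m n
      using norm_Rep_l2_le[of "X m - X n" t] by (simp add: dist_norm minus_l2.rep_eq)
    thus "\<exists>N. \<forall>m\<ge>N. \<forall>n\<ge>N. dist (Rep_l2 (X m) t) (Rep_l2 (X n) t) < e"
      using N by (meson le_less_trans)
  qed
  hence "\<exists>l. (\<lambda>n. Rep_l2 (X n) t) \<longlonglongrightarrow> l" for t
    using Cauchy_convergent convergent_def by blast
  then obtain x where x: "\<And>t. (\<lambda>n. Rep_l2 (X n) t) \<longlonglongrightarrow> x t" by metis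
  have key: "\<exists>N. \<forall>m\<ge>N. \<forall>S. finite S \<longrightarrow> (\<Sum>t\<in>S. (norm (Rep_l2 (X m) t - x t))\<^sup>2) \<le> e\<^sup>2"
    if "e > 0" for e :: real
  proof -
    obtain N where N: "\<forall>m\<ge>N. \<forall>n\<ge>N. dist (X m) (X n) < e"
      using X \<open>e > 0\<close> unfolding Cauchy_def by blast
    have "(\<Sum>t\<in>S. (norm (Rep_l2 (X m) t - x t))\<^sup>2) \<le> e\<^sup>2" if "m \<ge> N" "finite S" for m S
    proof (rule LIMSEQ_le_const2)
      show "(\<lambda>n. \<Sum>t\<in>S. (norm (Rep_l2 (X m) t - Rep_l2 (X n) t))\<^sup>2)
        \<longlonglongrightarrow> (\<Sum>t\<in>S. (norm (Rep_l2 (X m) t - x t))\<^sup>2)"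
        by (intro tendsto_intros x)
      have "(\<Sum>t\<in>S. (norm (Rep_l2 (X m) t - Rep_l2 (X n) t))\<^sup>2) \<le> e\<^sup>2" if "n \<ge> N" for n
      proof -
        have "(\<Sum>t\<in>S. (norm (Rep_l2 (X m) t - Rep_l2 (X n) t))\<^sup>2) \<le> (norm (X m - X n))\<^sup>2"
          using sum_le_norm_l2[OF \<open>finite S\<close>, of "X m - X n"] by (simp add: minus_l2.rep_eq)
        also have "\<dots> \<le> e\<^sup>2"
          using N \<open>m \<ge> N\<close> \<open>n \<ge> N\<close> by (intro power_mono) (auto simp: dist_norm less_imp_le)
        finally show ?thesis .
      qed
      thus "\<exists>N. \<forall>n\<ge>N. (\<Sum>t\<in>S. (norm (Rep_l2 (X m) t - Rep_l2 (X n) t))\<^sup>2) \<le> e\<^sup>2" by blast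
    qed
    thus ?thesis by blast
  qed
  have diff: "(\<lambda>t. (norm (Rep_l2 (X m) t - x t))\<^sup>2) summable_on UNIV"
    if "\<forall>S. finite S \<longrightarrow> (\<Sum>t\<in>S. (norm (Rep_l2 (X m) t - x t))\<^sup>2) \<le> e\<^sup>2" for m e
    using that by (intro nonneg_bdd_above_summable_on bdd_aboveI2[where M="e\<^sup>2"]) auto
  obtain m where "\<forall>S. finite S \<longrightarrow> (\<Sum>t\<in>S. (norm (Rep_l2 (X m) t - x t))\<^sup>2) \<le> 1\<^sup>2"
    using key[OF zero_less_one] by blast
  note m = diff[OF this]
  have "(\<lambda>t. (norm (Rep_l2 (X m) t + (x t - Rep_l2 (X m) t)))\<^sup>2) summable_on UNIV"
    by (rule square_summable_add[OF Rep_l2_summable])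
       (use m in \<open>simp only: norm_minus_commute[of "x _"]\<close>)
  hence "(\<lambda>t. (norm (x t))\<^sup>2) summable_on UNIV" by simp
  then obtain y where y: "Rep_l2 y = x"
    by (metis (mono_tags, lifting) Abs_l2_inverse mem_Collect_eq)
  have "X \<longlonglongrightarrow> y"
  proof (rule metric_LIMSEQ_I)
    fix r :: real assume "r > 0"
    hence "r/2 > 0" by simp
    from key[OF this] obtain N where N: "\<forall>m\<ge>N. \<forall>S. finite S \<longrightarrow>
        (\<Sum>t\<in>S. (norm (Rep_l2 (X m) t - x t))\<^sup>2) \<le> (r/2)\<^sup>2"
      by blast
    have "dist (X m) y < r" if "m \<ge> N" for m
    proof -
      have "(norm (X m - y))\<^sup>2 \<le> (r/2)\<^sup>2"
        unfolding norm_l2_square minus_l2.rep_eq y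
        using N that diff[of m "r/2"] by (intro infsum_le_finite_sums) auto
      hence "norm (X m - y) \<le> r/2" by (rule power2_le_imp_le) (use \<open>r > 0\<close> in simp)
      thus ?thesis using \<open>r > 0\<close> by (simp add: dist_norm)
    qed
    thus "\<exists>N. \<forall>n\<ge>N. dist (X n) y < r" by blast
  qed
  thus "convergent X" by (rule convergentI)
qed

instantiation l2 :: (type, complex_hilbert) complex_hilbert
begin

lift_definition cinner_l2 :: "('a, 'b) l2 \<Rightarrow> ('a, 'b) l2 \<Rightarrow> complex"
  is "\<lambda>f h. infsum (\<lambda>t. cinner (f t) (h t)) UNIV" .

instance
proof
  fix x y z :: "('a, 'b) l2" and c :: complex
  show "cinner x y = cnj (cinner y x)"
    by transfer (unfold infsum_cnj[symmetric] cinner_commute[symmetric], rule refl)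
  show "cinner (x + y) z = cinner x z + cinner y z"
    by transfer (auto simp: cinner_add_left intro!: infsum_add summable_on_cinner)
  show "cinner (c *\<^sub>C x) y = c * cinner x y"
    by transfer (simp add: cinner_scaleC_left infsum_cmult_right')
  show "Re (cinner x y) = inner x y"
    by transfer (subst infsum_Re[symmetric], auto intro: summable_on_cinner simp: Re_cinner)
qed

end

section \<open>Bounded operators\<close>

typedef (overloaded) 'h bop =
  "{T :: 'h::complex_hilbert \<Rightarrow> 'h. bounded_linear T \<and> (\<forall>c x. T (c *\<^sub>C x) = c *\<^sub>C T x)}"
  morphisms op_apply Bop
  by (rule exI[of _ "\<lambda>_. 0"]) (simp add: bounded_linear_zero)

setup_lifting type_definition_bop

instantiation bop :: (complex_hilbert) "{complex_vector, monoid_mult}"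
begin

lift_definition zero_bop :: "'a bop" is "\<lambda>_. 0"
  by (simp add: bounded_linear_zero)
lift_definition one_bop :: "'a bop" is "\<lambda>x. x" by (simp add: bounded_linear_ident)
lift_definition plus_bop :: "'a bop \<Rightarrow> 'a bop \<Rightarrow> 'a bop" is "\<lambda>S T x. S x + T x"
  by (simp add: bounded_linear_add scaleC_add_right)
lift_definition uminus_bop :: "'a bop \<Rightarrow> 'a bop" is "\<lambda>T x. - T x"
  by (simp add: bounded_linear_minus scaleC_minus_right)
lift_definition minus_bop :: "'a bop \<Rightarrow> 'a bop \<Rightarrow> 'a bop" is "\<lambda>S T x. S x - T x"
  by (simp add: bounded_linear_sub scaleC_diff_right)
lift_definition times_bop :: "'a bop \<Rightarrow> 'a bop \<Rightarrow> 'a bop" is "\<lambda>S T x. S (T x)"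
  by (simp add: bounded_linear_compose)
lift_definition scaleR_bop :: "real \<Rightarrow> 'a bop \<Rightarrow> 'a bop" is "\<lambda>r T x. r *\<^sub>R T x"
  by (simp add: bounded_linear_const_scaleR scaleC_scaleR)
lift_definition scaleC_bop :: "complex \<Rightarrow> 'a bop \<Rightarrow> 'a bop" is "\<lambda>c T x. c *\<^sub>C T x"
  by (simp add: bounded_linear_compose[OF bounded_linear_scaleC] scaleC_scaleC mult.commute)
instance
  by standard
    (transfer; simp add: fun_eq_iff add.assoc add.left_commute add.commute scaleR_add_left scaleR_add_right
      scaleC_add_right scaleC_add_left scaleC_scaleC scaleC_of_real)+

end

instantiation bop :: (complex_hilbert) real_normed_algebra
begin

lift_definition norm_bop :: "'a bop \<Rightarrow> real" is onorm .
definition sgn_bop :: "'a bop \<Rightarrow> 'a bop" where "sgn_bop T = T /\<^sub>R norm T"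
definition dist_bop :: "'a bop \<Rightarrow> 'a bop \<Rightarrow> real" where "dist_bop S T = norm (S - T)"
definition uniformity_bop :: "('a bop \<times> 'a bop) filter"
  where "uniformity_bop = (INF e\<in>{0<..}. principal {(x, y). dist x y < e})"
definition open_bop :: "'a bop set \<Rightarrow> bool"
  where "open_bop U \<longleftrightarrow> (\<forall>x\<in>U. \<forall>\<^sub>F (x', y) in uniformity. x' = x \<longrightarrow> y \<in> U)"

instance
proof
  fix R S T :: "'a bop" and r :: real
  show "norm T = 0 \<longleftrightarrow> T = 0" by transfer (simp add: onorm_eq_0 fun_eq_iff)
  show "norm (S + T) \<le> norm S + norm T" by transfer (simp add: onorm_triangle)
  show "norm (r *\<^sub>R T) = \<bar>r\<bar> * norm T" by transfer (simp add: onorm_scaleR)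
  show "norm (S * T) \<le> norm S * norm T"
    by transfer (use onorm_compose in \<open>auto simp: o_def\<close>)
  show "(R + S) * T = R * T + S * T" by transfer simp
  show "R * (S + T) = R * S + R * T"
    by transfer (simp add: fun_eq_iff linear_add bounded_linear.linear)
  show "(r *\<^sub>R S) * T = r *\<^sub>R (S * T)" by transfer simp
  show "S * (r *\<^sub>R T) = r *\<^sub>R (S * T)"
    by transfer (simp add: fun_eq_iff linear_scale bounded_linear.linear)
qed (rule sgn_bop_def dist_bop_def uniformity_bop_def open_bop_def)+

end

text \<open>The adjoint exists by the Riesz representation theorem; the characteristic property
  is \<open>cinner_adj\<close> below.\<close>

definition adj :: "'h::complex_hilbert bop \<Rightarrow> 'h bop"
  where "adj T = (THE S. \<forall>x y. cinner (op_apply T x) y = cinner x (op_apply S y))"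

lemma riesz_representation:
  fixes f :: "'a::{real_inner, complete_space} \<Rightarrow> real"
  assumes "bounded_linear f"
  shows "\<exists>z. \<forall>x. f x = inner x z"
proof -
  interpret bounded_linear f by fact
  obtain K where K: "\<And>x. \<bar>f x\<bar> \<le> norm x * K" using bounded by auto
  define g where "g x = (norm x)\<^sup>2 - 2 * f x" for x
  have lower: "- K\<^sup>2 \<le> g x" for x
  proof -
    have "2 * f x \<le> 2 * (norm x * K)" using K[of x] by simp
    moreover have "0 \<le> (norm x - K)\<^sup>2" by simp
    ultimately show ?thesis by (simp add: g_def power2_diff)
  qed
  define m where "m = Inf (range g)"
  have bdd: "bdd_below (range g)" using lower by (intro bdd_belowI2)
  have m_le: "m \<le> g x" for x unfolding m_def by (intro cInf_lower bdd) auto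
  have "\<exists>x. g x < m + inverse (real (Suc n))" for n
  proof -
    have "\<exists>y\<in>range g. y < m + inverse (real (Suc n))"
      unfolding m_def
      by (subst cInf_less_iff[symmetric]) (use bdd in auto)
    thus ?thesis by auto
  qed
  then obtain y where y: "\<And>n. g (y n) < m + inverse (real (Suc n))" by metis
  have par: "(norm (u - v))\<^sup>2 \<le> 2 * (g u - m) + 2 * (g v - m)" for u v
  proof -
    define w where "w = (1/2) *\<^sub>R (u + v)"
    have "(norm (u - v))\<^sup>2 = 2 * g u + 2 * g v - 4 * g w"
      by (simp add: g_def w_def power_mult_distrib power2_norm_eq_inner scaleR add inner_add_left
          inner_add_right inner_diff_left inner_diff_right inner_commute[of v u] algebra_simps)
    thus ?thesis using m_le[of w] by simp
  qed
  have "Cauchy y"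
  proof (rule metric_CauchyI)
    fix e :: real assume "e > 0"
    hence "e\<^sup>2 / 4 > 0" by simp
    then obtain N where N: "inverse (real (Suc N)) < e\<^sup>2 / 4"
      using reals_Archimedean by blast
    have "dist (y p) (y q) < e" if "p \<ge> N" "q \<ge> N" for p q
    proof -
      have "inverse (real (Suc p)) \<le> inverse (real (Suc N))"
        "inverse (real (Suc q)) \<le> inverse (real (Suc N))"
        using that by (auto simp: field_simps)
      hence "g (y p) < m + e\<^sup>2 / 4" "g (y q) < m + e\<^sup>2 / 4"
        using y[of p] y[of q] N
        by (meson add_le_cancel_left le_less_trans less_le_trans less_imp_le)+
      hence "(norm (y p - y q))\<^sup>2 < e\<^sup>2"
        using par[of "y p" "y q"] by argo
      thus ?thesis
        using \<open>e > 0\<close> unfolding dist_norm by (meson less_imp_le power_less_imp_less_base)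
    qed
    thus "\<exists>N. \<forall>p\<ge>N. \<forall>q\<ge>N. dist (y p) (y q) < e" by blast
  qed
  then obtain z where z: "y \<longlonglongrightarrow> z"
    using Cauchy_convergent convergent_def by blast
  have "g z \<le> m"
  proof (rule LIMSEQ_le)
    show "(\<lambda>n. g (y n)) \<longlonglongrightarrow> g z" unfolding g_def
      by (intro tendsto_intros z bounded_linear.tendsto[OF assms])
    show "(\<lambda>n. m + inverse (real (Suc n))) \<longlonglongrightarrow> m"
      using LIMSEQ_inverse_real_of_nat_add by simp
    show "\<exists>N. \<forall>n\<ge>N. g (y n) \<le> m + inverse (real (Suc n))"
      using y less_imp_le by blast
  qed
  hence min: "g z \<le> g x" for x using m_le[of x] by simp
  have "f x = inner x z" for x
  proof -
    define b where "b = inner x z - f x"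
    have *: "0 \<le> t\<^sup>2 * (norm x)\<^sup>2 + 2 * t * b" for t
    proof -
      have "(norm (z + t *\<^sub>R x))\<^sup>2 = (norm z)\<^sup>2 + 2 * t * inner x z + t\<^sup>2 * (norm x)\<^sup>2"
        unfolding power2_norm_eq_inner
        by (simp add: inner_add_left inner_add_right inner_commute[of z x] power2_eq_square algebra_simps)
      thus ?thesis
        using min[of "z + t *\<^sub>R x"] by (simp add: g_def b_def add scaleR algebra_simps)
    qed
    have "b = 0"
    proof (cases "x = 0")
      case False
      define t where "t = - b / (norm x)\<^sup>2"
      have "t\<^sup>2 * (norm x)\<^sup>2 + 2 * t * b = - b\<^sup>2 / (norm x)\<^sup>2"
        using False by (simp add: t_def power2_eq_square field_simps)
      hence "b\<^sup>2 / (norm x)\<^sup>2 \<le> 0" using *[of t] by simp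
      thus ?thesis using False by (simp add: divide_le_0_iff)
    qed (simp add: b_def zero)
    thus ?thesis by (simp add: b_def)
  qed
  thus ?thesis by blast
qed

lemma cinner_eqI: "x = y" if "\<And>z. cinner z x = cinner z y" for x y :: "'a::complex_hilbert"
proof -
  have "inner (x - y) x = inner (x - y) y" using that[of "x - y"] by (metis Re_cinner)
  hence "inner (x - y) (x - y) = 0" by (simp add: inner_diff_right)
  thus ?thesis by simp
qed

lemma cinner_add_right: "cinner x (y + z) = cinner x y + cinner x z"
  for x y z :: "'a::complex_hilbert"
  by (metis cinner_add_left cinner_commute complex_cnj_add)

lemma cinner_from_inner: "cinner x y = Complex (inner x y) (inner x (\<i> *\<^sub>C y))"
  for x y :: "'a::complex_hilbert"
  unfolding Re_cinner[symmetric] by (simp add: cinner_scaleC_right complex_eq_iff)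

lemma adj_exists: "\<exists>S. \<forall>x y. cinner (op_apply T x) y = cinner x (op_apply S y)"
  for T :: "'h::complex_hilbert bop"
proof -
  have T: "bounded_linear (op_apply T)" "op_apply T (c *\<^sub>C x) = c *\<^sub>C op_apply T x" for c x
    using op_apply[of T] by auto
  have "\<exists>z. \<forall>x. inner (op_apply T x) y = inner x z" for y
    by (rule riesz_representation)
       (rule bounded_linear_compose[OF bounded_linear_inner_left T(1)])
  then obtain s where s: "\<And>x y. inner (op_apply T x) y = inner x (s y)" by metis
  have i: "cinner (op_apply T x) y = cinner x (s y)" for x y
  proof -
    have "Re (\<i> * cinner (op_apply T x) y) = inner (op_apply T (\<i> *\<^sub>C x)) y"
      by (simp only: Re_cinner[symmetric] T cinner_scaleC_left)
    also have "\<dots> = Re (\<i> * cinner x (s y))"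
      by (simp only: s) (simp only: Re_cinner[symmetric] cinner_scaleC_left)
    finally show ?thesis using s[of x y] by (simp add: complex_eq_iff Re_cinner)
  qed
  have add: "s (y + z) = s y + s z" for y z
    by (rule cinner_eqI) (simp add: i[symmetric] cinner_add_right)
  have scale: "s (c *\<^sub>C y) = c *\<^sub>C s y" for c y
    by (rule cinner_eqI) (simp add: i[symmetric] cinner_scaleC_right)
  obtain K where K: "\<And>x. norm (op_apply T x) \<le> norm x * K"
    using bounded_linear.bounded[OF T(1)] by auto
  have "norm (s y) \<le> norm y * K" for y
  proof (cases "s y = 0")
    case False
    have "norm (s y) * norm (s y) = inner (op_apply T (s y)) y"
      by (simp add: s power2_norm_eq_inner flip: power2_eq_square)
    also have "\<dots> \<le> norm (op_apply T (s y)) * norm y" by (rule norm_cauchy_schwarz)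
    also have "\<dots> \<le> (norm (s y) * K) * norm y" by (intro mult_right_mono K) auto
    finally have "norm (s y) * norm (s y) \<le> norm (s y) * (norm y * K)"
      by (simp add: mult.commute mult.left_commute)
    thus ?thesis using False by simp
  next
    case True
    have "0 \<le> norm y * K" using K[of y] norm_ge_zero[of "op_apply T y"] by linarith
    thus ?thesis using True by simp
  qed
  hence "bounded_linear s"
    by (intro bounded_linear_intro[where K=K] add) (metis scale scaleC_of_real)
  hence "op_apply (Bop s) = s" by (intro Bop_inverse) (simp add: scale)
  thus ?thesis using i by (intro exI[of _ "Bop s"]) simp
qed

lemma cinner_adj: "cinner (op_apply T x) y = cinner x (op_apply (adj T) y)"
  for T :: "'h::complex_hilbert bop"
proof -
  have "\<exists>!S. \<forall>x y. cinner (op_apply T x) y = cinner x (op_apply S y)"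
  proof (rule ex_ex1I[OF adj_exists])
    fix S S'
    assume S: "\<forall>x y. cinner (op_apply T x) y = cinner x (op_apply S y)"
      and S': "\<forall>x y. cinner (op_apply T x) y = cinner x (op_apply S' y)"
    have "op_apply S y = op_apply S' y" for y
      by (rule cinner_eqI) (simp flip: S[rule_format] S'[rule_format])
    hence "op_apply S = op_apply S'" by (rule ext)
    thus "S = S'" by (rule op_apply_inject[THEN iffD1])
  qed
  from theI'[OF this] show ?thesis unfolding adj_def by blast
qed

definition unitary :: "'h::complex_hilbert bop \<Rightarrow> bool"
  where "unitary U \<longleftrightarrow> U * adj U = 1 \<and> adj U * U = 1"

subsection \<open>Operators on a Hilbert direct sum\<close>

lemma norm_op_apply_le: "norm (op_apply T x) \<le> norm T * norm x"
  by transfer (auto intro: onorm)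

lemma op_apply_add: "op_apply T (x + y) = op_apply T x + op_apply T y"
  by transfer (simp add: linear_add bounded_linear.linear)

lemma op_apply_scaleC: "op_apply T (c *\<^sub>C x) = c *\<^sub>C op_apply T x"
  by transfer simp

lift_definition l2_diag_fun :: "('g \<Rightarrow> 'h::complex_hilbert bop) \<Rightarrow> ('g, 'h) l2 \<Rightarrow> ('g, 'h) l2"
  is "\<lambda>T f t. if bounded (range T) then op_apply (T t) (f t) else 0"
proof -
  fix T :: "'g \<Rightarrow> 'h bop" and f :: "'g \<Rightarrow> 'h"
  assume f: "(\<lambda>t. (norm (f t))\<^sup>2) summable_on UNIV"
  show "(\<lambda>t. (norm (if bounded (range T) then op_apply (T t) (f t) else 0))\<^sup>2) summable_on UNIV"
  proof (cases "bounded (range T)")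
    case True
    then obtain K where K: "\<And>t. norm (T t) \<le> K" by (auto simp: bounded_iff)
    have "norm (op_apply (T t) (f t)) \<le> K * norm (f t)" for t
      by (rule order_trans[OF norm_op_apply_le]) (intro mult_right_mono K, simp)
    thus ?thesis using True square_summable_bound[OF f, of "\<lambda>t. op_apply (T t) (f t)" K] by simp
  qed simp
qed

text \<open>The block diagonal operator with uniformly bounded entries.\<close>

lift_definition l2_diag :: "('g \<Rightarrow> 'h::complex_hilbert bop) \<Rightarrow> ('g, 'h) l2 bop"
  is l2_diag_fun
proof (intro CollectI conjI allI)
  fix T :: "'g \<Rightarrow> 'h bop"
  show scale: "l2_diag_fun T (c *\<^sub>C x) = c *\<^sub>C l2_diag_fun T x" for c x
    by transfer (simp add: fun_eq_iff op_apply_scaleC)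
  show "bounded_linear (l2_diag_fun T)"
  proof (cases "bounded (range T)")
    case True
    then obtain K where K: "\<And>t. norm (T t) \<le> K" by (auto simp: bounded_iff)
    have "0 \<le> K" using K[of undefined] norm_ge_zero[of "T undefined"] by linarith
    show ?thesis
    proof (rule bounded_linear_intro[where K=K])
      show "l2_diag_fun T (x + y) = l2_diag_fun T x + l2_diag_fun T y" for x y
        by transfer (simp add: fun_eq_iff op_apply_add)
      show "l2_diag_fun T (r *\<^sub>R x) = r *\<^sub>R l2_diag_fun T x" for r x
        by (metis scale scaleC_of_real)
      fix x :: "('g, 'h) l2"
      have b: "(norm (Rep_l2 (l2_diag_fun T x) t))\<^sup>2 \<le> K\<^sup>2 * (norm (Rep_l2 x t))\<^sup>2" for t
      proof -
        have "norm (Rep_l2 (l2_diag_fun T x) t) \<le> K * norm (Rep_l2 x t)"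
          unfolding l2_diag_fun.rep_eq using True
          by (auto intro!: order_trans[OF norm_op_apply_le] mult_right_mono K)
        from power_mono[OF this, of 2] show ?thesis by (simp add: power_mult_distrib)
      qed
      have "(norm (l2_diag_fun T x))\<^sup>2 \<le> K\<^sup>2 * (norm x)\<^sup>2"
        unfolding norm_l2_square infsum_cmult_right'[symmetric]
        by (intro infsum_mono b Rep_l2_summable summable_on_cmult_right)
      hence "(norm (l2_diag_fun T x))\<^sup>2 \<le> (norm x * K)\<^sup>2"
        by (simp add: power_mult_distrib mult.commute)
      thus "norm (l2_diag_fun T x) \<le> norm x * K"
        by (rule power2_le_imp_le) (simp add: \<open>0 \<le> K\<close>)
    qed
  next
    case False
    hence "l2_diag_fun T = (\<lambda>_. 0)"
      by (intro ext) (transfer, simp)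
    thus ?thesis by (simp add: bounded_linear_zero)
  qed
qed

lift_definition l2_shift_fun :: "'g::group_add \<Rightarrow> ('g, 'h::complex_hilbert) l2 \<Rightarrow> ('g, 'h) l2"
  is "\<lambda>s f t. f (- s + t)"
proof -
  fix s :: 'g and f :: "'g \<Rightarrow> 'h"
  have "bij (\<lambda>t. - s + t)" by (rule bijI') (auto intro: exI[of _ "s + y" for y] simp: add.assoc[symmetric])
  moreover assume "(\<lambda>t. (norm (f t))\<^sup>2) summable_on UNIV"
  ultimately show "(\<lambda>t. (norm (f (- s + t)))\<^sup>2) summable_on UNIV"
    using summable_on_reindex_bij_betw[of "\<lambda>t. - s + t" UNIV UNIV "\<lambda>t. (norm (f t))\<^sup>2"] by simp
qed

text \<open>Left translation: \<open>(\<lambda>\<^sub>s \<xi>)(t) = \<xi>(s\<^sup>-\<^sup>1 t)\<close>.\<close>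

lift_definition l2_shift :: "'g::group_add \<Rightarrow> ('g, 'h::complex_hilbert) l2 bop"
  is l2_shift_fun
proof (intro CollectI conjI allI)
  fix s :: 'g
  show scale: "l2_shift_fun s (c *\<^sub>C x) = c *\<^sub>C l2_shift_fun s x" for c and x :: "('g, 'h) l2"
    by transfer simp
  show "bounded_linear (l2_shift_fun s :: ('g, 'h) l2 \<Rightarrow> _)"
  proof (rule bounded_linear_intro[where K=1])
    fix x y :: "('g, 'h) l2" and r :: real
    show "l2_shift_fun s (x + y) = l2_shift_fun s x + l2_shift_fun s y"
      by transfer simp
    show "l2_shift_fun s (r *\<^sub>R x) = r *\<^sub>R l2_shift_fun s x"
      by (metis scale scaleC_of_real)
    have "bij (\<lambda>t. - s + t)" by (rule bijI') (auto intro: exI[of _ "s + y" for y] simp: add.assoc[symmetric])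
    hence "(norm (l2_shift_fun s x))\<^sup>2 = (norm x)\<^sup>2"
      unfolding norm_l2_square l2_shift_fun.rep_eq
      using infsum_reindex_bij_betw[of "\<lambda>t. - s + t" UNIV UNIV "\<lambda>t. (norm (Rep_l2 x t))\<^sup>2"] by simp
    thus "norm (l2_shift_fun s x) \<le> norm x * 1" by simp
  qed
qed

section \<open>Operator algebras\<close>

definition operator_algebra :: "'h::complex_hilbert bop set \<Rightarrow> bool"
  where "operator_algebra A \<longleftrightarrow> closed A \<and> 0 \<in> A \<and>
    (\<forall>a\<in>A. \<forall>b\<in>A. a + b \<in> A \<and> a * b \<in> A) \<and> (\<forall>c. \<forall>a\<in>A. c *\<^sub>C a \<in> A)"

text \<open>C*-algebras are represented concretely, as selfadjoint norm-closed algebras of operators.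
  Neither they nor general operator algebras need to act nondegenerately.\<close>

definition cstar_algebra :: "'h::complex_hilbert bop set \<Rightarrow> bool"
  where "cstar_algebra C \<longleftrightarrow> operator_algebra C \<and> (\<forall>a\<in>C. adj a \<in> C)"

definition generated_algebra :: "'h::complex_hilbert bop set \<Rightarrow> 'h bop set"
  where "generated_algebra X = \<Inter>{B. operator_algebra B \<and> X \<subseteq> B}"

definition generated_cstar_algebra :: "'h::complex_hilbert bop set \<Rightarrow> 'h bop set"
  where "generated_cstar_algebra X = \<Inter>{B. cstar_algebra B \<and> X \<subseteq> B}"

definition algebra_hom_on ::
    "'h::complex_hilbert bop set \<Rightarrow> ('h bop \<Rightarrow> 'k::complex_hilbert bop) \<Rightarrow> bool"
  where "algebra_hom_on A \<phi> \<longleftrightarrow>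
    (\<forall>a\<in>A. \<forall>b\<in>A. \<phi> (a + b) = \<phi> a + \<phi> b \<and> \<phi> (a * b) = \<phi> a * \<phi> b) \<and>
    (\<forall>c. \<forall>a\<in>A. \<phi> (c *\<^sub>C a) = c *\<^sub>C \<phi> a)"

definition star_hom_on ::
    "'h::complex_hilbert bop set \<Rightarrow> ('h bop \<Rightarrow> 'k::complex_hilbert bop) \<Rightarrow> bool"
  where "star_hom_on C \<phi> \<longleftrightarrow> algebra_hom_on C \<phi> \<and> (\<forall>a\<in>C. \<phi> (adj a) = adj (\<phi> a))"

definition star_isomorphic ::
    "'h::complex_hilbert bop set \<Rightarrow> 'k::complex_hilbert bop set \<Rightarrow> bool"
  where "star_isomorphic C D \<longleftrightarrow> (\<exists>\<phi>. star_hom_on C \<phi> \<and> bij_betw \<phi> C D)"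

text \<open>The norm of the \<open>n \<times> n\<close> operator matrix \<open>T\<close> acting on the Hilbert space of column
  vectors of length \<open>n\<close>; only the entries with indices below \<open>n\<close> matter.\<close>

definition matrix_norm :: "nat \<Rightarrow> (nat \<Rightarrow> nat \<Rightarrow> 'h::complex_hilbert bop) \<Rightarrow> real"
  where "matrix_norm n T =
    Sup {sqrt (\<Sum>i<n. (norm (\<Sum>j<n. op_apply (T i j) (x j)))\<^sup>2) | x. (\<Sum>j<n. (norm (x j))\<^sup>2) \<le> 1}"

definition completely_contractive_on ::
    "'h::complex_hilbert bop set \<Rightarrow> ('h bop \<Rightarrow> 'k::complex_hilbert bop) \<Rightarrow> bool"
  where "completely_contractive_on A \<phi> \<longleftrightarrow>
    (\<forall>n T. (\<forall>i<n. \<forall>j<n. T i j \<in> A) \<longrightarrow> matrix_norm n (\<lambda>i j. \<phi> (T i j)) \<le> matrix_norm n T)"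

definition completely_isometric_on ::
    "'h::complex_hilbert bop set \<Rightarrow> ('h bop \<Rightarrow> 'k::complex_hilbert bop) \<Rightarrow> bool"
  where "completely_isometric_on A \<phi> \<longleftrightarrow>
    (\<forall>n T. (\<forall>i<n. \<forall>j<n. T i j \<in> A) \<longrightarrow> matrix_norm n (\<lambda>i j. \<phi> (T i j)) = matrix_norm n T)"

text \<open>Nets are rendered as families along a proper filter on the index type; for a directed
  index set this is the filter generated by its tails.\<close>

definition contractive_approximate_unit ::
    "'h::complex_hilbert bop set \<Rightarrow> 'i filter \<Rightarrow> ('i \<Rightarrow> 'h bop) \<Rightarrow> bool"
  where "contractive_approximate_unit A F e \<longleftrightarrow>
    F \<noteq> bot \<and> (\<forall>i. e i \<in> A \<and> norm (e i) \<le> 1) \<and>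
    (\<forall>a\<in>A. ((\<lambda>i. e i * a) \<longlongrightarrow> a) F \<and> ((\<lambda>i. a * e i) \<longlongrightarrow> a) F)"

text \<open>Any approximate unit can be reindexed by the elements of the algebra itself, so fixing the
  index type here is no restriction.\<close>

definition approximately_unital :: "'h::complex_hilbert bop set \<Rightarrow> bool"
  where "approximately_unital A \<longleftrightarrow>
    (\<exists>(F :: 'h bop filter) e. contractive_approximate_unit A F e)"

subsection \<open>C*-covers\<close>

definition cstar_cover ::
    "'h::complex_hilbert bop set \<Rightarrow> 'k::complex_hilbert bop set \<Rightarrow> ('h bop \<Rightarrow> 'k bop) \<Rightarrow> bool"
  where "cstar_cover A C j \<longleftrightarrow> cstar_algebra C \<and> algebra_hom_on A j \<and>
    completely_isometric_on A j \<and> C = generated_cstar_algebra (j ` A)"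

text \<open>The universal properties below quantify over C*-algebras acting on the Hilbert space
  \<open>\<ell>\<^sup>2\<close> over the set of all bounded operators of the Hilbert space on which \<open>A\<close> acts.  As a
  C*-algebra generated by a homomorphic image of \<open>A \<noteq> 0\<close> has cardinality at most that of \<open>A\<close>,
  it has a faithful representation on this space; hence nothing is lost by not quantifying over
  all Hilbert spaces.\<close>

type_synonym 'h test_space = "('h bop, complex) l2"

definition cstar_envelope ::
    "'h::complex_hilbert bop set \<Rightarrow> 'k::complex_hilbert bop set \<Rightarrow> ('h bop \<Rightarrow> 'k bop) \<Rightarrow> bool"
  where "cstar_envelope A E j \<longleftrightarrow> cstar_cover A E j \<and>
    (\<forall>(C :: 'h test_space bop set) i. cstar_cover A C i \<longrightarrow>
      (\<exists>\<phi>. star_hom_on C \<phi> \<and> \<phi> ` C = E \<and> (\<forall>a\<in>A. \<phi> (i a) = j a)))"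

definition cstar_maximal ::
    "'h::complex_hilbert bop set \<Rightarrow> 'k::complex_hilbert bop set \<Rightarrow> ('h bop \<Rightarrow> 'k bop) \<Rightarrow> bool"
  where "cstar_maximal A M j \<longleftrightarrow> cstar_cover A M j \<and>
    (\<forall>(D :: 'h test_space bop set) \<pi>.
      cstar_algebra D \<and> algebra_hom_on A \<pi> \<and> \<pi> ` A \<subseteq> D \<and> completely_contractive_on A \<pi> \<longrightarrow>
      (\<exists>\<phi>. star_hom_on M \<phi> \<and> \<phi> ` M \<subseteq> D \<and> (\<forall>a\<in>A. \<phi> (j a) = \<pi> a)))"

section \<open>Dynamical systems and crossed products\<close>

text \<open>Groups are types of class \<^class>\<open>group_add\<close>; they are written additively but need not be
  commutative.\<close>

definition dynamical_system ::
    "'h::complex_hilbert bop set \<Rightarrow> ('g::group_add \<Rightarrow> 'h bop \<Rightarrow> 'h bop) \<Rightarrow> bool"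
  where "dynamical_system A \<alpha> \<longleftrightarrow> operator_algebra A \<and> approximately_unital A \<and>
    (\<forall>s. algebra_hom_on A (\<alpha> s) \<and> completely_isometric_on A (\<alpha> s) \<and> bij_betw (\<alpha> s) A A) \<and>
    (\<forall>s t. \<forall>a\<in>A. \<alpha> (s + t) a = \<alpha> s (\<alpha> t a))"

definition cstar_action ::
    "'k::complex_hilbert bop set \<Rightarrow> ('g::group_add \<Rightarrow> 'k bop \<Rightarrow> 'k bop) \<Rightarrow> bool"
  where "cstar_action C \<gamma> \<longleftrightarrow> (\<forall>s. star_hom_on C (\<gamma> s) \<and> bij_betw (\<gamma> s) C C) \<and>
    (\<forall>s t. \<forall>c\<in>C. \<gamma> (s + t) c = \<gamma> s (\<gamma> t c))"

text \<open>\<open>(C, j)\<close> is an \<open>\<alpha>\<close>-admissible cover of \<open>A\<close>, and \<open>\<gamma>\<close> is the extension of \<open>\<alpha>\<close> to \<open>C\<close>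
  (which is unique, \<open>C\<close> being generated by \<open>j ` A\<close>).\<close>

definition admissible_cover ::
    "'h::complex_hilbert bop set \<Rightarrow> ('g::group_add \<Rightarrow> 'h bop \<Rightarrow> 'h bop) \<Rightarrow>
      'k::complex_hilbert bop set \<Rightarrow> ('h bop \<Rightarrow> 'k bop) \<Rightarrow> ('g \<Rightarrow> 'k bop \<Rightarrow> 'k bop) \<Rightarrow> bool"
  where "admissible_cover A \<alpha> C j \<gamma> \<longleftrightarrow> cstar_cover A C j \<and> cstar_action C \<gamma> \<and>
    (\<forall>s. \<forall>a\<in>A. \<gamma> s (j a) = j (\<alpha> s a))"

definition covariant_rep ::
    "'k::complex_hilbert bop set \<Rightarrow> ('g::group_add \<Rightarrow> 'k bop \<Rightarrow> 'k bop) \<Rightarrow>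
      ('k bop \<Rightarrow> 'u::complex_hilbert bop) \<Rightarrow> ('g \<Rightarrow> 'u bop) \<Rightarrow> bool"
  where "covariant_rep C \<gamma> \<pi> U \<longleftrightarrow> star_hom_on C \<pi> \<and> (\<forall>s. unitary (U s)) \<and>
    (\<forall>s t. U (s + t) = U s * U t) \<and> (\<forall>s. \<forall>c\<in>C. U s * \<pi> c * adj (U s) = \<pi> (\<gamma> s c))"

definition crossed_sums ::
    "'k::complex_hilbert bop set \<Rightarrow> ('k bop \<Rightarrow> 'u::complex_hilbert bop) \<Rightarrow> ('g \<Rightarrow> 'u bop) \<Rightarrow>
      'u bop set"
  where "crossed_sums X \<pi> U =
    {(\<Sum>g\<in>S. \<pi> (a g) * U g) | S a. finite S \<and> (\<forall>g\<in>S. a g \<in> X)}"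

text \<open>The C*-crossed product realised by a covariant representation (regular or universal).\<close>

definition crossed_product ::
    "'k::complex_hilbert bop set \<Rightarrow> ('k bop \<Rightarrow> 'u::complex_hilbert bop) \<Rightarrow> ('g \<Rightarrow> 'u bop) \<Rightarrow>
      'u bop set"
  where "crossed_product C \<pi> U = closure (crossed_sums C \<pi> U)"

definition relative_crossed_product ::
    "'h::complex_hilbert bop set \<Rightarrow> ('h bop \<Rightarrow> 'k::complex_hilbert bop) \<Rightarrow>
      ('k bop \<Rightarrow> 'u::complex_hilbert bop) \<Rightarrow> ('g \<Rightarrow> 'u bop) \<Rightarrow> 'u bop set"
  where "relative_crossed_product A j \<pi> U = generated_algebra (crossed_sums (j ` A) \<pi> U)"

subsection \<open>Reduced crossed products\<close>

text \<open>The regular covariant representation is \<open>(regular_rep \<gamma>, l2_shift)\<close>, where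
  \<open>(regular_rep \<gamma> c \<xi>)(t) = \<gamma>\<^sub>t\<^sup>-\<^sup>1(c) \<xi>(t)\<close>.\<close>

definition regular_rep ::
    "('g::group_add \<Rightarrow> 'k bop \<Rightarrow> 'k bop) \<Rightarrow> 'k bop \<Rightarrow> ('g, 'k::complex_hilbert) l2 bop"
  where "regular_rep \<gamma> c = l2_diag (\<lambda>t. \<gamma> (- t) c)"

definition reduced_crossed_product ::
    "'k::complex_hilbert bop set \<Rightarrow> ('g::group_add \<Rightarrow> 'k bop \<Rightarrow> 'k bop) \<Rightarrow> ('g, 'k) l2 bop set"
  where "reduced_crossed_product C \<gamma> = crossed_product C (regular_rep \<gamma>) l2_shift"

definition relative_reduced_crossed_product ::
    "'h::complex_hilbert bop set \<Rightarrow> ('h bop \<Rightarrow> 'k::complex_hilbert bop) \<Rightarrow>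
      ('g::group_add \<Rightarrow> 'k bop \<Rightarrow> 'k bop) \<Rightarrow> ('g, 'k) l2 bop set"
  where "relative_reduced_crossed_product A j \<gamma> =
    relative_crossed_product A j (regular_rep \<gamma>) l2_shift"

subsection \<open>Full crossed products\<close>

text \<open>A covariant representation is universal if its crossed product has the universal property of
  the full C*-crossed product; \<open>crossed_product C \<pi> U\<close> is then the full crossed product.  Test
  representations on \<open>\<ell>\<^sup>2(B(K) \<times> G)\<close> suffice: for \<open>C \<noteq> 0\<close> the \<open>*\<close>-algebra of finitely
  supported functions from \<open>G\<close> to \<open>C\<close> has at most as many elements as \<open>B(K) \<times> G\<close>, so its
  norm under any covariant representation is attained on an invariant subspace of at most this
  dimension.\<close>

definition universal_covariant_rep ::
    "'k::complex_hilbert bop set \<Rightarrow> ('g::group_add \<Rightarrow> 'k bop \<Rightarrow> 'k bop) \<Rightarrow>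
      ('k bop \<Rightarrow> 'u::complex_hilbert bop) \<Rightarrow> ('g \<Rightarrow> 'u bop) \<Rightarrow> bool"
  where "universal_covariant_rep C \<gamma> \<pi> U \<longleftrightarrow> covariant_rep C \<gamma> \<pi> U \<and>
    (\<forall>(\<rho> :: 'k bop \<Rightarrow> ('k bop \<times> 'g, complex) l2 bop) V. covariant_rep C \<gamma> \<rho> V \<longrightarrow>
      (\<exists>\<Phi>. star_hom_on (crossed_product C \<pi> U) \<Phi> \<and>
        (\<forall>c\<in>C. \<forall>s. \<Phi> (\<pi> c * U s) = \<rho> c * V s)))"

section \<open>Amenability\<close>

text \<open>Existence of a left invariant mean on the bounded real functions; the values of \<open>m\<close> on
  unbounded functions are irrelevant.\<close>

definition amenable :: "'g::group_add itself \<Rightarrow> bool"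
  where "amenable _ \<longleftrightarrow> (\<exists>m :: ('g \<Rightarrow> real) \<Rightarrow> real.
    m (\<lambda>_. 1) = 1 \<and>
    (\<forall>f. bounded (range f) \<longrightarrow> (\<forall>t. 0 \<le> f t) \<longrightarrow> 0 \<le> m f) \<and>
    (\<forall>f h. bounded (range f) \<longrightarrow> bounded (range h) \<longrightarrow> m (\<lambda>t. f t + h t) = m f + m h) \<and>
    (\<forall>c f. bounded (range f) \<longrightarrow> m (\<lambda>t. c * f t) = c * m f) \<and>
    (\<forall>s f. bounded (range f) \<longrightarrow> m (\<lambda>t. f (s + t)) = m f))"

end

theory Submission
  imports Defs
begin

text \<open>Write \<open>E\<close> for the C*-envelope of \<open>A\<close>, \<open>R\<close> for its reduced crossed product and \<open>B \<subseteq> R\<close> for the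
  closed algebra generated by the sums of the \<open>a u\<^sub>g\<close>. Comparing matrix entries shows that, up to
  complete isometry, \<open>B\<close> does not depend on the cover; so its envelope is a quotient \<open>q\<close> of \<open>R\<close> that is
  completely isometric on \<open>B\<close>, and \<open>q\<close> has to be injective. Let \<open>P : R \<rightarrow> E\<close> be the conditional
  expectation, which is faithful and maps \<open>B\<close> onto \<open>A\<close>; it suffices that \<open>P\<close> vanishes on \<open>ker q\<close>.
  Given a representation \<open>\<sigma>\<close> of \<open>E\<close>, the completely contractive map \<open>\<sigma> P\<close> on \<open>q(B)\<close> extends to a
  positive functional on matrices, whose GNS construction yields a representation \<open>\<tau>\<close> of \<open>R\<close> that
  kills \<open>ker q\<close> and has the compression \<open>\<sigma> P\<close> on \<open>B\<close>. Restrict \<open>\<tau>\<close> to \<open>E\<close> and repeat, starting from a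
  faithful \<open>\<sigma>\<close>: the strong limit \<open>\<rho>\<close> of this chain is completely isometric on \<open>A\<close>, hence faithful
  on the envelope \<open>E\<close>, and \<open>\<rho> P\<close> vanishes on \<open>ker q\<close>. If the group is amenable, almost invariant unit
  vectors in \<open>\<ell>\<^sup>2(G)\<close> show that the regular representation attains the norm of the full crossed
  product.\<close>

section \<open>Hahn-Banach separation through minimal sublinear functionals\<close>

section \<open>Sublinear functionals\<close>

text \<open>A single dilation \<tau> of \<sigma> P kills the kernel of q, but its restriction to E
  merely dilates \<sigma> on A, so nothing relates \<tau>(\<pi>(x) b) to \<sigma>(x P(b)). This is
  why the step is iterated: along the chain the restrictions to E converge strongly, consecutive
  ones become indistinguishable, and moving x to the other side of the inner product shows that the
  dilations tend weakly to \<rho> P on the products \<pi>(x) b, which are total in R. The algebras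
  may lack a unit. Positivity is therefore tested on matrices with entries q(b) + c 1, and a
  contractive approximate unit carries the resulting norm estimates back into the algebra. Every
  representation of the chain must act on one fixed type. A scalar sequence space is used whose
  index type absorbs the index sets of all the constructions; vectors are produced there from
  positive definite kernels, and isometries with pairwise orthogonal ranges supply fresh room for
  each dilation.\<close>

definition sublinear_on :: "'v::real_vector set \<Rightarrow> ('v \<Rightarrow> real) \<Rightarrow> bool"
  where "sublinear_on W p \<longleftrightarrow> (\<forall>x\<in>W. \<forall>y\<in>W. p (x + y) \<le> p x + p y) \<and>
    (\<forall>t\<ge>0. \<forall>x\<in>W. p (t *\<^sub>R x) = t * p x)"

lemma sublinear_on_zero: "subspace W \<Longrightarrow> sublinear_on W p \<Longrightarrow> p 0 = 0"
  unfolding sublinear_on_def using subspace_0[of W] by (metis order_refl mult_zero_left scaleR_zero_left)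

lemma sublinear_on_minus: "subspace W \<Longrightarrow> sublinear_on W p \<Longrightarrow> x \<in> W \<Longrightarrow> - p (- x) \<le> p x"
  using sublinear_on_zero[of W p] subspace_neg[of W x] unfolding sublinear_on_def
  by (smt (verit) add.right_inverse)

text \<open>The inequality for all t > 0 yields homogeneity: its instance for
  \<open>inverse t\<close> at the point t x is the reverse inequality.\<close>

lemma sublinear_onI:
  assumes W: "subspace W" and add: "\<And>x y. x \<in> W \<Longrightarrow> y \<in> W \<Longrightarrow> p (x + y) \<le> p x + p y"
    and scale: "\<And>t x. t > 0 \<Longrightarrow> x \<in> W \<Longrightarrow> p (t *\<^sub>R x) \<le> t * p x" and 0: "p 0 = 0"
  shows "sublinear_on W p"
  unfolding sublinear_on_def
proof (intro conjI ballI allI impI add)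
  fix t :: real and x assume t: "0 \<le> t" and x: "x \<in> W"
  show "p (t *\<^sub>R x) = t * p x"
  proof (cases "t = 0")
    case False
    hence t: "t > 0" using t by simp
    have "p x \<le> inverse t * p (t *\<^sub>R x)" using scale[of "inverse t" "t *\<^sub>R x"] t subspace_scale[OF W x] by simp
    hence "t * p x \<le> p (t *\<^sub>R x)" using t by (simp add: field_simps)
    with scale[OF t x] show ?thesis by simp
  qed (simp add: 0)
qed

text \<open>The functional is the lower boundary of the convex cone \<open>G\<close>. Its fibre over
  x is bounded below because adding a point over - x lands over 0, where \<open>G_pos\<close>
  applies.\<close>

lemma sublinear_Inf:
  fixes G :: "('v::real_vector \<times> real) set"
  assumes W: "subspace W" and G0: "(0, 0) \<in> G"
    and G_add: "\<And>x r y s. (x, r) \<in> G \<Longrightarrow> (y, s) \<in> G \<Longrightarrow> (x + y, r + s) \<in> G"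
    and G_scale: "\<And>t x r. t > 0 \<Longrightarrow> (x, r) \<in> G \<Longrightarrow> (t *\<^sub>R x, t * r) \<in> G"
    and G_pos: "\<And>r. (0, r) \<in> G \<Longrightarrow> 0 \<le> r" and G_ex: "\<And>x. x \<in> W \<Longrightarrow> \<exists>r. (x, r) \<in> G"
  obtains p where "sublinear_on W p" "\<And>x r. x \<in> W \<Longrightarrow> (x, r) \<in> G \<Longrightarrow> p x \<le> r"
proof -
  define p where "p x = Inf {r. (x, r) \<in> G}" for x
  have le: "p x \<le> r" if x: "x \<in> W" and r: "(x, r) \<in> G" for x r
  proof -
    obtain s where s: "(- x, s) \<in> G" using G_ex[OF subspace_neg[OF W x]] by blast
    have "- s \<le> r" if "(x, r) \<in> G" for r using G_pos G_add[OF that s] by fastforce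
    hence "bdd_below {r. (x, r) \<in> G}" by (intro bdd_belowI[of _ "- s"]) simp
    thus ?thesis unfolding p_def using r by (intro cInf_lower) simp_all
  qed
  have ge: "c \<le> p x" if "x \<in> W" "\<And>r. (x, r) \<in> G \<Longrightarrow> c \<le> r" for c x
    unfolding p_def using G_ex[OF that(1)] that(2) by (intro cInf_greatest) auto
  have "sublinear_on W p"
  proof (rule sublinear_onI[OF W])
    fix x y assume x: "x \<in> W" and y: "y \<in> W"
    have "p (x + y) - r \<le> p y" if r: "(x, r) \<in> G" for r
    proof (rule ge[OF y])
      show "p (x + y) - r \<le> s" if "(y, s) \<in> G" for s
        using le[OF subspace_add[OF W x y] G_add[OF r that]] by simp
    qed
    hence "p (x + y) - p y \<le> p x" by (intro ge[OF x]) (simp add: algebra_simps)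
    thus "p (x + y) \<le> p x + p y" by simp
  next
    fix t :: real and x assume t: "t > 0" and x: "x \<in> W"
    have "p (t *\<^sub>R x) / t \<le> p x"
    proof (rule ge[OF x])
      show "p (t *\<^sub>R x) / t \<le> r" if "(x, r) \<in> G" for r
        using le[OF subspace_scale[OF W x] G_scale[OF t that]] t by (simp add: field_simps)
    qed
    thus "p (t *\<^sub>R x) \<le> t * p x" using t by (simp add: field_simps)
  next
    show "p 0 = 0" by (rule order.antisym[OF le[OF subspace_0[OF W] G0] ge[OF subspace_0[OF W] G_pos]])
  qed
  thus ?thesis using le by (rule that)
qed

text \<open>The functional is the infimum of N (h + x) - r over (x, r) in \<open>K\<close>. It
  converts lower bounds on a cone into domination by one sublinear functional.\<close>

lemma sublinear_cone:
  fixes N :: "'v::real_vector \<Rightarrow> real"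
  assumes W: "subspace W" and N: "sublinear_on W N"
    and K: "(0, 0) \<in> K" "\<And>x r y s. (x, r) \<in> K \<Longrightarrow> (y, s) \<in> K \<Longrightarrow> (x + y, r + s) \<in> K"
      "\<And>t x r. t > 0 \<Longrightarrow> (x, r) \<in> K \<Longrightarrow> (t *\<^sub>R x, t * r) \<in> K" "\<And>x r. (x, r) \<in> K \<Longrightarrow> x \<in> W \<and> r \<le> N x"
  obtains p where "sublinear_on W p" "\<And>h x r. h \<in> W \<Longrightarrow> (x, r) \<in> K \<Longrightarrow> p h \<le> N (h + x) - r"
proof -
  note Wi = subspace_add[OF W] subspace_scale[OF W] subspace_neg[OF W]
  have add: "N (u + v) \<le> N u + N v" if "u \<in> W" "v \<in> W" for u v using N that by (auto simp: sublinear_on_def)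
  have hom: "N (t *\<^sub>R u) = t * N u" if "u \<in> W" "t \<ge> 0" for t u using N that by (auto simp: sublinear_on_def)
  define G where "G = {(h, c). h \<in> W \<and> (\<exists>(x, r)\<in>K. N (h + x) - r \<le> c)}"
  have GI: "(h, N (h + x) - r) \<in> G" if "h \<in> W" "(x, r) \<in> K" for h x r using that by (auto simp: G_def)
  obtain p where p: "sublinear_on W p" "\<And>h r. h \<in> W \<Longrightarrow> (h, r) \<in> G \<Longrightarrow> p h \<le> r"
  proof (rule sublinear_Inf[OF W])
    have N0: "N 0 = 0" by (rule sublinear_on_zero[OF W N])
    show "(0, 0) \<in> G" using GI[OF subspace_0[OF W] K(1)] N0 by simp
    show "(h + h', c + c') \<in> G" if h: "(h, c) \<in> G" and h': "(h', c') \<in> G" for h c h' c'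
    proof -
      obtain x r y s where x: "(x, r) \<in> K" "N (h + x) - r \<le> c" "h \<in> W" and y: "(y, s) \<in> K" "N (h' + y) - s \<le> c'" "h' \<in> W"
        using h h' unfolding G_def by blast
      have "N ((h + x) + (h' + y)) \<le> N (h + x) + N (h' + y)" using K(4)[OF x(1)] K(4)[OF y(1)] x y by (intro add Wi) auto
      also have "(h + x) + (h' + y) = (h + h') + (x + y)" by simp
      finally have "N ((h + h') + (x + y)) - (r + s) \<le> c + c'" using x y by simp
      thus ?thesis unfolding G_def using K(2)[OF x(1) y(1)] Wi(1)[OF x(3) y(3)] by blast
    qed
    show "(t *\<^sub>R h, t * c) \<in> G" if t: "t > 0" and h: "(h, c) \<in> G" for t h c
    proof -
      obtain x r where x: "(x, r) \<in> K" "N (h + x) - r \<le> c" "h \<in> W" using h unfolding G_def by blast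
      have "N (t *\<^sub>R h + t *\<^sub>R x) - t * r = t * (N (h + x) - r)"
        using hom[of "h + x" t] Wi(1)[OF x(3)] K(4)[OF x(1)] t by (simp add: scaleR_add_right right_diff_distrib)
      also have "\<dots> \<le> t * c" using x(2) t by simp
      finally show ?thesis unfolding G_def using K(3)[OF t x(1)] Wi(2)[OF x(3)] by blast
    qed
    show "0 \<le> c" if "(0, c) \<in> G" for c using that K(4) by (fastforce simp: G_def)
    show "\<exists>c. (h, c) \<in> G" if "h \<in> W" for h using GI[OF that K(1)] by blast
  qed (rule that)
  show ?thesis by (rule that[OF p(1) p(2)[OF _ GI]])
qed

text \<open>Zorn's lemma gives a minimal sublinear functional below \<open>p\<close>, and minimality
  forces additivity.\<close>

theorem hahn_banach_sublinear:
  fixes p :: "'v::real_vector \<Rightarrow> real"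
  assumes W: "subspace W" and p: "sublinear_on W p"
  obtains f where "\<And>x y. x \<in> W \<Longrightarrow> y \<in> W \<Longrightarrow> f (x + y) = f x + f y"
    "\<And>t x. x \<in> W \<Longrightarrow> f (t *\<^sub>R x) = t * f x" "\<And>x. x \<in> W \<Longrightarrow> f x \<le> p x"
proof -
  \<comment> \<open>Values outside \<open>W\<close> are normalised to 0, so that the pointwise order
    compares values on \<open>W\<close> only.\<close>
  define Q where "Q = {q. sublinear_on W q \<and> (\<forall>x\<in>W. q x \<le> p x) \<and> (\<forall>x. x \<notin> W \<longrightarrow> q x = 0)}"
  define P where "P = (\<lambda>q q' :: 'v \<Rightarrow> real. q' \<le> q)"
  note Wi = subspace_add[OF W] subspace_scale[OF W] subspace_neg[OF W]
  have lower: "- p (- x) \<le> q x" if "q \<in> Q" "x \<in> W" for q x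
    using that sublinear_on_minus[OF W, of q x] Wi(3)[of x] unfolding Q_def by force
  have "\<exists>m\<in>Q. \<forall>a\<in>Q. P m a \<longrightarrow> a = m"
  proof (rule predicate_Zorn)
    show "partial_order_on Q (relation_of P Q)"
      by (auto simp: partial_order_on_def preorder_on_def refl_on_def trans_def antisym_def
          relation_of_def P_def)
    fix C assume C: "C \<in> Chains (relation_of P Q)"
    hence CQ: "C \<subseteq> Q" by (auto simp: Chains_def relation_of_def)
    have chain: "q \<le> q' \<or> q' \<le> q" if "q \<in> C" "q' \<in> C" for q q'
      using C that by (auto simp: Chains_def relation_of_def P_def)
    show "\<exists>u\<in>Q. \<forall>a\<in>C. P a u"
    proof (cases "C = {}")
      case True
      have "(\<lambda>x. if x \<in> W then p x else 0) \<in> Q"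
        using p Wi unfolding Q_def sublinear_on_def by auto
      thus ?thesis using True by blast
    next
      case False
      define u where "u = (\<lambda>x. if x \<in> W then INF q\<in>C. q x else 0)"
      have bdd: "bdd_below ((\<lambda>q. q x) ` C)" if "x \<in> W" for x
        using lower that CQ by (intro bdd_belowI2[where m="- p (- x)"]) auto
      have le: "u x \<le> q x" if "q \<in> C" for q x
        using that CQ bdd unfolding u_def by (auto intro: cINF_lower simp: Q_def)
      have ge: "c \<le> u x" if "x \<in> W" "\<And>q. q \<in> C \<Longrightarrow> c \<le> q x" for c x
        using that False unfolding u_def by (auto intro: cINF_greatest)
      have sub: "sublinear_on W q" if "q \<in> C" for q using that CQ by (auto simp: Q_def)
      have "sublinear_on W u"
      proof (rule sublinear_onI[OF W])
        fix x y assume x: "x \<in> W" "y \<in> W"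
        have "u (x + y) - q y \<le> u x" if q: "q \<in> C" for q
        proof (rule ge[OF x(1)])
          fix q' assume q': "q' \<in> C"
          then obtain r where r: "r \<in> C" "r \<le> q" "r \<le> q'" using chain[OF q q'] q by blast
          have "u (x + y) \<le> r (x + y)" by (rule le[OF r(1)])
          also have "\<dots> \<le> r x + r y" using sub[OF r(1)] x by (simp add: sublinear_on_def)
          also have "\<dots> \<le> q' x + q y" using r by (intro add_mono) (auto simp: le_fun_def)
          finally show "u (x + y) - q y \<le> q' x" by simp
        qed
        hence "u (x + y) - u x \<le> u y" by (intro ge[OF x(2)]) (auto simp: algebra_simps)
        thus "u (x + y) \<le> u x + u y" by simp
      next
        fix t :: real and x assume t: "t > 0" and x: "x \<in> W"
        have "u (t *\<^sub>R x) / t \<le> u x"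
        proof (rule ge[OF x])
          fix q assume q: "q \<in> C"
          have "q (t *\<^sub>R x) = t * q x" using sub[OF q] t x by (simp add: sublinear_on_def)
          thus "u (t *\<^sub>R x) / t \<le> q x" using le[OF q, of "t *\<^sub>R x"] t by (simp add: field_simps)
        qed
        thus "u (t *\<^sub>R x) \<le> t * u x" using t by (simp add: field_simps)
      next
        have "u 0 = (INF q\<in>C. 0)" unfolding u_def using subspace_0[OF W] sub
          by (auto intro!: INF_cong sublinear_on_zero[OF W])
        thus "u 0 = 0" using False by simp
      qed
      moreover have "\<forall>x\<in>W. u x \<le> p x"
      proof
        fix x assume x: "x \<in> W"
        obtain q where q: "q \<in> C" using False by blast
        hence "q x \<le> p x" using CQ x by (auto simp: Q_def)
        thus "u x \<le> p x" using le[OF q, of x] by linarith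
      qed
      ultimately have "u \<in> Q" unfolding Q_def by (auto simp: u_def)
      thus ?thesis using le by (auto simp: P_def le_fun_def)
    qed
  qed
  then obtain m where m: "m \<in> Q" and min: "\<And>a. a \<in> Q \<Longrightarrow> a \<le> m \<Longrightarrow> a = m"
    unfolding P_def by blast
  have msub: "sublinear_on W m" and mp: "\<And>x. x \<in> W \<Longrightarrow> m x \<le> p x" using m by (auto simp: Q_def)
  have add: "m (x + y) = m x + m y" if x: "x \<in> W" and y: "y \<in> W" for x y
  proof -
    \<comment> \<open>The ray through (y, m y). The resulting n lies below m and satisfies n x \<le>
      m (x + y) - m y; as minimality gives n = m, this is superadditivity of m.\<close>
    define K where "K = {(t *\<^sub>R y, t * m y) | t. t \<ge> 0}"
    have K: "(t *\<^sub>R y, t * m y) \<in> K" if "t \<ge> 0" for t using that by (auto simp: K_def)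
    obtain n where n: "sublinear_on W n" "\<And>h x r. h \<in> W \<Longrightarrow> (x, r) \<in> K \<Longrightarrow> n h \<le> m (h + x) - r"
    proof (rule sublinear_cone[OF W msub])
      show "(0, 0) \<in> K" using K[of 0] by simp
      show "(u + v, r + s) \<in> K" if uv: "(u, r) \<in> K" "(v, s) \<in> K" for u r v s
      proof -
        obtain t t' where "t \<ge> 0" "t' \<ge> 0" "u = t *\<^sub>R y" "r = t * m y" "v = t' *\<^sub>R y" "s = t' * m y"
          using uv unfolding K_def by blast
        thus ?thesis using K[of "t + t'"] by (simp add: scaleR_add_left distrib_right)
      qed
      show "(c *\<^sub>R u, c * r) \<in> K" if c: "c > 0" and u: "(u, r) \<in> K" for c u r
      proof -
        obtain t where "t \<ge> 0" "u = t *\<^sub>R y" "r = t * m y" using u unfolding K_def by blast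
        thus ?thesis using K[of "c * t"] c by (simp add: mult.assoc)
      qed
      show "u \<in> W \<and> r \<le> m u" if "(u, r) \<in> K" for u r
        using that msub y Wi(2) by (auto simp: K_def sublinear_on_def)
    qed (rule that)
    have n: "sublinear_on W n" "\<And>x. x \<in> W \<Longrightarrow> n x \<le> m x" "\<And>x. x \<in> W \<Longrightarrow> n x \<le> m (x + y) - m y"
      using n n(2)[OF _ K, of _ 0] n(2)[OF _ K, of _ 1] by auto
    define n' where "n' = (\<lambda>x. if x \<in> W then n x else 0)"
    have "sublinear_on W n'" using n(1) Wi unfolding sublinear_on_def n'_def by auto
    moreover have "n' \<le> m" using n(2) m by (auto simp: le_fun_def n'_def Q_def)
    ultimately have "n' \<in> Q" using mp n(2) unfolding Q_def n'_def by force
    hence "n' = m" using min \<open>n' \<le> m\<close> by blast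
    hence "m x = n' x" by simp
    hence "m x = n x" using x by (simp add: n'_def)
    hence "m x + m y \<le> m (x + y)" using n(3)[OF x] by simp
    moreover have "m (x + y) \<le> m x + m y" using msub x y by (auto simp: sublinear_on_def)
    ultimately show ?thesis by simp
  qed
  have neg: "m (- x) = - m x" if "x \<in> W" for x
    using add[OF that Wi(3)[OF that]] sublinear_on_zero[OF W msub] by simp
  have "m (t *\<^sub>R x) = t * m x" if x: "x \<in> W" for t x
  proof (cases "t \<ge> 0")
    case True thus ?thesis using msub x by (auto simp: sublinear_on_def)
  next
    case False
    hence "- t \<ge> 0" by simp
    hence "m ((- t) *\<^sub>R x) = (- t) * m x" using msub x unfolding sublinear_on_def by blast
    thus ?thesis using neg[OF Wi(2)[OF x, of t]] by simp
  qed
  thus ?thesis using that add mp by blast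
qed

text \<open>A linear minorant of the functional from \<open>sublinear_cone\<close> obeys both
  bounds: (0, 0) in \<open>K\<close> gives f \<le> N, and the choice h = - x gives r \<le> f
  x.\<close>

lemma cone_separation:
  fixes N :: "'v::real_vector \<Rightarrow> real"
  assumes W: "subspace W" and N: "sublinear_on W N"
    and K: "(0, 0) \<in> K" "\<And>x r y s. (x, r) \<in> K \<Longrightarrow> (y, s) \<in> K \<Longrightarrow> (x + y, r + s) \<in> K"
      "\<And>t x r. t > 0 \<Longrightarrow> (x, r) \<in> K \<Longrightarrow> (t *\<^sub>R x, t * r) \<in> K" "\<And>x r. (x, r) \<in> K \<Longrightarrow> x \<in> W \<and> r \<le> N x"
  obtains f where "\<And>x y. x \<in> W \<Longrightarrow> y \<in> W \<Longrightarrow> f (x + y) = f x + f y"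
    "\<And>t x. x \<in> W \<Longrightarrow> f (t *\<^sub>R x) = t * f x" "\<And>x. x \<in> W \<Longrightarrow> f x \<le> N x" "\<And>x r. (x, r) \<in> K \<Longrightarrow> r \<le> f x"
proof -
  obtain p where p: "sublinear_on W p" "\<And>h x r. h \<in> W \<Longrightarrow> (x, r) \<in> K \<Longrightarrow> p h \<le> N (h + x) - r"
    by (rule sublinear_cone[OF W N K]) (assumption | rule that)+
  obtain f where f: "\<And>x y. x \<in> W \<Longrightarrow> y \<in> W \<Longrightarrow> f (x + y) = f x + f y"
    "\<And>t x. x \<in> W \<Longrightarrow> f (t *\<^sub>R x) = t * f x" "\<And>x. x \<in> W \<Longrightarrow> f x \<le> p x"
    by (rule hahn_banach_sublinear[OF W p(1)]) (assumption | rule that)+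
  have le: "f h \<le> N (h + x) - r" if "h \<in> W" "(x, r) \<in> K" for h x r
    by (rule order_trans[OF f(3)[OF that(1)] p(2)[OF that]])
  show ?thesis
  proof (rule that[OF f(1,2)])
    show "f x \<le> N x" if "x \<in> W" for x using le[OF that K(1)] by simp
    show "r \<le> f x" if "(x, r) \<in> K" for x r
    proof -
      have x: "x \<in> W" using K(4)[OF that] by simp
      show ?thesis
        using le[OF subspace_neg[OF W x] that] f(2)[OF x, of "- 1"] sublinear_on_zero[OF W N] by simp
    qed
  qed
qed

section \<open>Projections, adjoints, extension from spanning families, and positive definite
  kernels\<close>

section \<open>Hilbert space geometry\<close>

lemma cinner_zero_left [simp]: "cinner 0 y = 0"
  for y :: "'a::complex_hilbert"
  using cinner_add_left[of 0 0 y] by simp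

lemma cinner_zero_right [simp]: "cinner y 0 = 0"
  for y :: "'a::complex_hilbert"
  using cinner_add_right[of y 0 0] by simp

lemma cinner_minus_left [simp]: "cinner (- x) y = - cinner x y"
  for y :: "'a::complex_hilbert"
  using cinner_add_left[of x "- x" y] by (simp add: eq_neg_iff_add_eq_0 add.commute)

lemma cinner_minus_right [simp]: "cinner x (- y) = - cinner x y"
  for y :: "'a::complex_hilbert"
  using cinner_add_right[of x y "- y"] by (simp add: eq_neg_iff_add_eq_0 add.commute)

lemma cinner_diff_left: "cinner (x - y) z = cinner x z - cinner y z"
  for x y z :: "'a::complex_hilbert"
  using cinner_add_left[of x "- y" z] by simp

lemma cinner_diff_right: "cinner z (x - y) = cinner z x - cinner z y"
  for x y z :: "'a::complex_hilbert"
  using cinner_add_right[of z x "- y"] by simp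

lemma cinner_sum_left: "cinner (sum f S) y = (\<Sum>i\<in>S. cinner (f i) y)"
  for y :: "'a::complex_hilbert"
  by (induction S rule: infinite_finite_induct) (auto simp: cinner_add_left)

lemma cinner_sum_right: "cinner y (sum f S) = (\<Sum>i\<in>S. cinner y (f i))"
  for y :: "'a::complex_hilbert"
  by (induction S rule: infinite_finite_induct) (auto simp: cinner_add_right)

lemma cinner_self: "cinner x x = of_real ((norm x)\<^sup>2)"
  for x :: "'a::complex_hilbert"
proof -
  have "Im (cinner x x) = 0" using arg_cong[OF cinner_commute[of x x], of Im] by simp
  thus ?thesis by (simp add: complex_eq_iff Re_cinner power2_norm_eq_inner)
qed

lemma Re_cinner_self: "Re (cinner x x) = (norm x)\<^sup>2"
  for x :: "'a::complex_hilbert"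
  by (simp add: cinner_self del: of_real_power)

lemma scaleC_one [simp]: "1 *\<^sub>C x = (x::'a::complex_vector)"
  using scaleC_of_real[of 1 x] by simp

lemma scaleC_zero_left [simp]: "0 *\<^sub>C x = (0::'a::complex_vector)"
  using scaleC_of_real[of 0 x] by simp

lemma scaleC_minus_left [simp]: "(- c) *\<^sub>C x = - (c *\<^sub>C (x::'a::complex_vector))"
  using scaleC_add_left[of c "- c" x] by (simp add: eq_neg_iff_add_eq_0 add.commute)

lemma scaleC_sum_right: "c *\<^sub>C sum f S = (\<Sum>i\<in>S. c *\<^sub>C f i)"
  for f :: "'i \<Rightarrow> 'a::complex_vector"
  by (induction S rule: infinite_finite_induct) (auto simp: scaleC_add_right)

lemma norm_plus_square: "(norm (x + y))\<^sup>2 = (norm x)\<^sup>2 + 2 * Re (cinner x y) + (norm y)\<^sup>2"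
  for x y :: "'a::complex_hilbert"
  by (simp add: Re_cinner power2_norm_eq_inner inner_add_left inner_add_right inner_commute)

lemma norm_minus_square: "(norm (x - y))\<^sup>2 = (norm x)\<^sup>2 - 2 * Re (cinner x y) + (norm y)\<^sup>2"
  for x y :: "'a::complex_hilbert"
  using norm_plus_square[of x "- y"] by simp

lemma Re_cinner_le: "Re (cinner x y) \<le> norm x * norm y"
  for x y :: "'a::complex_hilbert"
  unfolding Re_cinner by (rule norm_cauchy_schwarz)

lemma cinner_eqI_left: "x = y" if "\<And>z. cinner x z = cinner y z" for x y :: "'a::complex_hilbert"
  by (rule cinner_eqI) (metis that cinner_commute)

lemma bounded_linear_cinner_left: "bounded_linear (\<lambda>x. cinner x y)"
  for y :: "'a::complex_hilbert"
proof (rule bounded_linear_intro[where K="norm y"])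
  show "cinner (r *\<^sub>R x) y = r *\<^sub>R cinner x y" for r x
    using cinner_scaleC_left[of "of_real r" x y] by (simp add: scaleC_of_real scaleR_conv_of_real)
  show "norm (cinner x y) \<le> norm x * norm y" for x using norm_cinner_le by auto
qed (rule cinner_add_left)

lemma bounded_linear_cinner_right: "bounded_linear (\<lambda>x. cinner y x)"
  for y :: "'a::complex_hilbert"
proof (rule bounded_linear_intro[where K="norm y"])
  show "cinner y (r *\<^sub>R x) = r *\<^sub>R cinner y x" for r x
    using cinner_scaleC_right[of y "of_real r" x] by (simp add: scaleC_of_real scaleR_conv_of_real)
  show "norm (cinner y x) \<le> norm x * norm y" for x
    using norm_cinner_le[of y x] by (simp add: mult.commute)
qed (rule cinner_add_right)

lemmas tendsto_cinner_left = bounded_linear.tendsto[OF bounded_linear_cinner_left]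
lemmas tendsto_cinner_right = bounded_linear.tendsto[OF bounded_linear_cinner_right]
lemmas continuous_on_cinner_left = bounded_linear.continuous_on[OF bounded_linear_cinner_left]
lemmas tendsto_scaleC = bounded_linear.tendsto[OF bounded_linear_scaleC]

subsection \<open>Closed subspaces\<close>

definition closed_csubspace :: "'a::complex_hilbert set \<Rightarrow> bool"
  where "closed_csubspace M \<longleftrightarrow> closed M \<and> 0 \<in> M \<and> (\<forall>x\<in>M. \<forall>y\<in>M. x + y \<in> M) \<and>
    (\<forall>c. \<forall>x\<in>M. c *\<^sub>C x \<in> M)"

lemma closed_csubspaceD:
  assumes "closed_csubspace M"
  shows "closed M" "0 \<in> M" "x \<in> M \<Longrightarrow> y \<in> M \<Longrightarrow> x + y \<in> M" "x \<in> M \<Longrightarrow> c *\<^sub>C x \<in> M"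
    "x \<in> M \<Longrightarrow> r *\<^sub>R x \<in> M" "x \<in> M \<Longrightarrow> - x \<in> M" "x \<in> M \<Longrightarrow> y \<in> M \<Longrightarrow> x - y \<in> M"
proof -
  show s: "closed M" "0 \<in> M" "x \<in> M \<Longrightarrow> y \<in> M \<Longrightarrow> x + y \<in> M" "x \<in> M \<Longrightarrow> c *\<^sub>C x \<in> M" for x y c
    using assms by (auto simp: closed_csubspace_def)
  show "x \<in> M \<Longrightarrow> r *\<^sub>R x \<in> M" using s(4)[of x "of_real r"] by (simp add: scaleC_of_real)
  show n: "x \<in> M \<Longrightarrow> - x \<in> M" for x using s(4)[of x "- 1"] by simp
  show "x \<in> M \<Longrightarrow> y \<in> M \<Longrightarrow> x - y \<in> M" using s(3)[of x "- y"] n[of y] by simp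
qed

text \<open>The closed span. As an intersection of closed subspaces it lets a property pass from
  spanning vectors to all vectors once its solution set is known to be a closed subspace.\<close>

definition cspan :: "'a::complex_hilbert set \<Rightarrow> 'a set"
  where "cspan B = \<Inter>{M. closed_csubspace M \<and> B \<subseteq> M}"

lemma closed_csubspace_cspan: "closed_csubspace (cspan B)"
  unfolding closed_csubspace_def cspan_def
  by (auto intro!: closed_Inter simp: closed_csubspaceD)

lemma cspan_superset: "x \<in> B \<Longrightarrow> x \<in> cspan B"
  unfolding cspan_def by blast

lemma cspan_subset: "closed_csubspace M \<Longrightarrow> B \<subseteq> M \<Longrightarrow> cspan B \<subseteq> M"
  unfolding cspan_def by blast

lemma closed_csubspace_orth: "closed_csubspace {x. \<forall>y\<in>B. cinner x y = 0}"
proof -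
  have "{x. \<forall>y\<in>B. cinner x y = 0} = (\<Inter>y\<in>B. {x. cinner x y = 0})" by auto
  moreover have "closed {x. cinner x y = 0}" for y :: 'a
    by (intro closed_Collect_eq continuous_on_cinner_left continuous_intros)
  ultimately show ?thesis
    unfolding closed_csubspace_def by (auto simp: cinner_add_left cinner_scaleC_left)
qed

lemma orth_cspan: "x \<in> cspan B \<Longrightarrow> (\<And>b. b \<in> B \<Longrightarrow> cinner b y = 0) \<Longrightarrow> cinner x y = 0"
  using cspan_subset[OF closed_csubspace_orth[of "{y}"], of B] by auto

text \<open>Closest points exist by the parallelogram law.\<close>

lemma orthogonal_decomposition:
  fixes M :: "'a::complex_hilbert set"
  assumes M: "closed_csubspace M"
  shows "\<exists>m\<in>M. \<forall>y\<in>M. cinner (x - m) y = 0"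
proof -
  note Mi = closed_csubspaceD[OF M]
  define d where "d = (INF y\<in>M. (norm (x - y))\<^sup>2)"
  have bdd: "bdd_below ((\<lambda>y. (norm (x - y))\<^sup>2) ` M)" by (intro bdd_belowI2[where m=0]) auto
  have d_le: "d \<le> (norm (x - y))\<^sup>2" if "y \<in> M" for y
    unfolding d_def using that bdd by (intro cINF_lower)
  have "\<exists>y\<in>M. (norm (x - y))\<^sup>2 < d + inverse (real (Suc n))" for n
  proof -
    have "d < d + inverse (real (Suc n))" by simp
    thus ?thesis unfolding d_def using Mi(2) bdd by (subst (asm) cINF_less_iff) auto
  qed
  then obtain y where yM: "\<And>n. y n \<in> M" and y: "\<And>n. (norm (x - y n))\<^sup>2 < d + inverse (real (Suc n))"
    by metis
  have par: "(norm (u - v))\<^sup>2 \<le> 2 * ((norm (x - u))\<^sup>2 - d) + 2 * ((norm (x - v))\<^sup>2 - d)"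
    if "u \<in> M" "v \<in> M" for u v
  proof -
    define w where "w = (1/2) *\<^sub>R (u + v)"
    have "d \<le> (norm (x - w))\<^sup>2" unfolding w_def using that by (intro d_le Mi)
    moreover have "(norm (u - v))\<^sup>2 = 2 * (norm (x - u))\<^sup>2 + 2 * (norm (x - v))\<^sup>2 - 4 * (norm (x - w))\<^sup>2"
      by (simp add: w_def power2_norm_eq_inner inner_add_left inner_add_right inner_diff_left
          inner_diff_right inner_commute algebra_simps)
    ultimately show ?thesis by simp
  qed
  have "Cauchy y"
  proof (rule metric_CauchyI)
    fix e :: real assume "e > 0"
    hence "e\<^sup>2 / 4 > 0" by simp
    then obtain N where N: "inverse (real (Suc N)) < e\<^sup>2 / 4"
      using reals_Archimedean by blast
    have "dist (y p) (y q) < e" if "p \<ge> N" "q \<ge> N" for p q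
    proof -
      have "inverse (real (Suc p)) \<le> inverse (real (Suc N))"
        "inverse (real (Suc q)) \<le> inverse (real (Suc N))"
        using that by (auto simp: field_simps)
      hence "(norm (x - y p))\<^sup>2 - d < e\<^sup>2 / 4" "(norm (x - y q))\<^sup>2 - d < e\<^sup>2 / 4"
        using y[of p] y[of q] N by linarith+
      hence "(norm (y p - y q))\<^sup>2 < e\<^sup>2" using par[OF yM[of p] yM[of q]] by argo
      thus ?thesis
        using \<open>e > 0\<close> unfolding dist_norm by (meson less_imp_le power_less_imp_less_base)
    qed
    thus "\<exists>N. \<forall>p\<ge>N. \<forall>q\<ge>N. dist (y p) (y q) < e" by blast
  qed
  then obtain m where m: "y \<longlonglongrightarrow> m" using Cauchy_convergent convergent_def by blast
  have mM: "m \<in> M" using Mi(1) yM m by (meson closed_sequentially)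
  have "(norm (x - m))\<^sup>2 \<le> d"
  proof (rule LIMSEQ_le)
    show "(\<lambda>n. (norm (x - y n))\<^sup>2) \<longlonglongrightarrow> (norm (x - m))\<^sup>2" by (intro tendsto_intros m)
    show "(\<lambda>n. d + inverse (real (Suc n))) \<longlonglongrightarrow> d" using LIMSEQ_inverse_real_of_nat_add by simp
    show "\<exists>N. \<forall>n\<ge>N. (norm (x - y n))\<^sup>2 \<le> d + inverse (real (Suc n))" using y less_imp_le by blast
  qed
  hence min: "(norm (x - m))\<^sup>2 \<le> (norm (x - y))\<^sup>2" if "y \<in> M" for y
    using d_le[OF that] by (rule order_trans)
  have "cinner (x - m) y = 0" if yM: "y \<in> M" for y
  proof (cases "y = 0")
    case False
    define c where "c = cinner (x - m) y"
    \<comment> \<open>Here s y is the component of x - m along y. Removing it would lower the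
      squared distance by the quotient of the squared norms of c and y, against the minimality of
      m.\<close>
    define s where "s = c / of_real ((norm y)\<^sup>2)"
    have "(norm (x - m))\<^sup>2 \<le> (norm ((x - m) - s *\<^sub>C y))\<^sup>2"
      using min[of "m + s *\<^sub>C y"] Mi(3)[OF mM Mi(4)[OF yM]] by (simp add: diff_diff_eq)
    also have "\<dots> = (norm (x - m))\<^sup>2 - 2 * Re (cnj s * c) + (cmod s)\<^sup>2 * (norm y)\<^sup>2"
      by (simp add: norm_minus_square cinner_scaleC_right c_def norm_scaleC power_mult_distrib)
    also have "cnj s * c = of_real ((cmod c)\<^sup>2 / (norm y)\<^sup>2)"
      by (simp add: s_def complex_norm_square mult.commute del: of_real_power)
    also have "(cmod s)\<^sup>2 * (norm y)\<^sup>2 = (cmod c)\<^sup>2 / (norm y)\<^sup>2"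
      using False by (simp add: s_def norm_divide power_divide norm_mult power2_eq_square)
    finally have "(cmod c)\<^sup>2 / (norm y)\<^sup>2 \<le> 0" by simp
    thus ?thesis using False by (simp add: divide_le_0_iff c_def)
  qed simp
  thus ?thesis using mM by blast
qed

subsection \<open>Operators\<close>

lemma bop_eqI: "S = T" if "\<And>x. op_apply S x = op_apply T x"
  using that by (metis ext op_apply_inject)

lemma op_apply_times [simp]: "op_apply (S * T) x = op_apply S (op_apply T x)"
  by (simp add: times_bop.rep_eq)
lemma op_apply_one [simp]: "op_apply 1 x = x"
  by (simp add: one_bop.rep_eq)
lemma op_apply_zero [simp]: "op_apply 0 x = 0"
  by (simp add: zero_bop.rep_eq)
lemma op_apply_plus: "op_apply (S + T) x = op_apply S x + op_apply T x"
  by (simp add: plus_bop.rep_eq)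
lemma op_apply_minus: "op_apply (S - T) x = op_apply S x - op_apply T x"
  by (simp add: minus_bop.rep_eq)
lemma op_apply_uminus: "op_apply (- S) x = - op_apply S x"
  by (simp add: uminus_bop.rep_eq)
lemma op_apply_scaleC_bop: "op_apply (c *\<^sub>C S) x = c *\<^sub>C op_apply S x"
  by (simp add: scaleC_bop.rep_eq)
lemma op_apply_scaleR_bop: "op_apply (c *\<^sub>R S) x = c *\<^sub>R op_apply S x"
  by (simp add: scaleR_bop.rep_eq)
lemma op_apply_sum: "op_apply (sum f S) x = (\<Sum>i\<in>S. op_apply (f i) x)"
  by (induction S rule: infinite_finite_induct) (auto simp: op_apply_plus)

lemmas op_apply_simps = op_apply_plus op_apply_minus op_apply_uminus op_apply_scaleC_bop
  op_apply_scaleR_bop op_apply_sum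

lemma bounded_linear_op_apply: "bounded_linear (op_apply T)"
  using op_apply[of T] by auto

lemmas tendsto_op_apply = bounded_linear.tendsto[OF bounded_linear_op_apply]
lemmas op_apply_zero_right [simp] = bounded_linear.linear[OF bounded_linear_op_apply, THEN linear_0]
lemmas op_apply_diff = bounded_linear.linear[OF bounded_linear_op_apply, THEN linear_diff]
lemmas op_apply_sum_right = bounded_linear.linear[OF bounded_linear_op_apply, THEN linear_sum]
lemmas op_apply_scaleR = bounded_linear.linear[OF bounded_linear_op_apply, THEN linear_scale]

lemma norm_bop_le: "norm T \<le> K" if "\<And>x. norm (op_apply T x) \<le> K * norm x" "K \<ge> 0"
  using that by transfer (auto intro: onorm_bound)

lemma norm_bop_le_unit: 
  assumes "K \<ge> 0" "\<And>x. norm x \<le> 1 \<Longrightarrow> norm (op_apply T x) \<le> K" shows "norm T \<le> K"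
proof (rule norm_bop_le[OF _ assms(1)])
  fix x
  show "norm (op_apply T x) \<le> K * norm x"
  proof (cases "x = 0")
    case False
    have "norm (op_apply T (x /\<^sub>R norm x)) \<le> K" using False by (intro assms) simp
    thus ?thesis using False by (simp add: op_apply_scaleR field_simps)
  qed simp
qed

lemma bounded_linear_apply_at: "bounded_linear (\<lambda>T. op_apply T x)"
proof (rule bounded_linear_intro[where K="norm x"])
  show "norm (op_apply T x) \<le> norm T * norm x" for T using norm_op_apply_le .
qed (simp_all add: op_apply_simps)

lemmas tendsto_apply_at = bounded_linear.tendsto[OF bounded_linear_apply_at]

lemma bounded_linear_scaleC_bop: "bounded_linear (\<lambda>T. c *\<^sub>C (T::'a::complex_hilbert bop))"
proof (rule bounded_linear_intro[where K="cmod c"])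
  show "norm (c *\<^sub>C T) \<le> norm T * cmod c" for T :: "'a bop"
  proof (rule norm_bop_le)
    show "0 \<le> norm T * cmod c" by simp
    fix x
    have "norm (op_apply T x) * cmod c \<le> norm T * norm x * cmod c"
      by (intro mult_right_mono norm_op_apply_le) auto
    thus "norm (op_apply (c *\<^sub>C T) x) \<le> norm T * cmod c * norm x"
      by (simp add: op_apply_simps norm_scaleC mult_ac)
  qed
qed (simp_all add: scaleC_add_right scaleC_scaleR)

lemmas tendsto_scaleC_bop = bounded_linear.tendsto[OF bounded_linear_scaleC_bop]

lemma scaleC_times_left [simp]: "(c *\<^sub>C S) * T = c *\<^sub>C (S * T)"
  for S :: "'a::complex_hilbert bop"
  by (rule bop_eqI) (simp add: op_apply_simps)
lemma scaleC_times_right [simp]: "S * (c *\<^sub>C T) = c *\<^sub>C (S * T)"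
  for S :: "'a::complex_hilbert bop"
  by (rule bop_eqI) (simp add: op_apply_simps op_apply_scaleC)

lemma cinner_adj_left: "cinner (op_apply (adj T) x) y = cinner x (op_apply T y)"
  by (metis cinner_adj cinner_commute)

lemma adj_eqI: "adj T = S" if "\<And>x y. cinner (op_apply T x) y = cinner x (op_apply S y)"
  by (rule bop_eqI, rule cinner_eqI) (simp flip: that cinner_adj)

lemma adj_adj [simp]: "adj (adj T) = T"
  by (rule adj_eqI) (rule cinner_adj_left)
lemma adj_times [simp]: "adj (S * T) = adj T * adj S"
  by (rule adj_eqI) (simp add: cinner_adj)
lemma adj_plus [simp]: "adj (S + T) = adj S + adj T"
  by (rule adj_eqI) (simp add: cinner_adj op_apply_simps cinner_add_left cinner_add_right)
lemma adj_minus [simp]: "adj (S - T) = adj S - adj T"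
  by (rule adj_eqI) (simp add: cinner_adj op_apply_simps cinner_diff_left cinner_diff_right)
lemma adj_zero [simp]: "adj 0 = 0"
  by (rule adj_eqI) simp
lemma adj_uminus [simp]: "adj (- T) = - adj T"
  using adj_minus[of 0 T] by simp
lemma adj_one [simp]: "adj 1 = 1"
  by (rule adj_eqI) simp
lemma adj_scaleC [simp]: "adj (c *\<^sub>C T) = cnj c *\<^sub>C adj T"
  by (rule adj_eqI) (simp add: cinner_adj op_apply_simps cinner_scaleC_left cinner_scaleC_right)
lemma adj_scaleR [simp]: "adj (r *\<^sub>R T) = r *\<^sub>R adj T"
  using adj_scaleC[of "of_real r" T] by (simp add: scaleC_of_real)
lemma adj_inject [simp]: "adj S = adj T \<longleftrightarrow> S = T"
  by (metis adj_adj)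

lemma norm_adj_le: "norm (adj T) \<le> norm T"
proof (rule norm_bop_le[OF _ norm_ge_zero])
  fix x
  let ?z = "op_apply (adj T) x"
  have "(norm ?z)\<^sup>2 = Re (cinner (op_apply T ?z) x)"
    by (simp only: cinner_adj[of T ?z x] Re_cinner_self)
  also have "\<dots> \<le> norm (op_apply T ?z) * norm x" by (rule Re_cinner_le)
  also have "\<dots> \<le> (norm T * norm ?z) * norm x" by (intro mult_right_mono norm_op_apply_le) auto
  finally show "norm ?z \<le> norm T * norm x"
    by (cases "norm ?z = 0") (auto simp: power2_eq_square mult_ac)
qed

lemma norm_adj [simp]: "norm (adj T) = norm T"
  by (metis adj_adj norm_adj_le order_antisym)

lemma bounded_linear_adj: "bounded_linear adj"
  by (rule bounded_linear_intro[where K=1]) auto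

lemmas tendsto_adj = bounded_linear.tendsto[OF bounded_linear_adj]

lemma norm_adj_times: "norm (adj T * T) = (norm T)\<^sup>2"
proof (rule antisym)
  show "norm (adj T * T) \<le> (norm T)\<^sup>2"
    using norm_mult_ineq[of "adj T" T] by (simp add: power2_eq_square)
  have "norm T \<le> sqrt (norm (adj T * T))"
  proof (rule norm_bop_le)
    show "0 \<le> sqrt (norm (adj T * T))" by simp
    fix x
    have "(norm (op_apply T x))\<^sup>2 = Re (cinner (op_apply (adj T * T) x) x)"
      by (simp add: cinner_adj_left Re_cinner_self)
    also have "\<dots> \<le> norm (op_apply (adj T * T) x) * norm x" by (rule Re_cinner_le)
    also have "\<dots> \<le> (norm (adj T * T) * norm x) * norm x"
      by (intro mult_right_mono norm_op_apply_le) auto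
    finally have "(norm (op_apply T x))\<^sup>2 \<le> (sqrt (norm (adj T * T)) * norm x)\<^sup>2"
      by (simp add: power_mult_distrib) (simp add: power2_eq_square mult.assoc)
    thus "norm (op_apply T x) \<le> sqrt (norm (adj T * T)) * norm x"
      by (rule power2_le_imp_le) simp
  qed
  thus "(norm T)\<^sup>2 \<le> norm (adj T * T)"
    using power_mono[of "norm T" "sqrt (norm (adj T * T))" 2] by simp
qed

instance bop :: (complex_hilbert) complete_space
proof
  fix X :: "nat \<Rightarrow> 'a bop" assume X: "Cauchy X"
  have dist: "dist (op_apply (X m) x) (op_apply (X n) x) \<le> dist (X m) (X n) * norm x" for m n x
    using norm_op_apply_le[of "X m - X n" x] by (simp add: dist_norm op_apply_simps)
  have "Cauchy (\<lambda>n. op_apply (X n) x)" for x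
  proof (rule metric_CauchyI)
    fix e :: real assume e: "e > 0"
    hence "e / (norm x + 1) > 0" by (simp add: add_nonneg_pos)
    then obtain N where N: "\<And>m n. m \<ge> N \<Longrightarrow> n \<ge> N \<Longrightarrow> dist (X m) (X n) < e / (norm x + 1)"
      using X unfolding Cauchy_def by metis
    have "dist (op_apply (X m) x) (op_apply (X n) x) < e" if "m \<ge> N" "n \<ge> N" for m n
    proof -
      have "dist (X m) (X n) * norm x \<le> dist (X m) (X n) * (norm x + 1)"
        by (intro mult_left_mono) auto
      also have "\<dots> < e" using N[OF that] by (simp add: pos_less_divide_eq add_nonneg_pos)
      finally show ?thesis using dist[of m x n] by linarith
    qed
    thus "\<exists>N. \<forall>m\<ge>N. \<forall>n\<ge>N. dist (op_apply (X m) x) (op_apply (X n) x) < e" by blast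
  qed
  hence "\<exists>l. (\<lambda>n. op_apply (X n) x) \<longlonglongrightarrow> l" for x
    using Cauchy_convergent convergent_def by blast
  then obtain f where f: "\<And>x. (\<lambda>n. op_apply (X n) x) \<longlonglongrightarrow> f x" by metis
  have "Bseq X" using X by (rule Cauchy_Bseq)
  then obtain K where K: "\<And>n. norm (X n) \<le> K" by (auto simp: Bseq_def)
  have "bounded_linear f"
  proof (rule bounded_linear_intro[where K=K])
    show "f (x + y) = f x + f y" for x y
      using LIMSEQ_unique[OF f[of "x + y"]] tendsto_add[OF f[of x] f[of y]]
      by (simp add: op_apply_add)
    show "f (r *\<^sub>R x) = r *\<^sub>R f x" for r x
      using LIMSEQ_unique[OF f[of "r *\<^sub>R x"]] tendsto_scaleR[OF tendsto_const f[of x], of r]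
      by (simp add: op_apply_scaleR)
    show "norm (f x) \<le> norm x * K" for x
    proof (rule LIMSEQ_le_const2[OF tendsto_norm[OF f[of x]]], intro exI allI impI)
      fix n
      show "norm (op_apply (X n) x) \<le> norm x * K"
        using norm_op_apply_le[of "X n" x] mult_right_mono[OF K[of n] norm_ge_zero[of x]]
        by (simp add: mult.commute)
    qed
  qed
  moreover have "f (c *\<^sub>C x) = c *\<^sub>C f x" for c x
    using LIMSEQ_unique[OF f[of "c *\<^sub>C x"]] tendsto_scaleC[OF f[of x], of c]
    by (simp add: op_apply_scaleC)
  ultimately have Bf: "op_apply (Bop f) = f" by (intro Bop_inverse) simp
  have "X \<longlonglongrightarrow> Bop f"
  proof (rule metric_LIMSEQ_I)
    fix r :: real assume r: "r > 0"
    then obtain N where N: "\<And>m n. m \<ge> N \<Longrightarrow> n \<ge> N \<Longrightarrow> dist (X m) (X n) < r / 2"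
      using X unfolding Cauchy_def by (meson half_gt_zero)
    have "dist (X n) (Bop f) < r" if n: "n \<ge> N" for n
    proof -
      have "norm (X n - Bop f) \<le> r / 2"
      proof (rule norm_bop_le)
        show "0 \<le> r / 2" using r by simp
        fix x
        have "(\<lambda>m. dist (op_apply (X n) x) (op_apply (X m) x)) \<longlonglongrightarrow> dist (op_apply (X n) x) (f x)"
          by (intro tendsto_intros f)
        moreover have "dist (op_apply (X n) x) (op_apply (X m) x) \<le> r / 2 * norm x" if "m \<ge> N" for m
          using dist[of n x m] mult_right_mono[OF less_imp_le[OF N[OF n that]] norm_ge_zero[of x]]
          by linarith
        ultimately have "dist (op_apply (X n) x) (f x) \<le> r / 2 * norm x"
          by (intro LIMSEQ_le_const2) auto
        thus "norm (op_apply (X n - Bop f) x) \<le> r / 2 * norm x"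
          by (simp add: op_apply_simps Bf dist_norm)
      qed
      thus ?thesis using r by (simp add: dist_norm)
    qed
    thus "\<exists>N. \<forall>n\<ge>N. dist (X n) (Bop f) < r" by blast
  qed
  thus "convergent X" by (rule convergentI)
qed

instance bop :: (complex_hilbert) banach ..

subsection \<open>Operators between different Hilbert spaces\<close>

text \<open>The type \<open>bop\<close> contains operators of one space only. Maps between different
  spaces, such as the isometries below, are plain functions with this property, and
  \<open>hadj\<close> is their adjoint.\<close>

definition bounded_clinear :: "('a::complex_hilbert \<Rightarrow> 'b::complex_hilbert) \<Rightarrow> bool"
  where "bounded_clinear T \<longleftrightarrow> bounded_linear T \<and> (\<forall>c x. T (c *\<^sub>C x) = c *\<^sub>C T x)"

lemma bounded_clinear_intro:
  fixes T :: "'a::complex_hilbert \<Rightarrow> 'b::complex_hilbert"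
  assumes "\<And>x y. T (x + y) = T x + T y" "\<And>c x. T (c *\<^sub>C x) = c *\<^sub>C T x"
    "\<And>x. norm (T x) \<le> K * norm x"
  shows "bounded_clinear T"
  unfolding bounded_clinear_def
proof (intro conjI allI assms(2) bounded_linear_intro[where K=K])
  show "T (r *\<^sub>R x) = r *\<^sub>R T x" for r x using assms(2)[of "of_real r" x] by (simp add: scaleC_of_real)
qed (use assms in \<open>auto simp: mult.commute\<close>)

lemma bounded_clinear_op_apply: "bounded_clinear (op_apply T)"
  unfolding bounded_clinear_def by (simp add: bounded_linear_op_apply op_apply_scaleC)

lemma op_apply_Bop: "bounded_clinear T \<Longrightarrow> op_apply (Bop T) = T"
  by (intro Bop_inverse) (auto simp: bounded_clinear_def)

lemma bounded_clinearD:
  assumes "bounded_clinear T"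
  shows "bounded_linear T" "T (x + y) = T x + T y" "T (c *\<^sub>C x) = c *\<^sub>C T x" "T 0 = 0"
    "T (x - y) = T x - T y" "T (r *\<^sub>R x) = r *\<^sub>R T x" "T (sum f S) = (\<Sum>i\<in>S. T (f i))"
proof -
  show b: "bounded_linear T" and "T (c *\<^sub>C x) = c *\<^sub>C T x" using assms by (auto simp: bounded_clinear_def)
  note l = bounded_linear.linear[OF b]
  show "T (x + y) = T x + T y" "T 0 = 0" "T (x - y) = T x - T y" "T (r *\<^sub>R x) = r *\<^sub>R T x"
    "T (sum f S) = (\<Sum>i\<in>S. T (f i))"
    using linear_add[OF l] linear_0[OF l] linear_diff[OF l] linear_scale[OF l] linear_sum[OF l] by auto
qed

lemma bounded_clinear_compose:
  "bounded_clinear S \<Longrightarrow> bounded_clinear T \<Longrightarrow> bounded_clinear (\<lambda>x. S (T x))"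
  unfolding bounded_clinear_def by (simp add: bounded_linear_compose)

lemma adjoint_exists:
  fixes T :: "'a::complex_hilbert \<Rightarrow> 'b::complex_hilbert"
  assumes T: "bounded_clinear T"
  shows "\<exists>S. bounded_clinear S \<and> (\<forall>x y. cinner (T x) y = cinner x (S y))"
proof -
  note Td = bounded_clinearD[OF T]
  have "\<exists>z. \<forall>x. inner (T x) y = inner x z" for y
    by (rule riesz_representation)
       (rule bounded_linear_compose[OF bounded_linear_inner_left Td(1)])
  then obtain s where s: "\<And>x y. inner (T x) y = inner x (s y)" by metis
  have i: "cinner (T x) y = cinner x (s y)" for x y
  proof -
    have "Re (\<i> * cinner (T x) y) = inner (T (\<i> *\<^sub>C x)) y"
      by (simp only: Re_cinner[symmetric] Td cinner_scaleC_left)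
    also have "\<dots> = Re (\<i> * cinner x (s y))"
      by (simp only: s) (simp only: Re_cinner[symmetric] cinner_scaleC_left)
    finally show ?thesis using s[of x y] by (simp add: complex_eq_iff Re_cinner)
  qed
  obtain K where K: "\<And>x. norm (T x) \<le> norm x * K" using bounded_linear.bounded[OF Td(1)] by auto
  have "bounded_clinear s"
  proof (rule bounded_clinear_intro)
    show "s (y + z) = s y + s z" for y z
      by (rule cinner_eqI) (simp add: i[symmetric] cinner_add_right)
    show "s (c *\<^sub>C y) = c *\<^sub>C s y" for c y
      by (rule cinner_eqI) (simp add: i[symmetric] cinner_scaleC_right)
    show "norm (s y) \<le> \<bar>K\<bar> * norm y" for y
    proof -
      have "(norm (s y))\<^sup>2 = Re (cinner (T (s y)) y)" by (simp add: i Re_cinner_self)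
      also have "\<dots> \<le> norm (T (s y)) * norm y" by (rule Re_cinner_le)
      also have "\<dots> \<le> (norm (s y) * K) * norm y" by (intro mult_right_mono K) auto
      also have "\<dots> \<le> (norm (s y) * \<bar>K\<bar>) * norm y" by (intro mult_right_mono mult_left_mono) auto
      finally show ?thesis by (cases "norm (s y) = 0") (auto simp: power2_eq_square mult_ac)
    qed
  qed
  thus ?thesis using i by blast
qed

definition hadj :: "('a::complex_hilbert \<Rightarrow> 'b::complex_hilbert) \<Rightarrow> 'b \<Rightarrow> 'a"
  where "hadj T = (SOME S. bounded_clinear S \<and> (\<forall>x y. cinner (T x) y = cinner x (S y)))"

lemma hadj:
  assumes "bounded_clinear T"
  shows "bounded_clinear (hadj T)" "cinner (T x) y = cinner x (hadj T y)"
    "cinner (hadj T y) x = cinner y (T x)"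
proof -
  have *: "bounded_clinear (hadj T) \<and> (\<forall>x y. cinner (T x) y = cinner x (hadj T y))"
    unfolding hadj_def by (rule someI_ex[OF adjoint_exists[OF assms]])
  thus "bounded_clinear (hadj T)" "cinner (T x) y = cinner x (hadj T y)" by blast+
  show "cinner (hadj T y) x = cinner y (T x)"
    using * by (metis cinner_commute)
qed

subsection \<open>Projections\<close>

lemma projection_exists:
  fixes M :: "'a::complex_hilbert set"
  assumes M: "closed_csubspace M"
  shows "\<exists>p. adj p = p \<and> p * p = p \<and> (\<forall>x. op_apply p x \<in> M) \<and> (\<forall>x\<in>M. op_apply p x = x)"
proof -
  note Mi = closed_csubspaceD[OF M]
  obtain P where P: "\<And>x. P x \<in> M" "\<And>x y. y \<in> M \<Longrightarrow> cinner (x - P x) y = 0"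
    using orthogonal_decomposition[OF M] by metis
  have uniq: "P x = m" if m: "m \<in> M" "\<And>y. y \<in> M \<Longrightarrow> cinner (x - m) y = 0" for x m
  proof -
    have "P x - m \<in> M" by (intro Mi P m)
    hence "cinner ((x - m) - (x - P x)) (P x - m) = 0"
      unfolding cinner_diff_left[of "x - m"] using P m by simp
    thus ?thesis by (simp add: cinner_self)
  qed
  have nle: "norm (P x) \<le> 1 * norm x" for x
  proof -
    have "(norm x)\<^sup>2 = (norm (x - P x))\<^sup>2 + (norm (P x))\<^sup>2"
      using norm_plus_square[of "x - P x" "P x"] P by simp
    hence "(norm (P x))\<^sup>2 \<le> (norm x)\<^sup>2" by simp
    thus ?thesis by (simp add: power2_le_iff_abs_le)
  qed
  have add: "P (x + y) = P x + P y" for x y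
    by (rule uniq) (auto intro!: Mi P simp: cinner_add_left P(2) add_diff_add)
  have scale: "P (c *\<^sub>C x) = c *\<^sub>C P x" for c x
    by (rule uniq) (auto intro!: Mi P simp: cinner_scaleC_left P(2) simp flip: scaleC_diff_right)
  define p where "p = Bop P"
  have p: "op_apply p = P" unfolding p_def
    by (rule op_apply_Bop, rule bounded_clinear_intro[OF add scale nle])
  have fixed: "P x = x" if "x \<in> M" for x by (rule uniq) (auto simp: that)
  have "adj p = p"
  proof (rule adj_eqI)
    fix x y
    have "cinner (P x) y = cinner (P x) (P y)"
      using P(2)[of "P x" y] P(1) by (metis cinner_commute cinner_diff_right complex_cnj_zero eq_iff_diff_eq_0)
    also have "\<dots> = cinner x (P y)" using P(2)[of "P y" x] P(1) by (simp add: cinner_diff_left)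
    finally show "cinner (op_apply p x) y = cinner x (op_apply p y)" by (simp add: p)
  qed
  moreover have "p * p = p" by (rule bop_eqI) (simp add: p fixed P(1))
  ultimately show ?thesis by (intro exI[of _ p]) (simp add: p fixed P(1))
qed

definition cproj :: "'a::complex_hilbert set \<Rightarrow> 'a bop"
  where "cproj M = (SOME p. adj p = p \<and> p * p = p \<and> (\<forall>x. op_apply p x \<in> M) \<and> (\<forall>x\<in>M. op_apply p x = x))"

lemma cproj:
  assumes "closed_csubspace M"
  shows "adj (cproj M) = cproj M" "cproj M * cproj M = cproj M" "op_apply (cproj M) x \<in> M"
    "x \<in> M \<Longrightarrow> op_apply (cproj M) x = x"
  using someI_ex[OF projection_exists[OF assms]] unfolding cproj_def by auto

lemma cproj_orth:
  assumes "closed_csubspace M" "\<And>y. y \<in> M \<Longrightarrow> cinner y x = 0"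
  shows "op_apply (cproj M) x = 0"
proof -
  let ?p = "cproj M"
  have "cinner (op_apply ?p x) (op_apply ?p x) = cinner (op_apply ?p (op_apply ?p x)) x"
    using cproj[OF assms(1)] by (metis cinner_adj)
  also have "\<dots> = 0" using cproj[OF assms(1)] assms(2) by blast
  finally show ?thesis by (simp add: cinner_self)
qed

lemma cspan_UNIV_I:
  assumes "\<And>x. (\<And>b. b \<in> B \<Longrightarrow> cinner b x = 0) \<Longrightarrow> x = 0"
  shows "cspan B = UNIV"
proof -
  have "x \<in> cspan B" for x
  proof -
    obtain m where m: "m \<in> cspan B" "\<And>y. y \<in> cspan B \<Longrightarrow> cinner (x - m) y = 0"
      using orthogonal_decomposition[OF closed_csubspace_cspan] by blast
    have "x - m = 0"
    proof (rule assms)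
      fix b assume "b \<in> B"
      hence "cinner (x - m) b = 0" by (intro m cspan_superset)
      thus "cinner b (x - m) = 0" by (metis cinner_commute complex_cnj_zero)
    qed
    thus ?thesis using m by simp
  qed
  thus ?thesis by blast
qed

subsection \<open>Extension from spanning families\<close>

lemma sum_glue:
  fixes f :: "'i \<Rightarrow> complex \<Rightarrow> 'v::comm_monoid_add"
  assumes "finite S" "finite S'" "\<And>i. f i 0 = 0" "\<And>i x y. f i (x + y) = f i x + f i y"
  shows "(\<Sum>i\<in>S \<union> S'. f i ((if i \<in> S then a i else 0) + (if i \<in> S' then a' i else 0)))
    = (\<Sum>i\<in>S. f i (a i)) + (\<Sum>i\<in>S'. f i (a' i))"
proof -
  have "(\<Sum>i\<in>S. f i (a i)) = (\<Sum>i\<in>S \<union> S'. f i (if i \<in> S then a i else 0))"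
    using assms by (intro sum.mono_neutral_cong_left) auto
  moreover have "(\<Sum>i\<in>S'. f i (a' i)) = (\<Sum>i\<in>S \<union> S'. f i (if i \<in> S' then a' i else 0))"
    using assms by (intro sum.mono_neutral_cong_left) auto
  ultimately show ?thesis by (simp add: assms sum.distrib)
qed

text \<open>Helly's solution of the moment problem. The vectors may be dependent, since consistency
  of the prescribed values is contained in the bound. Separating the cone of pairs (\<Sum> a v, Re
  \<Sum> a c) from the gauge \<open>M * norm x\<close> gives a bounded real functional, which is
  represented by a vector.\<close>

lemma riesz_family:
  fixes v :: "'i \<Rightarrow> 'h::complex_hilbert" and c :: "'i \<Rightarrow> complex"
  assumes M: "M \<ge> 0" and bound: "\<And>S a. finite S \<Longrightarrow> S \<subseteq> I \<Longrightarrow>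
    cmod (\<Sum>i\<in>S. a i * c i) \<le> M * norm (\<Sum>i\<in>S. a i *\<^sub>C v i)"
  obtains u where "\<And>i. i \<in> I \<Longrightarrow> cinner (v i) u = c i" "norm u \<le> M"
proof -
  define V where "V = (\<lambda>(S, a). \<Sum>i\<in>S. a i *\<^sub>C v i)"
  define C where "C = (\<lambda>(S, a). \<Sum>i\<in>S. a i * c i)"
  \<comment> \<open>Formal finite combinations: the same vector may come from several coefficient
    families.\<close>
  define D where "D = {(S :: 'i set, a :: 'i \<Rightarrow> complex). finite S \<and> S \<subseteq> I}"
  define K where "K = {(V d, Re (C d)) | d. d \<in> D}"
  have glue: "\<exists>e\<in>D. V e = V d + V d' \<and> C e = C d + C d'" if "d \<in> D" "d' \<in> D" for d d'
  proof -
    obtain S a S' a' where *: "d = (S, a)" "d' = (S', a')" by (cases d; cases d') auto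
    show ?thesis
      using that unfolding D_def * V_def C_def
      by (intro bexI[of _ "(S \<union> S', \<lambda>i. (if i \<in> S then a i else 0) + (if i \<in> S' then a' i else 0))"])
         (use sum_glue[of S S' "\<lambda>i x. x *\<^sub>C v i" a a'] sum_glue[of S S' "\<lambda>i x. x * c i" a a'] in
           \<open>auto simp: scaleC_add_left ring_distribs\<close>)
  qed
  have scale: "\<exists>e\<in>D. V e = t *\<^sub>C V d \<and> C e = t * C d" if "d \<in> D" for d t
  proof -
    obtain S a where *: "d = (S, a)" by (cases d) auto
    show ?thesis using that unfolding D_def * V_def C_def
      by (intro bexI[of _ "(S, \<lambda>i. t * a i)"])
         (auto simp: scaleC_sum_right scaleC_scaleC sum_distrib_left mult.assoc)
  qed
  obtain f where f: "\<And>x y. f (x + y) = f x + f y" "\<And>t x. f (t *\<^sub>R x) = t * f x" and f_le: "\<And>x. f x \<le> M * norm x"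
    and fV: "\<And>x r. (x, r) \<in> K \<Longrightarrow> r \<le> f x"
  proof (rule cone_separation[OF subspace_UNIV, of "\<lambda>x. M * norm x" K])
    show "sublinear_on UNIV (\<lambda>x::'h. M * norm x)"
      using mult_left_mono[OF norm_triangle_ineq M] unfolding sublinear_on_def by (auto simp: ring_distribs)
    have "({}, \<lambda>_. 0) \<in> D" by (simp add: D_def)
    thus "(0, 0) \<in> K" unfolding K_def by (force simp: V_def C_def)
    show "(x + y, r + s) \<in> K" if xy: "(x, r) \<in> K" "(y, s) \<in> K" for x r y s
    proof -
      obtain d d' where d: "d \<in> D" "x = V d" "r = Re (C d)" "d' \<in> D" "y = V d'" "s = Re (C d')" using xy unfolding K_def by blast
      obtain e where "e \<in> D" "V e = V d + V d'" "C e = C d + C d'" using glue[OF d(1,4)] by blast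
      thus ?thesis unfolding K_def d by (intro CollectI exI[of _ e]) simp
    qed
    show "(t *\<^sub>R x, t * r) \<in> K" if xr: "(x, r) \<in> K" for t x r
    proof -
      obtain d where d: "d \<in> D" "x = V d" "r = Re (C d)" using xr unfolding K_def by blast
      obtain e where "e \<in> D" "V e = of_real t *\<^sub>C V d" "C e = of_real t * C d" using scale[OF d(1)] by blast
      thus ?thesis unfolding K_def d by (intro CollectI exI[of _ e]) (simp add: scaleC_of_real)
    qed
    show "x \<in> UNIV \<and> r \<le> M * norm x" if xr: "(x, r) \<in> K" for x r
    proof -
      obtain S a where "finite S" "S \<subseteq> I" "x = V (S, a)" "r = Re (C (S, a))" using xr unfolding K_def D_def by blast
      thus ?thesis using bound[of S a] complex_Re_le_cmod[of "C (S, a)"] by (simp add: V_def C_def)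
    qed
  qed (rule that; simp)
  have f_neg: "f (- x) = - f x" for x using f(2)[of "- 1" x] by simp
  have "bounded_linear f"
  proof (rule bounded_linear_intro[where K=M])
    show "norm (f x) \<le> norm x * M" for x
      using f_le[of x] f_le[of "- x"] by (simp add: f_neg mult.commute abs_le_iff)
  qed (simp_all add: f)
  then obtain u where u: "\<And>x. f x = inner x u" using riesz_representation by blast
  have "cinner (v i) u = c i" if i: "i \<in> I" for i
  proof -
    have le: "Re (t * c i) \<le> Re (t * cinner (v i) u)" for t
    proof -
      have "(V ({i}, \<lambda>_. t), Re (C ({i}, \<lambda>_. t))) \<in> K" using i by (auto simp: K_def D_def)
      from fV[OF this] show ?thesis by (simp add: V_def C_def u Re_cinner[symmetric] cinner_scaleC_left)
    qed
    \<comment> \<open>The multiples 1, - 1, \<i> and - \<i> turn a one-sided inequality of real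
      parts into equality of real and imaginary parts.\<close>
    show ?thesis using le[of 1] le[of "- 1"] le[of "\<i>"] le[of "- \<i>"] by (simp add: complex_eq_iff)
  qed
  moreover have "norm u \<le> M"
  proof -
    have "norm u * norm u \<le> M * norm u"
      using f_le[of u] by (simp add: u power2_norm_eq_inner flip: power2_eq_square)
    thus ?thesis using M by (cases "norm u = 0") auto
  qed
  ultimately show ?thesis using that by blast
qed

text \<open>The adjoint is constructed instead: for each y the moment problem yields a vector with
  the inner products that the adjoint must have, and s y is its projection to the closed span of
  \<open>v\<close>. The adjoint of s then sends v i to w i and vanishes on the orthogonal
  complement.\<close>

lemma extend_operator:
  fixes v :: "'i \<Rightarrow> 'h::complex_hilbert" and w :: "'i \<Rightarrow> 'k::complex_hilbert"
  assumes M: "M \<ge> 0" and bound: "\<And>S a. finite S \<Longrightarrow> S \<subseteq> I \<Longrightarrow>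
    norm (\<Sum>i\<in>S. a i *\<^sub>C w i) \<le> M * norm (\<Sum>i\<in>S. a i *\<^sub>C v i)"
  obtains T where "bounded_clinear T" "\<And>i. i \<in> I \<Longrightarrow> T (v i) = w i"
    "\<And>x. (\<And>i. i \<in> I \<Longrightarrow> cinner (v i) x = 0) \<Longrightarrow> T x = 0" "\<And>x. norm (T x) \<le> M * norm x"
proof -
  let ?V = "cspan (v ` I)"
  have V: "closed_csubspace ?V" by (rule closed_csubspace_cspan)
  note Vi = closed_csubspaceD[OF V]
  have "\<exists>u\<in>?V. (\<forall>i\<in>I. cinner (v i) u = cinner (w i) y) \<and> norm u \<le> M * norm y" for y
  proof -
    have "cmod (\<Sum>i\<in>S. a i * cinner (w i) y) \<le> (M * norm y) * norm (\<Sum>i\<in>S. a i *\<^sub>C v i)"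
      if "finite S" "S \<subseteq> I" for S a
    proof -
      have "(\<Sum>i\<in>S. a i * cinner (w i) y) = cinner (\<Sum>i\<in>S. a i *\<^sub>C w i) y"
        by (simp add: cinner_sum_left cinner_scaleC_left)
      also have "cmod \<dots> \<le> norm (\<Sum>i\<in>S. a i *\<^sub>C w i) * norm y" by (rule norm_cinner_le)
      also have "\<dots> \<le> (M * norm (\<Sum>i\<in>S. a i *\<^sub>C v i)) * norm y"
        by (intro mult_right_mono bound that) auto
      finally show ?thesis by (simp add: mult_ac)
    qed
    then obtain u where u: "\<And>i. i \<in> I \<Longrightarrow> cinner (v i) u = cinner (w i) y" "norm u \<le> M * norm y"
      using riesz_family[of "M * norm y" I "\<lambda>i. cinner (w i) y" v] M by auto
    let ?p = "cproj ?V"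
    note p = cproj[OF V]
    have "cinner (v i) (op_apply ?p u) = cinner (v i) u" if "i \<in> I" for i
      using that p(1,4) by (metis cinner_adj cspan_superset imageI)
    moreover have "norm (op_apply ?p u) \<le> norm u"
    proof -
      have "(norm (op_apply ?p u))\<^sup>2 = Re (cinner u (op_apply ?p u))"
        using p(1,3,4) by (metis Re_cinner_self cinner_adj)
      also have "\<dots> \<le> norm u * norm (op_apply ?p u)" by (rule Re_cinner_le)
      finally show ?thesis by (cases "norm (op_apply ?p u) = 0") (auto simp: power2_eq_square)
    qed
    ultimately show ?thesis using p(3) u by (metis order_trans)
  qed
  then obtain s where s: "\<And>y. s y \<in> ?V" "\<And>i y. i \<in> I \<Longrightarrow> cinner (v i) (s y) = cinner (w i) y"
      "\<And>y. norm (s y) \<le> M * norm y" by metis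
  have uniq: "x = y" if "x \<in> ?V" "y \<in> ?V" "\<And>i. i \<in> I \<Longrightarrow> cinner (v i) x = cinner (v i) y" for x y
  proof -
    have "cinner (x - y) (x - y) = 0"
      by (rule orth_cspan[of "x - y" "v ` I"]) (use that in \<open>auto intro!: Vi simp: cinner_diff_right\<close>)
    thus ?thesis by (simp add: cinner_self)
  qed
  have "bounded_clinear s"
  proof (rule bounded_clinear_intro[OF _ _ s(3)])
    show "s (x + y) = s x + s y" for x y
      by (rule uniq) (auto intro!: s Vi simp: s cinner_add_right)
    show "s (c *\<^sub>C x) = c *\<^sub>C s x" for x c
      by (rule uniq) (auto intro!: s Vi simp: s cinner_scaleC_right)
  qed
  note h = hadj[OF this]
  have "hadj s (v i) = w i" if "i \<in> I" for i
    by (rule cinner_eqI_left) (simp add: h(3) s(2) that)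
  moreover have "hadj s x = 0" if "\<And>i. i \<in> I \<Longrightarrow> cinner (v i) x = 0" for x
  proof (rule cinner_eqI_left)
    fix y
    have "cinner (s y) x = 0" by (rule orth_cspan[OF s(1)]) (use that in auto)
    thus "cinner (hadj s x) y = cinner 0 y" by (metis h(3) cinner_commute complex_cnj_zero cinner_zero_left)
  qed
  moreover have "norm (hadj s x) \<le> M * norm x" for x
  proof -
    have "(norm (hadj s x))\<^sup>2 = Re (cinner x (s (hadj s x)))" by (simp flip: Re_cinner_self add: h(3))
    also have "\<dots> \<le> norm x * norm (s (hadj s x))" by (rule Re_cinner_le)
    also have "\<dots> \<le> norm x * (M * norm (hadj s x))" by (intro mult_left_mono s) auto
    finally show ?thesis using M by (cases "norm (hadj s x) = 0") (auto simp: power2_eq_square mult_ac)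
  qed
  ultimately show ?thesis using that h(1) by blast
qed

subsection \<open>Square summable families\<close>

lift_definition l2_single :: "'g \<Rightarrow> 'h::complex_hilbert \<Rightarrow> ('g, 'h) l2"
  is "\<lambda>x \<xi> t. if t = x then \<xi> else 0"
proof -
  fix x :: 'g and \<xi> :: 'h
  have "{t. (norm (if t = x then \<xi> else 0))\<^sup>2 \<noteq> 0} \<subseteq> {x}" by (auto split: if_splits)
  hence "finite {t\<in>UNIV. (norm (if t = x then \<xi> else 0))\<^sup>2 \<noteq> 0}"
    using finite_subset by auto
  thus "(\<lambda>t. (norm (if t = x then \<xi> else 0))\<^sup>2) summable_on UNIV"
    by (rule finite_nonzero_values_imp_summable_on)
qed

lemma Rep_l2_single: "Rep_l2 (l2_single x \<xi>) t = (if t = x then \<xi> else 0)"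
  by (simp add: l2_single.rep_eq)

lemma l2_eqI: "f = h" if "\<And>t. Rep_l2 f t = Rep_l2 h t"
  using that by (metis Rep_l2_inject ext)

lemmas Rep_l2_simps = plus_l2.rep_eq minus_l2.rep_eq uminus_l2.rep_eq zero_l2.rep_eq
  scaleC_l2.rep_eq scaleR_l2.rep_eq

lemma Rep_l2_sum: "Rep_l2 (sum f S) t = (\<Sum>i\<in>S. Rep_l2 (f i) t)"
  by (induction S rule: infinite_finite_induct) (auto simp: Rep_l2_simps)

lemma cinner_l2_single_right [simp]: "cinner f (l2_single x \<xi>) = cinner (Rep_l2 f x) \<xi>"
proof -
  have "cinner f (l2_single x \<xi>) = infsum (\<lambda>t. cinner (Rep_l2 f t) (if t = x then \<xi> else 0)) UNIV"
    by (simp add: cinner_l2.rep_eq l2_single.rep_eq)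
  also have "\<dots> = infsum (\<lambda>t. cinner (Rep_l2 f t) (if t = x then \<xi> else 0)) {x}"
    by (rule infsum_cong_neutral) auto
  finally show ?thesis by simp
qed

lemma cinner_l2_single_left [simp]: "cinner (l2_single x \<xi>) f = cinner \<xi> (Rep_l2 f x)"
  by (subst (1 2) cinner_commute) simp

lemma norm_l2_single [simp]: "norm (l2_single x \<xi>) = norm \<xi>"
proof -
  have "complex_of_real ((norm (l2_single x \<xi>))\<^sup>2) = of_real ((norm \<xi>)\<^sup>2)"
    by (simp add: cinner_self[symmetric] Rep_l2_single del: of_real_power)
  hence "(norm (l2_single x \<xi>))\<^sup>2 = (norm \<xi>)\<^sup>2" using of_real_eq_iff by blast
  thus ?thesis by simp
qed

lemma l2_single_add: "l2_single x (\<xi> + \<eta>) = l2_single x \<xi> + l2_single x \<eta>"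
  by (rule l2_eqI) (simp add: Rep_l2_simps Rep_l2_single)
lemma l2_single_scaleC: "l2_single x (c *\<^sub>C \<xi>) = c *\<^sub>C l2_single x \<xi>"
  by (rule l2_eqI) (simp add: Rep_l2_simps Rep_l2_single)
lemma l2_single_zero [simp]: "l2_single x 0 = 0"
  by (rule l2_eqI) (simp add: Rep_l2_simps Rep_l2_single)

lemma bounded_clinear_l2_single: "bounded_clinear (l2_single x)"
  by (rule bounded_clinear_intro[where K=1]) (auto simp: l2_single_add l2_single_scaleC)

lemma bounded_clinear_Rep_l2: "bounded_clinear (\<lambda>f. Rep_l2 f x)"
  by (rule bounded_clinear_intro[where K=1]) (auto simp: Rep_l2_simps norm_Rep_l2_le)

lemma l2_singles_total: "cspan {l2_single x \<xi> |x \<xi>. True} = (UNIV :: ('g, 'h::complex_hilbert) l2 set)"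
proof (rule cspan_UNIV_I)
  fix f :: "('g, 'h) l2"
  assume *: "\<And>b. b \<in> {l2_single x \<xi> |x \<xi>. True} \<Longrightarrow> cinner b f = 0"
  show "f = 0"
  proof (rule l2_eqI, rule cinner_eqI)
    fix x \<xi>
    have "cinner (l2_single x \<xi>) f = 0" by (rule *) blast
    thus "cinner \<xi> (Rep_l2 f x) = cinner \<xi> (Rep_l2 0 x)" by (simp add: Rep_l2_simps)
  qed
qed

lemma norm_l2_finite_support:
  assumes "finite S" "\<And>t. t \<notin> S \<Longrightarrow> Rep_l2 f t = 0"
  shows "(norm f)\<^sup>2 = (\<Sum>t\<in>S. (norm (Rep_l2 f t))\<^sup>2)"
proof -
  have "(norm f)\<^sup>2 = infsum (\<lambda>t. (norm (Rep_l2 f t))\<^sup>2) S"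
    unfolding norm_l2_square by (rule infsum_cong_neutral) (use assms in auto)
  thus ?thesis using assms by simp
qed

lemma Rep_l2_diag: "bounded (range T) \<Longrightarrow> Rep_l2 (op_apply (l2_diag T) f) t = op_apply (T t) (Rep_l2 f t)"
  by (simp add: l2_diag.rep_eq l2_diag_fun.rep_eq)

lemma Rep_l2_shift: "Rep_l2 (op_apply (l2_shift s) f) t = Rep_l2 f (- s + t)"
  by (simp add: l2_shift.rep_eq l2_shift_fun.rep_eq)

definition l2_restrict :: "'g set \<Rightarrow> ('g, 'h::complex_hilbert) l2 bop"
  where "l2_restrict A = l2_diag (\<lambda>t. if t \<in> A then 1 else 0)"

lemma Rep_l2_restrict: "Rep_l2 (op_apply (l2_restrict A) f) t = (if t \<in> A then Rep_l2 f t else 0)"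
proof -
  have "bounded (range (\<lambda>t. if t \<in> A then 1 else (0 :: 'h::complex_hilbert bop)))"
    by (rule bounded_subset[of "{0, 1}"]) (auto simp: finite_imp_bounded)
  thus ?thesis unfolding l2_restrict_def by (subst Rep_l2_diag) auto
qed

lemma norm_l2_restrict_le: "norm (op_apply (l2_restrict A) f) \<le> norm f"
proof (rule power2_le_imp_le)
  show "(norm (op_apply (l2_restrict A) f))\<^sup>2 \<le> (norm f)\<^sup>2"
    unfolding norm_l2_square
    by (intro infsum_mono Rep_l2_summable) (auto simp: Rep_l2_restrict)
qed simp

subsection \<open>Positive definite kernels\<close>

definition pos_kernel :: "('w \<Rightarrow> 'w \<Rightarrow> complex) \<Rightarrow> bool"
  where "pos_kernel \<kappa> \<longleftrightarrow> (\<forall>x y. \<kappa> y x = cnj (\<kappa> x y)) \<and>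
    (\<forall>S a. finite S \<longrightarrow> 0 \<le> Re (\<Sum>x\<in>S. \<Sum>y\<in>S. a x * cnj (a y) * \<kappa> x y))"

lemma gram_sum:
  fixes v :: "'w \<Rightarrow> 'h::complex_hilbert"
  shows "cinner (\<Sum>x\<in>S. a x *\<^sub>C v x) (\<Sum>y\<in>S. b y *\<^sub>C w y) = (\<Sum>x\<in>S. \<Sum>y\<in>S. a x * cnj (b y) * cinner (v x) (w y))"
  unfolding cinner_sum_left cinner_scaleC_left
  unfolding cinner_sum_right cinner_scaleC_right by (simp add: sum_distrib_left mult_ac)

lemma pos_kernel_gram: "pos_kernel (\<lambda>x y. cinner (v x) (v y))"
  for v :: "'w \<Rightarrow> 'h::complex_hilbert"
  unfolding pos_kernel_def
proof (intro conjI allI impI)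
  show "cinner (v y) (v x) = cnj (cinner (v x) (v y))" for x y by (rule cinner_commute)
  show "0 \<le> Re (\<Sum>x\<in>S. \<Sum>y\<in>S. a x * cnj (a y) * cinner (v x) (v y))" for S a
    unfolding gram_sum[symmetric] Re_cinner_self by simp
qed

text \<open>A discriminant argument: positivity is used on \<open>insert x S\<close> with a free
  coefficient s at x, which is why x must lie outside \<open>S\<close>. The optimal value is s = - Z
  / k; for k = 0 large negative multiples of Z force Z = 0.\<close>

lemma pos_kernel_Cauchy_Schwarz:
  assumes \<kappa>: "pos_kernel \<kappa>" and S: "finite S" "x \<notin> S"
  shows "(cmod (\<Sum>d\<in>S. a d * \<kappa> d x))\<^sup>2 \<le> Re (\<kappa> x x) * Re (\<Sum>d\<in>S. \<Sum>e\<in>S. a d * cnj (a e) * \<kappa> d e)"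
proof -
  define Z where "Z = (\<Sum>d\<in>S. a d * \<kappa> d x)"
  define N where "N = (\<Sum>d\<in>S. \<Sum>e\<in>S. a d * cnj (a e) * \<kappa> d e)"
  define k where "k = Re (\<kappa> x x)"
  have herm: "\<kappa> y z = cnj (\<kappa> z y)" for y z using \<kappa> unfolding pos_kernel_def by blast
  have k: "\<kappa> x x = of_real k" using arg_cong[OF herm[of x x], of Im] by (simp add: complex_eq_iff k_def)
  have key: "0 \<le> Re N + 2 * Re (cnj s * Z) + (cmod s)\<^sup>2 * k" for s
  proof -
    define b where "b = (\<lambda>y. if y = x then s else a y)"
    have b: "b x = s" "\<And>y. y \<in> S \<Longrightarrow> b y = a y" using S by (auto simp: b_def)
    have "(\<Sum>d\<in>insert x S. \<Sum>e\<in>insert x S. b d * cnj (b e) * \<kappa> d e)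
      = s * cnj s * \<kappa> x x + (\<Sum>e\<in>S. s * cnj (a e) * \<kappa> x e) + (\<Sum>d\<in>S. a d * cnj s * \<kappa> d x) + N"
      using S by (simp add: b sum.distrib N_def add.assoc cong: sum.cong)
    also have "(\<Sum>e\<in>S. s * cnj (a e) * \<kappa> x e) = cnj (cnj s * Z)"
      unfolding Z_def by (simp add: sum_distrib_left cnj_sum herm[of x] mult_ac)
    also have "(\<Sum>d\<in>S. a d * cnj s * \<kappa> d x) = cnj s * Z"
      unfolding Z_def by (simp add: sum_distrib_left mult_ac)
    also have "Re (s * cnj s * \<kappa> x x + cnj (cnj s * Z) + cnj s * Z + N)
        = Re N + 2 * Re (cnj s * Z) + (cmod s)\<^sup>2 * k"
      by (simp add: k complex_norm_square[symmetric] del: of_real_power)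
    finally have eq: "Re (\<Sum>d\<in>insert x S. \<Sum>e\<in>insert x S. b d * cnj (b e) * \<kappa> d e)
      = Re N + 2 * Re (cnj s * Z) + (cmod s)\<^sup>2 * k" .
    have "finite (insert x S)" using S by simp
    from \<kappa>[unfolded pos_kernel_def, THEN conjunct2, rule_format, OF this, of b] show ?thesis
      unfolding eq .
  qed
  have N0: "0 \<le> Re N" using key[of 0] by simp
  have k0: "0 \<le> k"
    using \<kappa>[unfolded pos_kernel_def, THEN conjunct2, rule_format, of "{x}" "\<lambda>_. 1"] by (simp add: k_def)
  have cz: "Re (cnj (of_real r * Z) * Z) = r * (cmod Z)\<^sup>2" for r
    unfolding cmod_power2 by (simp add: power2_eq_square algebra_simps)
  have "(cmod Z)\<^sup>2 \<le> k * Re N"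
  proof (cases "k = 0")
    case True
    have "2 * t * (cmod Z)\<^sup>2 \<le> Re N" for t :: real
      using key[of "of_real (- t) * Z"] True unfolding cz by simp
    from this[of "Re N / (cmod Z)\<^sup>2"] this[of "1 / (cmod Z)\<^sup>2 * (Re N + 1)"] have "cmod Z = 0"
      using N0 by (cases "cmod Z = 0") auto
    thus ?thesis using True by simp
  next
    case False
    define s where "s = of_real (- 1 / k) * Z"
    have 1: "Re (cnj s * Z) = (- 1 / k) * (cmod Z)\<^sup>2" unfolding s_def cz ..
    have 2: "(cmod s)\<^sup>2 * k = (cmod Z)\<^sup>2 / k"
      using False by (simp add: s_def norm_mult norm_divide power_divide power2_eq_square)
    have "0 \<le> Re N + 2 * ((- 1 / k) * (cmod Z)\<^sup>2) + (cmod Z)\<^sup>2 / k"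
      using key[of s] unfolding 1 2 .
    thus ?thesis using False k0 by (simp add: field_simps)
  qed
  thus ?thesis by (simp add: Z_def N_def k_def)
qed

text \<open>A transfinite Gram--Schmidt process: the vector of \<open>x\<close> uses only the coordinates indexed
  by the elements up to \<open>x\<close> in a well-ordering.\<close>

lemma gram_representation:
  fixes \<kappa> :: "'w \<Rightarrow> 'w \<Rightarrow> complex" and c :: "'w \<Rightarrow> 'j"
  assumes \<kappa>: "pos_kernel \<kappa>" and c: "inj c"
  obtains v :: "'w \<Rightarrow> ('j, complex) l2" where "\<And>x y. cinner (v x) (v y) = \<kappa> x y"
proof -
  obtain r :: "'w rel" where r: "well_order_on UNIV r" using well_order_on[where A=UNIV] ..
  define lt where "lt = r - Id"
  have wo: "wf (r - Id)" "total_on UNIV r" "antisym r" "trans r"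
    using r by (auto simp: well_order_on_def linear_order_on_def partial_order_on_def preorder_on_def)
  have wf: "wf lt" unfolding lt_def by (rule wo)
  have tot: "(x, y) \<in> lt \<or> x = y \<or> (y, x) \<in> lt" for x y
    using wo(2) by (auto simp: lt_def total_on_def)
  have irr: "(x, x) \<notin> lt" for x by (simp add: lt_def)
  have asym: "(y, x) \<notin> lt" if "(x, y) \<in> lt" for x y
    using antisymD[OF wo(3), of x y] that by (auto simp: lt_def)
  have tr: "(x, z) \<in> lt" if "(x, y) \<in> lt" "(y, z) \<in> lt" for x y z
    using transD[OF wo(4), of x y z] antisymD[OF wo(3), of x y] that by (auto simp: lt_def)
  have herm: "\<kappa> y z = cnj (\<kappa> z y)" for y z using \<kappa> unfolding pos_kernel_def by blast
  define ok where "ok = (\<lambda>(g :: 'w \<Rightarrow> ('j, complex) l2) x u. (\<forall>d. (d, x) \<in> lt \<longrightarrow> cinner (g d) u = \<kappa> d x) \<and>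
    (norm u)\<^sup>2 \<le> Re (\<kappa> x x) \<and> (\<forall>j. j \<notin> c ` {y. (y, x) \<in> lt} \<longrightarrow> Rep_l2 u j = 0))"
  \<comment> \<open>The part of the norm that u lacks is put on the coordinate \<open>c x\<close>.
    All earlier vectors vanish there, so the inner products with them are unchanged.\<close>
  define F where "F = (\<lambda>g x. let u = SOME u. ok g x u in
     u + complex_of_real (sqrt (Re (\<kappa> x x) - (norm u)\<^sup>2)) *\<^sub>C l2_single (c x) 1)"
  define v where "v = wfrec lt F"
  have v_eq: "v x = F v x" for x
  proof -
    \<comment> \<open>The predicate \<open>ok\<close> reads its first argument only strictly below
      x, so the recursion is well founded.\<close>
    have "ok (cut v lt x) x = ok v x" unfolding ok_def by (auto simp: cut_def fun_eq_iff)
    thus ?thesis unfolding v_def[THEN fun_cong, of x] wfrec[OF wf, of F x]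
      by (simp add: F_def v_def)
  qed
  define Q where "Q x \<longleftrightarrow> (\<forall>d. (d, x) \<in> lt \<longrightarrow> cinner (v d) (v x) = \<kappa> d x) \<and> cinner (v x) (v x) = \<kappa> x x \<and>
    (\<forall>j. j \<notin> c ` {y. (y, x) \<in> lt \<or> y = x} \<longrightarrow> Rep_l2 (v x) j = 0)" for x
  have Q: "Q x" for x
  proof (induction x rule: wf_induct_rule[OF wf])
    case (1 x)
    define I where "I = {d. (d, x) \<in> lt}"
    have gram: "cinner (v d) (v e) = \<kappa> d e" if "d \<in> I" "e \<in> I" for d e
      using tot[of d e] 1[of d] 1[of e] that herm[of d e] cinner_commute[of "v d" "v e"]
      unfolding Q_def I_def by auto
    have supp: "Rep_l2 (v d) j = 0" if "d \<in> I" "j \<notin> c ` I" for d j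
      using 1[of d] that tr[of _ d x] unfolding Q_def I_def by blast
    have k0: "0 \<le> Re (\<kappa> x x)"
      using \<kappa>[unfolded pos_kernel_def, THEN conjunct2, rule_format, of "{x}" "\<lambda>_. 1"] by simp
    have "cmod (\<Sum>i\<in>S. a i * \<kappa> i x) \<le> sqrt (Re (\<kappa> x x)) * norm (\<Sum>i\<in>S. a i *\<^sub>C v i)"
      if S: "finite S" "S \<subseteq> I" for S a
    proof (rule power2_le_imp_le)
      have "x \<notin> S" using S irr by (auto simp: I_def)
      have "(norm (\<Sum>i\<in>S. a i *\<^sub>C v i))\<^sup>2 = Re (\<Sum>x\<in>S. \<Sum>y\<in>S. a x * cnj (a y) * \<kappa> x y)"
        unfolding Re_cinner_self[symmetric] gram_sum
        using S gram by (intro arg_cong[where f=Re] sum.cong refl) auto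
      thus "(cmod (\<Sum>i\<in>S. a i * \<kappa> i x))\<^sup>2 \<le> (sqrt (Re (\<kappa> x x)) * norm (\<Sum>i\<in>S. a i *\<^sub>C v i))\<^sup>2"
        using pos_kernel_Cauchy_Schwarz[OF \<kappa> S(1) \<open>x \<notin> S\<close>, of a] k0 by (simp add: power_mult_distrib)
    qed (simp add: k0)
    then obtain u0 where u0: "\<And>i. i \<in> I \<Longrightarrow> cinner (v i) u0 = \<kappa> i x" "norm u0 \<le> sqrt (Re (\<kappa> x x))"
      using riesz_family[of "sqrt (Re (\<kappa> x x))" I "\<lambda>i. \<kappa> i x" v] k0 by auto
    \<comment> \<open>Truncation to the coordinates of the earlier indices does not affect inner
      products with the earlier vectors, which are supported there, and leaves \<open>c x\<close>
      free.\<close>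
    define u1 where "u1 = op_apply (l2_restrict (c ` I)) u0"
    have "ok v x u1"
      unfolding ok_def
    proof (intro conjI allI impI)
      fix d assume "(d, x) \<in> lt"
      hence d: "d \<in> I" by (simp add: I_def)
      have "cinner (v d) u1 = cinner (v d) u0"
        unfolding cinner_l2.rep_eq u1_def Rep_l2_restrict
        by (rule infsum_cong) (use supp[OF d] in auto)
      thus "cinner (v d) u1 = \<kappa> d x" using u0(1)[OF d] by simp
    next
      have "norm u1 \<le> sqrt (Re (\<kappa> x x))" unfolding u1_def using norm_l2_restrict_le u0(2) by (rule order_trans)
      thus "(norm u1)\<^sup>2 \<le> Re (\<kappa> x x)" using power_mono[of "norm u1" "sqrt (Re (\<kappa> x x))" 2] k0 by simp
    qed (simp add: u1_def Rep_l2_restrict I_def)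
    hence "ok v x (SOME u. ok v x u)" by (rule someI)
    moreover define u where "u = (SOME u. ok v x u)"
    ultimately have u: "\<And>d. (d, x) \<in> lt \<Longrightarrow> cinner (v d) u = \<kappa> d x" "(norm u)\<^sup>2 \<le> Re (\<kappa> x x)"
      "\<And>j. j \<notin> c ` {y. (y, x) \<in> lt} \<Longrightarrow> Rep_l2 u j = 0" unfolding ok_def by blast+
    define s where "s = sqrt (Re (\<kappa> x x) - (norm u)\<^sup>2)"
    have vx: "v x = u + complex_of_real s *\<^sub>C l2_single (c x) 1"
      unfolding v_eq F_def Let_def u_def[symmetric] s_def by simp
    have ux: "Rep_l2 u (c x) = 0" by (rule u(3)) (use c irr in \<open>auto simp: inj_def\<close>)
    show "Q x"
      unfolding Q_def
    proof (intro conjI allI impI)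
      fix d assume d: "(d, x) \<in> lt"
      have "c x \<notin> c ` {y. (y, d) \<in> lt \<or> y = d}" using c d asym irr by (auto simp: inj_def)
      hence "Rep_l2 (v d) (c x) = 0" using 1[OF d] by (simp add: Q_def)
      thus "cinner (v d) (v x) = \<kappa> d x"
        by (simp add: vx cinner_add_right cinner_scaleC_right u(1)[OF d])
    next
      have "Im (\<kappa> x x) = 0" using arg_cong[OF herm[of x x], of Im] by simp
      have "cinner (v x) (v x) = cinner u u + of_real (s * s)"
        by (simp add: vx cinner_add_left cinner_add_right cinner_scaleC_right cinner_scaleC_left ux Rep_l2_single
            cinner_complex_def Rep_l2_simps scaleC_complex_def)
      also have "\<dots> = of_real ((norm u)\<^sup>2 + s * s)" by (simp add: cinner_self)
      also have "(norm u)\<^sup>2 + s * s = Re (\<kappa> x x)" using u(2) by (simp add: s_def)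
      finally show "cinner (v x) (v x) = \<kappa> x x" using \<open>Im (\<kappa> x x) = 0\<close> by (simp add: complex_eq_iff)
    next
      fix j assume "j \<notin> c ` {y. (y, x) \<in> lt \<or> y = x}"
      thus "Rep_l2 (v x) j = 0" using u(3)[of j] by (auto simp: vx Rep_l2_simps Rep_l2_single)
    qed
  qed
  have "cinner (v x) (v y) = \<kappa> x y" for x y
    using tot[of x y] Q[of x] Q[of y] herm[of x y] cinner_commute[of "v x" "v y"] unfolding Q_def by auto
  thus ?thesis using that by blast
qed

lemma closed_csubspace_equalizer:
  assumes "bounded_clinear S" "bounded_clinear T"
  shows "closed_csubspace {x. S x = T x}"
proof -
  note s = bounded_clinearD[OF assms(1)] and t = bounded_clinearD[OF assms(2)]
  have "closed {x. S x = T x}"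
    by (intro closed_Collect_eq linear_continuous_on s(1) t(1))
  thus ?thesis unfolding closed_csubspace_def by (auto simp: s t)
qed

text \<open>The Gram kernel of \<omega> is realised a second time by vectors of scalar sequences,
  and \<omega> i \<mapsto> v i preserves norms of combinations. The size of the target is governed
  by the index type alone; this is how subspaces of arbitrary Hilbert spaces are moved to a
  prescribed type.\<close>

lemma isometric_embedding:
  fixes \<omega> :: "'i \<Rightarrow> 'h::complex_hilbert" and c :: "'i \<Rightarrow> 'j"
  assumes c: "inj c"
  obtains V :: "'h \<Rightarrow> ('j, complex) l2" where "bounded_clinear V"
    "\<And>x. hadj V (V x) = op_apply (cproj (cspan (range \<omega>))) x"
proof -
  obtain v :: "'i \<Rightarrow> ('j, complex) l2" where v: "\<And>x y. cinner (v x) (v y) = cinner (\<omega> x) (\<omega> y)"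
    using gram_representation[OF pos_kernel_gram c] by metis
  have bound: "norm (\<Sum>i\<in>S. a i *\<^sub>C v i) \<le> 1 * norm (\<Sum>i\<in>S. a i *\<^sub>C \<omega> i)" for S a
  proof -
    have "(norm (\<Sum>i\<in>S. a i *\<^sub>C v i))\<^sup>2 = (norm (\<Sum>i\<in>S. a i *\<^sub>C \<omega> i))\<^sup>2"
      unfolding Re_cinner_self[symmetric] gram_sum v ..
    thus ?thesis by simp
  qed
  obtain V where V: "bounded_clinear V" "\<And>i. V (\<omega> i) = v i"
    "\<And>x. (\<And>i. cinner (\<omega> i) x = 0) \<Longrightarrow> V x = 0"
    using extend_operator[of 1 UNIV v \<omega>] bound by (metis UNIV_I zero_le_one)
  note Vd = bounded_clinearD[OF V(1)] and h = hadj[OF V(1)]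
  let ?M = "cspan (range \<omega>)" let ?p = "cproj ?M"
  note M = closed_csubspace_cspan[of "range \<omega>"]
  note p = cproj[OF M]
  have compl: "cinner (\<omega> i) (x - op_apply ?p x) = 0" for i x
    using p(4)[OF cspan_superset[of "\<omega> i" "range \<omega>"]] p(1)
    by (simp add: cinner_diff_right) (metis cinner_adj)
  have Vp: "V x = V (op_apply ?p x)" for x
    using V(3)[of "x - op_apply ?p x"] compl by (simp add: Vd)
  have 1: "cinner (v i) (V y) = cinner (\<omega> i) y" for i y
  proof -
    have "?M \<subseteq> {y. cinner (V y) (v i) = cinner y (\<omega> i)}"
    proof (rule cspan_subset)
      show "closed_csubspace {y. cinner (V y) (v i) = cinner y (\<omega> i)}"
        using closed_csubspace_orth[of "{hadj V (v i) - \<omega> i}"] by (simp add: cinner_diff_right h)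
    qed (auto simp: V v)
    hence "cinner (V (op_apply ?p y)) (v i) = cinner (op_apply ?p y) (\<omega> i)" using p(3) by blast
    hence "cinner (v i) (V y) = cinner (\<omega> i) (op_apply ?p y)" using Vp by (metis cinner_commute)
    thus ?thesis using compl[of i y] by (simp add: cinner_diff_right)
  qed
  have "?M \<subseteq> {x. hadj V (V x) = x}"
  proof (rule cspan_subset)
    show "closed_csubspace {x. hadj V (V x) = x}"
      by (intro closed_csubspace_equalizer bounded_clinear_compose[OF h(1) V(1)])
         (rule bounded_clinear_intro[where K=1], auto)
    show "range \<omega> \<subseteq> {x. hadj V (V x) = x}"
    proof clarify
      show "hadj V (V (\<omega> i)) = \<omega> i" for i by (rule cinner_eqI_left) (simp only: h(3) V(2) 1)
    qed
  qed
  hence "hadj V (V x) = op_apply ?p x" for x using p(3)[of x] Vp[of x] by auto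
  thus ?thesis using that V(1) by blast
qed

section \<open>Homomorphisms, operator matrices, faithful representations of bounded size, and
  strong limits\<close>

section \<open>Operator algebras\<close>

lemma operator_algebraD:
  assumes "operator_algebra A"
  shows "closed A" "0 \<in> A" "a \<in> A \<Longrightarrow> b \<in> A \<Longrightarrow> a + b \<in> A" "a \<in> A \<Longrightarrow> b \<in> A \<Longrightarrow> a * b \<in> A"
    "a \<in> A \<Longrightarrow> c *\<^sub>C a \<in> A" "a \<in> A \<Longrightarrow> r *\<^sub>R a \<in> A" "a \<in> A \<Longrightarrow> - a \<in> A" "a \<in> A \<Longrightarrow> b \<in> A \<Longrightarrow> a - b \<in> A"
    "(\<And>i. i \<in> S \<Longrightarrow> f i \<in> A) \<Longrightarrow> sum f S \<in> A"
proof -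
  show s: "closed A" "0 \<in> A" "a \<in> A \<Longrightarrow> b \<in> A \<Longrightarrow> a + b \<in> A" "a \<in> A \<Longrightarrow> b \<in> A \<Longrightarrow> a * b \<in> A"
    "a \<in> A \<Longrightarrow> c *\<^sub>C a \<in> A" for a b c
    using assms by (auto simp: operator_algebra_def)
  show "a \<in> A \<Longrightarrow> r *\<^sub>R a \<in> A" using s(5)[of a "of_real r"] by (simp add: scaleC_of_real)
  show n: "a \<in> A \<Longrightarrow> - a \<in> A" for a using s(5)[of a "- 1"] by simp
  show "a \<in> A \<Longrightarrow> b \<in> A \<Longrightarrow> a - b \<in> A" using s(3)[of a "- b"] n[of b] by simp
  show "(\<And>i. i \<in> S \<Longrightarrow> f i \<in> A) \<Longrightarrow> sum f S \<in> A"
    by (induction S rule: infinite_finite_induct) (auto intro: s)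
qed

lemma cstar_algebraD:
  assumes "cstar_algebra A"
  shows "operator_algebra A" "a \<in> A \<Longrightarrow> adj a \<in> A"
  using assms by (auto simp: cstar_algebra_def)

lemma closure_map:
  assumes "continuous_on UNIV f" "\<And>a. a \<in> Y \<Longrightarrow> f a \<in> Y'" "x \<in> closure Y"
  shows "f x \<in> closure Y'"
proof -
  have "f ` closure Y \<subseteq> closure Y'"
    using assms(2) closure_subset by (intro image_closure_subset continuous_on_subset[OF assms(1)]) blast+
  thus ?thesis using assms(3) by blast
qed

lemma closure_map2:
  assumes "continuous_on UNIV (\<lambda>p. f (fst p) (snd p))" "\<And>a b. a \<in> Y \<Longrightarrow> b \<in> Y \<Longrightarrow> f a b \<in> Y" "x \<in> closure Y" "y \<in> closure Y"
  shows "f x y \<in> closure Y"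
  using closure_map[OF assms(1), of "Y \<times> Y" Y "(x, y)"] assms(2-4) by (auto simp: closure_Times)

lemmas continuous_on_bop [continuous_intros] =
  bounded_linear.continuous_on[OF bounded_linear_scaleC_bop] bounded_linear.continuous_on[OF bounded_linear_adj]

lemma operator_algebra_closure:
  fixes Y :: "'h::complex_hilbert bop set"
  assumes "0 \<in> Y" "\<And>a b. a \<in> Y \<Longrightarrow> b \<in> Y \<Longrightarrow> a + b \<in> Y" "\<And>a b. a \<in> Y \<Longrightarrow> b \<in> Y \<Longrightarrow> a * b \<in> Y"
    "\<And>c a. a \<in> Y \<Longrightarrow> c *\<^sub>C a \<in> Y"
  shows "operator_algebra (closure Y)"
  unfolding operator_algebra_def
proof (intro conjI ballI allI)
  show "0 \<in> closure Y" using assms(1) closure_subset by blast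
  fix a b assume a: "a \<in> closure Y" and b: "b \<in> closure Y"
  show "a + b \<in> closure Y" by (rule closure_map2[OF _ assms(2) a b]) (intro continuous_intros)
  show "a * b \<in> closure Y" by (rule closure_map2[OF _ assms(3) a b]) (intro continuous_intros)
next
  fix c a assume a: "a \<in> closure Y"
  show "c *\<^sub>C a \<in> closure Y" by (rule closure_map[OF _ assms(4) a]) (intro continuous_intros)
qed simp

lemma cstar_algebra_closure:
  fixes Y :: "'h::complex_hilbert bop set"
  assumes "0 \<in> Y" "\<And>a b. a \<in> Y \<Longrightarrow> b \<in> Y \<Longrightarrow> a + b \<in> Y" "\<And>a b. a \<in> Y \<Longrightarrow> b \<in> Y \<Longrightarrow> a * b \<in> Y"
    "\<And>c a. a \<in> Y \<Longrightarrow> c *\<^sub>C a \<in> Y" "\<And>a. a \<in> Y \<Longrightarrow> adj a \<in> Y"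
  shows "cstar_algebra (closure Y)"
  unfolding cstar_algebra_def
proof (intro conjI ballI operator_algebra_closure assms(1-4))
  show "adj a \<in> closure Y" if "a \<in> closure Y" for a
    by (rule closure_map[OF _ assms(5) that]) (intro continuous_intros)
qed

lemma operator_algebra_Inter:
  "(\<And>B. B \<in> \<B> \<Longrightarrow> operator_algebra B) \<Longrightarrow> operator_algebra (\<Inter>\<B>)"
  unfolding operator_algebra_def by (auto intro: closed_Inter)

lemma operator_algebra_generated: "operator_algebra (generated_algebra X)"
  unfolding generated_algebra_def by (rule operator_algebra_Inter) auto

lemma generated_algebra_superset: "x \<in> X \<Longrightarrow> x \<in> generated_algebra X"
  unfolding generated_algebra_def by blast

lemma generated_algebra_subset: "operator_algebra B \<Longrightarrow> X \<subseteq> B \<Longrightarrow> generated_algebra X \<subseteq> B"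
  unfolding generated_algebra_def by blast

lemma cstar_algebra_generated: "cstar_algebra (generated_cstar_algebra X)"
  unfolding generated_cstar_algebra_def cstar_algebra_def
  by (intro conjI operator_algebra_Inter) auto

lemma generated_cstar_superset: "x \<in> X \<Longrightarrow> x \<in> generated_cstar_algebra X"
  unfolding generated_cstar_algebra_def by blast

lemma generated_cstar_subset: "cstar_algebra B \<Longrightarrow> X \<subseteq> B \<Longrightarrow> generated_cstar_algebra X \<subseteq> B"
  unfolding generated_cstar_algebra_def by blast

lemma algebra_hom_onD:
  assumes "algebra_hom_on A \<phi>" "operator_algebra A"
  shows "a \<in> A \<Longrightarrow> b \<in> A \<Longrightarrow> \<phi> (a + b) = \<phi> a + \<phi> b" "a \<in> A \<Longrightarrow> b \<in> A \<Longrightarrow> \<phi> (a * b) = \<phi> a * \<phi> b"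
    "a \<in> A \<Longrightarrow> \<phi> (c *\<^sub>C a) = c *\<^sub>C \<phi> a" "a \<in> A \<Longrightarrow> \<phi> (r *\<^sub>R a) = r *\<^sub>R \<phi> a" "\<phi> 0 = 0"
    "a \<in> A \<Longrightarrow> \<phi> (- a) = - \<phi> a" "a \<in> A \<Longrightarrow> b \<in> A \<Longrightarrow> \<phi> (a - b) = \<phi> a - \<phi> b"
    "(\<And>i. i \<in> S \<Longrightarrow> f i \<in> A) \<Longrightarrow> \<phi> (sum f S) = (\<Sum>i\<in>S. \<phi> (f i))"
proof -
  note Ai = operator_algebraD[OF assms(2)]
  show s: "a \<in> A \<Longrightarrow> b \<in> A \<Longrightarrow> \<phi> (a + b) = \<phi> a + \<phi> b" "a \<in> A \<Longrightarrow> b \<in> A \<Longrightarrow> \<phi> (a * b) = \<phi> a * \<phi> b"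
    "a \<in> A \<Longrightarrow> \<phi> (c *\<^sub>C a) = c *\<^sub>C \<phi> a" for a b c
    using assms(1) by (auto simp: algebra_hom_on_def)
  show "a \<in> A \<Longrightarrow> \<phi> (r *\<^sub>R a) = r *\<^sub>R \<phi> a" using s(3)[of a "of_real r"] by (simp add: scaleC_of_real)
  show z: "\<phi> 0 = 0" using s(3)[OF Ai(2), of 0] by simp
  show m: "a \<in> A \<Longrightarrow> \<phi> (- a) = - \<phi> a" for a using s(3)[of a "- 1"] by simp
  show "a \<in> A \<Longrightarrow> b \<in> A \<Longrightarrow> \<phi> (a - b) = \<phi> a - \<phi> b" using s(1)[of a "- b"] m[of b] Ai(7)[of b] by simp
  show "(\<And>i. i \<in> S \<Longrightarrow> f i \<in> A) \<Longrightarrow> \<phi> (sum f S) = (\<Sum>i\<in>S. \<phi> (f i))"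
    by (induction S rule: infinite_finite_induct) (auto simp: s z Ai(9))
qed

lemma star_hom_onD:
  assumes "star_hom_on C \<phi>"
  shows "algebra_hom_on C \<phi>" "a \<in> C \<Longrightarrow> \<phi> (adj a) = adj (\<phi> a)"
  using assms by (auto simp: star_hom_on_def)

lemmas cstarD = operator_algebraD[OF cstar_algebraD(1)]
lemmas star_homD = algebra_hom_onD[OF star_hom_onD(1) cstar_algebraD(1)]

text \<open>For selfadjoint \<open>h\<close> of norm less than 1 the equation \<open>2 s = h\<^sup>2 + s\<^sup>2\<close>, that is
  \<open>1 - h\<^sup>2 = (1 - s)\<^sup>2\<close>, has a selfadjoint solution in the algebra. As it is preserved by
  *-homomorphisms, these cannot increase the norm.\<close>

lemma star_hom_contractive_selfadjoint:
  assumes C: "cstar_algebra C" and \<phi>: "star_hom_on C \<phi>"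
    and h: "h \<in> C" "adj h = h" "norm h < 1"
  shows "norm (\<phi> h) \<le> 1"
proof -
  note Ci = cstarD[OF C]
  define r where "r = (norm h)\<^sup>2"
  \<comment> \<open>The smaller root of t = (r + t^2) / 2. The ball of radius t is mapped into
    itself by f, and t is a Lipschitz constant of f on it.\<close>
  define t where "t = 1 - sqrt (1 - r)"
  have r: "0 \<le> r" "r < 1" using h(3) by (auto simp: r_def abs_square_less_1)
  have t: "0 \<le> t" "t < 1" using r by (auto simp: t_def)
  have rt: "(r + t\<^sup>2) / 2 = t" using r by (simp add: t_def power2_diff)
  define X where "X = {s\<in>C. adj s = s \<and> norm s \<le> t}"
  define f where "f s = (1/2) *\<^sub>R (h * h + s * s)" for s
  have "\<exists>!s. s \<in> X \<and> f s = s"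
  proof (rule Banach_fix[where c=t, OF _ _ t])
    have "X = C \<inter> {s. adj s = s} \<inter> {s. norm s \<le> t}" by (auto simp: X_def)
    moreover have "closed {s :: 'a bop. adj s = s}"
      by (intro closed_Collect_eq linear_continuous_on bounded_linear_adj continuous_on_id)
    moreover have "closed {s :: 'a bop. norm s \<le> t}"
      by (intro closed_Collect_le continuous_on_norm continuous_on_id continuous_on_const)
    ultimately show "complete X" using Ci(1) by (simp add: complete_eq_closed closed_Int)
    show "X \<noteq> {}" using Ci(2) t by (auto simp: X_def intro: exI[of _ 0])
    show "f ` X \<subseteq> X"
    proof safe
      fix s assume s: "s \<in> X"
      have "norm (f s) \<le> (norm (h * h) + norm (s * s)) / 2"
        unfolding f_def using norm_triangle_ineq[of "h * h" "s * s"] by simp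
      also have "\<dots> \<le> (r + t\<^sup>2) / 2"
      proof -
        have "norm (h * h) \<le> r" using norm_mult_ineq[of h h] by (simp add: r_def power2_eq_square)
        moreover have "norm (s * s) \<le> norm s * norm s" by (rule norm_mult_ineq)
        moreover have "norm s * norm s \<le> t * t" using s t by (intro mult_mono) (auto simp: X_def)
        ultimately show ?thesis by (simp add: power2_eq_square)
      qed
      finally show "f s \<in> X"
        using s h rt unfolding X_def f_def by (auto intro!: Ci)
    qed
    show "dist (f x) (f y) \<le> t * dist x y" if xy: "x \<in> X" "y \<in> X" for x y
    proof -
      have "f x - f y = (1/2) *\<^sub>R (x * (x - y) + (x - y) * y)" by (simp add: f_def algebra_simps)
      hence "norm (f x - f y) \<le> (norm (x * (x - y)) + norm ((x - y) * y)) / 2"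
        using norm_triangle_ineq[of "x * (x - y)" "(x - y) * y"] by simp
      also have "\<dots> \<le> (norm x * norm (x - y) + norm (x - y) * norm y) / 2"
        using norm_mult_ineq[of x "x - y"] norm_mult_ineq[of "x - y" y] by simp
      also have "\<dots> \<le> (t * norm (x - y) + norm (x - y) * t) / 2"
        using xy by (intro divide_right_mono add_mono mult_right_mono mult_left_mono) (auto simp: X_def)
      finally show ?thesis by (simp add: dist_norm)
    qed
  qed
  then obtain s where s: "s \<in> C" "adj s = s" "f s = s" by (auto simp: X_def)
  note p = star_homD[OF \<phi> C]
  define k where "k = \<phi> h" define u where "u = \<phi> s"
  have k: "adj k = k" and u: "adj u = u"
    using star_hom_onD(2)[OF \<phi>, of h] star_hom_onD(2)[OF \<phi>, of s] h s by (auto simp: k_def u_def)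
  have "u = \<phi> (f s)" using s by (simp add: u_def)
  also have "\<dots> = (1/2) *\<^sub>R (k * k + u * u)"
    unfolding f_def using h(1) s(1) by (simp add: p Ci k_def u_def)
  finally have "2 *\<^sub>R u = k * k + u * u" by (metis (no_types) add_divide_distrib field_sum_of_halves one_add_one scaleR_one scaleR_scaleR times_divide_eq_right mult.right_neutral mult_2)
  hence eq: "1 - k * k = (1 - u) * (1 - u)" by (simp add: algebra_simps scaleR_2)
  show ?thesis unfolding k_def[symmetric]
  proof (rule norm_bop_le)
    fix \<xi>
    have "cinner (op_apply (1 - k * k) \<xi>) \<xi> = cinner (op_apply (1 - u) \<xi>) (op_apply (1 - u) \<xi>)"
      unfolding eq op_apply_times by (subst cinner_adj) (simp add: u)
    hence "0 \<le> Re (cinner (op_apply (1 - k * k) \<xi>) \<xi>)" by (simp add: Re_cinner_self)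
    also have "cinner (op_apply (1 - k * k) \<xi>) \<xi> = cinner \<xi> \<xi> - cinner (op_apply k \<xi>) (op_apply k \<xi>)"
      using cinner_adj[of k "op_apply k \<xi>" \<xi>] by (simp add: op_apply_minus cinner_diff_left k)
    finally have "(norm (op_apply k \<xi>))\<^sup>2 \<le> (norm \<xi>)\<^sup>2" by (simp add: Re_cinner_self)
    thus "norm (op_apply k \<xi>) \<le> 1 * norm \<xi>" by (simp add: power2_le_iff_abs_le)
  qed simp
qed

text \<open>By the C*-identity it suffices to treat \<open>adj a * a\<close> divided by c^2, a
  selfadjoint element of norm less than 1 for every c above the norm of a.\<close>

lemma star_hom_contractive:
  assumes C: "cstar_algebra C" and \<phi>: "star_hom_on C \<phi>" and a: "a \<in> C"
  shows "norm (\<phi> a) \<le> norm a"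
proof (rule dense_ge)
  note Ci = cstarD[OF C] and Ca = cstar_algebraD(2)[OF C]
  note p = star_homD[OF \<phi> C]
  fix c assume c: "norm a < c"
  hence c0: "c > 0" using norm_ge_zero[of a] by linarith
  define h where "h = (1 / c\<^sup>2) *\<^sub>R (adj a * a)"
  have "norm (\<phi> h) \<le> 1"
  proof (rule star_hom_contractive_selfadjoint[OF C \<phi>])
    show "h \<in> C" "adj h = h" using a by (auto simp: h_def intro!: Ci Ca)
    have "(norm a)\<^sup>2 < c\<^sup>2" using c by (intro power_strict_mono) auto
    thus "norm h < 1" using c0 by (simp add: h_def norm_adj_times field_simps)
  qed
  also have "\<phi> h = (1 / c\<^sup>2) *\<^sub>R (adj (\<phi> a) * \<phi> a)"
    unfolding h_def using a by (simp add: p Ci Ca star_hom_onD(2)[OF \<phi>])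
  finally have "(norm (\<phi> a))\<^sup>2 \<le> c\<^sup>2" using c0 by (simp add: norm_adj_times field_simps)
  thus "norm (\<phi> a) \<le> c" using c0 by (simp add: power2_le_iff_abs_le)
qed

subsection \<open>Operator matrices\<close>

text \<open>An operator matrix over \<open>S\<close>, extended by zero to the square summable
  families over the whole index type. Matrix norms thereby become norms in \<open>bop\<close>, and
  results on C*-algebras apply to matrix algebras.\<close>

definition block :: "'x set \<Rightarrow> ('x \<Rightarrow> 'x \<Rightarrow> 'h::complex_hilbert bop) \<Rightarrow> ('x, 'h) l2 bop"
  where "block S T = Bop (\<lambda>f. \<Sum>x\<in>S. \<Sum>y\<in>S. l2_single x (op_apply (T x y) (Rep_l2 f y)))"

lemma bounded_clinear_sum:
  assumes "\<And>i. i \<in> S \<Longrightarrow> bounded_clinear (T i)"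
  shows "bounded_clinear (\<lambda>x. \<Sum>i\<in>S. T i x)"
  using assms unfolding bounded_clinear_def by (simp add: bounded_linear_sum scaleC_sum_right)

lemma block_apply: "op_apply (block S T) f = (\<Sum>x\<in>S. \<Sum>y\<in>S. l2_single x (op_apply (T x y) (Rep_l2 f y)))"
  unfolding block_def
  by (subst op_apply_Bop)
     (intro bounded_clinear_sum bounded_clinear_compose[OF bounded_clinear_l2_single]
       bounded_clinear_compose[OF bounded_clinear_op_apply] bounded_clinear_Rep_l2 refl)+

lemma Rep_l2_block:
  assumes "finite S"
  shows "Rep_l2 (op_apply (block S T) f) x = (if x \<in> S then \<Sum>y\<in>S. op_apply (T x y) (Rep_l2 f y) else 0)"
proof -
  have "Rep_l2 (op_apply (block S T) f) x = (\<Sum>z\<in>S. \<Sum>y\<in>S. if x = z then op_apply (T z y) (Rep_l2 f y) else 0)"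
    unfolding block_apply Rep_l2_sum Rep_l2_single ..
  also have "\<dots> = (\<Sum>z\<in>S. if x = z then \<Sum>y\<in>S. op_apply (T z y) (Rep_l2 f y) else 0)"
    by (intro sum.cong) auto
  finally show ?thesis using assms by simp
qed

lemma norm_block_apply:
  assumes "finite S"
  shows "(norm (op_apply (block S T) f))\<^sup>2 = (\<Sum>x\<in>S. (norm (\<Sum>y\<in>S. op_apply (T x y) (Rep_l2 f y)))\<^sup>2)"
  by (subst norm_l2_finite_support[OF assms]) (auto simp: Rep_l2_block[OF assms] intro!: sum.cong)

definition column :: "'x set \<Rightarrow> ('x \<Rightarrow> 'h::complex_hilbert) \<Rightarrow> ('x, 'h) l2"
  where "column S \<xi> = (\<Sum>x\<in>S. l2_single x (\<xi> x))"

lemma Rep_l2_column: "finite S \<Longrightarrow> Rep_l2 (column S \<xi>) x = (if x \<in> S then \<xi> x else 0)"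
  by (simp add: column_def Rep_l2_sum Rep_l2_single)

lemma norm_column: "finite S \<Longrightarrow> (norm (column S \<xi>))\<^sup>2 = (\<Sum>x\<in>S. (norm (\<xi> x))\<^sup>2)"
  by (subst norm_l2_finite_support[of S]) (auto simp: Rep_l2_column intro!: sum.cong)

lemma norm_block_column:
  assumes "finite S"
  shows "(norm (op_apply (block S T) (column S \<xi>)))\<^sup>2 = (\<Sum>x\<in>S. (norm (\<Sum>y\<in>S. op_apply (T x y) (\<xi> y)))\<^sup>2)"
  unfolding norm_block_apply[OF assms] by (intro sum.cong) (auto simp: Rep_l2_column[OF assms] cong: sum.cong)

lemma norm_block_le_iff:
  assumes S: "finite S" and K: "K \<ge> 0"
  shows "norm (block S T) \<le> K \<longleftrightarrow>
    (\<forall>\<xi>. (\<Sum>x\<in>S. (norm (\<Sum>y\<in>S. op_apply (T x y) (\<xi> y)))\<^sup>2) \<le> K\<^sup>2 * (\<Sum>x\<in>S. (norm (\<xi> x))\<^sup>2))"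
proof safe
  fix \<xi> assume le: "norm (block S T) \<le> K"
  have "norm (op_apply (block S T) (column S \<xi>)) \<le> K * norm (column S \<xi>)"
    using norm_op_apply_le mult_right_mono[OF le norm_ge_zero] by (rule order_trans)
  from power_mono[OF this, of 2]
  show "(\<Sum>x\<in>S. (norm (\<Sum>y\<in>S. op_apply (T x y) (\<xi> y)))\<^sup>2) \<le> K\<^sup>2 * (\<Sum>x\<in>S. (norm (\<xi> x))\<^sup>2)"
    by (simp add: norm_block_column[OF S] norm_column[OF S] power_mult_distrib)
next
  assume *: "\<forall>\<xi>. (\<Sum>x\<in>S. (norm (\<Sum>y\<in>S. op_apply (T x y) (\<xi> y)))\<^sup>2) \<le> K\<^sup>2 * (\<Sum>x\<in>S. (norm (\<xi> x))\<^sup>2)"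
  show "norm (block S T) \<le> K"
  proof (rule norm_bop_le[OF _ K])
    fix f
    have "(norm (op_apply (block S T) f))\<^sup>2 \<le> K\<^sup>2 * (\<Sum>x\<in>S. (norm (Rep_l2 f x))\<^sup>2)"
      unfolding norm_block_apply[OF S] using * by blast
    also have "\<dots> \<le> K\<^sup>2 * (norm f)\<^sup>2" by (intro mult_left_mono sum_le_norm_l2 S) auto
    finally have "(norm (op_apply (block S T) f))\<^sup>2 \<le> (K * norm f)\<^sup>2" by (simp add: power_mult_distrib)
    thus "norm (op_apply (block S T) f) \<le> K * norm f" by (rule power2_le_imp_le) (simp add: K)
  qed
qed

lemma block_cong: "(\<And>x y. x \<in> S \<Longrightarrow> y \<in> S \<Longrightarrow> T x y = T' x y) \<Longrightarrow> block S T = block S T'"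
  by (rule bop_eqI) (simp add: block_apply)

lemma norm_block_reindex:
  fixes T :: "'y \<Rightarrow> 'y \<Rightarrow> 'h::complex_hilbert bop"
  assumes S: "finite S" and f: "bij_betw f S S'"
  shows "norm (block S' T) = norm (block S (\<lambda>x y. T (f x) (f y)))"
proof -
  have S': "finite S'" using f S bij_betw_finite by blast
  have 1: "(\<Sum>x\<in>S'. (norm (\<Sum>y\<in>S'. op_apply (T x y) (\<xi> y)))\<^sup>2)
      = (\<Sum>x\<in>S. (norm (\<Sum>y\<in>S. op_apply (T (f x) (f y)) (\<xi> (f y))))\<^sup>2)" for \<xi>
    unfolding sum.reindex_bij_betw[OF f, symmetric] ..
  have 2: "(\<Sum>x\<in>S'. (norm (\<xi> x))\<^sup>2) = (\<Sum>x\<in>S. (norm (\<xi> (f x)))\<^sup>2)" for \<xi> :: "'y \<Rightarrow> 'h"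
    unfolding sum.reindex_bij_betw[OF f, symmetric] ..
  show ?thesis
  proof (rule antisym)
    show "norm (block S' T) \<le> norm (block S (\<lambda>x y. T (f x) (f y)))"
      unfolding norm_block_le_iff[OF S' norm_ge_zero] 1 2
      by (rule allI) (rule norm_block_le_iff[OF S norm_ge_zero, THEN iffD1, OF order_refl, rule_format])
    show "norm (block S (\<lambda>x y. T (f x) (f y))) \<le> norm (block S' T)"
      unfolding norm_block_le_iff[OF S norm_ge_zero]
    proof
      fix \<xi> :: "_ \<Rightarrow> 'h"
      define \<eta> where "\<eta> = (\<lambda>z. \<xi> (the_inv_into S f z))"
      have \<eta>: "\<eta> (f y) = \<xi> y" if "y \<in> S" for y
        using that f by (simp add: \<eta>_def bij_betw_def the_inv_into_f_f)
      show "(\<Sum>x\<in>S. (norm (\<Sum>y\<in>S. op_apply (T (f x) (f y)) (\<xi> y)))\<^sup>2)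
          \<le> (norm (block S' T))\<^sup>2 * (\<Sum>x\<in>S. (norm (\<xi> x))\<^sup>2)"
        using norm_block_le_iff[OF S' norm_ge_zero, THEN iffD1, OF order_refl, rule_format, of T \<eta>]
        unfolding 1 2 by (simp add: \<eta> cong: sum.cong)
    qed
  qed
qed

text \<open>Columns of length n correspond to families supported below n, and the block ignores all
  other coordinates; so both sides are the supremum over the same unit ball.\<close>

lemma matrix_norm_eq: "matrix_norm n T = norm (block {..<n} T)"
proof -
  define N where "N x = sqrt (\<Sum>i<n. (norm (\<Sum>j<n. op_apply (T i j) (x j)))\<^sup>2)" for x
  define X where "X = {x :: nat \<Rightarrow> 'a. (\<Sum>j<n. (norm (x j))\<^sup>2) \<le> 1}"
  have mn: "matrix_norm n T = Sup (N ` X)"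
    unfolding matrix_norm_def N_def X_def by (intro arg_cong[where f=Sup]) blast
  have N: "N x = norm (op_apply (block {..<n} T) (column {..<n} x))" for x
    unfolding N_def norm_block_column[OF finite_lessThan, symmetric] by simp
  have le: "N x \<le> norm (block {..<n} T)" if "x \<in> X" for x
  proof -
    have "(norm (column {..<n} x))\<^sup>2 \<le> 1" using that by (simp add: norm_column X_def)
    hence "norm (column {..<n} x) \<le> 1" by (simp add: power2_le_iff_abs_le abs_square_le_1)
    thus ?thesis unfolding N
      using norm_op_apply_le[of "block {..<n} T" "column {..<n} x"]
        mult_left_mono[OF _ norm_ge_zero, of "norm (column {..<n} x)" 1 "block {..<n} T"] by simp
  qed
  have X0: "(\<lambda>_. 0) \<in> X" by (simp add: X_def)
  show ?thesis unfolding mn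
  proof (rule antisym)
    show "Sup (N ` X) \<le> norm (block {..<n} T)" using X0 le by (intro cSup_least) auto
    have bdd: "bdd_above (N ` X)" using le by (intro bdd_aboveI2) auto
    show "norm (block {..<n} T) \<le> Sup (N ` X)"
    proof (rule norm_bop_le_unit)
      have "N (\<lambda>_. 0) \<le> Sup (N ` X)" using X0 bdd by (intro cSup_upper) auto
      thus "0 \<le> Sup (N ` X)" by (simp add: N_def)
      fix f :: "(nat, 'a) l2" assume f: "norm f \<le> 1"
      have "(\<Sum>j<n. (norm (Rep_l2 f j))\<^sup>2) \<le> (norm f)\<^sup>2" by (rule sum_le_norm_l2) simp
      also have "\<dots> \<le> 1" using f by (simp add: abs_square_le_1)
      finally have "Rep_l2 f \<in> X" by (simp add: X_def)
      moreover have "norm (op_apply (block {..<n} T) f) = N (Rep_l2 f)"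
        unfolding N_def norm_block_apply[OF finite_lessThan, symmetric] by simp
      ultimately show "norm (op_apply (block {..<n} T) f) \<le> Sup (N ` X)"
        using bdd by (auto intro: cSup_upper)
    qed
  qed
qed

lemma norm_block_card:
  "bij_betw f {..<card S} S \<Longrightarrow> norm (block S T) = matrix_norm (card S) (\<lambda>i j. T (f i) (f j))"
  unfolding matrix_norm_eq by (rule norm_block_reindex) simp_all

lemma completely_contractive_block:
  fixes \<phi> :: "'h::complex_hilbert bop \<Rightarrow> 'k::complex_hilbert bop"
  assumes \<phi>: "completely_contractive_on A \<phi>" and S: "finite S" and T: "\<And>x y. x \<in> S \<Longrightarrow> y \<in> S \<Longrightarrow> T x y \<in> A"
  shows "norm (block S (\<lambda>x y. \<phi> (T x y))) \<le> norm (block S T)"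
proof -
  obtain f where f: "bij_betw f {..<card S} S"
    using ex_bij_betw_nat_finite[OF S] by (auto simp: atLeast0LessThan)
  have "f i \<in> S" if "i < card S" for i using f that by (auto simp: bij_betw_def)
  thus ?thesis unfolding norm_block_card[OF f]
    by (intro \<phi>[unfolded completely_contractive_on_def, rule_format] T)
qed

lemma completely_isometric_onI:
  assumes "completely_contractive_on A \<phi>"
    "\<And>n T. (\<And>i j. i < n \<Longrightarrow> j < n \<Longrightarrow> T i j \<in> A) \<Longrightarrow> matrix_norm n T \<le> matrix_norm n (\<lambda>i j. \<phi> (T i j))"
  shows "completely_isometric_on A \<phi>"
  using assms unfolding completely_isometric_on_def completely_contractive_on_def
  by (intro allI impI antisym) simp_all

lemma completely_isometric_block:
  fixes \<phi> :: "'h::complex_hilbert bop \<Rightarrow> 'k::complex_hilbert bop"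
  assumes \<phi>: "completely_isometric_on A \<phi>" and S: "finite S" and T: "\<And>x y. x \<in> S \<Longrightarrow> y \<in> S \<Longrightarrow> T x y \<in> A"
  shows "norm (block S (\<lambda>x y. \<phi> (T x y))) = norm (block S T)"
proof -
  obtain f where f: "bij_betw f {..<card S} S"
    using ex_bij_betw_nat_finite[OF S] by (auto simp: atLeast0LessThan)
  have "f i \<in> S" if "i < card S" for i using f that by (auto simp: bij_betw_def)
  thus ?thesis unfolding norm_block_card[OF f]
    by (intro \<phi>[unfolded completely_isometric_on_def, rule_format] T)
qed

definition l2_entry :: "('x, 'h::complex_hilbert) l2 bop \<Rightarrow> 'x \<Rightarrow> 'x \<Rightarrow> 'h bop"
  where "l2_entry Z x y = Bop (\<lambda>\<xi>. Rep_l2 (op_apply Z (l2_single y \<xi>)) x)"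

lemma l2_entry_apply: "op_apply (l2_entry Z x y) \<xi> = Rep_l2 (op_apply Z (l2_single y \<xi>)) x"
  unfolding l2_entry_def
  by (subst op_apply_Bop)
     (intro bounded_clinear_compose[OF bounded_clinear_Rep_l2] bounded_clinear_compose[OF bounded_clinear_op_apply]
       bounded_clinear_l2_single refl)+

lemma cinner_l2_entry: "cinner (op_apply (l2_entry Z x y) \<xi>) \<eta> = cinner (op_apply Z (l2_single y \<xi>)) (l2_single x \<eta>)"
  by (simp add: l2_entry_apply)

lemma l2_entry_plus: "l2_entry (Z + Z') x y = l2_entry Z x y + l2_entry Z' x y"
  by (rule bop_eqI) (simp add: l2_entry_apply op_apply_simps Rep_l2_simps)
lemma l2_entry_scaleC: "l2_entry (c *\<^sub>C Z) x y = c *\<^sub>C l2_entry Z x y"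
  by (rule bop_eqI) (simp add: l2_entry_apply op_apply_simps Rep_l2_simps)
lemma l2_entry_scaleR: "l2_entry (c *\<^sub>R Z) x y = c *\<^sub>R l2_entry Z x y"
  by (rule bop_eqI) (simp add: l2_entry_apply op_apply_simps Rep_l2_simps)
lemma l2_entry_zero [simp]: "l2_entry 0 x y = 0"
  by (rule bop_eqI) (simp add: l2_entry_apply Rep_l2_simps)
lemma norm_l2_entry_le: "norm (l2_entry Z x y) \<le> norm Z"
proof (rule norm_bop_le[OF _ norm_ge_zero])
  fix \<xi>
  show "norm (op_apply (l2_entry Z x y) \<xi>) \<le> norm Z * norm \<xi>"
    unfolding l2_entry_apply using norm_Rep_l2_le norm_op_apply_le[of Z "l2_single y \<xi>"]
    by (metis norm_l2_single order_trans)
qed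

lemma bounded_linear_l2_entry: "bounded_linear (\<lambda>Z. l2_entry Z x y)"
  by (rule bounded_linear_intro[where K=1]) (auto simp: l2_entry_plus l2_entry_scaleR norm_l2_entry_le)

lemma l2_entry_adj: "l2_entry (adj Z) x y = adj (l2_entry Z y x)"
proof (rule adj_eqI[symmetric])
  fix \<xi> \<eta>
  have "cinner (op_apply (l2_entry Z y x) \<xi>) \<eta> = cinner (l2_single x \<xi>) (op_apply (adj Z) (l2_single y \<eta>))"
    unfolding cinner_l2_entry by (rule cinner_adj)
  thus "cinner (op_apply (l2_entry Z y x) \<xi>) \<eta> = cinner \<xi> (op_apply (l2_entry (adj Z) x y) \<eta>)"
    by (simp add: l2_entry_apply)
qed

lemma l2_entry_eqI:
  assumes "\<And>x y. l2_entry Z x y = l2_entry Z' x y"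
  shows "Z = Z'"
proof -
  have "UNIV \<subseteq> {f. op_apply Z f = op_apply Z' f}"
    unfolding l2_singles_total[symmetric]
  proof (rule cspan_subset)
    show "closed_csubspace {f. op_apply Z f = op_apply Z' f}"
      by (intro closed_csubspace_equalizer bounded_clinear_op_apply)
    show "{l2_single x \<xi> |x \<xi>. True} \<subseteq> {f. op_apply Z f = op_apply Z' f}"
      using assms by (auto intro!: l2_eqI simp: l2_entry_apply[symmetric])
  qed
  thus ?thesis by (auto intro: bop_eqI)
qed

lemma l2_entry_block:
  assumes "finite S"
  shows "l2_entry (block S T) x y = (if x \<in> S \<and> y \<in> S then T x y else 0)"
proof (rule bop_eqI)
  fix \<xi>
  have "(\<Sum>z\<in>S. op_apply (T x z) (if z = y then \<xi> else 0)) = (\<Sum>z\<in>S. if z = y then op_apply (T x z) \<xi> else 0)"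
    by (intro sum.cong) auto
  thus "op_apply (l2_entry (block S T) x y) \<xi> = op_apply (if x \<in> S \<and> y \<in> S then T x y else 0) \<xi>"
    using assms by (simp add: l2_entry_apply Rep_l2_block Rep_l2_single)
qed

lemma norm_block_single: "norm (block {x} T) = norm (T x x)"
proof (rule antisym)
  show "norm (block {x} T) \<le> norm (T x x)"
    unfolding norm_block_le_iff[OF finite.insertI[OF finite.emptyI] norm_ge_zero]
    by (auto simp: power_mult_distrib[symmetric] intro!: power_mono norm_op_apply_le)
  show "norm (T x x) \<le> norm (block {x} T)"
    using norm_l2_entry_le[of "block {x} T" x x] by (simp add: l2_entry_block)
qed

lemma completely_isometric_norm: "completely_isometric_on A \<phi> \<Longrightarrow> a \<in> A \<Longrightarrow> norm (\<phi> a) = norm a"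
  using completely_isometric_block[of A \<phi> "{0::nat}" "\<lambda>_ _. a"] by (simp add: norm_block_single)

lemma block_l2_entry:
  assumes "finite S" "\<And>x y. \<not> (x \<in> S \<and> y \<in> S) \<Longrightarrow> l2_entry Z x y = 0"
  shows "block S (l2_entry Z) = Z"
  by (rule l2_entry_eqI) (use assms in \<open>auto simp: l2_entry_block\<close>)

lemma block_plus: "block S (\<lambda>x y. T x y + T' x y) = block S T + block S T'"
  by (rule bop_eqI) (simp add: block_apply op_apply_simps l2_single_add sum.distrib)
lemma block_scaleC: "block S (\<lambda>x y. c *\<^sub>C T x y) = c *\<^sub>C block S T"
  by (rule bop_eqI) (simp add: block_apply op_apply_simps l2_single_scaleC scaleC_sum_right)
lemma block_times:
  assumes "finite S"
  shows "block S T * block S T' = block S (\<lambda>x y. \<Sum>z\<in>S. T x z * T' z y)"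
proof (rule bop_eqI, rule l2_eqI)
  fix f x
  have "(\<Sum>z\<in>S. op_apply (T x z) (\<Sum>y\<in>S. op_apply (T' z y) (Rep_l2 f y)))
    = (\<Sum>y\<in>S. \<Sum>z\<in>S. op_apply (T x z) (op_apply (T' z y) (Rep_l2 f y)))"
    unfolding op_apply_sum_right by (rule sum.swap)
  thus "Rep_l2 (op_apply (block S T * block S T') f) x = Rep_l2 (op_apply (block S (\<lambda>x y. \<Sum>z\<in>S. T x z * T' z y)) f) x"
    using assms by (simp add: Rep_l2_block op_apply_sum cong: sum.cong)
qed
lemma block_adj:
  assumes "finite S"
  shows "adj (block S T) = block S (\<lambda>x y. adj (T y x))"
  by (rule l2_entry_eqI) (use assms in \<open>auto simp: l2_entry_block l2_entry_adj\<close>)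

text \<open>The matrix algebra over \<open>C\<close> with rows and columns in \<open>S\<close>, as a
  concrete algebra of operators.\<close>

definition block_algebra :: "'x set \<Rightarrow> 'h::complex_hilbert bop set \<Rightarrow> ('x, 'h) l2 bop set"
  where "block_algebra S C = {Z. (\<forall>x\<in>S. \<forall>y\<in>S. l2_entry Z x y \<in> C) \<and> (\<forall>x y. \<not> (x \<in> S \<and> y \<in> S) \<longrightarrow> l2_entry Z x y = 0)}"

lemma block_algebra_eq: "finite S \<Longrightarrow> Z \<in> block_algebra S C \<Longrightarrow> block S (l2_entry Z) = Z"
  by (rule block_l2_entry) (auto simp: block_algebra_def)

lemma cstar_algebra_block_algebra:
  assumes C: "cstar_algebra C" and S: "finite S"
  shows "cstar_algebra (block_algebra S C)"
proof -
  note Ci = cstarD[OF C] and Ca = cstar_algebraD(2)[OF C]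
  have "block_algebra S C = (\<Inter>x\<in>S. \<Inter>y\<in>S. (\<lambda>Z. l2_entry Z x y) -` C) \<inter>
      (\<Inter>p\<in>{(x, y). \<not> (x \<in> S \<and> y \<in> S)}. (\<lambda>Z. l2_entry Z (fst p) (snd p)) -` {0})"
    by (auto simp: block_algebra_def)
  moreover have "closed ((\<lambda>Z. l2_entry Z x y) -` D)" if "closed D" for D :: "'a bop set" and x y :: 'b
    using that by (intro closed_vimage linear_continuous_on[OF bounded_linear_l2_entry, THEN continuous_on_eq_continuous_within[THEN iffD1]] ) 
      (auto intro: linear_continuous_on bounded_linear_l2_entry)
  ultimately have "closed (block_algebra S C)" using Ci(1) by (auto intro!: closed_Int closed_INT)
  moreover have "Z * Z' \<in> block_algebra S C" if "Z \<in> block_algebra S C" "Z' \<in> block_algebra S C" for Z Z'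
  proof -
    have "Z * Z' = block S (\<lambda>x y. \<Sum>z\<in>S. l2_entry Z x z * l2_entry Z' z y)"
      using block_times[OF S, of "l2_entry Z" "l2_entry Z'"] that S by (simp add: block_algebra_eq)
    thus ?thesis using that S by (auto simp: block_algebra_def l2_entry_block intro!: Ci)
  qed
  ultimately show ?thesis
    unfolding cstar_algebra_def operator_algebra_def
    by (auto simp: block_algebra_def l2_entry_plus l2_entry_scaleC l2_entry_adj intro!: Ci Ca)
qed

lemma star_hom_block:
  assumes C: "cstar_algebra C" and S: "finite S" and \<phi>: "star_hom_on C \<phi>"
  shows "star_hom_on (block_algebra S C) (\<lambda>Z. block S (\<lambda>x y. \<phi> (l2_entry Z x y)))"
proof -
  note Ci = cstarD[OF C]
  note p = star_homD[OF \<phi> C]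
  have e: "l2_entry Z x y \<in> C" if "Z \<in> block_algebra S C" for Z x y
    using that Ci(2) unfolding block_algebra_def by (cases "x \<in> S \<and> y \<in> S") auto
  have "block S (\<lambda>x y. \<phi> (l2_entry (Z * Z') x y)) =
      block S (\<lambda>x y. \<phi> (l2_entry Z x y)) * block S (\<lambda>x y. \<phi> (l2_entry Z' x y))"
    if "Z \<in> block_algebra S C" "Z' \<in> block_algebra S C" for Z Z'
  proof -
    have "Z * Z' = block S (\<lambda>x y. \<Sum>z\<in>S. l2_entry Z x z * l2_entry Z' z y)"
      using block_times[OF S, of "l2_entry Z" "l2_entry Z'"] that S by (simp add: block_algebra_eq)
    thus ?thesis using S e that by (auto simp: block_times l2_entry_block p Ci intro!: block_cong)
  qed
  thus ?thesis
    unfolding star_hom_on_def algebra_hom_on_def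
    using e S star_hom_onD(2)[OF \<phi>]
    by (auto simp: l2_entry_plus l2_entry_scaleC l2_entry_adj p block_plus block_scaleC block_adj)
qed

text \<open>The amplification to matrices is again a *-homomorphism on a C*-algebra, hence
  contractive.\<close>

theorem star_hom_completely_contractive:
  assumes C: "cstar_algebra C" and \<phi>: "star_hom_on C \<phi>"
  shows "completely_contractive_on C \<phi>"
  unfolding completely_contractive_on_def matrix_norm_eq
proof (intro allI impI)
  fix n :: nat and T assume T: "\<forall>i<n. \<forall>j<n. T i j \<in> C"
  let ?Z = "block {..<n} T"
  have "?Z \<in> block_algebra {..<n} C" using T by (auto simp: block_algebra_def l2_entry_block)
  from star_hom_contractive[OF cstar_algebra_block_algebra[OF C] star_hom_block[OF C _ \<phi>] this]
  have "norm (block {..<n} (\<lambda>x y. \<phi> (l2_entry ?Z x y))) \<le> norm ?Z" by simp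
  also have "block {..<n} (\<lambda>x y. \<phi> (l2_entry ?Z x y)) = block {..<n} (\<lambda>x y. \<phi> (T x y))"
    by (rule block_cong) (simp add: l2_entry_block)
  finally show "norm (block {..<n} (\<lambda>i j. \<phi> (T i j))) \<le> norm ?Z" .
qed

subsection \<open>Images under *-homomorphisms\<close>

lemma star_hom_on_subset: "star_hom_on C \<phi> \<Longrightarrow> D \<subseteq> C \<Longrightarrow> star_hom_on D \<phi>"
  unfolding star_hom_on_def algebra_hom_on_def by blast

lemma star_hom_compose:
  assumes "star_hom_on C \<phi>" "star_hom_on D \<psi>" "\<phi> ` C \<subseteq> D"
  shows "star_hom_on C (\<lambda>x. \<psi> (\<phi> x))"
proof -
  have "\<phi> a \<in> D" if "a \<in> C" for a using that assms(3) by blast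
  thus ?thesis using assms(1,2) unfolding star_hom_on_def algebra_hom_on_def by simp
qed

lemma star_hom_dist_le:
  assumes "cstar_algebra C" "star_hom_on C \<phi>" "a \<in> C" "b \<in> C"
  shows "dist (\<phi> a) (\<phi> b) \<le> dist a b"
  using star_hom_contractive[OF assms(1,2), of "a - b"] assms(3,4)
    star_homD(7)[OF assms(2) assms(1), of a b]
    cstarD(8)[OF assms(1), of a b]
  by (simp add: dist_norm)

lemma star_hom_tendsto:
  assumes C: "cstar_algebra C" "star_hom_on C \<phi>" and X: "\<And>n. X n \<in> C" "c \<in> C" "(X \<longlongrightarrow> c) F"
  shows "((\<lambda>n. \<phi> (X n)) \<longlongrightarrow> \<phi> c) F"
proof (rule tendstoI)
  fix e :: real assume "e > 0"
  with X(3) have "\<forall>\<^sub>F n in F. dist (X n) c < e" by (rule tendstoD)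
  thus "\<forall>\<^sub>F n in F. dist (\<phi> (X n)) (\<phi> c) < e"
    by (rule eventually_mono) (use star_hom_dist_le[OF C X(1) X(2)] in \<open>meson le_less_trans\<close>)
qed

lemma cstar_algebra_preimage:
  assumes C: "cstar_algebra C" and \<phi>: "star_hom_on C \<phi>" and B: "cstar_algebra B"
  shows "cstar_algebra {c\<in>C. \<phi> c \<in> B}"
proof -
  note Ci = cstarD[OF C] and Ca = cstar_algebraD(2)[OF C]
  note Bi = cstarD[OF B] and Ba = cstar_algebraD(2)[OF B]
  note p = star_homD[OF \<phi> C]
  have "closed {c\<in>C. \<phi> c \<in> B}"
    unfolding closed_sequential_limits
  proof (intro allI impI, elim conjE)
    fix X c assume X: "\<forall>n. X n \<in> {c\<in>C. \<phi> c \<in> B}" "X \<longlonglongrightarrow> c"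
    have c: "c \<in> C" using closed_sequentially[OF Ci(1), of X c] X by auto
    have "(\<lambda>n. \<phi> (X n)) \<longlonglongrightarrow> \<phi> c" using X by (intro star_hom_tendsto[OF C \<phi> _ c]) auto
    hence "\<phi> c \<in> B" using closed_sequentially[OF Bi(1), of "\<lambda>n. \<phi> (X n)"] X by auto
    thus "c \<in> {c\<in>C. \<phi> c \<in> B}" using c by simp
  qed
  thus ?thesis unfolding cstar_algebra_def operator_algebra_def
    by (auto simp: p star_hom_onD(2)[OF \<phi>] intro: Ci Ca Bi Ba)
qed

lemma star_hom_generated_subset:
  assumes C: "cstar_algebra C" and \<phi>: "star_hom_on C \<phi>" and X: "X \<subseteq> C" and B: "cstar_algebra B" "\<phi> ` X \<subseteq> B"
  shows "\<phi> ` generated_cstar_algebra X \<subseteq> B"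
proof -
  have "generated_cstar_algebra X \<subseteq> {c\<in>C. \<phi> c \<in> B}"
    using X B(2) by (intro generated_cstar_subset cstar_algebra_preimage[OF C \<phi> B(1)]) auto
  thus ?thesis by blast
qed

lemma star_hom_eq_on_generated:
  assumes C: "cstar_algebra C" and \<phi>: "star_hom_on C \<phi>" and \<psi>: "star_hom_on C \<psi>" and X: "X \<subseteq> C"
    and eq: "\<And>x. x \<in> X \<Longrightarrow> \<phi> x = \<psi> x" and c: "c \<in> generated_cstar_algebra X"
  shows "\<phi> c = \<psi> c"
proof -
  note Ci = cstarD[OF C] and Ca = cstar_algebraD(2)[OF C]
  note p = star_homD[OF \<phi> C]
  note q = star_homD[OF \<psi> C]
  have "closed {c\<in>C. \<phi> c = \<psi> c}"
    unfolding closed_sequential_limits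
  proof (intro allI impI, elim conjE)
    fix Y c assume Y: "\<forall>n. Y n \<in> {c\<in>C. \<phi> c = \<psi> c}" "Y \<longlonglongrightarrow> c"
    have c: "c \<in> C" using closed_sequentially[OF Ci(1), of Y c] Y by auto
    have "(\<lambda>n. \<phi> (Y n)) \<longlonglongrightarrow> \<phi> c" using Y by (intro star_hom_tendsto[OF C \<phi> _ c]) auto
    moreover have "(\<lambda>n. \<psi> (Y n)) \<longlonglongrightarrow> \<psi> c" using Y by (intro star_hom_tendsto[OF C \<psi> _ c]) auto
    moreover have "(\<lambda>n. \<phi> (Y n)) = (\<lambda>n. \<psi> (Y n))" using Y by auto
    ultimately have "\<phi> c = \<psi> c" by (metis LIMSEQ_unique)
    thus "c \<in> {c\<in>C. \<phi> c = \<psi> c}" using c by simp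
  qed
  hence "cstar_algebra {c\<in>C. \<phi> c = \<psi> c}"
    unfolding cstar_algebra_def operator_algebra_def
    by (auto simp: p q star_hom_onD(2)[OF \<phi>] star_hom_onD(2)[OF \<psi>] intro: Ci Ca)
  hence "generated_cstar_algebra X \<subseteq> {c\<in>C. \<phi> c = \<psi> c}" using X eq by (intro generated_cstar_subset) auto
  thus ?thesis using c by blast
qed

lemma inv_star_hom:
  assumes C: "cstar_algebra C" and \<phi>: "star_hom_on C \<phi>" and inj: "inj_on \<phi> C"
  shows "star_hom_on (\<phi> ` C) (inv_into C \<phi>)"
proof -
  note Ci = cstarD[OF C] and Ca = cstar_algebraD(2)[OF C]
  note p = star_homD[OF \<phi> C]
  have i: "inv_into C \<phi> (\<phi> c) = c" if "c \<in> C" for c using inj that by simp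
  show ?thesis
    unfolding star_hom_on_def algebra_hom_on_def
    by (auto simp: i Ci Ca simp flip: p star_hom_onD(2)[OF \<phi>])
qed

lemma isometric_imp_inj_on:
  assumes C: "cstar_algebra C" and \<phi>: "star_hom_on C \<phi>" and iso: "\<And>c. c \<in> C \<Longrightarrow> norm (\<phi> c) = norm c"
  shows "inj_on \<phi> C"
proof (rule inj_onI)
  fix a b assume "a \<in> C" "b \<in> C" "\<phi> a = \<phi> b"
  hence "norm (a - b) = 0"
    using iso[of "a - b"] cstarD(8)[OF C, of a b]
      star_homD(7)[OF \<phi> C, of a b] by simp
  thus "a = b" by simp
qed

text \<open>Completeness passes through an isometry, which makes the image closed.\<close>

lemma operator_algebra_isometric_image:
  assumes A: "operator_algebra A" and \<phi>: "algebra_hom_on A \<phi>" and iso: "\<And>a. a \<in> A \<Longrightarrow> norm (\<phi> a) = norm a"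
  shows "operator_algebra (\<phi> ` A)"
proof -
  note Ai = operator_algebraD[OF A] and p = algebra_hom_onD[OF \<phi> A]
  have d: "dist (\<phi> a) (\<phi> b) = dist a b" if "a \<in> A" "b \<in> A" for a b
    using iso[of "a - b"] that by (simp add: dist_norm p Ai)
  have "complete (\<phi> ` A)"
    unfolding complete_def
  proof (intro allI impI, elim conjE)
    fix Y assume Y: "\<forall>n. Y n \<in> \<phi> ` A" "Cauchy Y"
    hence "\<forall>n. \<exists>c. c \<in> A \<and> Y n = \<phi> c" by blast
    then obtain X where X: "\<And>n. X n \<in> A" "\<And>n. Y n = \<phi> (X n)" using choice by meson
    have "Cauchy X" using Y(2) unfolding Cauchy_def X(2) d[OF X(1) X(1)] .
    then obtain c where c: "X \<longlonglongrightarrow> c" using Cauchy_convergent convergent_def by blast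
    have cA: "c \<in> A" using closed_sequentially[OF Ai(1) X(1) c] .
    have "Y \<longlonglongrightarrow> \<phi> c" using c unfolding tendsto_iff X(2) d[OF X(1) cA] .
    thus "\<exists>l\<in>\<phi> ` A. Y \<longlonglongrightarrow> l" using cA by auto
  qed
  hence "closed (\<phi> ` A)" by (rule complete_imp_closed)
  moreover have "0 \<in> \<phi> ` A" using p(5) Ai(2) by (metis imageI)
  ultimately show ?thesis
    unfolding operator_algebra_def by (auto simp flip: p intro!: imageI Ai)
qed

lemma cstar_algebra_isometric_image:
  assumes C: "cstar_algebra C" and \<phi>: "star_hom_on C \<phi>" and iso: "\<And>c. c \<in> C \<Longrightarrow> norm (\<phi> c) = norm c"
  shows "cstar_algebra (\<phi> ` C)"
  using operator_algebra_isometric_image[OF cstar_algebraD(1)[OF C] star_hom_onD(1)[OF \<phi>] iso] cstar_algebraD(2)[OF C]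
  by (auto simp: cstar_algebra_def simp flip: star_hom_onD(2)[OF \<phi>])

lemma star_hom_image_generated:
  assumes C: "cstar_algebra C" and \<phi>: "star_hom_on C \<phi>" and iso: "\<And>c. c \<in> C \<Longrightarrow> norm (\<phi> c) = norm c"
    and X: "X \<subseteq> C"
  shows "\<phi> ` generated_cstar_algebra X = generated_cstar_algebra (\<phi> ` X)"
proof
  have sub: "generated_cstar_algebra X \<subseteq> C" by (rule generated_cstar_subset[OF C X])
  show "\<phi> ` generated_cstar_algebra X \<subseteq> generated_cstar_algebra (\<phi> ` X)"
    by (rule star_hom_generated_subset[OF C \<phi> X cstar_algebra_generated])
       (auto intro: generated_cstar_superset)
  show "generated_cstar_algebra (\<phi> ` X) \<subseteq> \<phi> ` generated_cstar_algebra X"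
  proof (rule generated_cstar_subset)
    show "cstar_algebra (\<phi> ` generated_cstar_algebra X)"
      using sub iso by (intro cstar_algebra_isometric_image cstar_algebra_generated star_hom_on_subset[OF \<phi>]) auto
  qed (auto intro: generated_cstar_superset)
qed

text \<open>The inverse is a *-homomorphism on the image, which is a C*-algebra; complete
  contractivity of both directions gives equality.\<close>

lemma isometric_star_hom_completely_isometric:
  assumes C: "cstar_algebra C" and \<phi>: "star_hom_on C \<phi>" and iso: "\<And>c. c \<in> C \<Longrightarrow> norm (\<phi> c) = norm c"
  shows "completely_isometric_on C \<phi>"
proof (rule completely_isometric_onI)
  show "completely_contractive_on C \<phi>" by (rule star_hom_completely_contractive[OF C \<phi>])
  fix n and T :: "nat \<Rightarrow> nat \<Rightarrow> _" assume T: "\<And>i j. i < n \<Longrightarrow> j < n \<Longrightarrow> T i j \<in> C"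
  note inj = isometric_imp_inj_on[OF C \<phi> iso]
  have "completely_contractive_on (\<phi> ` C) (inv_into C \<phi>)"
    using iso by (intro star_hom_completely_contractive cstar_algebra_isometric_image[OF C \<phi>] inv_star_hom[OF C \<phi>] inj)
  hence "matrix_norm n (\<lambda>i j. inv_into C \<phi> (\<phi> (T i j))) \<le> matrix_norm n (\<lambda>i j. \<phi> (T i j))"
    using T unfolding completely_contractive_on_def by simp
  also have "matrix_norm n (\<lambda>i j. inv_into C \<phi> (\<phi> (T i j))) = matrix_norm n T"
    unfolding matrix_norm_eq using T inj by (intro arg_cong[where f=norm] block_cong) auto
  finally show "matrix_norm n T \<le> matrix_norm n (\<lambda>i j. \<phi> (T i j))" .
qed

subsection \<open>Transporting operators along partial isometries\<close>

definition transport :: "('h::complex_hilbert \<Rightarrow> 'k::complex_hilbert) \<Rightarrow> 'h bop \<Rightarrow> 'k bop"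
  where "transport V T = Bop (\<lambda>y. V (op_apply T (hadj V y)))"

lemma transport_apply: "bounded_clinear V \<Longrightarrow> op_apply (transport V T) y = V (op_apply T (hadj V y))"
  unfolding transport_def
  by (subst op_apply_Bop) (auto intro!: bounded_clinear_compose[of V] bounded_clinear_compose[OF bounded_clinear_op_apply] hadj)

lemma transport_adj: "bounded_clinear V \<Longrightarrow> adj (transport V T) = transport V (adj T)"
  by (rule adj_eqI) (simp add: transport_apply hadj(2) cinner_adj flip: hadj(3))

lemma transport_plus: "bounded_clinear V \<Longrightarrow> transport V (S + T) = transport V S + transport V T"
  by (rule bop_eqI) (simp add: transport_apply op_apply_simps bounded_clinearD)
lemma transport_scaleC: "bounded_clinear V \<Longrightarrow> transport V (c *\<^sub>C T) = c *\<^sub>C transport V T"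
  by (rule bop_eqI) (simp add: transport_apply op_apply_simps bounded_clinearD)
lemma transport_scaleR: "bounded_clinear V \<Longrightarrow> transport V (c *\<^sub>R T) = c *\<^sub>R transport V T"
  using transport_scaleC[of V "of_real c" T] by (simp add: scaleC_of_real)

text \<open>The operator \<open>p\<close> is the initial projection of \<open>V\<close>. Conjugation
  by \<open>V\<close> is multiplicative on operators that commute with it.\<close>

locale partial_isometry =
  fixes V :: "'h::complex_hilbert \<Rightarrow> 'k::complex_hilbert" and p :: "'h bop"
  assumes V: "bounded_clinear V" and VV: "\<And>x. hadj V (V x) = op_apply p x"
    and p: "adj p = p" "p * p = p"
begin

lemma cinner_V: "cinner (V x) (V y) = cinner (op_apply p x) y"
  using hadj(3)[OF V, of "V x" y] by (simp add: VV)

lemma pp: "op_apply p (op_apply p x) = op_apply p x"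
  using p(2) by (metis op_apply_times)

lemma V_p: "V (op_apply p x) = V x"
proof -
  have "V (x - op_apply p x) = 0"
    using cinner_self[of "V (x - op_apply p x)"] by (simp add: cinner_V op_apply_diff pp)
  thus ?thesis by (simp add: bounded_clinearD[OF V])
qed

lemma p_hadj: "op_apply p (hadj V y) = hadj V y"
proof (rule cinner_eqI)
  fix z
  have "cinner z (op_apply p (hadj V y)) = cinner (op_apply p z) (hadj V y)" using p(1) by (metis cinner_adj)
  also have "\<dots> = cinner z (hadj V y)" by (simp add: V_p flip: hadj(2)[OF V])
  finally show "cinner z (op_apply p (hadj V y)) = cinner z (hadj V y)" .
qed

lemma norm_p_le: "norm (op_apply p x) \<le> norm x"
proof -
  have "(norm (op_apply p x))\<^sup>2 = Re (cinner (op_apply p x) x)"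
    unfolding Re_cinner_self[symmetric] using p(1) by (metis cinner_adj pp)
  also have "\<dots> \<le> norm (op_apply p x) * norm x" by (rule Re_cinner_le)
  finally show ?thesis by (cases "norm (op_apply p x) = 0") (auto simp: power2_eq_square)
qed

lemma norm_V: "norm (V x) = norm (op_apply p x)"
proof -
  have "(norm (V x))\<^sup>2 = Re (cinner (op_apply p x) x)" by (simp add: cinner_V flip: Re_cinner_self)
  also have "cinner (op_apply p x) x = cinner (op_apply p x) (op_apply p x)"
    using p(1) by (metis cinner_adj pp)
  finally show ?thesis by (simp add: Re_cinner_self)
qed

lemma norm_V_le: "norm (V x) \<le> norm x"
  unfolding norm_V by (rule norm_p_le)

lemma norm_hadj_le: "norm (hadj V y) \<le> norm y"
proof -
  have "(norm (hadj V y))\<^sup>2 = Re (cinner y (V (hadj V y)))" by (simp flip: Re_cinner_self add: hadj(3)[OF V])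
  also have "\<dots> \<le> norm y * norm (V (hadj V y))" by (rule Re_cinner_le)
  also have "\<dots> \<le> norm y * norm (hadj V y)" by (intro mult_left_mono norm_V_le) auto
  finally show ?thesis by (cases "norm (hadj V y) = 0") (auto simp: power2_eq_square)
qed

lemma norm_transport_le: "norm (transport V T) \<le> norm T"
proof (rule norm_bop_le[OF _ norm_ge_zero])
  fix y
  have "norm (op_apply (transport V T) y) \<le> norm (op_apply T (hadj V y))"
    by (simp add: transport_apply[OF V] norm_V_le)
  also have "\<dots> \<le> norm T * norm (hadj V y)" by (rule norm_op_apply_le)
  also have "\<dots> \<le> norm T * norm y" by (intro mult_left_mono norm_hadj_le) auto
  finally show "norm (op_apply (transport V T) y) \<le> norm T * norm y" .
qed

lemma bounded_linear_transport: "bounded_linear (transport V)"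
  by (rule bounded_linear_intro[where K=1]) (auto simp: transport_plus[OF V] transport_scaleR[OF V] norm_transport_le)

lemma star_hom_transport:
  assumes "\<And>c. c \<in> C \<Longrightarrow> c * p = p * c"
  shows "star_hom_on C (transport V)"
proof -
  have "transport V (S * T) = transport V S * transport V T" if T: "T \<in> C" for S T
  proof (rule bop_eqI)
    fix y
    have "op_apply p (op_apply T (hadj V y)) = op_apply T (op_apply p (hadj V y))"
      using assms[OF T] by (metis op_apply_times)
    thus "op_apply (transport V (S * T)) y = op_apply (transport V S * transport V T) y"
      by (simp add: transport_apply[OF V] VV p_hadj)
  qed
  thus ?thesis
    unfolding star_hom_on_def algebra_hom_on_def
    by (simp add: transport_plus[OF V] transport_scaleC[OF V] transport_adj[OF V])
qed

lemma transport_V: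
  assumes "T * p = p * T"
  shows "op_apply (transport V T) (V x) = V (op_apply T x)"
  using assms V_p by (simp add: transport_apply[OF V] VV) (metis op_apply_times)

lemma isometry_transport:
  assumes p1: "p = 1"
  shows "star_hom_on UNIV (transport V)" "transport V (S * T) = transport V S * transport V T" "norm (transport V T) = norm T"
proof -
  show h: "star_hom_on UNIV (transport V)" by (rule star_hom_transport) (simp add: p1)
  thus "transport V (S * T) = transport V S * transport V T" by (simp add: star_hom_on_def algebra_hom_on_def)
  have "norm T \<le> norm (transport V T)"
  proof (rule norm_bop_le[OF _ norm_ge_zero])
    fix x
    have "norm (op_apply T x) = norm (op_apply (transport V T) (V x))" by (simp add: transport_V norm_V p1)
    also have "\<dots> \<le> norm (transport V T) * norm (V x)" by (rule norm_op_apply_le)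
    finally show "norm (op_apply T x) \<le> norm (transport V T) * norm x" by (simp add: norm_V p1)
  qed
  thus "norm (transport V T) = norm T" using norm_transport_le[of T] by simp
qed

end

subsection \<open>Cardinality\<close>

lemma infinite_inj_pair:
  assumes "infinite (UNIV :: 'b set)"
  obtains g :: "'b \<times> 'b \<Rightarrow> 'b" where "inj g"
proof -
  have "(card_of (UNIV \<times> UNIV :: ('b \<times> 'b) set), card_of (UNIV :: 'b set)) \<in> ordLeq"
    using card_of_Times_same_infinite[OF assms] ordIso_imp_ordLeq by blast
  hence "\<exists>g :: 'b \<times> 'b \<Rightarrow> 'b. inj_on g (UNIV \<times> UNIV) \<and> g ` (UNIV \<times> UNIV) \<subseteq> UNIV"
    unfolding card_of_ordLeq .
  thus ?thesis using that by auto
qed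

lemma infinite_inj_list:
  assumes "infinite (UNIV :: 'b set)"
  obtains h :: "'b list \<Rightarrow> 'b" where "inj h"
proof -
  obtain g :: "'b \<times> 'b \<Rightarrow> 'b" where g: "inj g" using infinite_inj_pair[OF assms] .
  obtain e :: "nat \<Rightarrow> 'b" where e: "inj e" using infinite_countable_subset[OF assms] by auto
  define c where "c = rec_list (e 0) (\<lambda>x _ r. g (x, r))"
  have c: "c (x # l) = g (x, c l)" for x l by (simp add: c_def)
  have "l = l'" if "length l = length l'" "c l = c l'" for l l'
    using that
  proof (induction l l' rule: list_induct2)
    case (Cons x xs y ys)
    hence "g (x, c xs) = g (y, c ys)" by (simp add: c)
    hence "(x, c xs) = (y, c ys)" by (rule injD[OF g])
    thus ?case using Cons by simp
  qed simp
  note c_inj = this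
  \<comment> \<open>Injectivity of the folded pairing c was obtained for lists of equal length, so
    the length is recorded as well.\<close>
  have "inj (\<lambda>l. g (e (length l), c l))"
  proof (rule injI)
    fix l l' assume "g (e (length l), c l) = g (e (length l'), c l')"
    from injD[OF g this] have "e (length l) = e (length l')" "c l = c l'" by simp_all
    thus "l = l'" using c_inj injD[OF e] by blast
  qed
  thus ?thesis using that by blast
qed

lemma inj_map_prod: "inj f \<Longrightarrow> inj g \<Longrightarrow> inj (map_prod f g)"
  by (rule prod.inj_map)

text \<open>The domain is the index type of the vectors \<omega> in
  \<open>faithful_on_test_space\<close>: a word, a formal sum of words, and a number for the
  accuracy.\<close>

lemma infinite_inj_words:
  assumes "infinite (UNIV :: 'b set)"
  obtains f :: "('b \<times> bool) list \<times> (('b \<times> bool) \<times> ('b \<times> bool) list) list \<times> nat \<Rightarrow> 'b" where "inj f"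
proof -
  obtain g :: "'b \<times> 'b \<Rightarrow> 'b" where g: "inj g" using infinite_inj_pair[OF assms] .
  obtain h :: "'b list \<Rightarrow> 'b" where h: "inj h" using infinite_inj_list[OF assms] .
  obtain e :: "nat \<Rightarrow> 'b" where e: "inj e" using infinite_countable_subset[OF assms] by auto
  define b where "b = (\<lambda>x. e (if x then 0 else 1))"
  have b: "inj b" using e by (auto simp: b_def inj_def split: if_splits)
  define l where "l = g \<circ> map_prod id b"
  have l: "inj l" unfolding l_def by (intro inj_compose g inj_map_prod b inj_on_id)
  define w where "w = h \<circ> map l"
  have w: "inj w" unfolding w_def by (intro inj_compose h) (use l in simp)
  define s where "s = h \<circ> map (g \<circ> map_prod l w)"
  have gw: "inj (g \<circ> map_prod l w)" by (intro inj_compose g inj_map_prod l w)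
  have s: "inj s" unfolding s_def by (intro inj_compose h) (use gw in simp)
  have "inj (g \<circ> map_prod w (g \<circ> map_prod s e))"
    by (intro inj_compose g inj_map_prod w s e)
  thus ?thesis using that by blast
qed

lemma norming_vector:
  fixes T :: "'h::complex_hilbert bop"
  assumes "e > 0"
  shows "\<exists>\<xi>. norm \<xi> \<le> 1 \<and> norm T - e \<le> norm (op_apply T \<xi>)"
proof (rule ccontr)
  assume neg: "\<not> ?thesis"
  show False
  proof (cases "norm T \<le> e")
    case True
    thus False using neg by (auto dest!: spec[of _ 0])
  next
    case False
    have "norm T \<le> norm T - e"
    proof (rule norm_bop_le_unit)
      fix x :: 'h assume "norm x \<le> 1"
      thus "norm (op_apply T x) \<le> norm T - e" using neg by (meson linear)
    qed (use False in simp)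
    thus False using assms by simp
  qed
qed

text \<open>A Loewenheim-Skolem argument. Noncommutative polynomials in \<rho> a and their adjoints
  are dense in \<open>C\<close>. Vectors that nearly attain the norms of these polynomials, together
  with their images under words, span a reducing subspace on which \<open>C\<close> acts
  isometrically. There are no more such vectors than operators on the original space, so the
  subspace embeds into the test space.\<close>

lemma faithful_on_test_space:
  fixes A :: "'a::complex_hilbert bop set" and \<rho> :: "'a bop \<Rightarrow> 'k::complex_hilbert bop"
  assumes A: "operator_algebra A" and \<rho>: "algebra_hom_on A \<rho>"
  defines "C \<equiv> generated_cstar_algebra (\<rho> ` A)"
  obtains \<theta> :: "'k bop \<Rightarrow> ('a bop, complex) l2 bop" where "star_hom_on C \<theta>" "\<And>c. c \<in> C \<Longrightarrow> norm (\<theta> c) = norm c"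
proof (cases "A = {0}")
  case True
  have "\<rho> ` A = {0}" using True algebra_hom_onD(5)[OF \<rho> A] by simp
  moreover have "cstar_algebra {0 :: 'k bop}"
    by (auto simp: cstar_algebra_def operator_algebra_def)
  ultimately have "C \<subseteq> {0}" unfolding C_def by (intro generated_cstar_subset) auto
  hence "star_hom_on C (\<lambda>_. 0 :: ('a bop, complex) l2 bop)" "\<And>c. c \<in> C \<Longrightarrow> norm (0 :: ('a bop, complex) l2 bop) = norm c"
    by (auto simp: star_hom_on_def algebra_hom_on_def)
  thus ?thesis using that by blast
next
  case False
  note Ai = operator_algebraD[OF A] and r = algebra_hom_onD[OF \<rho> A]
  obtain a0 where a0: "a0 \<in> A" "a0 \<noteq> 0" using False Ai(2) by blast
  \<comment> \<open>Multiples of a nonzero element make the type of operators infinite, as the count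
    of words requires; hence the separate treatment of A = {0}.\<close>
  have "inj (\<lambda>n::nat. real n *\<^sub>R a0)" using a0 by (auto simp: inj_def)
  hence inf: "infinite (UNIV :: 'a bop set)" using infinite_iff_countable_subset by blast
  \<comment> \<open>A letter (a, True) stands for \<rho> a and (a, False) for its adjoint. Letters
    outside \<open>A\<close> stand for 0, so that every value of the type is a letter.\<close>
  define L where "L = (\<lambda>(a, b). if a \<in> A then if b then \<rho> a else adj (\<rho> a) else 0)"
  define W where "W w = prod_list (map L w)" for w
  \<comment> \<open>Each summand has at least one letter: the empty word is the identity, which need
    not belong to \<open>C\<close>.\<close>
  define D where "D ls = sum_list (map (\<lambda>(x, w). L x * W w) ls)" for ls
  have CC: "cstar_algebra C" unfolding C_def by (rule cstar_algebra_generated)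
  note Ci = cstarD[OF CC] and Ca = cstar_algebraD(2)[OF CC]
  have LC: "L x \<in> C" for x
    unfolding L_def C_def by (auto split: prod.splits intro!: generated_cstar_superset Ca[unfolded C_def] Ci(2)[unfolded C_def])
  have LW: "L x * W w \<in> C" for x w
  proof (induction w arbitrary: x)
    case (Cons y w) thus ?case using Ci(4)[OF LC[of x]] by (simp add: W_def)
  qed (simp add: W_def LC)
  have DC: "D ls \<in> C" for ls
    by (induction ls) (auto simp: D_def Ci LW[unfolded W_def] W_def)
  have W_append: "W (v @ w) = W v * W w" for v w by (simp add: W_def)
  have D_append: "D (ls @ ls') = D ls + D ls'" for ls ls' by (simp add: D_def)
  have mult1: "\<exists>ls'. D ls' = L x * W w * D ls" for x w ls
  proof (induction ls)
    case Nil thus ?case by (intro exI[of _ "[]"]) (simp add: D_def)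
  next
    case (Cons y ls)
    then obtain ls' where ls': "D ls' = L x * W w * D ls" by blast
    obtain y1 y2 where y: "y = (y1, y2)" by (cases y)
    have "D ((x, w @ y1 # y2) # ls') = L x * W w * D (y # ls)"
      using ls' by (simp add: D_def y W_def ring_distribs mult.assoc)
    thus ?case by blast
  qed
  have mult: "\<exists>ls. D ls = D ls1 * D ls2" for ls1 ls2
  proof (induction ls1)
    case Nil thus ?case by (intro exI[of _ "[]"]) (simp add: D_def)
  next
    case (Cons y ls1)
    then obtain ls where ls: "D ls = D ls1 * D ls2" by blast
    obtain y1 y2 where y: "y = (y1, y2)" by (cases y)
    obtain ls' where "D ls' = L y1 * W y2 * D ls2" using mult1 by blast
    hence "D (ls' @ ls) = D (y # ls1) * D ls2" unfolding D_append ls by (simp add: D_def y ring_distribs)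
    thus ?case by blast
  qed
  have Ladj: "\<exists>x'. L x' = adj (L x)" for x
    by (cases x) (auto simp: L_def intro!: exI[of _ "(fst x, \<not> snd x)"])
  have Wadj: "\<exists>x' w'. L x' * W w' = adj (L x * W w)" for x w
  proof (induction w arbitrary: x)
    case Nil
    obtain x' where "L x' = adj (L x)" using Ladj by blast
    hence "L x' * W [] = adj (L x * W [])" by (simp add: W_def)
    thus ?case by blast
  next
    case (Cons y w)
    obtain x' w' where 1: "L x' * W w' = adj (L y * W w)" using Cons by blast
    obtain z where z: "L z = adj (L x)" using Ladj by blast
    have "L x' * W (w' @ [z]) = (L x' * W w') * L z" by (simp add: W_append mult.assoc) (simp add: W_def)
    also have "\<dots> = adj (L x * W (y # w))" unfolding 1 z by (simp add: W_def mult.assoc)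
    finally show ?case by blast
  qed
  have Dadj: "\<exists>ls'. D ls' = adj (D ls)" for ls
  proof (induction ls)
    case Nil thus ?case by (intro exI[of _ "[]"]) (simp add: D_def)
  next
    case (Cons y ls)
    then obtain ls' where 1: "D ls' = adj (D ls)" by blast
    obtain y1 y2 where y: "y = (y1, y2)" by (cases y)
    obtain x' w' where "L x' * W w' = adj (L y1 * W y2)" using Wadj by blast
    hence "D ((x', w') # ls') = adj (D (y # ls))" using 1 by (simp add: D_def y)
    thus ?case by blast
  qed
  have Lscale: "\<exists>x'. L x' = c *\<^sub>C L x" for c x
  proof (cases x)
    case (Pair a b)
    show ?thesis
    proof (cases "a \<in> A")
      case True
      show ?thesis using True Pair
        by (intro exI[of _ "(if b then c *\<^sub>C a else cnj c *\<^sub>C a, b)"]) (auto simp: L_def Ai r)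
    qed (use Pair in \<open>auto simp: L_def intro!: exI[of _ x]\<close>)
  qed
  have Dscale: "\<exists>ls'. D ls' = c *\<^sub>C D ls" for c ls
  proof (induction ls)
    case Nil thus ?case by (intro exI[of _ "[]"]) (simp add: D_def)
  next
    case (Cons y ls)
    then obtain ls' where 1: "D ls' = c *\<^sub>C D ls" by blast
    obtain y1 y2 where y: "y = (y1, y2)" by (cases y)
    obtain x' where "L x' = c *\<^sub>C L y1" using Lscale by blast
    hence "D ((x', y2) # ls') = c *\<^sub>C D (y # ls)" using 1 by (simp add: D_def y scaleC_add_right)
    thus ?case by blast
  qed
  have dense: "C \<subseteq> closure (range D)"
    unfolding C_def
  proof (rule generated_cstar_subset)
    show "cstar_algebra (closure (range D))"
    proof (rule cstar_algebra_closure)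
      show "0 \<in> range D" by (rule range_eqI[of _ _ "[]"]) (simp add: D_def)
      fix u assume "u \<in> range D"
      then obtain ls where u: "u = D ls" by blast
      show "c *\<^sub>C u \<in> range D" "adj u \<in> range D" for c
        using Dscale[of c ls] Dadj[of ls] unfolding u by (metis rangeI)+
      fix v assume "v \<in> range D"
      then obtain ls' where v: "v = D ls'" by blast
      show "u + v \<in> range D" "u * v \<in> range D"
        using mult[of ls ls'] unfolding u v D_append[symmetric] by (metis rangeI)+
    qed
    show "\<rho> ` A \<subseteq> closure (range D)"
    proof clarify
      fix a assume a: "a \<in> A"
      have "D [((a, True), [])] = \<rho> a" using a by (simp add: D_def W_def L_def)
      hence "\<rho> a \<in> range D" by (metis rangeI)
      thus "\<rho> a \<in> closure (range D)" using closure_subset[of "range D"] by (rule set_mp[rotated])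
    qed
  qed
  have "\<exists>\<xi>. norm \<xi> \<le> 1 \<and> norm (D ls) - inverse (real (Suc m)) \<le> norm (op_apply (D ls) \<xi>)" for ls m
    by (rule norming_vector) simp
  then obtain \<xi> where \<xi>: "\<And>ls m. norm (\<xi> ls m) \<le> 1"
    "\<And>ls m. norm (D ls) - inverse (real (Suc m)) \<le> norm (op_apply (D ls) (\<xi> ls m))" by metis
  \<comment> \<open>All words, the empty one included, applied to the norming vectors; the family is
    invariant under letters.\<close>
  define \<omega> where "\<omega> = (\<lambda>(w, ls, m). op_apply (W w) (\<xi> ls m))"
  obtain f :: "('a bop \<times> bool) list \<times> (('a bop \<times> bool) \<times> ('a bop \<times> bool) list) list \<times> nat \<Rightarrow> 'a bop"
    where f: "inj f" using infinite_inj_words[OF inf] .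
  let ?M = "cspan (range \<omega>)" let ?p = "cproj ?M"
  obtain V :: "'k \<Rightarrow> ('a bop, complex) l2" where V: "bounded_clinear V" "\<And>x. hadj V (V x) = op_apply ?p x"
    using isometric_embedding[OF f, of \<omega>] by blast
  note M = closed_csubspace_cspan[of "range \<omega>"]
  note pr = cproj[OF M]
  interpret partial_isometry V ?p by unfold_locales (use V pr in auto)
  have inv: "op_apply (L x) z \<in> ?M" if z: "z \<in> ?M" for x z
  proof -
    have "?M \<subseteq> {z. op_apply (L x) z \<in> ?M}"
    proof (rule cspan_subset)
      have "closed {z. op_apply (L x) z \<in> ?M}"
        using closed_vimage[OF closed_csubspaceD(1)[OF M] linear_continuous_on[OF bounded_linear_op_apply[of "L x"]]]
        by (simp add: vimage_def)
      thus "closed_csubspace {z. op_apply (L x) z \<in> ?M}"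
        unfolding closed_csubspace_def using closed_csubspaceD[OF M] by (auto simp: op_apply_add op_apply_scaleC)
      have "op_apply (L x) (\<omega> (w, ls, m)) = \<omega> (x # w, ls, m)" for w ls m by (simp add: \<omega>_def W_def)
      hence "op_apply (L x) (\<omega> y) \<in> ?M" for y by (cases y) (simp add: cspan_superset)
      thus "range \<omega> \<subseteq> {z. op_apply (L x) z \<in> ?M}" by auto
    qed
    thus ?thesis using z by blast
  qed
  have inv2: "?p * (L x * ?p) = L x * ?p" for x
    by (rule bop_eqI) (simp add: pr(3,4) inv)
  \<comment> \<open>The closed span is invariant under each letter and under its adjoint, which is
    again a letter; so the projection commutes with both.\<close>
  have com: "L x * ?p = ?p * L x" for x
  proof -
    obtain x' where x': "L x' = adj (L x)" using Ladj by blast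
    have "adj (?p * (L x' * ?p)) = adj (L x' * ?p)" using inv2 by simp
    hence "?p * L x * ?p = ?p * L x" by (simp add: x' pr(1) mult.assoc)
    thus ?thesis using inv2[of x] by (simp add: mult.assoc)
  qed
  have "C \<subseteq> {c. c * ?p = ?p * c}"
    unfolding C_def
  proof (rule generated_cstar_subset)
    have "closed {c. c * ?p = ?p * c}"
      by (intro closed_Collect_eq continuous_intros)
    moreover have "adj c * ?p = ?p * adj c" if "c * ?p = ?p * c" for c
    proof -
      have "adj (c * ?p) = adj (?p * c)" using that by simp
      thus ?thesis by (simp add: pr(1))
    qed
    moreover have "a * b * ?p = ?p * (a * b)" if "a * ?p = ?p * a" "b * ?p = ?p * b" for a b
    proof -
      have "a * b * ?p = a * ?p * b" using that(2) by (simp add: mult.assoc)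
      thus ?thesis using that(1) by (simp add: mult.assoc)
    qed
    ultimately show "cstar_algebra {c. c * ?p = ?p * c}"
      unfolding cstar_algebra_def operator_algebra_def by (auto simp: ring_distribs)
    show "\<rho> ` A \<subseteq> {c. c * ?p = ?p * c}"
    proof safe
      show "\<rho> a * ?p = ?p * \<rho> a" if "a \<in> A" for a using com[of "(a, True)"] that by (simp add: L_def)
    qed
  qed
  hence com: "c * ?p = ?p * c" if "c \<in> C" for c using that by blast
  have "norm (D ls) \<le> norm (transport V (D ls))" for ls
  proof (rule LIMSEQ_le_const2)
    show "(\<lambda>m. norm (D ls) - inverse (real (Suc m))) \<longlonglongrightarrow> norm (D ls)"
      using tendsto_diff[OF tendsto_const[of "norm (D ls)"] LIMSEQ_inverse_real_of_nat] by simp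
    have "norm (D ls) - inverse (real (Suc m)) \<le> norm (transport V (D ls))" for m
    proof -
      have "\<xi> ls m = \<omega> ([], ls, m)" by (simp add: \<omega>_def W_def)
      hence x: "\<xi> ls m \<in> ?M" by (simp add: cspan_superset)
      have "op_apply ?p (op_apply (D ls) (\<xi> ls m)) = op_apply (D ls) (op_apply ?p (\<xi> ls m))"
        using com[OF DC[of ls]] by (metis op_apply_times)
      hence px: "op_apply ?p (op_apply (D ls) (\<xi> ls m)) = op_apply (D ls) (\<xi> ls m)"
        using pr(4)[OF x] by simp
      have "norm (op_apply (D ls) (\<xi> ls m)) = norm (V (op_apply (D ls) (\<xi> ls m)))"
        unfolding norm_V px ..
      also have "\<dots> = norm (op_apply (transport V (D ls)) (V (\<xi> ls m)))"
        using transport_V[OF com[OF DC]] by simp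
      also have "\<dots> \<le> norm (transport V (D ls)) * norm (V (\<xi> ls m))" by (rule norm_op_apply_le)
      also have "\<dots> \<le> norm (transport V (D ls)) * 1"
        by (intro mult_left_mono) (use norm_V_le[of "\<xi> ls m"] \<xi>(1)[of ls m] in linarith, simp)
      finally show ?thesis using \<xi>(2)[of ls m] by linarith
    qed
    thus "\<exists>N. \<forall>n\<ge>N. norm (D ls) - inverse (real (Suc n)) \<le> norm (transport V (D ls))" by blast
  qed
  hence "range D \<subseteq> {c. norm c \<le> norm (transport V c)}" by auto
  moreover have "closed {c. norm c \<le> norm (transport V c)}"
    by (intro closed_Collect_le continuous_intros linear_continuous_on bounded_linear_transport)
  ultimately have "C \<subseteq> {c. norm c \<le> norm (transport V c)}"
    using dense closure_minimal by blast
  hence "norm (transport V c) = norm c" if "c \<in> C" for c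
    using that norm_transport_le[of c] by (auto intro: antisym)
  thus ?thesis using that[OF star_hom_transport[OF com]] by blast
qed

text \<open>The universal property of the C*-envelope, freed from the restriction to the test space.\<close>

lemma cstar_envelope_universal:
  fixes A :: "'a::complex_hilbert bop set" and \<rho> :: "'a bop \<Rightarrow> 'k::complex_hilbert bop"
  assumes A: "operator_algebra A" and env: "cstar_envelope A E j"
    and \<rho>: "algebra_hom_on A \<rho>" "completely_isometric_on A \<rho>"
  obtains \<phi> where "star_hom_on (generated_cstar_algebra (\<rho> ` A)) \<phi>" "\<phi> ` generated_cstar_algebra (\<rho> ` A) = E"
    "\<And>a. a \<in> A \<Longrightarrow> \<phi> (\<rho> a) = j a"
proof -
  let ?C = "generated_cstar_algebra (\<rho> ` A)"
  obtain \<theta> :: "'k bop \<Rightarrow> ('a bop, complex) l2 bop" where \<theta>: "star_hom_on ?C \<theta>"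
    and iso: "\<And>c. c \<in> ?C \<Longrightarrow> norm (\<theta> c) = norm c"
    using faithful_on_test_space[OF A \<rho>(1)] by blast
  note C = cstar_algebra_generated[of "\<rho> ` A"]
  have \<rho>C: "\<rho> a \<in> ?C" if "a \<in> A" for a using that by (intro generated_cstar_superset) auto
  have "cstar_cover A (\<theta> ` ?C) (\<lambda>a. \<theta> (\<rho> a))"
    unfolding cstar_cover_def
  proof (intro conjI)
    show "cstar_algebra (\<theta> ` ?C)" by (rule cstar_algebra_isometric_image[OF C \<theta> iso])
    show "algebra_hom_on A (\<lambda>a. \<theta> (\<rho> a))"
      using \<rho>(1) \<rho>C \<theta> unfolding star_hom_on_def algebra_hom_on_def by simp
    have ci: "completely_isometric_on ?C \<theta>" by (rule isometric_star_hom_completely_isometric[OF C \<theta> iso])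
    show "completely_isometric_on A (\<lambda>a. \<theta> (\<rho> a))"
      unfolding completely_isometric_on_def
    proof (intro allI impI)
      fix n and T :: "nat \<Rightarrow> nat \<Rightarrow> 'a bop" assume T: "\<forall>i<n. \<forall>j<n. T i j \<in> A"
      have "matrix_norm n (\<lambda>i j. \<theta> (\<rho> (T i j))) = matrix_norm n (\<lambda>i j. \<rho> (T i j))"
        using ci T \<rho>C unfolding completely_isometric_on_def by simp
      also have "\<dots> = matrix_norm n T" using \<rho>(2) T unfolding completely_isometric_on_def by simp
      finally show "matrix_norm n (\<lambda>i j. \<theta> (\<rho> (T i j))) = matrix_norm n T" .
    qed
    show "\<theta> ` ?C = generated_cstar_algebra ((\<lambda>a. \<theta> (\<rho> a)) ` A)"
      using star_hom_image_generated[OF C \<theta> iso, of "\<rho> ` A"] \<rho>C by (simp add: image_image image_subset_iff)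
  qed
  then obtain \<phi> where \<phi>: "star_hom_on (\<theta> ` ?C) \<phi>" "\<phi> ` \<theta> ` ?C = E" "\<And>a. a \<in> A \<Longrightarrow> \<phi> (\<theta> (\<rho> a)) = j a"
    using env unfolding cstar_envelope_def by metis
  show ?thesis
  proof (rule that)
    show "star_hom_on ?C (\<lambda>c. \<phi> (\<theta> c))" by (rule star_hom_compose[OF \<theta> \<phi>(1)]) simp
    show "(\<lambda>c. \<phi> (\<theta> c)) ` ?C = E" using \<phi>(2) by (simp add: image_image)
  qed (rule \<phi>(3))
qed

subsection \<open>Limits of uniformly Lipschitz families\<close>

text \<open>An \<epsilon>/3 argument: the Lipschitz constant is uniform in i, so convergence at
  nearby points carries over to the limit point.\<close>

lemma closed_tendsto_on:
  fixes T :: "'i \<Rightarrow> 'a::metric_space \<Rightarrow> 'b::metric_space"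
  assumes Z: "closed Z" and T: "\<And>i x y. x \<in> Z \<Longrightarrow> y \<in> Z \<Longrightarrow> dist (T i x) (T i y) \<le> K * dist x y"
    and L: "\<And>x y. x \<in> Z \<Longrightarrow> y \<in> Z \<Longrightarrow> dist (L x) (L y) \<le> K * dist x y" and K: "K \<ge> 0"
  shows "closed {x\<in>Z. ((\<lambda>i. T i x) \<longlongrightarrow> L x) F}"
  unfolding closed_sequential_limits
proof (intro allI impI, elim conjE)
  fix X l assume X: "\<forall>n. X n \<in> {x\<in>Z. ((\<lambda>i. T i x) \<longlongrightarrow> L x) F}" and l: "X \<longlonglongrightarrow> l"
  have XZ: "X n \<in> Z" for n using X by simp
  have lZ: "l \<in> Z" by (rule closed_sequentially[OF Z XZ l])
  have "((\<lambda>i. T i l) \<longlongrightarrow> L l) F"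
  proof (rule tendstoI)
    fix e :: real assume e: "e > 0"
    hence "e / (3 * (K + 1)) > 0" using K by simp
    with l obtain n where n: "dist (X n) l < e / (3 * (K + 1))" unfolding LIMSEQ_def by blast
    have "K * dist (X n) l \<le> (K + 1) * dist (X n) l" by (intro mult_right_mono) auto
    also have "\<dots> < e / 3" using n K by (simp add: field_simps)
    finally have n: "K * dist (X n) l < e / 3" .
    have "\<forall>\<^sub>F i in F. dist (T i (X n)) (L (X n)) < e / 3" using X e by (intro tendstoD) auto
    thus "\<forall>\<^sub>F i in F. dist (T i l) (L l) < e"
    proof (rule eventually_mono)
      fix i assume i: "dist (T i (X n)) (L (X n)) < e / 3"
      have "dist (T i l) (L l) \<le> dist (T i l) (T i (X n)) + dist (T i (X n)) (L (X n)) + dist (L (X n)) (L l)"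
        using dist_triangle[of "T i l" "L l" "T i (X n)"] dist_triangle[of "T i (X n)" "L l" "L (X n)"] by linarith
      also have "\<dots> < e" using T[OF XZ[of n] lZ, of i] L[OF XZ[of n] lZ] n i by (simp add: dist_commute)
      finally show "dist (T i l) (L l) < e" .
    qed
  qed
  thus "l \<in> {x\<in>Z. ((\<lambda>i. T i x) \<longlongrightarrow> L x) F}" using lZ by simp
qed

lemma closed_convergent_on:
  fixes T :: "nat \<Rightarrow> 'a::metric_space \<Rightarrow> 'b::complete_space"
  assumes Z: "closed Z" and T: "\<And>i x y. x \<in> Z \<Longrightarrow> y \<in> Z \<Longrightarrow> dist (T i x) (T i y) \<le> K * dist x y" and K: "K \<ge> 0"
  shows "closed {x\<in>Z. convergent (\<lambda>n. T n x)}"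
  unfolding closed_sequential_limits
proof (intro allI impI, elim conjE)
  fix X l assume X: "\<forall>n. X n \<in> {x\<in>Z. convergent (\<lambda>n. T n x)}" and l: "X \<longlonglongrightarrow> l"
  have XZ: "X n \<in> Z" for n using X by simp
  have lZ: "l \<in> Z" by (rule closed_sequentially[OF Z XZ l])
  have "Cauchy (\<lambda>n. T n l)"
  proof (rule metric_CauchyI)
    fix e :: real assume e: "e > 0"
    hence "e / (3 * (K + 1)) > 0" using K by simp
    with l obtain n where n: "dist (X n) l < e / (3 * (K + 1))" unfolding LIMSEQ_def by blast
    have "K * dist (X n) l \<le> (K + 1) * dist (X n) l" by (intro mult_right_mono) auto
    also have "\<dots> < e / 3" using n K by (simp add: field_simps)
    finally have n: "K * dist (X n) l < e / 3" .
    have "Cauchy (\<lambda>m. T m (X n))" using X by (auto intro: convergent_Cauchy)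
    then obtain N where N: "\<And>i k. i \<ge> N \<Longrightarrow> k \<ge> N \<Longrightarrow> dist (T i (X n)) (T k (X n)) < e / 3"
      using e unfolding Cauchy_def by (meson divide_pos_pos zero_less_numeral)
    have "dist (T i l) (T k l) < e" if "i \<ge> N" "k \<ge> N" for i k
      using dist_triangle[of "T i l" "T k l" "T i (X n)"] dist_triangle[of "T i (X n)" "T k l" "T k (X n)"]
        T[OF lZ XZ[of n], of i] T[OF XZ[of n] lZ, of k] n N[OF that] by (simp add: dist_commute)
    thus "\<exists>N. \<forall>i\<ge>N. \<forall>k\<ge>N. dist (T i l) (T k l) < e" by blast
  qed
  thus "l \<in> {x\<in>Z. convergent (\<lambda>n. T n x)}" using Cauchy_convergent lZ by blast
qed

lemma dist_op_apply_le: "norm T \<le> K \<Longrightarrow> dist (op_apply T x) (op_apply T y) \<le> K * dist x y"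
  using norm_op_apply_le[of T "x - y"] mult_right_mono[of "norm T" K "norm (x - y)"]
  by (simp add: dist_norm op_apply_diff)

lemma closed_csubspace_tendsto:
  assumes T: "\<And>i. norm (T i) \<le> K" and L: "norm L \<le> K"
  shows "closed_csubspace {x. ((\<lambda>i. op_apply (T i) x) \<longlongrightarrow> op_apply L x) F}"
proof -
  have "K \<ge> 0" using L norm_ge_zero[of L] by linarith
  hence "closed {x. ((\<lambda>i. op_apply (T i) x) \<longlongrightarrow> op_apply L x) F}"
    using closed_tendsto_on[where K=K and Z=UNIV and T="\<lambda>i. op_apply (T i)" and L="op_apply L"] T L
    by (simp add: dist_op_apply_le)
  thus ?thesis
    unfolding closed_csubspace_def by (auto simp: op_apply_add op_apply_scaleC intro: tendsto_add tendsto_scaleC)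
qed

lemma closed_csubspace_convergent:
  assumes T: "\<And>i. norm (T i) \<le> K"
  shows "closed_csubspace {x. convergent (\<lambda>i. op_apply (T i) x)}"
proof -
  have "K \<ge> 0" using T[of 0] norm_ge_zero[of "T 0"] by linarith
  hence "closed {x. convergent (\<lambda>i. op_apply (T i) x)}"
    using closed_convergent_on[where K=K and Z=UNIV and T="\<lambda>i. op_apply (T i)"] T
    by (simp add: dist_op_apply_le)
  thus ?thesis
    unfolding closed_csubspace_def convergent_def
    by (auto simp: op_apply_add op_apply_scaleC intro: tendsto_add tendsto_scaleC tendsto_const)
qed

lemma bounded_bilinear_cinner: "bounded_bilinear (cinner :: 'a::complex_hilbert \<Rightarrow> 'a \<Rightarrow> complex)"
proof
  show "\<exists>K. \<forall>a b :: 'a. norm (cinner a b) \<le> norm a * norm b * K"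
    by (rule exI[of _ 1]) (simp add: norm_cinner_le)
qed (use bounded_linear.linear[OF bounded_linear_cinner_left, THEN linear_scale]
    bounded_linear.linear[OF bounded_linear_cinner_right, THEN linear_scale]
    in \<open>auto simp: cinner_add_left cinner_add_right\<close>)

lemmas tendsto_cinner = bounded_bilinear.tendsto[OF bounded_bilinear_cinner]

text \<open>On norm bounded sets evaluation is jointly continuous for the strong topology.\<close>

lemma strong_tendsto_apply:
  assumes T: "\<And>x. (\<lambda>n. op_apply (T n) x) \<longlonglongrightarrow> op_apply L x" and K: "\<And>n. norm (T n) \<le> K"
    and X: "X \<longlonglongrightarrow> x"
  shows "(\<lambda>n. op_apply (T n) (X n)) \<longlonglongrightarrow> op_apply L x"
proof -
  have "(\<lambda>n. op_apply (T n) (X n - x)) \<longlonglongrightarrow> 0"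
  proof (rule Lim_null_comparison)
    show "\<forall>\<^sub>F n in sequentially. norm (op_apply (T n) (X n - x)) \<le> K * norm (X n - x)"
    proof (intro always_eventually allI)
      fix n
      show "norm (op_apply (T n) (X n - x)) \<le> K * norm (X n - x)"
        using norm_op_apply_le[of "T n" "X n - x"] mult_right_mono[OF K[of n], of "norm (X n - x)"] by simp
    qed
    show "(\<lambda>n. K * norm (X n - x)) \<longlonglongrightarrow> 0"
      by (intro tendsto_mult_right_zero tendsto_norm_zero LIM_zero X)
  qed
  from tendsto_add[OF this T[of x]] show ?thesis by (simp add: op_apply_diff)
qed

definition strong_limit :: "(nat \<Rightarrow> 'h::complex_hilbert bop) \<Rightarrow> 'h bop \<Rightarrow> bool"
  where "strong_limit T S \<longleftrightarrow> (\<forall>\<xi>. (\<lambda>n. op_apply (T n) \<xi>) \<longlonglongrightarrow> op_apply S \<xi>)"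

lemma strong_limitD: "strong_limit T S \<Longrightarrow> (\<lambda>n. op_apply (T n) \<xi>) \<longlonglongrightarrow> op_apply S \<xi>"
  by (simp add: strong_limit_def)

lemma strong_limit_unique: "strong_limit T S \<Longrightarrow> strong_limit T S' \<Longrightarrow> S = S'"
  by (rule bop_eqI) (rule LIMSEQ_unique[OF strong_limitD strong_limitD])

lemma strong_limit_plus: "strong_limit T S \<Longrightarrow> strong_limit T' S' \<Longrightarrow> strong_limit (\<lambda>n. T n + T' n) (S + S')"
  by (simp add: strong_limit_def op_apply_plus tendsto_add)

lemma strong_limit_scaleC: "strong_limit T S \<Longrightarrow> strong_limit (\<lambda>n. c *\<^sub>C T n) (c *\<^sub>C S)"
  by (simp add: strong_limit_def op_apply_scaleC_bop tendsto_scaleC)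

lemma strong_limit_times:
  "strong_limit T S \<Longrightarrow> (\<And>n. norm (T n) \<le> K) \<Longrightarrow> strong_limit T' S' \<Longrightarrow> strong_limit (\<lambda>n. T n * T' n) (S * S')"
  by (simp add: strong_limit_def strong_tendsto_apply[of T S K])

lemma strong_limit_adj:
  assumes "strong_limit T S" "strong_limit (\<lambda>n. adj (T n)) S'"
  shows "S' = adj S"
proof (rule adj_eqI[symmetric])
  fix \<xi> \<eta>
  have "(\<lambda>n. cinner (op_apply (T n) \<xi>) \<eta>) \<longlonglongrightarrow> cinner (op_apply S \<xi>) \<eta>"
    "(\<lambda>n. cinner \<xi> (op_apply (adj (T n)) \<eta>)) \<longlonglongrightarrow> cinner \<xi> (op_apply S' \<eta>)"
    using assms by (auto intro: tendsto_cinner_left tendsto_cinner_right dest: strong_limitD)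
  thus "cinner (op_apply S \<xi>) \<eta> = cinner \<xi> (op_apply S' \<eta>)" unfolding cinner_adj by (rule LIMSEQ_unique)
qed

lemma strong_limit_exists:
  assumes conv: "\<And>\<xi>. convergent (\<lambda>n. op_apply (T n) \<xi>)" and K: "\<And>n. norm (T n) \<le> K"
  shows "\<exists>S. strong_limit T S"
proof -
  have l: "(\<lambda>n. op_apply (T n) \<xi>) \<longlonglongrightarrow> lim (\<lambda>n. op_apply (T n) \<xi>)" for \<xi>
    using conv by (simp add: convergent_LIMSEQ_iff)
  have "bounded_clinear (\<lambda>\<xi>. lim (\<lambda>n. op_apply (T n) \<xi>))"
  proof (rule bounded_clinear_intro[where K=K])
    fix \<xi> \<eta> and c :: complex
    show "lim (\<lambda>n. op_apply (T n) (\<xi> + \<eta>)) = lim (\<lambda>n. op_apply (T n) \<xi>) + lim (\<lambda>n. op_apply (T n) \<eta>)"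
      unfolding op_apply_add by (intro limI tendsto_add l)
    show "lim (\<lambda>n. op_apply (T n) (c *\<^sub>C \<xi>)) = c *\<^sub>C lim (\<lambda>n. op_apply (T n) \<xi>)"
      unfolding op_apply_scaleC by (intro limI tendsto_scaleC l)
    have "norm (op_apply (T n) \<xi>) \<le> K * norm \<xi>" for n
      by (rule order_trans[OF norm_op_apply_le mult_right_mono[OF K norm_ge_zero]])
    thus "norm (lim (\<lambda>n. op_apply (T n) \<xi>)) \<le> K * norm \<xi>"
      by (intro LIMSEQ_le_const2[OF tendsto_norm[OF l]]) auto
  qed
  thus ?thesis using l by (intro exI[of _ "Bop (\<lambda>\<xi>. lim (\<lambda>n. op_apply (T n) \<xi>))"]) (simp add: strong_limit_def op_apply_Bop)
qed

text \<open>Since the adjoint is not strongly continuous, convergence is demanded for both x and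
  \<open>adj x\<close>. With this symmetric condition the elements of convergence form a C*-algebra:
  products converge because *-homomorphisms are uniformly bounded, and closedness holds because they
  are uniformly Lipschitz.\<close>

lemma strong_limit_star_hom:
  fixes \<sigma> :: "nat \<Rightarrow> 'e::complex_hilbert bop \<Rightarrow> 'k::complex_hilbert bop"
  assumes E: "cstar_algebra E" "E = generated_cstar_algebra X" and \<sigma>: "\<And>n. star_hom_on E (\<sigma> n)"
    and conv: "\<And>x \<xi>. x \<in> X \<Longrightarrow> convergent (\<lambda>n. op_apply (\<sigma> n x) \<xi>)" "\<And>x \<xi>. x \<in> X \<Longrightarrow> convergent (\<lambda>n. op_apply (\<sigma> n (adj x)) \<xi>)"
  obtains \<rho> where "star_hom_on E \<rho>" "\<And>x \<xi>. x \<in> E \<Longrightarrow> (\<lambda>n. op_apply (\<sigma> n x) \<xi>) \<longlonglongrightarrow> op_apply (\<rho> x) \<xi>"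
proof -
  note Ei = cstarD[OF E(1)] and Ea = cstar_algebraD(2)[OF E(1)]
  note \<sigma>h = star_homD[OF \<sigma> E(1)] and \<sigma>a = star_hom_onD(2)[OF \<sigma>]
  have \<sigma>n: "norm (\<sigma> n x) \<le> norm x" if "x \<in> E" for n x by (rule star_hom_contractive[OF E(1) \<sigma> that])
  let ?L = "\<lambda>x. strong_limit (\<lambda>n. \<sigma> n x)"
  have L: "?L (x + y) (S + T)" "?L (x * y) (S * T)"
    if "x \<in> E" "y \<in> E" "?L x S" "?L y T" for x y S T
    using strong_limit_plus[OF that(3,4)] strong_limit_times[OF that(3) \<sigma>n[OF that(1)] that(4)] that(1,2)
    by (simp_all add: \<sigma>h)
  have Lc: "?L (c *\<^sub>C x) (c *\<^sub>C S)" if "x \<in> E" "?L x S" for x S c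
    using strong_limit_scaleC[OF that(2)] that(1) by (simp add: \<sigma>h)
  define C where "C = {x\<in>E. (\<exists>S. ?L x S) \<and> (\<exists>S. ?L (adj x) S)}"
  have L_iff: "(\<exists>S. ?L x S) \<longleftrightarrow> (\<forall>\<xi>. convergent (\<lambda>n. op_apply (\<sigma> n x) \<xi>))" if x: "x \<in> E" for x
    using strong_limit_exists[OF _ \<sigma>n[OF x]] by (auto intro: convergentI dest: strong_limitD)
  have "cstar_algebra C"
    unfolding cstar_algebra_def operator_algebra_def
  proof (intro conjI ballI allI)
    have lip: "dist (op_apply (\<sigma> n x) \<xi>) (op_apply (\<sigma> n y) \<xi>) \<le> norm \<xi> * dist x y" if "x \<in> E" "y \<in> E" for n x y \<xi>
    proof -
      have "norm (op_apply (\<sigma> n x - \<sigma> n y) \<xi>) \<le> dist x y * norm \<xi>"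
        using star_hom_dist_le[OF E(1) \<sigma> that] by (intro order_trans[OF norm_op_apply_le] mult_right_mono) (auto simp: dist_norm)
      thus ?thesis by (simp add: dist_norm op_apply_minus mult.commute)
    qed
    have lip': "dist (op_apply (\<sigma> n (adj x)) \<xi>) (op_apply (\<sigma> n (adj y)) \<xi>) \<le> norm \<xi> * dist x y" if "x \<in> E" "y \<in> E" for n x y \<xi>
    proof -
      have "dist (adj x) (adj y) = dist x y" by (simp add: dist_norm flip: adj_minus)
      thus ?thesis using lip[OF Ea Ea, OF that] by simp
    qed
    have "C = (\<Inter>\<xi>. {x\<in>E. convergent (\<lambda>n. op_apply (\<sigma> n x) \<xi>)} \<inter> {x\<in>E. convergent (\<lambda>n. op_apply (\<sigma> n (adj x)) \<xi>)})"
      unfolding C_def using L_iff Ea by auto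
    moreover have "closed \<dots>"
      by (intro closed_INT ballI closed_Int closed_convergent_on[OF Ei(1) lip] closed_convergent_on[OF Ei(1) lip']) simp_all
    ultimately show "closed C" by simp
    show "0 \<in> C" using L_iff[OF Ei(2)] Ei(2) by (simp add: C_def \<sigma>h convergent_const)
    fix x assume x: "x \<in> C"
    show "adj x \<in> C" using x Ea by (simp add: C_def)
    show "c *\<^sub>C x \<in> C" for c using x Lc[of x] Lc[of "adj x" _ "cnj c"] Ei(5) Ea by (auto simp: C_def; blast)
    fix y assume y: "y \<in> C"
    show "x + y \<in> C" using x y L(1)[of x y] L(1)[of "adj x" "adj y"] Ei(3) Ea by (auto simp: C_def; blast)
    show "x * y \<in> C" using x y L(2)[of x y] L(2)[of "adj y" "adj x"] Ei(4) Ea by (auto simp: C_def; blast)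
  qed
  moreover have XE: "x \<in> E" if "x \<in> X" for x unfolding E(2) by (rule generated_cstar_superset[OF that])
  hence "X \<subseteq> C" using conv Ea by (auto simp: C_def L_iff)
  ultimately have "E \<subseteq> C" unfolding E(2) by (rule generated_cstar_subset)
  hence "\<forall>x\<in>E. \<exists>S. ?L x S" by (auto simp: C_def)
  then obtain \<rho> where \<rho>: "\<And>x. x \<in> E \<Longrightarrow> ?L x (\<rho> x)" by (auto dest!: bchoice)
  have "star_hom_on E \<rho>"
    unfolding star_hom_on_def algebra_hom_on_def
  proof (intro conjI ballI allI)
    fix x y assume x: "x \<in> E" "y \<in> E"
    note l = L[OF x \<rho>[OF x(1)] \<rho>[OF x(2)]]
    show "\<rho> (x + y) = \<rho> x + \<rho> y" by (rule strong_limit_unique[OF \<rho>[OF Ei(3)[OF x]] l(1)])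
    show "\<rho> (x * y) = \<rho> x * \<rho> y" by (rule strong_limit_unique[OF \<rho>[OF Ei(4)[OF x]] l(2)])
  next
    fix c x assume x: "x \<in> E"
    show "\<rho> (c *\<^sub>C x) = c *\<^sub>C \<rho> x" by (rule strong_limit_unique[OF \<rho>[OF Ei(5)[OF x]] Lc[OF x \<rho>[OF x]]])
  next
    fix x assume x: "x \<in> E"
    show "\<rho> (adj x) = adj (\<rho> x)" using strong_limit_adj[OF \<rho>[OF x]] \<rho>[OF Ea[OF x]] x by (simp add: \<sigma>a)
  qed
  thus ?thesis by (rule that[OF _ strong_limitD[OF \<rho>]])
qed

subsection \<open>Equality of operators on total sets\<close>

lemma decompose_cspan: "\<exists>u\<in>cspan B. \<exists>w. x = u + w \<and> (\<forall>b\<in>cspan B. cinner b w = 0)"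
proof -
  obtain m where m: "m \<in> cspan B" "\<And>y. y \<in> cspan B \<Longrightarrow> cinner (x - m) y = 0"
    using orthogonal_decomposition[OF closed_csubspace_cspan] by blast
  have "cinner y (x - m) = 0" if "y \<in> cspan B" for y
    using m(2)[OF that] cinner_commute[of y "x - m"] by simp
  thus ?thesis using m(1) by (intro bexI[of _ m] exI[of _ "x - m"]) auto
qed

lemma bop_eq_on_cspan:
  assumes "\<And>b. b \<in> B \<Longrightarrow> op_apply S b = op_apply T b"
    and "\<And>x. (\<And>b. b \<in> B \<Longrightarrow> cinner b x = 0) \<Longrightarrow> op_apply S x = op_apply T x"
  shows "S = T"
proof (rule bop_eqI)
  fix x
  obtain u w where uw: "u \<in> cspan B" "x = u + w" "\<And>b. b \<in> cspan B \<Longrightarrow> cinner b w = 0"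
    using decompose_cspan[of B x] by blast
  have "cspan B \<subseteq> {x. op_apply S x = op_apply T x}"
    by (intro cspan_subset closed_csubspace_equalizer bounded_clinear_op_apply) (use assms(1) in auto)
  moreover have "op_apply S w = op_apply T w" by (rule assms(2)) (intro uw cspan_superset)
  ultimately show "op_apply S x = op_apply T x" using uw by (auto simp: op_apply_add)
qed

lemma closed_csubspace_vimage:
  assumes "closed_csubspace M"
  shows "closed_csubspace {x. op_apply T x \<in> M}"
proof -
  have "closed {x. op_apply T x \<in> M}"
    using closed_vimage[OF closed_csubspaceD(1)[OF assms] linear_continuous_on[OF bounded_linear_op_apply[of T]]]
    by (simp add: vimage_def)
  thus ?thesis unfolding closed_csubspace_def using closed_csubspaceD[OF assms]
    by (auto simp: op_apply_add op_apply_scaleC)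
qed

text \<open>Both operators map the closed span of \<open>B\<close> into itself and vanish on its
  complement, so the adjoint relation only has to be tested on \<open>B\<close>.\<close>

lemma adj_eq_on_cspan:
  assumes inner: "\<And>b b'. b \<in> B \<Longrightarrow> b' \<in> B \<Longrightarrow> cinner (op_apply S b) b' = cinner b (op_apply T b')"
    and S: "\<And>b. b \<in> B \<Longrightarrow> op_apply S b \<in> cspan B" "\<And>x. (\<And>b. b \<in> B \<Longrightarrow> cinner b x = 0) \<Longrightarrow> op_apply S x = 0"
    and T: "\<And>b. b \<in> B \<Longrightarrow> op_apply T b \<in> cspan B" "\<And>x. (\<And>b. b \<in> B \<Longrightarrow> cinner b x = 0) \<Longrightarrow> op_apply T x = 0"
  shows "adj S = T"
proof -
  have orth: "cinner x w = 0" if "x \<in> cspan B" "\<And>b. b \<in> B \<Longrightarrow> cinner b w = 0" for x w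
    using orth_cspan that .
  have sp: "op_apply U x \<in> cspan B" if U: "\<And>b. b \<in> B \<Longrightarrow> op_apply U b \<in> cspan B"
    and 0: "\<And>x. (\<And>b. b \<in> B \<Longrightarrow> cinner b x = 0) \<Longrightarrow> op_apply U x = 0" for U x
  proof -
    obtain u w where uw: "u \<in> cspan B" "x = u + w" "\<And>b. b \<in> cspan B \<Longrightarrow> cinner b w = 0"
      using decompose_cspan[of B x] by blast
    have "cspan B \<subseteq> {x. op_apply U x \<in> cspan B}"
      by (intro cspan_subset closed_csubspace_vimage closed_csubspace_cspan) (use U in auto)
    moreover have "op_apply U w = 0" by (rule 0) (intro uw cspan_superset)
    ultimately show ?thesis using uw by (auto simp: op_apply_add)
  qed
  have "adj S = adj (adj T)"
  proof -
    have "S = adj T"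
    proof (rule bop_eq_on_cspan)
      fix b assume b: "b \<in> B"
      show "op_apply S b = op_apply (adj T) b"
      proof (rule cinner_eqI_left)
        fix x
        obtain u w where uw: "u \<in> cspan B" "x = u + w" "\<And>b. b \<in> cspan B \<Longrightarrow> cinner b w = 0"
          using decompose_cspan[of B x] by blast
        have "cspan B \<subseteq> {x. cinner x (op_apply S b - op_apply (adj T) b) = 0}"
        proof (rule cspan_subset)
          show "closed_csubspace {x. cinner x (op_apply S b - op_apply (adj T) b) = 0}"
            using closed_csubspace_orth[of "{op_apply S b - op_apply (adj T) b}"] by simp
          have "cinner b' (op_apply S b) = cinner b' (op_apply (adj T) b)" if "b' \<in> B" for b'
            using inner[OF b that] by (metis cinner_adj cinner_commute)
          thus "B \<subseteq> {x. cinner x (op_apply S b - op_apply (adj T) b) = 0}" by (auto simp: cinner_diff_right)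
        qed
        hence "cinner u (op_apply S b) = cinner u (op_apply (adj T) b)" using uw(1) by (auto simp: cinner_diff_right)
        hence 1: "cinner (op_apply S b) u = cinner (op_apply (adj T) b) u" by (metis cinner_commute)
        have 2: "cinner (op_apply S b) w = 0" by (rule uw(3)[OF S(1)[OF b]])
        have "op_apply T w = 0" by (rule T(2)) (intro uw cspan_superset)
        hence "cinner (op_apply (adj T) b) w = 0" by (simp add: cinner_adj_left)
        thus "cinner (op_apply S b) x = cinner (op_apply (adj T) b) x"
          using 1 2 by (simp add: uw cinner_add_right)
      qed
    next
      fix x assume x: "\<And>b. b \<in> B \<Longrightarrow> cinner b x = 0"
      have "op_apply (adj T) x = 0"
      proof (rule cinner_eqI)
        fix z
        have "cinner z (op_apply (adj T) x) = cinner (op_apply T z) x" by (simp add: cinner_adj)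
        also have "\<dots> = 0" by (rule orth[OF sp[OF T] x])
        finally show "cinner z (op_apply (adj T) x) = cinner z 0" by simp
      qed
      thus "op_apply S x = op_apply (adj T) x" using S(2) x by simp
    qed
    thus ?thesis by simp
  qed
  thus ?thesis by simp
qed

lemma complex_l2_single: "l2_single x z = z *\<^sub>C l2_single x (1::complex)"
  by (simp add: scaleC_complex_def flip: l2_single_scaleC)

lemma bop_complex_l2_eqI:
  fixes S T :: "('x, complex) l2 bop"
  assumes "\<And>x y. cinner (op_apply S (l2_single x 1)) (l2_single y 1) = cinner (op_apply T (l2_single x 1)) (l2_single y 1)"
  shows "S = T"
proof (rule l2_entry_eqI, rule bop_eqI)
  fix x y and \<xi> :: complex
  have "Rep_l2 (op_apply S (l2_single y 1)) x = Rep_l2 (op_apply T (l2_single y 1)) x"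
    using assms[of y x] by (simp add: cinner_complex_def)
  hence "Rep_l2 (op_apply S (\<xi> *\<^sub>C l2_single y 1)) x = Rep_l2 (op_apply T (\<xi> *\<^sub>C l2_single y 1)) x"
    by (simp add: op_apply_scaleC Rep_l2_simps)
  thus "op_apply (l2_entry S x y) \<xi> = op_apply (l2_entry T x y) \<xi>"
    by (simp add: l2_entry_apply complex_l2_single[symmetric])
qed

lemma complex_l2_operator:
  fixes w :: "'x \<Rightarrow> ('x, complex) l2"
  assumes bound: "\<And>S a. finite S \<Longrightarrow> norm (\<Sum>i\<in>S. a i *\<^sub>C w i) \<le> M * norm (\<Sum>i\<in>S. a i *\<^sub>C l2_single i (1::complex))"
    and M: "M \<ge> 0"
  obtains T where "\<And>x. op_apply T (l2_single x 1) = w x"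
proof -
  obtain T where T: "bounded_clinear T" "\<And>i. i \<in> UNIV \<Longrightarrow> T (l2_single i (1::complex)) = w i"
    by (rule extend_operator[OF M, of UNIV w "\<lambda>i. l2_single i 1"]) (rule bound, assumption, rule that)
  show ?thesis by (rule that[of "Bop T"]) (simp add: op_apply_Bop T)
qed

lemma complex_l2_isometry:
  fixes s :: "'x \<Rightarrow> 'x"
  assumes s: "inj s"
  obtains T :: "('x, complex) l2 bop" where "\<And>x. op_apply T (l2_single x 1) = l2_single (s x) 1"
proof (rule complex_l2_operator[of "\<lambda>x. l2_single (s x) 1" 1])
  fix S :: "'x set" and a
  have "(norm (\<Sum>i\<in>S. a i *\<^sub>C l2_single (s i) (1::complex)))\<^sup>2 = (norm (\<Sum>i\<in>S. a i *\<^sub>C l2_single i (1::complex)))\<^sup>2"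
    unfolding Re_cinner_self[symmetric] gram_sum using s
    by (intro arg_cong[where f=Re] sum.cong) (auto simp: Rep_l2_single inj_def)
  thus "norm (\<Sum>i\<in>S. a i *\<^sub>C l2_single (s i) (1::complex)) \<le> 1 * norm (\<Sum>i\<in>S. a i *\<^sub>C l2_single i (1::complex))"
    by simp
qed (use that in auto)

text \<open>Basis vectors are moved along injections with disjoint ranges. These Cuntz type
  isometries provide orthogonal copies of the whole space within itself, one for each stage of the
  dilation chain.\<close>

lemma isometry_family:
  fixes s :: "nat \<Rightarrow> 'x \<Rightarrow> 'x"
  assumes s: "\<And>k l x y. s k x = s l y \<Longrightarrow> k = l \<and> x = y"
  obtains S :: "nat \<Rightarrow> ('x, complex) l2 bop" where "\<And>k l. adj (S k) * S l = (if k = l then 1 else 0)"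
proof -
  have "\<exists>T :: ('x, complex) l2 bop. \<forall>x. op_apply T (l2_single x 1) = l2_single (s k x) 1" for k
    using complex_l2_isometry[of "s k"] s by (metis injI)
  then obtain S :: "nat \<Rightarrow> ('x, complex) l2 bop" where
    S: "\<And>k x. op_apply (S k) (l2_single x 1) = l2_single (s k x) 1" by metis
  have "adj (S k) * S l = (if k = l then 1 else 0)" for k l
    by (rule bop_complex_l2_eqI) (use s in \<open>auto simp: cinner_adj_left S Rep_l2_single simp del: cinner_l2_single_right\<close>)
  thus ?thesis using that by blast
qed

subsection \<open>Increasing sequences of projections\<close>

lemma projection_Pythagoras:
  assumes "adj p = p" "p * p = p"
  shows "(norm (x - op_apply p x))\<^sup>2 = (norm x)\<^sup>2 - (norm (op_apply p x))\<^sup>2"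
proof -
  have "cinner x (op_apply p x) = cinner (op_apply p x) (op_apply p x)"
    using cinner_adj[of p x "op_apply p x"] assms by (metis op_apply_times)
  thus ?thesis by (simp add: norm_minus_square Re_cinner_self)
qed

lemma projection_norm_le:
  assumes "adj p = p" "p * p = p"
  shows "norm (op_apply p x) \<le> norm x"
proof (rule power2_le_imp_le)
  show "(norm (op_apply p x))\<^sup>2 \<le> (norm x)\<^sup>2"
    using projection_Pythagoras[OF assms, of x] zero_le_power2[of "norm (x - op_apply p x)"] by linarith
qed simp

lemma projection_bop_norm_le: "adj p = p \<Longrightarrow> p * p = p \<Longrightarrow> norm p \<le> 1"
  by (rule norm_bop_le) (simp_all add: projection_norm_le)

text \<open>By Pythagoras the squared distance of two members is the difference of their squared
  norms. These norms increase and are bounded, so the sequence is Cauchy.\<close>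

lemma convergent_compressions:
  fixes p :: "nat \<Rightarrow> 'h::complex_hilbert bop"
  assumes p: "\<And>n. adj (p n) = p n" "\<And>n. p n * p n = p n"
    and x: "\<And>m n. n \<ge> k \<Longrightarrow> n \<le> m \<Longrightarrow> x n = op_apply (p n) (x m)" and K: "\<And>n. norm (x n) \<le> K"
  shows "convergent x"
proof -
  define u where "u n = (norm (x (n + k)))\<^sup>2" for n
  have d: "(dist (x (m + k)) (x (n + k)))\<^sup>2 = u m - u n" if "n \<le> m" for m n
    using projection_Pythagoras[OF p, of "x (m + k)" "n + k"] x[of "n + k" "m + k"] that
    by (simp add: dist_norm u_def)
  have mono: "u n \<le> u m" if "n \<le> m" for m n
    using d[OF that] zero_le_power2[of "dist (x (m + k)) (x (n + k))"] by linarith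
  have "u n \<le> K\<^sup>2" for n unfolding u_def using K by (intro power_mono) auto
  hence "Bseq u" using mono by (intro BseqI'[of _ "K\<^sup>2"]) (auto simp: u_def)
  hence "convergent u" using mono by (intro Bseq_mono_convergent) auto
  hence Cu: "Cauchy u" by (rule convergent_Cauchy)
  have "Cauchy (\<lambda>n. x (n + k))"
  proof (rule metric_CauchyI)
    fix e :: real assume e: "e > 0"
    hence "e\<^sup>2 > 0" by simp
    then obtain N where N: "\<And>m n. m \<ge> N \<Longrightarrow> n \<ge> N \<Longrightarrow> dist (u m) (u n) < e\<^sup>2"
      using Cu unfolding Cauchy_def by blast
    have "dist (x (m + k)) (x (n + k)) < e" if "m \<ge> N" "n \<ge> N" "n \<le> m" for m n
    proof -
      have "(dist (x (m + k)) (x (n + k)))\<^sup>2 < e\<^sup>2" using d[OF that(3)] N[OF that(1,2)] by (simp add: dist_real_def)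
      thus ?thesis using e by (meson less_imp_le power_less_imp_less_base)
    qed
    hence "dist (x (m + k)) (x (n + k)) < e" if "m \<ge> N" "n \<ge> N" for m n
      using that by (metis dist_commute nat_le_linear)
    thus "\<exists>N. \<forall>m\<ge>N. \<forall>n\<ge>N. dist (x (m + k)) (x (n + k)) < e" by blast
  qed
  hence "convergent (\<lambda>n. x (n + k))" by (rule Cauchy_convergent)
  thus ?thesis unfolding convergent_def using LIMSEQ_offset by blast
qed

text \<open>On the range of p k the vectors T n x are compressions of one another for n \<ge> k, and
  vectors orthogonal to all the ranges are killed.\<close>

lemma convergent_compression_operators:
  fixes p :: "nat \<Rightarrow> 'h::complex_hilbert bop"
  assumes p: "\<And>n. adj (p n) = p n" "\<And>n. p n * p n = p n" and mono: "\<And>m n. n \<le> m \<Longrightarrow> p m * p n = p n"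
    and T: "\<And>m n. n \<le> m \<Longrightarrow> p n * T m * p n = T n" and K: "\<And>n. norm (T n) \<le> K"
  shows "convergent (\<lambda>n. op_apply (T n) x)"
proof -
  let ?R = "{op_apply (p k) y | k y. True}"
  have M: "closed_csubspace {x. convergent (\<lambda>n. op_apply (T n) x)}" by (rule closed_csubspace_convergent[OF K])
  have "cspan ?R \<subseteq> {x. convergent (\<lambda>n. op_apply (T n) x)}"
  proof (rule cspan_subset[OF M], clarify)
    fix k y
    show "convergent (\<lambda>n. op_apply (T n) (op_apply (p k) y))"
    proof (rule convergent_compressions[OF p])
      fix m n assume mn: "n \<ge> k" "n \<le> m"
      have "T n * p k = (p n * T m * p n) * p k" using T[OF mn(2)] by simp
      also have "\<dots> = p n * T m * (p n * p k)" by (simp only: mult.assoc)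
      also have "\<dots> = p n * (T m * p k)" using mono[OF mn(1)] by (simp add: mult.assoc)
      finally show "op_apply (T n) (op_apply (p k) y) = op_apply (p n) (op_apply (T m) (op_apply (p k) y))"
        by (metis op_apply_times)
    next
      show "norm (op_apply (T n) (op_apply (p k) y)) \<le> K * norm (op_apply (p k) y)" for n
        using norm_op_apply_le[of "T n" "op_apply (p k) y"] mult_right_mono[OF K[of n], of "norm (op_apply (p k) y)"] by simp
    qed
  qed
  moreover obtain u w where uw: "u \<in> cspan ?R" "x = u + w" "\<And>b. b \<in> cspan ?R \<Longrightarrow> cinner b w = 0"
    using decompose_cspan[of ?R x] by blast
  \<comment> \<open>Orthogonality to the range of p n gives p n w = 0, and T n = p n * T n * p
    n.\<close>
  moreover have "op_apply (T n) w = 0" for n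
  proof -
    have "cinner (op_apply (p n) w) w = 0" by (rule uw(3)) (auto intro: cspan_superset)
    hence "cinner (op_apply (p n) w) (op_apply (p n) w) = 0"
      using cinner_adj[of "p n" "op_apply (p n) w" w] p by (metis op_apply_times)
    hence "op_apply (p n) w = 0" by (simp add: cinner_self)
    thus ?thesis using T[of n n] by (metis op_apply_times op_apply_zero_right order_refl)
  qed
  ultimately show ?thesis by (auto simp: op_apply_add)
qed

section \<open>Matrix functionals, transfer of positivity, and the abstract setting of the boundary
  argument\<close>

section \<open>Dilations and the C*-envelope\<close>

subsection \<open>Finitely supported operator matrices\<close>

definition finite_ops :: "('x, 'h::complex_hilbert) l2 bop set"
  where "finite_ops = {T. \<exists>S. finite S \<and> (\<forall>x y. \<not> (x \<in> S \<and> y \<in> S) \<longrightarrow> l2_entry T x y = 0)}"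

lemma finite_opsE:
  assumes "T \<in> finite_ops"
  obtains S where "finite S" "block S (l2_entry T) = T"
  using assms block_l2_entry unfolding finite_ops_def by blast

lemma block_finite_ops: "finite S \<Longrightarrow> block S T \<in> finite_ops"
  unfolding finite_ops_def using l2_entry_block[of S T] by auto

lemma finite_ops_zero: "0 \<in> finite_ops"
  unfolding finite_ops_def by (auto intro: exI[of _ "{}"])

lemma finite_ops_plus:
  assumes "T \<in> finite_ops" "T' \<in> finite_ops"
  shows "T + T' \<in> finite_ops"
proof -
  obtain S where S: "finite S" "\<And>x y. \<not> (x \<in> S \<and> y \<in> S) \<Longrightarrow> l2_entry T x y = 0"
    using assms(1) unfolding finite_ops_def by blast
  obtain S' where S': "finite S'" "\<And>x y. \<not> (x \<in> S' \<and> y \<in> S') \<Longrightarrow> l2_entry T' x y = 0"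
    using assms(2) unfolding finite_ops_def by blast
  have "l2_entry (T + T') x y = 0" if "\<not> (x \<in> S \<union> S' \<and> y \<in> S \<union> S')" for x y
    using S(2)[of x y] S'(2)[of x y] that unfolding l2_entry_plus by auto
  thus ?thesis unfolding finite_ops_def using S(1) S'(1) by (intro CollectI exI[of _ "S \<union> S'"]) auto
qed

lemma finite_ops_scaleC: "T \<in> finite_ops \<Longrightarrow> c *\<^sub>C T \<in> finite_ops"
  unfolding finite_ops_def by (auto simp: l2_entry_scaleC intro: scaleC_zero_right)

lemma finite_ops_adj: "T \<in> finite_ops \<Longrightarrow> adj T \<in> finite_ops"
  unfolding finite_ops_def by (auto simp: l2_entry_adj)

lemma finite_ops_scaleR: "T \<in> finite_ops \<Longrightarrow> c *\<^sub>R T \<in> finite_ops"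
  using finite_ops_scaleC[of T "of_real c"] by (simp add: scaleC_of_real)

lemma finite_ops_minus: "T \<in> finite_ops \<Longrightarrow> T' \<in> finite_ops \<Longrightarrow> T - T' \<in> finite_ops"
  using finite_ops_plus[of T "- 1 *\<^sub>R T'"] finite_ops_scaleR[of T' "- 1"] by simp

lemma finite_ops_sum: "(\<And>i. i \<in> S \<Longrightarrow> f i \<in> finite_ops) \<Longrightarrow> sum f S \<in> finite_ops"
  by (induction S rule: infinite_finite_induct) (auto simp: finite_ops_zero finite_ops_plus)

lemma subspace_finite_ops: "subspace finite_ops"
  unfolding subspace_def by (auto simp: finite_ops_zero finite_ops_plus finite_ops_scaleR)

lemma cinner_block:
  "cinner (op_apply (block S T) f) h = (\<Sum>x\<in>S. \<Sum>y\<in>S. cinner (op_apply (T x y) (Rep_l2 f y)) (Rep_l2 h x))"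
  unfolding block_apply cinner_sum_left by simp

definition l2_unit :: "'x \<Rightarrow> 'x \<Rightarrow> 'h::complex_hilbert bop \<Rightarrow> ('x, 'h) l2 bop"
  where "l2_unit x y T = block {x, y} (\<lambda>x' y'. if x' = x \<and> y' = y then T else 0)"

lemma l2_unit_apply: "op_apply (l2_unit x y T) f = l2_single x (op_apply T (Rep_l2 f y))"
  unfolding l2_unit_def block_apply by (cases "x = y") auto

lemma cinner_l2_unit: "cinner (op_apply (l2_unit x y T) f) h = cinner (op_apply T (Rep_l2 f y)) (Rep_l2 h x)"
  by (simp add: l2_unit_apply)

lemma l2_unit_finite_ops [simp]: "l2_unit x y T \<in> finite_ops"
  unfolding l2_unit_def by (rule block_finite_ops) simp

lemma l2_unit_plus: "l2_unit x y (S + T) = l2_unit x y S + l2_unit x y T"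
  by (rule bop_eqI) (simp add: l2_unit_apply op_apply_simps l2_single_add)
lemma l2_unit_scaleC: "l2_unit x y (c *\<^sub>C T) = c *\<^sub>C l2_unit x y T"
  by (rule bop_eqI) (simp add: l2_unit_apply op_apply_simps l2_single_scaleC)
lemma l2_unit_adj: "adj (l2_unit x y T) = l2_unit y x (adj T)"
  by (rule adj_eqI) (simp add: l2_unit_apply cinner_adj)

text \<open>Only the real part of the form is tested. A skew-adjoint operator is thus nonnegative
  together with its negative, which makes positive functionals invariant under adjoints.\<close>

definition op_nonneg :: "'h::complex_hilbert bop \<Rightarrow> bool"
  where "op_nonneg T \<longleftrightarrow> (\<forall>f. 0 \<le> Re (cinner (op_apply T f) f))"

text \<open>Finitely supported matrices with entries \<open>b + c 1\<close> are coded by their entries, since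
  the functionals below depend on this representation.\<close>

type_synonym ('x, 'r) matrix_code = "('x \<times> 'x) set \<times> ('x \<times> 'x \<Rightarrow> 'r bop \<times> complex)"

definition code_term :: "('r::complex_hilbert bop \<Rightarrow> 'k::complex_hilbert bop) \<Rightarrow> ('x \<Rightarrow> 'k) \<Rightarrow> 'x \<times> 'x \<Rightarrow>
    'r bop \<times> complex \<Rightarrow> complex"
  where "code_term Q \<zeta> u z = cinner (op_apply (Q (fst z)) (\<zeta> (snd u)) + snd z *\<^sub>C \<zeta> (snd u)) (\<zeta> (fst u))"

definition code_form :: "('r::complex_hilbert bop \<Rightarrow> 'k::complex_hilbert bop) \<Rightarrow> ('x \<Rightarrow> 'k) \<Rightarrow>
    ('x, 'r) matrix_code \<Rightarrow> real"
  where "code_form Q \<zeta> d = Re (\<Sum>u\<in>fst d. code_term Q \<zeta> u (snd d u))"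

definition codes :: "'r::complex_hilbert bop set \<Rightarrow> ('x, 'r) matrix_code set"
  where "codes B = {d. finite (fst d) \<and> (\<forall>u\<in>fst d. fst (snd d u) \<in> B)}"

definition code_plus :: "('x, 'r::complex_hilbert) matrix_code \<Rightarrow> ('x, 'r) matrix_code \<Rightarrow> ('x, 'r) matrix_code"
  where "code_plus d d' = (fst d \<union> fst d',
    \<lambda>u. (if u \<in> fst d then snd d u else 0) + (if u \<in> fst d' then snd d' u else 0))"

definition code_scale :: "real \<Rightarrow> ('x, 'r::complex_hilbert) matrix_code \<Rightarrow> ('x, 'r) matrix_code"
  where "code_scale t d = (fst d, \<lambda>u. t *\<^sub>R snd d u)"

lemma code_plus_codes:
  assumes "operator_algebra B" "d \<in> codes B" "d' \<in> codes B"
  shows "code_plus d d' \<in> codes B"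
  using assms(2,3) operator_algebraD[OF assms(1)] unfolding codes_def code_plus_def by auto

lemma code_scale_codes: "operator_algebra B \<Longrightarrow> d \<in> codes B \<Longrightarrow> code_scale t d \<in> codes B"
  unfolding codes_def code_scale_def by (auto dest: operator_algebraD(6))

definition real_linear_on :: "'r::complex_hilbert bop set \<Rightarrow> ('r bop \<Rightarrow> 'k::complex_hilbert bop) \<Rightarrow> bool"
  where "real_linear_on B Q \<longleftrightarrow> (\<forall>a\<in>B. \<forall>b\<in>B. Q (a + b) = Q a + Q b) \<and> (\<forall>t. \<forall>a\<in>B. Q (t *\<^sub>R a) = t *\<^sub>R Q a)"

lemma code_term_plus:
  assumes "real_linear_on B Q" "fst z \<in> B" "fst z' \<in> B"
  shows "code_term Q \<zeta> u (z + z') = code_term Q \<zeta> u z + code_term Q \<zeta> u z'"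
  using assms unfolding code_term_def real_linear_on_def
  by (simp add: op_apply_plus scaleC_add_left cinner_add_left)

lemma code_term_scale:
  assumes "real_linear_on B Q" "fst z \<in> B"
  shows "code_term Q \<zeta> u (t *\<^sub>R z) = of_real t * code_term Q \<zeta> u z"
proof -
  have "Q (t *\<^sub>R fst z) = t *\<^sub>R Q (fst z)" using assms by (simp add: real_linear_on_def)
  hence "code_term Q \<zeta> u (t *\<^sub>R z) = cinner (of_real t *\<^sub>C (op_apply (Q (fst z)) (\<zeta> (snd u)) + snd z *\<^sub>C \<zeta> (snd u))) (\<zeta> (fst u))"
    by (simp add: code_term_def op_apply_scaleR_bop scaleC_add_right scaleC_scaleC scaleC_of_real scaleR_conv_of_real)
  thus ?thesis by (simp add: cinner_scaleC_left code_term_def)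
qed

lemma code_form_plus:
  assumes Q: "real_linear_on B Q" and B: "operator_algebra B" and d: "d \<in> codes B" "d' \<in> codes B"
  shows "code_form Q \<zeta> (code_plus d d') = code_form Q \<zeta> d + code_form Q \<zeta> d'"
proof -
  obtain I a I' a' where dd: "d = (I, a)" "d' = (I', a')" by (cases d; cases d') auto
  have fin: "finite I" "finite I'" and a: "\<And>u. u \<in> I \<Longrightarrow> fst (a u) \<in> B" "\<And>u. u \<in> I' \<Longrightarrow> fst (a' u) \<in> B"
    using d by (auto simp: dd codes_def)
  have z: "code_term Q \<zeta> u 0 = 0" for u
    using code_term_scale[OF Q, of 0 \<zeta> u 0] operator_algebraD(2)[OF B] by simp
  have "(\<Sum>u\<in>I \<union> I'. code_term Q \<zeta> u ((if u \<in> I then a u else 0) + (if u \<in> I' then a' u else 0)))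
    = (\<Sum>u\<in>I \<union> I'. code_term Q \<zeta> u (if u \<in> I then a u else 0)) + (\<Sum>u\<in>I \<union> I'. code_term Q \<zeta> u (if u \<in> I' then a' u else 0))"
    unfolding sum.distrib[symmetric]
    by (intro sum.cong refl code_term_plus[OF Q]) (use a operator_algebraD(2)[OF B] in auto)
  also have "(\<Sum>u\<in>I \<union> I'. code_term Q \<zeta> u (if u \<in> I then a u else 0)) = (\<Sum>u\<in>I. code_term Q \<zeta> u (a u))"
    using fin by (intro sum.mono_neutral_cong_right) (auto simp: z)
  also have "(\<Sum>u\<in>I \<union> I'. code_term Q \<zeta> u (if u \<in> I' then a' u else 0)) = (\<Sum>u\<in>I'. code_term Q \<zeta> u (a' u))"
    using fin by (intro sum.mono_neutral_cong_right) (auto simp: z)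
  finally have eq: "(\<Sum>u\<in>I \<union> I'. code_term Q \<zeta> u ((if u \<in> I then a u else 0) + (if u \<in> I' then a' u else 0)))
    = (\<Sum>u\<in>I. code_term Q \<zeta> u (a u)) + (\<Sum>u\<in>I'. code_term Q \<zeta> u (a' u))" .
  show ?thesis unfolding code_form_def code_plus_def dd fst_conv snd_conv eq by simp
qed

lemma code_form_scale:
  assumes Q: "real_linear_on B Q" and d: "d \<in> codes B"
  shows "code_form Q \<zeta> (code_scale t d) = t * code_form Q \<zeta> d"
proof -
  have "(\<Sum>u\<in>fst d. code_term Q \<zeta> u (t *\<^sub>R snd d u)) = of_real t * (\<Sum>u\<in>fst d. code_term Q \<zeta> u (snd d u))"
    unfolding sum_distrib_left using d by (intro sum.cong refl code_term_scale[OF Q]) (auto simp: codes_def)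
  thus ?thesis by (simp add: code_form_def code_scale_def)
qed

text \<open>The group is abstracted away: \<open>R\<close> stands for the crossed product of the
  envelope \<open>E\<close>, \<open>BB\<close> for that of \<open>A\<close>, \<open>P\<close> for
  the conditional expectation onto \<open>E\<close>, and \<open>q\<close> for the map to the
  envelope of \<open>BB\<close> whose injectivity is at stake. By \<open>total\<close>, closed
  additive sets containing all products of \<open>\<pi> x\<close> with elements of \<open>BB\<close>
  exhaust \<open>R\<close>. The approximate unit of \<open>A\<close> acts as a left unit on
  \<open>E\<close> and \<open>R\<close>.\<close>

locale boundary_setup =
  fixes A :: "'h::complex_hilbert bop set" and E :: "'e::complex_hilbert bop set" and j :: "'h bop \<Rightarrow> 'e bop"
    and R :: "'r::complex_hilbert bop set" and BB :: "'r bop set" and \<pi> :: "'e bop \<Rightarrow> 'r bop"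
    and P :: "'r bop \<Rightarrow> 'e bop" and q :: "'r bop \<Rightarrow> 'f::complex_hilbert bop"
    and \<F> :: "'i filter" and e :: "'i \<Rightarrow> 'h bop"
  assumes A: "operator_algebra A" and env: "cstar_envelope A E j"
    and R: "cstar_algebra R" and BB: "operator_algebra BB" "BB \<subseteq> R"
    and \<pi>: "star_hom_on E \<pi>" "\<pi> ` E \<subseteq> R" "\<And>a. a \<in> A \<Longrightarrow> \<pi> (j a) \<in> BB"
    and P_plus: "\<And>x y. P (x + y) = P x + P y" and P_scaleC: "\<And>c x. P (c *\<^sub>C x) = c *\<^sub>C P x"
    and P_E: "\<And>y. y \<in> R \<Longrightarrow> P y \<in> E" and P_norm: "\<And>y. norm (P y) \<le> norm y"
    and P_module: "\<And>x y. x \<in> E \<Longrightarrow> y \<in> R \<Longrightarrow> P (\<pi> x * y) = x * P y"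
    and P_BB: "\<And>b. b \<in> BB \<Longrightarrow> P b \<in> j ` A" and P_\<pi>: "\<And>x. x \<in> E \<Longrightarrow> P (\<pi> x) = x"
    and P_cc: "completely_contractive_on BB P"
    and P_faithful: "\<And>y. y \<in> R \<Longrightarrow> P (adj y * y) = 0 \<Longrightarrow> y = 0"
    and total: "\<And>S. closed S \<Longrightarrow> (\<And>x y. x \<in> S \<Longrightarrow> y \<in> S \<Longrightarrow> x + y \<in> S) \<Longrightarrow>
      (\<And>x b. x \<in> E \<Longrightarrow> b \<in> BB \<Longrightarrow> \<pi> x * b \<in> S) \<Longrightarrow> R \<subseteq> S"
    and q: "star_hom_on R q" "completely_isometric_on BB q"
    and F: "\<F> \<noteq> bot" and e: "\<And>i. e i \<in> A" "\<And>i. norm (e i) \<le> 1"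
    and e_E: "\<And>x. x \<in> E \<Longrightarrow> ((\<lambda>i. j (e i) * x) \<longlongrightarrow> x) \<F>"
    and e_R: "\<And>y. y \<in> R \<Longrightarrow> ((\<lambda>i. \<pi> (j (e i)) * y) \<longlongrightarrow> y) \<F>"
begin

lemma cover: "cstar_algebra E" "algebra_hom_on A j" "completely_isometric_on A j" "E = generated_cstar_algebra (j ` A)"
  using env by (auto simp: cstar_envelope_def cstar_cover_def)

lemma jE: "a \<in> A \<Longrightarrow> j a \<in> E"
  unfolding cover(4) by (intro generated_cstar_superset) auto

lemmas Ei = cstarD[OF cover(1)]
lemmas Ri = cstarD[OF R]
lemmas Bi = operator_algebraD[OF BB(1)]
lemmas Ea = cstar_algebraD(2)[OF cover(1)]
lemmas Ra = cstar_algebraD(2)[OF R]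
lemmas qh = star_homD[OF q(1) R]
lemmas q_norm = star_hom_contractive[OF R q(1)]

lemma BR: "b \<in> BB \<Longrightarrow> b \<in> R" using BB(2) by blast
lemma \<pi>R: "x \<in> E \<Longrightarrow> \<pi> x \<in> R" using \<pi>(2) by blast

lemma P_scaleR: "P (r *\<^sub>R x) = r *\<^sub>R P x"
  using P_scaleC[of "of_real r" x] by (simp add: scaleC_of_real)
lemma P_zero: "P 0 = 0" using P_scaleR[of 0 0] by simp
lemma P_diff: "P (x - y) = P x - P y"
  using P_plus[of "x - y" y] by (simp add: algebra_simps)

lemma norm_je: "norm (j (e i)) \<le> 1"
  using completely_isometric_norm[OF cover(3) e(1)] e(2) by simp

lemma norm_\<pi>je: "norm (\<pi> (j (e i))) \<le> 1"
  by (rule order_trans[OF star_hom_contractive[OF cover(1) \<pi>(1) jE[OF e(1)]] norm_je])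

lemma sum_norm_diff_square:
  fixes \<eta> \<zeta> :: "'x \<Rightarrow> 'k::complex_hilbert"
  shows "(\<Sum>x\<in>S. (norm (\<eta> x - t *\<^sub>R \<zeta> x))\<^sup>2)
    = (\<Sum>x\<in>S. (norm (\<eta> x))\<^sup>2) - 2 * t * Re (\<Sum>x\<in>S. cinner (\<zeta> x) (\<eta> x)) + t\<^sup>2 * (\<Sum>x\<in>S. (norm (\<zeta> x))\<^sup>2)"
proof -
  have "Re (cinner (\<eta> x) (t *\<^sub>R \<zeta> x)) = t * Re (cinner (\<zeta> x) (\<eta> x))" for x
    by (simp add: Re_cinner inner_commute)
  hence "(norm (\<eta> x - t *\<^sub>R \<zeta> x))\<^sup>2 = (norm (\<eta> x))\<^sup>2 - 2 * t * Re (cinner (\<zeta> x) (\<eta> x)) + t\<^sup>2 * (norm (\<zeta> x))\<^sup>2" for x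
    by (simp add: norm_minus_square power_mult_distrib)
  thus ?thesis by (simp add: sum.distrib sum_subtractf sum_distrib_left Re_sum)
qed

text \<open>If \<open>q(b) + c\<close> has nonnegative real part then \<open>\<parallel>1 - t (q(b) + c)\<parallel>\<^sup>2 \<le> 1 + O(t\<^sup>2)\<close>. Multiplied by
  \<open>u = \<pi>(j(e i))\<close> this is an estimate in \<open>q(BB)\<close>, which complete isometry carries to \<open>\<sigma> P\<close>.\<close>

lemma sum_damped_apply:
  assumes S: "finite S" "x \<in> S"
  shows "(\<Sum>y\<in>S. op_apply ((if x = y then U else 0) - t *\<^sub>R (U * V y + c y *\<^sub>C U)) (\<eta> y))
    = op_apply U (\<eta> x - t *\<^sub>R (\<Sum>y\<in>S. op_apply (V y) (\<eta> y) + c y *\<^sub>C \<eta> y))"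
proof -
  have "(\<Sum>y\<in>S. op_apply ((if x = y then U else 0) - t *\<^sub>R (U * V y + c y *\<^sub>C U)) (\<eta> y))
      = (\<Sum>y\<in>S. (if x = y then op_apply U (\<eta> y) else 0) - t *\<^sub>R op_apply U (op_apply (V y) (\<eta> y) + c y *\<^sub>C \<eta> y))"
    by (intro sum.cong refl) (simp add: op_apply_simps op_apply_add op_apply_scaleC)
  also have "\<dots> = op_apply U (\<eta> x - t *\<^sub>R (\<Sum>y\<in>S. op_apply (V y) (\<eta> y) + c y *\<^sub>C \<eta> y))"
    using S by (simp add: sum_subtractf op_apply_diff op_apply_scaleR op_apply_sum_right scaleR_sum_right)
  finally show ?thesis .
qed

lemma positivity_transfer:
  fixes \<sigma> :: "'e bop \<Rightarrow> 'k::complex_hilbert bop" and b :: "'x \<Rightarrow> 'x \<Rightarrow> 'r bop"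
  assumes \<sigma>: "star_hom_on E \<sigma>" and S: "finite S" and b: "\<And>x y. x \<in> S \<Longrightarrow> y \<in> S \<Longrightarrow> b x y \<in> BB"
    and \<xi>: "\<And>x. x \<in> S \<Longrightarrow> ((\<lambda>i. op_apply (\<sigma> (j (e i))) (\<xi> x)) \<longlongrightarrow> \<xi> x) \<F>"
    and pos: "\<And>\<eta> :: 'x \<Rightarrow> 'f. 0 \<le> Re (\<Sum>x\<in>S. \<Sum>y\<in>S. cinner (op_apply (q (b x y)) (\<eta> y) + c x y *\<^sub>C \<eta> y) (\<eta> x))"
  shows "0 \<le> Re (\<Sum>x\<in>S. \<Sum>y\<in>S. cinner (op_apply (\<sigma> (P (b x y))) (\<xi> y) + c x y *\<^sub>C \<xi> y) (\<xi> x))"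
proof -
  note \<sigma>h = star_homD[OF \<sigma> cover(1)]
  define Tq where "Tq \<eta> x = (\<Sum>y\<in>S. op_apply (q (b x y)) (\<eta> y) + c x y *\<^sub>C \<eta> y)" for \<eta> x
  define T\<sigma> where "T\<sigma> x = (\<Sum>y\<in>S. op_apply (\<sigma> (P (b x y))) (\<xi> y) + c x y *\<^sub>C \<xi> y)" for x
  define M where "M = norm (block S (\<lambda>x y. q (b x y) + c x y *\<^sub>C 1))"
  have pos: "0 \<le> Re (\<Sum>x\<in>S. cinner (Tq \<eta> x) (\<eta> x))" for \<eta>
    using pos[of \<eta>] by (simp add: Tq_def cinner_sum_left)
  have TqM: "(\<Sum>x\<in>S. (norm (Tq \<eta> x))\<^sup>2) \<le> M\<^sup>2 * (\<Sum>x\<in>S. (norm (\<eta> x))\<^sup>2)" for \<eta>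
    using norm_block_le_iff[OF S norm_ge_zero, THEN iffD1, OF order_refl, rule_format, of "\<lambda>x y. q (b x y) + c x y *\<^sub>C 1" \<eta>]
    by (simp add: M_def Tq_def op_apply_simps)
  define B where "B = (\<Sum>x\<in>S. (norm (\<xi> x))\<^sup>2)"
  define X where "X = Re (\<Sum>x\<in>S. cinner (T\<sigma> x) (\<xi> x))"
  have key: "(\<Sum>x\<in>S. (norm (\<xi> x - t *\<^sub>R T\<sigma> x))\<^sup>2) \<le> (1 + t\<^sup>2 * M\<^sup>2) * B" if t: "t > 0" for t
  proof -
    define K where "K = sqrt (1 + t\<^sup>2 * M\<^sup>2)"
    have K: "K \<ge> 0" "K\<^sup>2 = 1 + t\<^sup>2 * M\<^sup>2" by (auto simp: K_def)
    define u where "u i = \<pi> (j (e i))" for i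
    have uB: "u i \<in> BB" for i unfolding u_def by (rule \<pi>(3)[OF e(1)])
    \<comment> \<open>This is u (1 - t (b + c)) as a matrix. The factor u brings the scalar parts
      into \<open>BB\<close>, where complete isometry of q can be applied.\<close>
    define Y where "Y i x y = (if x = y then u i else 0) - t *\<^sub>R (u i * b x y + c x y *\<^sub>C u i)" for i x y
    have YB: "Y i x y \<in> BB" if "x \<in> S" "y \<in> S" for i x y
      unfolding Y_def using that b uB by (auto intro!: Bi)
    have 1: "norm (block S (\<lambda>x y. q (Y i x y))) \<le> K" for i
      unfolding norm_block_le_iff[OF S K(1)]
    proof
      fix \<eta>
      have qY: "q (Y i x y) = (if x = y then q (u i) else 0) - t *\<^sub>R (q (u i) * q (b x y) + c x y *\<^sub>C q (u i))"
        if "x \<in> S" "y \<in> S" for x y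
        unfolding Y_def using that b uB by (auto simp: qh BR Bi)
      have "(\<Sum>y\<in>S. op_apply (q (Y i x y)) (\<eta> y)) = op_apply (q (u i)) (\<eta> x - t *\<^sub>R Tq \<eta> x)" if x: "x \<in> S" for x
        unfolding Tq_def by (subst sum_damped_apply[OF S x, symmetric]) (simp add: qY x cong: sum.cong)
      hence "(\<Sum>x\<in>S. (norm (\<Sum>y\<in>S. op_apply (q (Y i x y)) (\<eta> y)))\<^sup>2)
          = (\<Sum>x\<in>S. (norm (op_apply (q (u i)) (\<eta> x - t *\<^sub>R Tq \<eta> x)))\<^sup>2)" by simp
      also have "\<dots> \<le> (\<Sum>x\<in>S. (norm (\<eta> x - t *\<^sub>R Tq \<eta> x))\<^sup>2)"
      proof (intro sum_mono power_mono norm_ge_zero)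
        fix x
        have "norm (q (u i)) \<le> 1" using q_norm[OF BR[OF uB[of i]]] norm_\<pi>je[of i] unfolding u_def by linarith
        thus "norm (op_apply (q (u i)) (\<eta> x - t *\<^sub>R Tq \<eta> x)) \<le> norm (\<eta> x - t *\<^sub>R Tq \<eta> x)"
          using norm_op_apply_le[of "q (u i)" "\<eta> x - t *\<^sub>R Tq \<eta> x"]
            mult_right_mono[of "norm (q (u i))" 1 "norm (\<eta> x - t *\<^sub>R Tq \<eta> x)"] by simp
      qed
      also have "\<dots> \<le> (\<Sum>x\<in>S. (norm (\<eta> x))\<^sup>2) + t\<^sup>2 * (\<Sum>x\<in>S. (norm (Tq \<eta> x))\<^sup>2)"
        unfolding sum_norm_diff_square using pos[of \<eta>] t by simp
      also have "\<dots> \<le> (\<Sum>x\<in>S. (norm (\<eta> x))\<^sup>2) + t\<^sup>2 * (M\<^sup>2 * (\<Sum>x\<in>S. (norm (\<eta> x))\<^sup>2))"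
        by (intro add_left_mono mult_left_mono TqM) simp
      finally show "(\<Sum>x\<in>S. (norm (\<Sum>y\<in>S. op_apply (q (Y i x y)) (\<eta> y)))\<^sup>2) \<le> K\<^sup>2 * (\<Sum>x\<in>S. (norm (\<eta> x))\<^sup>2)"
        unfolding K(2) by (simp add: ring_distribs)
    qed
    have 2: "norm (block S (\<lambda>x y. \<sigma> (P (Y i x y)))) \<le> K" for i
    proof -
      have "norm (block S (\<lambda>x y. \<sigma> (P (Y i x y)))) \<le> norm (block S (\<lambda>x y. P (Y i x y)))"
        by (rule completely_contractive_block[OF star_hom_completely_contractive[OF cover(1) \<sigma>] S])
           (intro P_E BR YB)
      also have "\<dots> \<le> norm (block S (Y i))" by (rule completely_contractive_block[OF P_cc S YB])
      also have "\<dots> = norm (block S (\<lambda>x y. q (Y i x y)))"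
        by (rule completely_isometric_block[OF q(2) S YB, symmetric])
      also note 1
      finally show ?thesis .
    qed
    have 3: "(\<Sum>x\<in>S. (norm (op_apply (\<sigma> (j (e i))) (\<xi> x - t *\<^sub>R T\<sigma> x)))\<^sup>2) \<le> K\<^sup>2 * B" for i
    proof -
      have Pu: "P (u i) = j (e i)" unfolding u_def by (rule P_\<pi>[OF jE[OF e(1)]])
      have PY: "\<sigma> (P (Y i x y)) = (if x = y then \<sigma> (j (e i)) else 0)
          - t *\<^sub>R (\<sigma> (j (e i)) * \<sigma> (P (b x y)) + c x y *\<^sub>C \<sigma> (j (e i)))"
        if xy: "x \<in> S" "y \<in> S" for x y
      proof -
        have Pb: "P (b x y) \<in> E" by (intro P_E BR b xy)
        have je: "j (e i) \<in> E" by (intro jE e)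
        have ub: "P (u i * b x y) = j (e i) * P (b x y)" unfolding u_def by (rule P_module[OF je BR[OF b[OF xy]]])
        have "P (Y i x y) = (if x = y then j (e i) else 0) - t *\<^sub>R (j (e i) * P (b x y) + c x y *\<^sub>C j (e i))"
          unfolding Y_def by (simp add: P_diff P_plus P_scaleR P_scaleC ub Pu P_zero)
        thus ?thesis using Pb je by (auto simp: \<sigma>h Ei)
      qed
      have "(\<Sum>y\<in>S. op_apply (\<sigma> (P (Y i x y))) (\<xi> y)) = op_apply (\<sigma> (j (e i))) (\<xi> x - t *\<^sub>R T\<sigma> x)" if x: "x \<in> S" for x
        unfolding T\<sigma>_def by (subst sum_damped_apply[OF S x, symmetric]) (simp add: PY x cong: sum.cong)
      hence "(\<Sum>x\<in>S. (norm (op_apply (\<sigma> (j (e i))) (\<xi> x - t *\<^sub>R T\<sigma> x)))\<^sup>2)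
          = (\<Sum>x\<in>S. (norm (\<Sum>y\<in>S. op_apply (\<sigma> (P (Y i x y))) (\<xi> y)))\<^sup>2)" by simp
      also have "\<dots> \<le> K\<^sup>2 * B"
        unfolding B_def by (rule norm_block_le_iff[OF S K(1), THEN iffD1, OF 2, rule_format])
      finally show ?thesis .
    qed
    \<comment> \<open>The factor u disappears in the limit: on the \<xi> x by assumption, on the
      vectors \<sigma> (P b) \<xi> y because j (e i) is a left approximate unit for
      \<open>E\<close>.\<close>
    have lim: "((\<lambda>i. op_apply (\<sigma> (j (e i))) (\<xi> x - t *\<^sub>R T\<sigma> x)) \<longlongrightarrow> \<xi> x - t *\<^sub>R T\<sigma> x) \<F>" if x: "x \<in> S" for x
    proof -
      have a: "((\<lambda>i. op_apply (\<sigma> (j (e i))) (op_apply (\<sigma> (P (b x y))) (\<xi> y))) \<longlongrightarrow> op_apply (\<sigma> (P (b x y))) (\<xi> y)) \<F>"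
        if y: "y \<in> S" for y
      proof -
        have Pb: "P (b x y) \<in> E" by (intro P_E BR b x y)
        have "((\<lambda>i. \<sigma> (j (e i) * P (b x y))) \<longlongrightarrow> \<sigma> (P (b x y))) \<F>"
          by (rule star_hom_tendsto[OF cover(1) \<sigma> _ Pb e_E[OF Pb]]) (intro Ei jE e Pb)
        hence "((\<lambda>i. op_apply (\<sigma> (j (e i) * P (b x y))) (\<xi> y)) \<longlongrightarrow> op_apply (\<sigma> (P (b x y))) (\<xi> y)) \<F>"
          by (rule tendsto_apply_at)
        thus ?thesis using Pb by (simp add: \<sigma>h jE e)
      qed
      have "((\<lambda>i. op_apply (\<sigma> (j (e i))) (T\<sigma> x)) \<longlongrightarrow> T\<sigma> x) \<F>"
        unfolding T\<sigma>_def op_apply_sum_right op_apply_add op_apply_scaleC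
        by (intro tendsto_sum tendsto_add a tendsto_scaleC \<xi>)
      thus ?thesis unfolding op_apply_diff op_apply_scaleR
        by (intro tendsto_diff tendsto_scaleR tendsto_const \<xi>[OF x])
    qed
    have "((\<lambda>i. \<Sum>x\<in>S. (norm (op_apply (\<sigma> (j (e i))) (\<xi> x - t *\<^sub>R T\<sigma> x)))\<^sup>2) \<longlongrightarrow> (\<Sum>x\<in>S. (norm (\<xi> x - t *\<^sub>R T\<sigma> x))\<^sup>2)) \<F>"
      by (intro tendsto_sum tendsto_power tendsto_norm lim)
    from tendsto_upperbound[OF this _ F] 3 show ?thesis unfolding K(2) by simp
  qed
  have le: "- 2 * X \<le> t * (M\<^sup>2 * B)" if t: "t > 0" for t
  proof -
    have "- 2 * t * X \<le> t\<^sup>2 * (M\<^sup>2 * B)"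
    proof -
      have "0 \<le> t\<^sup>2 * (\<Sum>x\<in>S. (norm (T\<sigma> x))\<^sup>2)" by (intro mult_nonneg_nonneg sum_nonneg) auto
      thus ?thesis using key[OF t] unfolding sum_norm_diff_square B_def[symmetric] X_def[symmetric]
        by (simp add: ring_distribs)
    qed
    hence "t * (- 2 * X) \<le> t * (t * (M\<^sup>2 * B))" by (simp add: power2_eq_square mult_ac)
    thus ?thesis using t by (simp only: mult_le_cancel_left_pos)
  qed
  have "0 \<le> X"
  proof (rule ccontr)
    assume "\<not> 0 \<le> X"
    hence X: "X < 0" by simp
    define C where "C = M\<^sup>2 * B"
    have C: "C \<ge> 0" unfolding C_def B_def by (intro mult_nonneg_nonneg sum_nonneg) auto
    \<comment> \<open>The estimate is used at t = - X / (C + 1); the summand 1 keeps the denominator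
      positive when C = 0.\<close>
    have "- 2 * X \<le> (- X / (C + 1)) * C" using X C by (intro le[folded C_def] divide_pos_pos) auto
    also have "\<dots> \<le> - X" using X C by (simp add: field_simps)
    finally show False using X by simp
  qed
  thus ?thesis by (simp add: X_def T\<sigma>_def cinner_sum_left)
qed

end

section \<open>Extension of the functional and the Stinespring construction\<close>

context boundary_setup
begin

lemma real_linear_q: "real_linear_on BB q"
  unfolding real_linear_on_def by (simp add: qh BR)

lemma real_linear_\<sigma>P:
  assumes \<sigma>: "star_hom_on E \<sigma>"
  shows "real_linear_on BB (\<lambda>b. \<sigma> (P b))"
proof -
  note \<sigma>h = star_homD[OF \<sigma> cover(1)]
  show ?thesis unfolding real_linear_on_def by (simp add: \<sigma>h P_plus P_scaleR P_E BR)
qed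

lemma code_form_square:
  fixes I :: "('x \<times> 'x) set" and Q :: "'r bop \<Rightarrow> 'k::complex_hilbert bop"
  assumes I: "finite I" and Q: "Q 0 = 0"
  defines "S \<equiv> fst ` I \<union> snd ` I"
  shows "(\<Sum>x\<in>S. \<Sum>y\<in>S. cinner (op_apply (Q (if (x, y) \<in> I then fst (a (x, y)) else 0)) (\<zeta> y)
      + (if (x, y) \<in> I then snd (a (x, y)) else 0) *\<^sub>C \<zeta> y) (\<zeta> x)) = (\<Sum>u\<in>I. code_term Q \<zeta> u (a u))"
proof -
  have sub: "I \<subseteq> S \<times> S" unfolding S_def by force
  have fin: "finite (S \<times> S)" unfolding S_def using I by simp
  have "(\<Sum>x\<in>S. \<Sum>y\<in>S. cinner (op_apply (Q (if (x, y) \<in> I then fst (a (x, y)) else 0)) (\<zeta> y)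
      + (if (x, y) \<in> I then snd (a (x, y)) else 0) *\<^sub>C \<zeta> y) (\<zeta> x))
    = (\<Sum>u\<in>S \<times> S. code_term Q \<zeta> u (if u \<in> I then a u else 0))"
    unfolding sum.cartesian_product
    by (intro sum.cong) (auto simp: code_term_def)
  also have "\<dots> = (\<Sum>u\<in>I. code_term Q \<zeta> u (a u))"
    using fin sub by (intro sum.mono_neutral_cong_right) (auto simp: code_term_def Q)
  finally show ?thesis .
qed

lemma code_form_transfer:
  fixes \<sigma> :: "'e bop \<Rightarrow> 'k::complex_hilbert bop" and \<xi> :: "'x \<Rightarrow> 'k"
  assumes \<sigma>: "star_hom_on E \<sigma>" and \<xi>: "\<And>x. ((\<lambda>i. op_apply (\<sigma> (j (e i))) (\<xi> x)) \<longlongrightarrow> \<xi> x) \<F>"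
    and d: "d \<in> codes BB" and pos: "\<And>\<zeta>. 0 \<le> code_form q \<zeta> d"
  shows "0 \<le> code_form (\<lambda>b. \<sigma> (P b)) \<xi> d"
proof -
  note \<sigma>h = star_homD[OF \<sigma> cover(1)]
  obtain I a where da: "d = (I, a)" by (cases d)
  have I: "finite I" and a: "\<And>u. u \<in> I \<Longrightarrow> fst (a u) \<in> BB" using d by (auto simp: da codes_def)
  let ?S = "fst ` I \<union> snd ` I"
  let ?b = "\<lambda>x y. if (x, y) \<in> I then fst (a (x, y)) else 0"
  let ?c = "\<lambda>x y. if (x, y) \<in> I then snd (a (x, y)) else 0"
  have "0 \<le> Re (\<Sum>x\<in>?S. \<Sum>y\<in>?S. cinner (op_apply (\<sigma> (P (?b x y))) (\<xi> y) + ?c x y *\<^sub>C \<xi> y) (\<xi> x))"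
  proof (rule positivity_transfer[OF \<sigma> _ _ \<xi>])
    show "finite ?S" using I by simp
    show "?b x y \<in> BB" for x y using a Bi(2) by auto
    show "0 \<le> Re (\<Sum>x\<in>?S. \<Sum>y\<in>?S. cinner (op_apply (q (?b x y)) (\<eta> y) + ?c x y *\<^sub>C \<eta> y) (\<eta> x))" for \<eta>
      using pos[of \<eta>] unfolding code_form_square[where Q=q, OF I qh(5)] by (simp add: code_form_def da)
  qed
  also have "(\<Sum>x\<in>?S. \<Sum>y\<in>?S. cinner (op_apply (\<sigma> (P (?b x y))) (\<xi> y) + ?c x y *\<^sub>C \<xi> y) (\<xi> x))
      = (\<Sum>u\<in>I. code_term (\<lambda>b. \<sigma> (P b)) \<xi> u (a u))"
    by (rule code_form_square[OF I]) (simp add: P_zero \<sigma>h)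
  finally show ?thesis by (simp add: code_form_def da)
qed

text \<open>Arveson's extension in scalar form. The map \<sigma> P becomes one functional
  \<open>psi\<close> on codes, and p T is bounded by \<open>psi\<close> of every code whose form
  dominates that of T. Transfer of positivity makes \<open>psi\<close> nonnegative on codes
  dominating 0, so such a sublinear p exists. A linear minorant is positive because the empty code
  dominates - T whenever T is nonnegative.\<close>

lemma extended_functional:
  fixes \<sigma> :: "'e bop \<Rightarrow> 'k::complex_hilbert bop" and \<xi> :: "'x \<Rightarrow> 'k"
  assumes \<sigma>: "star_hom_on E \<sigma>" and \<xi>: "\<And>x. ((\<lambda>i. op_apply (\<sigma> (j (e i))) (\<xi> x)) \<longlongrightarrow> \<xi> x) \<F>"
  obtains l :: "('x, 'f) l2 bop \<Rightarrow> real" where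
    "\<And>S T. S \<in> finite_ops \<Longrightarrow> T \<in> finite_ops \<Longrightarrow> l (S + T) = l S + l T"
    "\<And>t T. T \<in> finite_ops \<Longrightarrow> l (t *\<^sub>R T) = t * l T"
    "\<And>T. T \<in> finite_ops \<Longrightarrow> op_nonneg T \<Longrightarrow> 0 \<le> l T"
    "\<And>x y b c. b \<in> BB \<Longrightarrow> l (l2_unit x y (q b + c *\<^sub>C 1)) = Re (cinner (op_apply (\<sigma> (P b)) (\<xi> y) + c *\<^sub>C \<xi> y) (\<xi> x))"
proof -
  define psi where "psi = code_form (\<lambda>b. \<sigma> (P b)) \<xi>"
  define dom where "dom T = {d \<in> codes BB. \<forall>f. Re (cinner (op_apply T f) f) \<le> code_form q (Rep_l2 f) d}"
    for T :: "('x, 'f) l2 bop"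
  have psi_plus: "psi (code_plus d d') = psi d + psi d'" if "d \<in> codes BB" "d' \<in> codes BB" for d d'
    unfolding psi_def by (rule code_form_plus[OF real_linear_\<sigma>P[OF \<sigma>] BB(1) that])
  have psi_scale: "psi (code_scale t d) = t * psi d" if "d \<in> codes BB" for t d
    unfolding psi_def by (rule code_form_scale[OF real_linear_\<sigma>P[OF \<sigma>] that])
  have dom_codes: "d \<in> codes BB" if "d \<in> dom T" for d T using that by (simp add: dom_def)
  have dom_plus: "code_plus d d' \<in> dom (T + T')" if "d \<in> dom T" "d' \<in> dom T'" for d d' T T'
  proof -
    have "Re (cinner (op_apply (T + T') f) f) \<le> code_form q (Rep_l2 f) (code_plus d d')" for f
    proof -
      have "Re (cinner (op_apply (T + T') f) f) = Re (cinner (op_apply T f) f) + Re (cinner (op_apply T' f) f)"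
        by (simp add: op_apply_plus cinner_add_left)
      also have "\<dots> \<le> code_form q (Rep_l2 f) d + code_form q (Rep_l2 f) d'"
        using that unfolding dom_def by (intro add_mono) auto
      finally show ?thesis
        by (simp add: code_form_plus[OF real_linear_q BB(1) dom_codes[OF that(1)] dom_codes[OF that(2)]])
    qed
    thus ?thesis unfolding dom_def using code_plus_codes[OF BB(1) dom_codes[OF that(1)] dom_codes[OF that(2)]] by simp
  qed
  have dom_scale: "code_scale t d \<in> dom (t *\<^sub>R T)" if d: "d \<in> dom T" and t: "t \<ge> 0" for d T t
  proof -
    have "Re (cinner (op_apply (t *\<^sub>R T) f) f) \<le> code_form q (Rep_l2 f) (code_scale t d)" for f
    proof -
      have "Re (cinner (op_apply (t *\<^sub>R T) f) f) = t * Re (cinner (op_apply T f) f)"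
        by (simp add: op_apply_scaleR_bop Re_cinner)
      also have "\<dots> \<le> t * code_form q (Rep_l2 f) d" using d t unfolding dom_def by (intro mult_left_mono) auto
      finally show ?thesis by (simp add: code_form_scale[OF real_linear_q dom_codes[OF d]])
    qed
    thus ?thesis unfolding dom_def using code_scale_codes[OF BB(1) dom_codes[OF d]] by simp
  qed
  have dom_pos: "0 \<le> psi d" if d: "d \<in> dom 0" for d
    unfolding psi_def
  proof (rule code_form_transfer[OF \<sigma> \<xi> dom_codes[OF d]])
    fix \<zeta> :: "'x \<Rightarrow> 'f"
    obtain I a where da: "d = (I, a)" by (cases d)
    have I: "finite I" using dom_codes[OF d] by (simp add: codes_def da)
    let ?S = "fst ` I \<union> snd ` I"
    \<comment> \<open>A code involves finitely many values of \<zeta>, so \<zeta> may be replaced by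
      a square summable family, to which the defining inequality of \<open>dom\<close>
      applies.\<close>
    let ?f = "column ?S \<zeta>"
    have "Rep_l2 ?f (fst u) = \<zeta> (fst u)" "Rep_l2 ?f (snd u) = \<zeta> (snd u)" if "u \<in> I" for u
      using that I by (auto simp: Rep_l2_column)
    hence "code_form q (Rep_l2 ?f) d = code_form q \<zeta> d"
      unfolding code_form_def da code_term_def by simp
    moreover have "Re (cinner (op_apply 0 ?f) ?f) \<le> code_form q (Rep_l2 ?f) d" using d unfolding dom_def by blast
    ultimately show "0 \<le> code_form q \<zeta> d" by simp
  qed
  have dom_nonempty: "\<exists>d. d \<in> dom T" if T: "T \<in> finite_ops" for T
  proof -
    obtain S where S: "finite S" "block S (l2_entry T) = T" using finite_opsE[OF T] .
    \<comment> \<open>The code of the norm of T times the identity on the finite support of T; it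
      dominates T.\<close>
    define d :: "('x, 'r) matrix_code" where "d = ((\<lambda>x. (x, x)) ` S, \<lambda>_. (0, of_real (norm T)))"
    have d: "d \<in> codes BB" unfolding codes_def d_def using S Bi(2) by auto
    have "Re (cinner (op_apply T f) f) \<le> code_form q (Rep_l2 f) d" for f
    proof -
      let ?g = "column S (Rep_l2 f)"
      have "cinner (op_apply (block S (l2_entry T)) f) f = cinner (op_apply (block S (l2_entry T)) ?g) ?g"
        unfolding cinner_block using S(1) by (simp add: Rep_l2_column cong: sum.cong)
      hence "Re (cinner (op_apply T f) f) = Re (cinner (op_apply T ?g) ?g)" unfolding S(2) by simp
      also have "\<dots> \<le> norm (op_apply T ?g) * norm ?g" by (rule Re_cinner_le)
      also have "\<dots> \<le> (norm T * norm ?g) * norm ?g" by (intro mult_right_mono norm_op_apply_le) auto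
      also have "\<dots> = norm T * (\<Sum>x\<in>S. (norm (Rep_l2 f x))\<^sup>2)"
        using norm_column[OF S(1), of "Rep_l2 f"] by (simp add: power2_eq_square)
      also have "\<dots> = code_form q (Rep_l2 f) d"
        unfolding code_form_def d_def code_term_def
        by (simp add: sum.reindex inj_on_def qh cinner_scaleC_left cinner_self Re_sum sum_distrib_left del: of_real_power)
      finally show ?thesis .
    qed
    thus ?thesis using d unfolding dom_def by blast
  qed
  define G where "G = {(T, psi d) | T d. T \<in> finite_ops \<and> d \<in> dom T}"
  have neg: "- T \<in> finite_ops" if "T \<in> finite_ops" for T :: "('x, 'f) l2 bop"
    using finite_ops_scaleR[OF that, of "- 1"] by simp
  obtain p where p: "sublinear_on finite_ops p" "\<And>T r. T \<in> finite_ops \<Longrightarrow> (T, r) \<in> G \<Longrightarrow> p T \<le> r"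
  proof (rule sublinear_Inf[OF subspace_finite_ops])
    show "(0, 0) \<in> G" unfolding G_def using finite_ops_zero
      by (intro CollectI exI[of _ 0] exI[of _ "({}, \<lambda>_. 0)"]) (simp add: dom_def codes_def psi_def code_form_def)
    show "(S + T, r + s) \<in> G" if S: "(S, r) \<in> G" and T: "(T, s) \<in> G" for S r T s
    proof -
      obtain d d' where d: "S \<in> finite_ops" "d \<in> dom S" "r = psi d" "T \<in> finite_ops" "d' \<in> dom T" "s = psi d'"
        using S T unfolding G_def by blast
      show ?thesis unfolding G_def d using d finite_ops_plus dom_plus
        by (intro CollectI exI[of _ "S + T"] exI[of _ "code_plus d d'"]) (simp add: psi_plus dom_codes)
    qed
    show "(t *\<^sub>R T, t * r) \<in> G" if t: "t > 0" and T: "(T, r) \<in> G" for t T r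
    proof -
      obtain d where d: "T \<in> finite_ops" "d \<in> dom T" "r = psi d" using T unfolding G_def by blast
      show ?thesis unfolding G_def d using d t finite_ops_scaleR dom_scale
        by (intro CollectI exI[of _ "t *\<^sub>R T"] exI[of _ "code_scale t d"]) (simp add: psi_scale dom_codes)
    qed
    show "0 \<le> r" if "(0, r) \<in> G" for r using that dom_pos unfolding G_def by blast
    show "\<exists>r. (T, r) \<in> G" if "T \<in> finite_ops" for T using dom_nonempty[OF that] that unfolding G_def by blast
  qed (rule that)
  obtain l where l: "\<And>S T. S \<in> finite_ops \<Longrightarrow> T \<in> finite_ops \<Longrightarrow> l (S + T) = l S + l T"
    "\<And>t T. T \<in> finite_ops \<Longrightarrow> l (t *\<^sub>R T) = t * l T" "\<And>T. T \<in> finite_ops \<Longrightarrow> l T \<le> p T"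
    by (rule hahn_banach_sublinear[OF subspace_finite_ops p(1)]) (assumption | rule that)+
  have l_le: "l T \<le> psi d" if "T \<in> finite_ops" "d \<in> dom T" for T d
  proof -
    have "(T, psi d) \<in> G" unfolding G_def using that by blast
    thus ?thesis using l(3)[OF that(1)] p(2)[OF that(1)] by fastforce
  qed
  have l_neg: "l (- T) = - l T" if "T \<in> finite_ops" for T using l(2)[OF that, of "- 1"] by simp
  show ?thesis
  proof (rule that[OF l(1,2)])
    fix T :: "('x, 'f) l2 bop" assume T: "T \<in> finite_ops" "op_nonneg T"
    have "({}, \<lambda>_. 0) \<in> dom (- T)"
      using T(2) by (simp add: dom_def codes_def code_form_def op_nonneg_def op_apply_uminus)
    hence "l (- T) \<le> psi ({}, \<lambda>_. 0)" by (rule l_le[OF neg[OF T(1)]])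
    thus "0 \<le> l T" by (simp add: l_neg T(1) psi_def code_form_def)
  next
    fix x y b c assume b: "b \<in> BB"
    define d :: "('x, 'r) matrix_code" where "d = ({(x, y)}, \<lambda>_. (b, c))"
    let ?T = "l2_unit x y (q b + c *\<^sub>C 1)"
    have d: "d \<in> codes BB" using b by (simp add: codes_def d_def)
    have eq: "Re (cinner (op_apply ?T f) f) = code_form q (Rep_l2 f) d" for f
      by (simp add: code_form_def code_term_def d_def cinner_l2_unit op_apply_simps)
    have d1: "d \<in> dom ?T" using d eq by (simp add: dom_def)
    \<comment> \<open>The code and its negative are both admissible, so two upper bounds determine
      the value of l.\<close>
    have d2: "code_scale (- 1) d \<in> dom (- ?T)"
      using eq code_scale_codes[OF BB(1) d]
      by (simp add: dom_def code_form_scale[OF real_linear_q d] op_apply_uminus)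
    have "l ?T \<le> psi d" by (rule l_le[OF l2_unit_finite_ops d1])
    moreover have "l (- ?T) \<le> psi (code_scale (- 1) d)" by (rule l_le[OF neg[OF l2_unit_finite_ops] d2])
    ultimately have "l ?T = psi d" by (simp add: l_neg psi_scale d)
    thus "l ?T = Re (cinner (op_apply (\<sigma> (P b)) (\<xi> y) + c *\<^sub>C \<xi> y) (\<xi> x))"
      by (simp add: psi_def code_form_def code_term_def d_def)
  qed
qed

text \<open>The matrix of the form that sends f to the inner product of h X with X, where X is the
  sum of the a u times \<open>fst u\<close> applied to the component of f at \<open>snd u\<close>.
  For h = 1 the functional turns it into the squared GNS norm of \<Sum> a u v u.\<close>

definition gram_op :: "('f bop \<times> 'x) set \<Rightarrow> ('f bop \<times> 'x \<Rightarrow> complex) \<Rightarrow> 'f bop \<Rightarrow> ('x, 'f) l2 bop"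
  where "gram_op S a h = (\<Sum>u\<in>S. \<Sum>w\<in>S. (a u * cnj (a w)) *\<^sub>C l2_unit (snd w) (snd u) (adj (fst w) * h * fst u))"

lemma gram_op_finite: "gram_op S a h \<in> finite_ops"
  unfolding gram_op_def by (intro finite_ops_sum finite_ops_scaleC l2_unit_finite_ops)

lemma gram_op_form:
  "cinner (op_apply (gram_op S a h) f) f =
    cinner (op_apply h (\<Sum>u\<in>S. a u *\<^sub>C op_apply (fst u) (Rep_l2 f (snd u)))) (\<Sum>u\<in>S. a u *\<^sub>C op_apply (fst u) (Rep_l2 f (snd u)))"
  unfolding gram_op_def op_apply_sum op_apply_sum_right op_apply_scaleC gram_sum
  by (simp add: cinner_sum_left op_apply_scaleC_bop cinner_scaleC_left cinner_l2_unit cinner_adj_left)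

text \<open>Stinespring's construction: \<open>v (f, x)\<close> stands for f applied to the image of
  \<open>\<xi> x\<close> in the dilation space. Inner products are values of the complexified
  functional at matrix units with entry \<open>adj g * f\<close>, a positive definite kernel. The
  injection \<open>c\<close> fits all vectors into a prescribed sequence space.\<close>

lemma dilation_vectors:
  fixes \<sigma> :: "'e bop \<Rightarrow> 'k::complex_hilbert bop" and \<xi> :: "'x \<Rightarrow> 'k" and c :: "'f bop \<times> 'x \<Rightarrow> 'y"
  assumes \<sigma>: "star_hom_on E \<sigma>" and \<xi>: "\<And>x. ((\<lambda>i. op_apply (\<sigma> (j (e i))) (\<xi> x)) \<longlongrightarrow> \<xi> x) \<F>" and c: "inj c"
  obtains v :: "'f bop \<times> 'x \<Rightarrow> ('y, complex) l2" where
    "\<And>f g x. v (f + g, x) = v (f, x) + v (g, x)" "\<And>z f x. v (z *\<^sub>C f, x) = z *\<^sub>C v (f, x)"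
    "\<And>h S a. finite S \<Longrightarrow> norm (\<Sum>u\<in>S. a u *\<^sub>C v (h * fst u, snd u)) \<le> norm h * norm (\<Sum>u\<in>S. a u *\<^sub>C v u)"
    "\<And>h f g x y. cinner (v (h * f, x)) (v (g, y)) = cinner (v (f, x)) (v (adj h * g, y))"
    "\<And>x y. cinner (v (1, x)) (v (1, y)) = cinner (\<xi> x) (\<xi> y)"
    "\<And>b x y. b \<in> BB \<Longrightarrow> cinner (v (q b, x)) (v (1, y)) = cinner (op_apply (\<sigma> (P b)) (\<xi> x)) (\<xi> y)"
proof -
  note \<sigma>h = star_homD[OF \<sigma> cover(1)]
  obtain l :: "('x, 'f) l2 bop \<Rightarrow> real" where
    l_plus: "\<And>S T. S \<in> finite_ops \<Longrightarrow> T \<in> finite_ops \<Longrightarrow> l (S + T) = l S + l T"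
    and l_scale: "\<And>t T. T \<in> finite_ops \<Longrightarrow> l (t *\<^sub>R T) = t * l T"
    and l_pos: "\<And>T. T \<in> finite_ops \<Longrightarrow> op_nonneg T \<Longrightarrow> 0 \<le> l T"
    and l_val: "\<And>x y b c. b \<in> BB \<Longrightarrow> l (l2_unit x y (q b + c *\<^sub>C 1)) = Re (cinner (op_apply (\<sigma> (P b)) (\<xi> y) + c *\<^sub>C \<xi> y) (\<xi> x))"
    by (rule extended_functional[where \<sigma>=\<sigma> and \<xi>=\<xi>, OF \<sigma> \<xi>]) (rule that)
  have l_diff: "l (S - T) = l S - l T" if "S \<in> finite_ops" "T \<in> finite_ops" for S T
    using l_plus[OF finite_ops_minus[OF that] that(2)] by simp
  \<comment> \<open>The standard complexification of a real functional; here l is the real part of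
    L.\<close>
  define L where "L T = Complex (l T) (- l (\<i> *\<^sub>C T))" for T
  have L_plus: "L (S + T) = L S + L T" if "S \<in> finite_ops" "T \<in> finite_ops" for S T
    using that by (simp add: L_def complex_eq_iff l_plus scaleC_add_right finite_ops_scaleC)
  have L_scale: "L (z *\<^sub>C T) = z * L T" if T: "T \<in> finite_ops" for z T
  proof -
    have lz: "l (w *\<^sub>C T) = Re w * l T + Im w * l (\<i> *\<^sub>C T)" for w
    proof -
      have "w *\<^sub>C T = Re w *\<^sub>R T + Im w *\<^sub>R (\<i> *\<^sub>C T)"
        unfolding scaleC_of_real[symmetric] scaleC_scaleC scaleC_add_left[symmetric]
        by (rule arg_cong[where f="\<lambda>w. w *\<^sub>C T"]) (simp add: complex_eq_iff)
      thus ?thesis using T by (simp add: l_plus l_scale finite_ops_scaleC finite_ops_scaleR)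
    qed
    show ?thesis using lz[of z] lz[of "\<i> * z"] by (simp add: L_def scaleC_scaleC complex_eq_iff)
  qed
  have L_zero: "L 0 = 0" using L_scale[OF finite_ops_zero, of 0] by simp
  have L_sum: "L (sum f S) = (\<Sum>i\<in>S. L (f i))" if "\<And>i. f i \<in> finite_ops" for f :: "'f bop \<times> 'x \<Rightarrow> _" and S
    by (induction S rule: infinite_finite_induct) (auto simp: L_zero L_plus that finite_ops_sum)
  have l_adj: "l (adj T) = l T" if T: "T \<in> finite_ops" for T
  proof -
    have eq: "Re (cinner (op_apply (adj T) f) f) = Re (cinner (op_apply T f) f)" for f
      by (simp add: cinner_adj_left Re_cinner inner_commute)
    have "op_nonneg (T - adj T)" "op_nonneg (adj T - T)"
      by (simp_all add: op_nonneg_def op_apply_minus cinner_diff_left eq)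
    hence "0 \<le> l (T - adj T)" "0 \<le> l (adj T - T)"
      using T by (auto intro!: l_pos finite_ops_minus finite_ops_adj)
    thus ?thesis using T by (simp add: l_diff finite_ops_adj)
  qed
  have L_adj: "L (adj T) = cnj (L T)" if T: "T \<in> finite_ops" for T
  proof -
    have "l (\<i> *\<^sub>C adj T) = l (adj ((- \<i>) *\<^sub>C T))" by simp
    also have "\<dots> = l ((- 1) *\<^sub>R (\<i> *\<^sub>C T))" using T by (subst l_adj) (auto intro: finite_ops_scaleC simp flip: scaleC_minus_left)
    also have "\<dots> = - l (\<i> *\<^sub>C T)" using l_scale[OF finite_ops_scaleC[OF T], of "- 1" \<i>] by simp
    finally show ?thesis using T by (simp add: L_def complex_eq_iff l_adj)
  qed
  define \<kappa> where "\<kappa> u w = L (l2_unit (snd w) (snd u) (adj (fst w) * fst u))" for u w :: "'f bop \<times> 'x"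
  have \<kappa>_gram: "(\<Sum>u\<in>S. \<Sum>w\<in>S. a u * cnj (a w) * \<kappa> (h * fst u, snd u) (h * fst w, snd w)) = L (gram_op S a (adj h * h))" for S a h
    unfolding gram_op_def \<kappa>_def by (simp add: L_sum L_scale finite_ops_scaleC finite_ops_sum mult.assoc)
  have \<kappa>: "pos_kernel \<kappa>"
    unfolding pos_kernel_def
  proof (intro conjI allI impI)
    show "\<kappa> w u = cnj (\<kappa> u w)" for u w unfolding \<kappa>_def by (simp add: l2_unit_adj flip: L_adj)
    fix S and a :: "'f bop \<times> 'x \<Rightarrow> complex"
    have "op_nonneg (gram_op S a 1)" by (simp add: op_nonneg_def gram_op_form Re_cinner_self)
    hence "0 \<le> l (gram_op S a 1)" by (intro l_pos gram_op_finite)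
    thus "0 \<le> Re (\<Sum>u\<in>S. \<Sum>w\<in>S. a u * cnj (a w) * \<kappa> u w)" using \<kappa>_gram[of a 1 S] by (simp add: L_def)
  qed
  obtain v :: "'f bop \<times> 'x \<Rightarrow> ('y, complex) l2" where v: "\<And>u w. cinner (v u) (v w) = \<kappa> u w"
    using gram_representation[OF \<kappa> c] by blast
  have bound: "norm (\<Sum>u\<in>S. a u *\<^sub>C v (h * fst u, snd u)) \<le> norm h * norm (\<Sum>u\<in>S. a u *\<^sub>C v u)" for h S a
  proof (rule power2_le_imp_le)
    have n: "(norm (\<Sum>u\<in>S. a u *\<^sub>C v (h * fst u, snd u)))\<^sup>2 = l (gram_op S a (adj h * h))" for h
      unfolding Re_cinner_self[symmetric] gram_sum v \<kappa>_gram by (simp add: L_def)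
    \<comment> \<open>The matrix is positive because h expands the vector X by at most its norm.
      Applying l bounds left multiplication by h.\<close>
    have "op_nonneg ((norm h)\<^sup>2 *\<^sub>R gram_op S a 1 - gram_op S a (adj h * h))"
      unfolding op_nonneg_def
    proof
      fix f
      define X where "X = (\<Sum>u\<in>S. a u *\<^sub>C op_apply (fst u) (Rep_l2 f (snd u)))"
      have "Re (cinner (op_apply ((norm h)\<^sup>2 *\<^sub>R gram_op S a 1 - gram_op S a (adj h * h)) f) f)
          = (norm h)\<^sup>2 * Re (cinner (op_apply (gram_op S a 1) f) f) - Re (cinner (op_apply (gram_op S a (adj h * h)) f) f)"
        by (simp add: op_apply_minus op_apply_scaleR_bop cinner_diff_left Re_cinner)
      also have "\<dots> = (norm h * norm X)\<^sup>2 - (norm (op_apply h X))\<^sup>2"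
        by (simp add: gram_op_form X_def[symmetric] cinner_adj_left Re_cinner_self power_mult_distrib)
      also have "0 \<le> \<dots>" using power_mono[OF norm_op_apply_le[of h X] norm_ge_zero, of 2] by simp
      finally show "0 \<le> Re (cinner (op_apply ((norm h)\<^sup>2 *\<^sub>R gram_op S a 1 - gram_op S a (adj h * h)) f) f)" .
    qed
    hence "0 \<le> l ((norm h)\<^sup>2 *\<^sub>R gram_op S a 1 - gram_op S a (adj h * h))"
      by (intro l_pos finite_ops_minus finite_ops_scaleR gram_op_finite)
    hence "l (gram_op S a (adj h * h)) \<le> (norm h)\<^sup>2 * l (gram_op S a 1)"
      by (simp add: l_diff l_scale finite_ops_scaleR gram_op_finite)
    thus "(norm (\<Sum>u\<in>S. a u *\<^sub>C v (h * fst u, snd u)))\<^sup>2 \<le> (norm h * norm (\<Sum>u\<in>S. a u *\<^sub>C v u))\<^sup>2"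
      using n[of h] n[of 1] by (simp add: power_mult_distrib)
  qed simp
  \<comment> \<open>Only inner products of the v u are known, so linearity of v in its first
    argument is tested against all v w.\<close>
  have ext: "X = Y" if "X - Y \<in> cspan (range v)" "\<And>w. cinner X (v w) = cinner Y (v w)" for X Y
  proof -
    have "cinner (X - Y) (X - Y) = 0"
    proof (rule orth_cspan[OF that(1)])
      fix b assume "b \<in> range v"
      then obtain w where "b = v w" by blast
      hence "cinner (X - Y) b = 0" using that(2)[of w] by (simp add: cinner_diff_left)
      thus "cinner b (X - Y) = 0" using cinner_commute[of b "X - Y"] by simp
    qed
    thus ?thesis by (simp add: cinner_self)
  qed
  note Vi = closed_csubspaceD[OF closed_csubspace_cspan[of "range v"]]
  have vV: "v u \<in> cspan (range v)" for u by (intro cspan_superset) simp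
  show ?thesis
  proof (rule that[OF _ _ bound])
    show "v (f + g, x) = v (f, x) + v (g, x)" for f g x
      by (rule ext) (simp_all add: Vi vV cinner_add_left v \<kappa>_def ring_distribs l2_unit_plus L_plus)
    show "v (z *\<^sub>C f, x) = z *\<^sub>C v (f, x)" for z f x
      by (rule ext) (simp_all add: Vi vV cinner_scaleC_left v \<kappa>_def l2_unit_scaleC L_scale)
    show "cinner (v (h * f, x)) (v (g, y)) = cinner (v (f, x)) (v (adj h * g, y))" for h f g x y
      by (simp add: v \<kappa>_def mult.assoc)
    have val: "L (l2_unit y x (q b + z *\<^sub>C 1)) = cinner (op_apply (\<sigma> (P b)) (\<xi> x) + z *\<^sub>C \<xi> x) (\<xi> y)" if b: "b \<in> BB" for b x y z
    proof -
      have ib: "\<i> *\<^sub>C b \<in> BB" using b by (rule Bi)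
      have "\<i> *\<^sub>C l2_unit y x (q b + z *\<^sub>C 1) = l2_unit y x (q (\<i> *\<^sub>C b) + (\<i> * z) *\<^sub>C 1)"
        unfolding l2_unit_scaleC[symmetric] using b by (simp add: qh BR scaleC_add_right scaleC_scaleC)
      hence "l (\<i> *\<^sub>C l2_unit y x (q b + z *\<^sub>C 1)) = Re (cinner (op_apply (\<sigma> (P (\<i> *\<^sub>C b))) (\<xi> x) + (\<i> * z) *\<^sub>C \<xi> x) (\<xi> y))"
        by (simp add: l_val[OF ib])
      also have "\<dots> = Re (\<i> * cinner (op_apply (\<sigma> (P b)) (\<xi> x) + z *\<^sub>C \<xi> x) (\<xi> y))"
        using b by (simp add: P_scaleC \<sigma>h P_E BR op_apply_scaleC_bop cinner_add_left cinner_scaleC_left ring_distribs)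
      finally show ?thesis by (simp add: L_def l_val[OF b] complex_eq_iff)
    qed
    show "cinner (v (1, x)) (v (1, y)) = cinner (\<xi> x) (\<xi> y)" for x y
      using val[OF Bi(2), of y x 1] by (simp add: v \<kappa>_def qh \<sigma>h P_zero)
    show "cinner (v (q b, x)) (v (1, y)) = cinner (op_apply (\<sigma> (P b)) (\<xi> x)) (\<xi> y)" if "b \<in> BB" for b x y
      using val[OF that, of y x 0] by (simp add: v \<kappa>_def)
  qed
qed

end

lemma bop_complex_l2_eqI2:
  fixes S T :: "('x, complex) l2 bop"
  assumes "\<And>x. op_apply S (l2_single x 1) = op_apply T (l2_single x 1)"
  shows "S = T"
  by (rule bop_complex_l2_eqI) (simp only: assms)

section \<open>A single dilation step and its nested form\<close>

context boundary_setup
begin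

text \<open>An element y of \<open>R\<close> acts on the vectors v (f, x) by left multiplication of
  f with q y, so \<tau> factors through q and kills its kernel. The vectors v (1, x) have the Gram
  matrix of the \<xi> x, hence W is a partial isometry with initial projection p, along which \<tau>
  compresses to \<sigma> P on \<open>BB\<close>. The limit of the approximate unit is carried along
  as the projection p', so that the step can be repeated.\<close>

lemma one_step:
  fixes \<sigma> :: "'e bop \<Rightarrow> ('x, complex) l2 bop" and p :: "('x, complex) l2 bop" and c :: "'f bop \<times> 'x \<Rightarrow> 'x"
  assumes \<sigma>: "star_hom_on E \<sigma>" and p: "adj p = p" "p * p = p" and \<sigma>p: "\<And>x. x \<in> E \<Longrightarrow> \<sigma> x * p = \<sigma> x"
    and nondeg: "\<And>\<xi>. ((\<lambda>i. op_apply (\<sigma> (j (e i))) \<xi>) \<longlongrightarrow> op_apply p \<xi>) \<F>" and c: "inj c"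
  obtains p' W :: "('x, complex) l2 bop" and \<tau> where "adj p' = p'" "p' * p' = p'" "adj W * W = p" "p' * W = W"
    "star_hom_on R \<tau>" "\<And>y. y \<in> R \<Longrightarrow> q y = 0 \<Longrightarrow> \<tau> y = 0" "\<And>y. y \<in> R \<Longrightarrow> \<tau> y * p' = \<tau> y"
    "\<And>b. b \<in> BB \<Longrightarrow> adj W * \<tau> b * W = \<sigma> (P b)"
    "\<And>\<xi>. ((\<lambda>i. op_apply (\<tau> (\<pi> (j (e i)))) \<xi>) \<longlongrightarrow> op_apply p' \<xi>) \<F>"
proof -
  note \<sigma>h = star_homD[OF \<sigma> cover(1)]
  define \<xi> where "\<xi> x = op_apply p (l2_single x 1)" for x
  have p\<xi>: "op_apply p (\<xi> x) = \<xi> x" for x unfolding \<xi>_def using p(2) by (metis op_apply_times)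
  have "((\<lambda>i. op_apply (\<sigma> (j (e i))) (\<xi> x)) \<longlongrightarrow> \<xi> x) \<F>" for x using nondeg[of "\<xi> x"] by (simp add: p\<xi>)
  then obtain v :: "'f bop \<times> 'x \<Rightarrow> ('x, complex) l2" where
    v_plus: "\<And>f g x. v (f + g, x) = v (f, x) + v (g, x)" and v_scale: "\<And>z f x. v (z *\<^sub>C f, x) = z *\<^sub>C v (f, x)"
    and v_bound: "\<And>h S a. finite S \<Longrightarrow> norm (\<Sum>u\<in>S. a u *\<^sub>C v (h * fst u, snd u)) \<le> norm h * norm (\<Sum>u\<in>S. a u *\<^sub>C v u)"
    and v_adj: "\<And>h f g x y. cinner (v (h * f, x)) (v (g, y)) = cinner (v (f, x)) (v (adj h * g, y))"
    and v_1: "\<And>x y. cinner (v (1, x)) (v (1, y)) = cinner (\<xi> x) (\<xi> y)"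
    and v_q: "\<And>b x y. b \<in> BB \<Longrightarrow> cinner (v (q b, x)) (v (1, y)) = cinner (op_apply (\<sigma> (P b)) (\<xi> x)) (\<xi> y)"
    by (rule dilation_vectors[where \<sigma>=\<sigma> and \<xi>=\<xi> and c=c, OF \<sigma> _ c]) (rule that)
  have v_diff: "v (f - g, x) = v (f, x) - v (g, x)" for f g x
    using v_plus[of f "- 1 *\<^sub>C g" x] v_scale[of "- 1" g x] by simp
  have v_zero: "v (0, x) = 0" for x using v_diff[of 0 0 x] by simp
  have v_norm: "norm (v (h, x)) \<le> norm h * norm (v (1, x))" for h x
    using v_bound[of "{(1, x)}" "\<lambda>_. 1" h] by simp
  define F0 where "F0 = insert 1 (q ` R)"
  define B where "B = v ` (F0 \<times> UNIV)"
  let ?M = "cspan B"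
  define p' where "p' = cproj ?M"
  note M = closed_csubspace_cspan[of B]
  note pr = cproj[OF M, folded p'_def]
  have BI: "v (f, x) \<in> B" if "f \<in> F0" for f x using that by (simp add: B_def)
  have BE: "\<exists>f\<in>F0. \<exists>x. b = v (f, x)" if "b \<in> B" for b using that by (auto simp: B_def)
  have F0_q: "q y * f \<in> F0" if "y \<in> R" "f \<in> F0" for y f
    using that unfolding F0_def by (auto simp: qh(2)[symmetric] Ri)
  have "\<exists>T. (\<forall>f\<in>F0. \<forall>x. op_apply T (v (f, x)) = v (q y * f, x)) \<and>
      (\<forall>z. (\<forall>b\<in>B. cinner b z = 0) \<longrightarrow> op_apply T z = 0)" for y
  proof -
    show ?thesis
    proof (rule extend_operator[of "norm (q y)" "F0 \<times> UNIV" "\<lambda>u. v (q y * fst u, snd u)" v])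
      fix T assume T: "bounded_clinear T" "\<And>u. u \<in> F0 \<times> UNIV \<Longrightarrow> T (v u) = v (q y * fst u, snd u)"
        "\<And>z. (\<And>u. u \<in> F0 \<times> UNIV \<Longrightarrow> cinner (v u) z = 0) \<Longrightarrow> T z = 0"
      show ?thesis
        by (intro exI[of _ "Bop T"]) (auto simp: op_apply_Bop[OF T(1)] T(2) B_def intro!: T(3))
    qed (simp, rule v_bound)
  qed
  then obtain \<tau> where \<tau>_v: "\<And>y f x. f \<in> F0 \<Longrightarrow> op_apply (\<tau> y) (v (f, x)) = v (q y * f, x)"
    and \<tau>_orth: "\<And>y z. (\<And>b. b \<in> B \<Longrightarrow> cinner b z = 0) \<Longrightarrow> op_apply (\<tau> y) z = 0"
    by metis
  have \<tau>_eq: "\<tau> y = T" if "\<And>f x. f \<in> F0 \<Longrightarrow> op_apply T (v (f, x)) = v (q y * f, x)"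
    "\<And>z. (\<And>b. b \<in> B \<Longrightarrow> cinner b z = 0) \<Longrightarrow> op_apply T z = 0" for y T
  proof (rule bop_eq_on_cspan[where B=B])
    fix b assume "b \<in> B"
    then obtain f x where "f \<in> F0" "b = v (f, x)" using BE by blast
    thus "op_apply (\<tau> y) b = op_apply T b" by (simp add: \<tau>_v that(1))
  next
    fix z assume "\<And>b. b \<in> B \<Longrightarrow> cinner b z = 0"
    thus "op_apply (\<tau> y) z = op_apply T z" by (simp add: \<tau>_orth that(2))
  qed
  have \<tau>: "star_hom_on R \<tau>"
    unfolding star_hom_on_def algebra_hom_on_def
  proof (intro conjI ballI allI)
    fix y z assume yz: "y \<in> R" "z \<in> R"
    show "\<tau> (y + z) = \<tau> y + \<tau> z"
      by (rule \<tau>_eq) (simp_all add: op_apply_plus \<tau>_v \<tau>_orth qh yz ring_distribs v_plus)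
    show "\<tau> (y * z) = \<tau> y * \<tau> z"
      by (rule \<tau>_eq) (simp_all add: \<tau>_v \<tau>_orth qh yz mult.assoc F0_q)
  next
    fix k y assume y: "y \<in> R"
    show "\<tau> (k *\<^sub>C y) = k *\<^sub>C \<tau> y"
      by (rule \<tau>_eq) (simp_all add: op_apply_scaleC_bop \<tau>_v \<tau>_orth qh y v_scale)
  next
    fix y assume y: "y \<in> R"
    have sp: "op_apply (\<tau> y) b \<in> ?M" if b: "b \<in> B" and y: "y \<in> R" for b y
    proof -
      obtain f x where "f \<in> F0" "b = v (f, x)" using BE[OF b] by blast
      thus ?thesis using y by (auto simp: \<tau>_v intro!: cspan_superset BI F0_q)
    qed
    show "\<tau> (adj y) = adj (\<tau> y)"
    proof (rule adj_eq_on_cspan[where B=B, symmetric])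
      fix b b' assume "b \<in> B" "b' \<in> B"
      then obtain f x g z where "f \<in> F0" "b = v (f, x)" "g \<in> F0" "b' = v (g, z)" using BE by blast
      thus "cinner (op_apply (\<tau> y) b) b' = cinner b (op_apply (\<tau> (adj y)) b')"
        using y by (simp add: \<tau>_v v_adj star_hom_onD(2)[OF q(1)])
    qed (use sp y Ra \<tau>_orth in auto)
  qed
  have "\<exists>W. \<forall>x. op_apply W (l2_single x 1) = v (1, x)"
  proof -
    have "norm (\<Sum>i\<in>S. a i *\<^sub>C v (1, i)) \<le> 1 * norm (\<Sum>i\<in>S. a i *\<^sub>C l2_single i (1::complex))" for S a
    proof -
      have "(norm (\<Sum>i\<in>S. a i *\<^sub>C v (1, i)))\<^sup>2 = (norm (\<Sum>i\<in>S. a i *\<^sub>C \<xi> i))\<^sup>2"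
        unfolding Re_cinner_self[symmetric] gram_sum v_1 ..
      hence "norm (\<Sum>i\<in>S. a i *\<^sub>C v (1, i)) = norm (\<Sum>i\<in>S. a i *\<^sub>C \<xi> i)" by simp
      also have "(\<Sum>i\<in>S. a i *\<^sub>C \<xi> i) = op_apply p (\<Sum>i\<in>S. a i *\<^sub>C l2_single i 1)"
        by (simp add: op_apply_sum_right op_apply_scaleC \<xi>_def)
      also have "norm \<dots> \<le> norm (\<Sum>i\<in>S. a i *\<^sub>C l2_single i (1::complex))" by (rule projection_norm_le[OF p])
      finally show ?thesis by simp
    qed
    then obtain W where "\<And>x. op_apply W (l2_single x 1) = v (1, x)"
      by (rule complex_l2_operator[of "\<lambda>x. v (1, x)" 1]) (simp, rule that)
    thus ?thesis by blast
  qed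
  then obtain W where W: "\<And>x. op_apply W (l2_single x 1) = v (1, x)" by blast
  have 1: "1 \<in> F0" by (simp add: F0_def)
  have \<xi>\<xi>: "cinner \<zeta> (\<xi> y) = cinner (op_apply p \<zeta>) (l2_single y 1)" for \<zeta> y
    unfolding \<xi>_def using p(1) by (metis cinner_adj)
  have WW: "adj W * W = p"
    by (rule bop_complex_l2_eqI) (simp only: op_apply_times cinner_adj_left W v_1 \<xi>\<xi> p\<xi>, simp add: \<xi>_def)
  have p'W: "p' * W = W"
    by (rule bop_complex_l2_eqI2) (simp add: W pr(4) cspan_superset BI 1)
  have \<tau>p': "\<tau> y * p' = \<tau> y" for y
  proof (rule \<tau>_eq[symmetric])
    fix f x assume f: "f \<in> F0"
    show "op_apply (\<tau> y * p') (v (f, x)) = v (q y * f, x)"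
      using pr(4)[OF cspan_superset[OF BI[OF f]]] by (simp add: \<tau>_v f)
  next
    fix z assume z: "\<And>b. b \<in> B \<Longrightarrow> cinner b z = 0"
    have "op_apply p' z = 0" unfolding p'_def by (rule cproj_orth[OF M]) (rule orth_cspan[OF _ z])
    thus "op_apply (\<tau> y * p') z = 0" by simp
  qed
  have comp: "adj W * \<tau> b * W = \<sigma> (P b)" if b: "b \<in> BB" for b
  proof (rule bop_complex_l2_eqI)
    fix x y
    have Pb: "P b \<in> E" by (intro P_E BR b)
    have "p * \<sigma> (P b) = adj (\<sigma> (adj (P b)) * p)"
      using Pb by (simp add: p(1) star_hom_onD(2)[OF \<sigma>])
    also have "\<dots> = \<sigma> (P b)" unfolding \<sigma>p[OF Ea[OF Pb]] using Pb by (simp add: star_hom_onD(2)[OF \<sigma>])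
    finally have p\<sigma>: "op_apply p (op_apply (\<sigma> (P b)) \<zeta>) = op_apply (\<sigma> (P b)) \<zeta>" for \<zeta> by (metis op_apply_times)
    have "op_apply (\<sigma> (P b)) (\<xi> x) = op_apply (\<sigma> (P b)) (l2_single x 1)"
      unfolding \<xi>_def using \<sigma>p[OF Pb] by (metis op_apply_times)
    hence "cinner (op_apply (\<sigma> (P b)) (\<xi> x)) (\<xi> y) = cinner (op_apply (\<sigma> (P b)) (l2_single x 1)) (l2_single y 1)"
      unfolding \<xi>\<xi> by (simp only: p\<sigma>)
    moreover have "cinner (op_apply (adj W * \<tau> b * W) (l2_single x 1)) (l2_single y 1) = cinner (v (q b, x)) (v (1, y))"
      by (simp only: op_apply_times cinner_adj_left W \<tau>_v[OF 1] mult_1_right)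
    ultimately show "cinner (op_apply (adj W * \<tau> b * W) (l2_single x 1)) (l2_single y 1)
        = cinner (op_apply (\<sigma> (P b)) (l2_single x 1)) (l2_single y 1)" by (simp only: v_q[OF b])
  qed
  define u where "u i = \<pi> (j (e i))" for i
  have uB: "u i \<in> BB" for i unfolding u_def by (rule \<pi>(3)[OF e(1)])
  have qu: "norm (q (u i)) \<le> 1" for i
    using q_norm[OF BR[OF uB[of i]]] norm_\<pi>je[of i] unfolding u_def by linarith
  have lim: "((\<lambda>i. op_apply (\<tau> (u i)) b) \<longlongrightarrow> b) \<F>" if "b \<in> B" for b
  proof -
    obtain f x where f: "f \<in> F0" "b = v (f, x)" using BE \<open>b \<in> B\<close> by blast
    have "((\<lambda>i. v (q (u i) * f, x)) \<longlongrightarrow> v (f, x)) \<F>"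
    proof (cases "f = 1")
      case True
      \<comment> \<open>Expanding the square bounds it by twice the defect between the squared norm
        of \<xi> x and the diagonal coefficient of \<sigma> (j (e i)), which tends to 0 as \<sigma>
        is nondegenerate on \<xi> x.\<close>
      have "((\<lambda>i. v (q (u i), x) - v (1, x)) \<longlongrightarrow> 0) \<F>"
      proof -
        let ?g = "\<lambda>i. 2 * (norm (\<xi> x))\<^sup>2 - 2 * Re (cinner (op_apply (\<sigma> (j (e i))) (\<xi> x)) (\<xi> x))"
        have n1: "(norm (v (1, x)))\<^sup>2 = (norm (\<xi> x))\<^sup>2" using v_1[of x x] by (simp flip: Re_cinner_self)
        have le: "(norm (v (q (u i), x) - v (1, x)))\<^sup>2 \<le> ?g i" for i
        proof -
          have "norm (v (q (u i), x)) \<le> norm (v (1, x))"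
            using v_norm[of "q (u i)" x] mult_right_mono[OF qu[of i], of "norm (v (1, x))"] by simp
          hence "(norm (v (q (u i), x)))\<^sup>2 \<le> (norm (\<xi> x))\<^sup>2"
            unfolding n1[symmetric] by (intro power_mono) auto
          moreover have "Re (cinner (v (q (u i), x)) (v (1, x))) = Re (cinner (op_apply (\<sigma> (j (e i))) (\<xi> x)) (\<xi> x))"
            using v_q[OF uB[of i]] by (simp add: u_def P_\<pi> jE e)
          ultimately show ?thesis by (simp add: norm_minus_square n1)
        qed
        have "((\<lambda>i. Re (cinner (op_apply (\<sigma> (j (e i))) (\<xi> x)) (\<xi> x))) \<longlongrightarrow> Re (cinner (op_apply p (\<xi> x)) (\<xi> x))) \<F>"
          by (intro tendsto_Re tendsto_cinner_left nondeg)
        hence "(?g \<longlongrightarrow> 2 * (norm (\<xi> x))\<^sup>2 - 2 * Re (cinner (op_apply p (\<xi> x)) (\<xi> x))) \<F>"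
          by (intro tendsto_diff tendsto_mult tendsto_const)
        hence g: "(?g \<longlongrightarrow> 0) \<F>" by (simp add: p\<xi> Re_cinner_self)
        have "((\<lambda>i. (norm (v (q (u i), x) - v (1, x)))\<^sup>2) \<longlongrightarrow> 0) \<F>"
          by (rule tendsto_sandwich[OF _ _ tendsto_const g]) (simp_all add: le)
        from tendsto_real_sqrt[OF this] have "((\<lambda>i. norm (v (q (u i), x) - v (1, x))) \<longlongrightarrow> 0) \<F>" by simp
        thus ?thesis by (rule tendsto_norm_zero_cancel)
      qed
      hence "((\<lambda>i. v (q (u i), x)) \<longlongrightarrow> v (1, x)) \<F>" by (rule LIM_zero_cancel)
      thus ?thesis using True by simp
    next
      case False
      then obtain y where y: "y \<in> R" "f = q y" using f(1) by (auto simp: F0_def)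
      have "((\<lambda>i. q (u i * y)) \<longlongrightarrow> q y) \<F>"
        by (rule star_hom_tendsto[OF R q(1) _ y(1)]) (auto intro: Ri BR uB y e_R[folded u_def])
      hence "((\<lambda>i. norm (q (u i * y) - q y) * norm (v (1, x))) \<longlongrightarrow> 0) \<F>"
        by (intro tendsto_mult_left_zero tendsto_norm_zero LIM_zero)
      hence "((\<lambda>i. v (q (u i * y), x) - v (q y, x)) \<longlongrightarrow> 0) \<F>"
        by (rule Lim_null_comparison[rotated]) (simp add: v_norm flip: v_diff)
      hence "((\<lambda>i. v (q (u i * y), x)) \<longlongrightarrow> v (q y, x)) \<F>" by (rule LIM_zero_cancel)
      thus ?thesis using y by (simp add: qh BR uB)
    qed
    thus ?thesis using f by (simp add: \<tau>_v)
  qed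
  have nondeg': "((\<lambda>i. op_apply (\<tau> (u i)) \<zeta>) \<longlongrightarrow> op_apply p' \<zeta>) \<F>" for \<zeta>
  proof -
    have n: "norm (\<tau> (u i)) \<le> 1" for i
      using star_hom_contractive[OF R \<tau> BR[OF uB[of i]]] norm_\<pi>je[of i] unfolding u_def by linarith
    have n': "norm p' \<le> 1" by (rule projection_bop_norm_le[OF pr(1,2)])
    have "?M \<subseteq> {x. ((\<lambda>i. op_apply (\<tau> (u i)) x) \<longlongrightarrow> op_apply p' x) \<F>}"
      by (intro cspan_subset closed_csubspace_tendsto[OF n n']) (auto simp: lim pr(4) cspan_superset)
    moreover obtain a b where ab: "a \<in> ?M" "\<zeta> = a + b" "\<And>m. m \<in> ?M \<Longrightarrow> cinner m b = 0"
      using decompose_cspan[of B \<zeta>] by blast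
    moreover have "op_apply (\<tau> (u i)) b = 0" for i by (rule \<tau>_orth) (intro ab cspan_superset)
    moreover have "op_apply p' b = 0" unfolding p'_def by (rule cproj_orth[OF M]) (rule ab)
    ultimately show ?thesis by (auto simp: op_apply_add)
  qed
  have zero: "\<tau> y = 0" if "y \<in> R" "q y = 0" for y
    by (rule \<tau>_eq) (simp_all add: that v_zero)
  show ?thesis
    by (rule that[OF pr(1,2) WW p'W \<tau> zero \<tau>p' comp nondeg'[unfolded u_def]])
qed

text \<open>The dilation space is moved so that the old space becomes a subspace of the new one: its
  part W W* goes back to the range of p, and the rest is put into the range of s, which is
  orthogonal to p. The last conclusion records that p' uses nothing beyond the ranges of p and s, so
  later isometries stay free.\<close>

lemma nested_step:
  fixes \<sigma> :: "'e bop \<Rightarrow> ('x, complex) l2 bop" and p s :: "('x, complex) l2 bop" and c :: "'f bop \<times> 'x \<Rightarrow> 'x"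
  assumes \<sigma>: "star_hom_on E \<sigma>" and p: "adj p = p" "p * p = p" and \<sigma>p: "\<And>x. x \<in> E \<Longrightarrow> \<sigma> x * p = \<sigma> x"
    and nondeg: "\<And>\<xi>. ((\<lambda>i. op_apply (\<sigma> (j (e i))) \<xi>) \<longlongrightarrow> op_apply p \<xi>) \<F>" and c: "inj c"
    and s: "adj s * s = 1" "p * s = 0"
  obtains p' \<tau> where "adj p' = p'" "p' * p' = p'"
    "star_hom_on R \<tau>" "\<And>y. y \<in> R \<Longrightarrow> q y = 0 \<Longrightarrow> \<tau> y = 0" "\<And>y. y \<in> R \<Longrightarrow> \<tau> y * p' = \<tau> y"
    "\<And>\<xi>. ((\<lambda>i. op_apply (\<tau> (\<pi> (j (e i)))) \<xi>) \<longlongrightarrow> op_apply p' \<xi>) \<F>"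
    "p' * p = p" "\<And>b. b \<in> BB \<Longrightarrow> p * \<tau> b * p = \<sigma> (P b)" "\<And>r. p * r = 0 \<Longrightarrow> adj s * r = 0 \<Longrightarrow> p' * r = 0"
proof -
  obtain p1 W :: "('x, complex) l2 bop" and \<tau> where p1: "adj p1 = p1" "p1 * p1 = p1" and WW: "adj W * W = p" and p1W: "p1 * W = W"
    and \<tau>: "star_hom_on R \<tau>" and \<tau>0: "\<And>y. y \<in> R \<Longrightarrow> q y = 0 \<Longrightarrow> \<tau> y = 0" and \<tau>p1: "\<And>y. y \<in> R \<Longrightarrow> \<tau> y * p1 = \<tau> y"
    and comp: "\<And>b. b \<in> BB \<Longrightarrow> adj W * \<tau> b * W = \<sigma> (P b)"
    and nd: "\<And>\<xi>. ((\<lambda>i. op_apply (\<tau> (\<pi> (j (e i)))) \<xi>) \<longlongrightarrow> op_apply p1 \<xi>) \<F>"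
    by (rule one_step[where \<sigma>=\<sigma> and p=p and c=c, OF \<sigma> p \<sigma>p nondeg c]) (assumption | rule that)+
  have Wp: "W * p = W"
  proof -
    have "adj (W - W * p) * (W - W * p) = adj W * W - adj W * W * p - p * (adj W * W) + p * (adj W * W) * p"
      by (simp add: p(1) algebra_simps)
    also have "\<dots> = 0" by (simp add: WW p(2))
    finally have "norm (W - W * p) = 0" using norm_adj_times[of "W - W * p"] by simp
    thus ?thesis by simp
  qed
  have Ws: "W * s = 0"
  proof -
    have "W * s = W * (p * s)" by (simp only: Wp mult.assoc[symmetric])
    thus ?thesis by (simp add: s)
  qed
  \<comment> \<open>The projection onto the part of the dilation space that is orthogonal to the
    range of W.\<close>
  define D where "D = p1 - W * adj W"
  have D: "adj D = D" by (simp add: D_def p1)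
  have Wp1: "adj W * p1 = adj W" using arg_cong[OF p1W, of adj] by (simp add: p1)
  have DW: "D * W = 0" using Wp by (simp add: D_def left_diff_distrib p1W mult.assoc WW)
  have DD: "D * D = D"
  proof -
    have "D * D = D * p1 - (D * W) * adj W" by (simp add: D_def right_diff_distrib mult.assoc)
    also have "D * p1 = D" by (simp add: D_def left_diff_distrib p1 mult.assoc Wp1)
    finally show ?thesis by (simp add: DW)
  qed
  have Dp1: "D * p1 = D" by (simp add: D_def left_diff_distrib p1 mult.assoc Wp1)
  \<comment> \<open>A partial isometry with initial projection p1 that undoes W on its range and
    shifts the complement by s.\<close>
  define Z where "Z = adj W + s * D"
  have Za: "adj Z = W + D * adj s" by (simp add: Z_def D)
  have sW: "adj s * adj W = 0" using arg_cong[OF Ws, of adj] by simp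
  have "adj Z * Z = W * adj W + (W * s) * D + D * (adj s * adj W) + D * (adj s * s) * D"
    unfolding Za unfolding Z_def by (simp add: distrib_left distrib_right mult.assoc)
  also have "\<dots> = p1" by (simp add: Ws sW s DD) (simp add: D_def)
  finally have ZZ: "adj Z * Z = p1" .
  have ZW: "Z * W = p" by (simp add: Z_def distrib_right WW mult.assoc DW)
  have Zp1: "Z * p1 = Z" by (simp add: Z_def distrib_right mult.assoc Dp1 Wp1)
  have sp: "adj s * p = 0" using arg_cong[OF s(2), of adj] by (simp add: p)
  have Zap: "adj Z * p = W" by (simp add: Za distrib_right Wp mult.assoc sp)
  have pZ: "p * Z = adj W" using arg_cong[OF Zap, of adj] by (simp add: p)
  define p' where "p' = Z * adj Z"
  define t where "t y = Z * \<tau> y * adj Z" for y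
  note \<tau>h = star_homD[OF \<tau> R]
  have t_mult: "t (y * z) = t y * t z" if "y \<in> R" "z \<in> R" for y z
  proof -
    have "t y * t z = Z * (\<tau> y * (adj Z * Z)) * \<tau> z * adj Z" by (simp add: t_def mult.assoc)
    also have "\<dots> = t (y * z)" using that by (simp add: ZZ \<tau>p1 t_def \<tau>h mult.assoc)
    finally show ?thesis ..
  qed
  show ?thesis
  proof (rule that[of p' t])
    show "adj p' = p'" by (simp add: p'_def)
    have "p' * p' = Z * (adj Z * Z) * adj Z" by (simp add: p'_def mult.assoc)
    thus "p' * p' = p'" by (simp add: ZZ Zp1 p'_def)
    show "star_hom_on R t"
      unfolding star_hom_on_def algebra_hom_on_def
    proof (intro conjI ballI allI t_mult)
      show "t (y + z) = t y + t z" if "y \<in> R" "z \<in> R" for y z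
        using that by (simp add: t_def \<tau>h distrib_left distrib_right)
      show "t (k *\<^sub>C y) = k *\<^sub>C t y" if "y \<in> R" for k y using that by (simp add: t_def \<tau>h)
      show "t (adj y) = adj (t y)" if "y \<in> R" for y using that by (simp add: t_def star_hom_onD(2)[OF \<tau>] mult.assoc)
    qed
    show "t y = 0" if "y \<in> R" "q y = 0" for y by (simp add: t_def \<tau>0 that)
    show "t y * p' = t y" if "y \<in> R" for y
    proof -
      have "t y * p' = Z * (\<tau> y * (adj Z * Z)) * adj Z" by (simp add: t_def p'_def mult.assoc)
      thus ?thesis using that by (simp add: ZZ \<tau>p1 t_def)
    qed
    show "((\<lambda>i. op_apply (t (\<pi> (j (e i)))) \<xi>) \<longlongrightarrow> op_apply p' \<xi>) \<F>" for \<xi>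
    proof -
      have "((\<lambda>i. op_apply Z (op_apply (\<tau> (\<pi> (j (e i)))) (op_apply (adj Z) \<xi>))) \<longlongrightarrow> op_apply Z (op_apply p1 (op_apply (adj Z) \<xi>))) \<F>"
        by (intro tendsto_op_apply nd)
      moreover have "op_apply Z (op_apply p1 (op_apply (adj Z) \<xi>)) = op_apply p' \<xi>"
        unfolding p'_def using Zp1 by (metis op_apply_times)
      ultimately show ?thesis by (simp add: t_def)
    qed
    have "p' * p = Z * (adj Z * p)" by (simp add: p'_def mult.assoc)
    thus "p' * p = p" by (simp add: Zap ZW)
    show "p * t b * p = \<sigma> (P b)" if "b \<in> BB" for b
    proof -
      have "p * t b * p = (p * Z) * \<tau> b * (adj Z * p)" by (simp add: t_def mult.assoc)
      thus ?thesis using comp[OF that] by (simp add: pZ Zap)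
    qed
    show "p' * r = 0" if r: "p * r = 0" "adj s * r = 0" for r
    proof -
      have "W * r = W * (p * r)" by (simp only: Wp mult.assoc[symmetric])
      hence "adj Z * r = 0" by (simp add: Za distrib_right mult.assoc r)
      thus ?thesis by (simp add: p'_def mult.assoc)
    qed
  qed
qed

end

lemma norm_block_compress:
  assumes S: "finite S" and p: "\<And>x. norm (op_apply p x) \<le> norm x"
  shows "norm (block S (\<lambda>x y. p * T x y * p)) \<le> norm (block S T)"
  unfolding norm_block_le_iff[OF S norm_ge_zero]
proof
  fix \<xi>
  have "(\<Sum>x\<in>S. (norm (\<Sum>y\<in>S. op_apply (p * T x y * p) (\<xi> y)))\<^sup>2)
      = (\<Sum>x\<in>S. (norm (op_apply p (\<Sum>y\<in>S. op_apply (T x y) (op_apply p (\<xi> y)))))\<^sup>2)"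
    by (simp add: op_apply_sum_right)
  also have "\<dots> \<le> (\<Sum>x\<in>S. (norm (\<Sum>y\<in>S. op_apply (T x y) (op_apply p (\<xi> y))))\<^sup>2)"
    by (intro sum_mono power_mono p norm_ge_zero)
  also have "\<dots> \<le> (norm (block S T))\<^sup>2 * (\<Sum>x\<in>S. (norm (op_apply p (\<xi> x)))\<^sup>2)"
    by (rule norm_block_le_iff[OF S norm_ge_zero, THEN iffD1, OF order_refl, rule_format])
  also have "\<dots> \<le> (norm (block S T))\<^sup>2 * (\<Sum>x\<in>S. (norm (\<xi> x))\<^sup>2)"
    by (intro mult_left_mono sum_mono power_mono p norm_ge_zero) simp
  finally show "(\<Sum>x\<in>S. (norm (\<Sum>y\<in>S. op_apply (p * T x y * p) (\<xi> y)))\<^sup>2)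
      \<le> (norm (block S T))\<^sup>2 * (\<Sum>x\<in>S. (norm (\<xi> x))\<^sup>2)" .
qed

section \<open>The dilation chain, its strong limit and the faithfulness argument\<close>

context boundary_setup
begin

definition chain_inv :: "(nat \<Rightarrow> ('x, complex) l2 bop) \<Rightarrow> nat \<Rightarrow> ('x, complex) l2 bop \<times> ('e bop \<Rightarrow> ('x, complex) l2 bop) \<Rightarrow> bool"
  where "chain_inv S n = (\<lambda>(p, \<sigma>). adj p = p \<and> p * p = p \<and> star_hom_on E \<sigma> \<and> (\<forall>x\<in>E. \<sigma> x * p = \<sigma> x) \<and>
    (\<forall>\<xi>. ((\<lambda>i. op_apply (\<sigma> (j (e i))) \<xi>) \<longlongrightarrow> op_apply p \<xi>) \<F>) \<and> (\<forall>k>n. p * S k = 0))"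

text \<open>The witness \<tau> is the dilation of \<sigma> P that leads from one state to the next;
  the new \<sigma>' is its restriction to \<open>E\<close> along \<pi>.\<close>

definition chain_rel :: "('x, complex) l2 bop \<times> ('e bop \<Rightarrow> ('x, complex) l2 bop) \<Rightarrow>
    ('x, complex) l2 bop \<times> ('e bop \<Rightarrow> ('x, complex) l2 bop) \<Rightarrow> ('r bop \<Rightarrow> ('x, complex) l2 bop) \<Rightarrow> bool"
  where "chain_rel = (\<lambda>(p, \<sigma>) (p', \<sigma>') \<tau>. p' * p = p \<and> star_hom_on R \<tau> \<and> (\<forall>y\<in>R. q y = 0 \<longrightarrow> \<tau> y = 0) \<and>
    (\<forall>x\<in>E. \<sigma>' x = \<tau> (\<pi> x)) \<and> (\<forall>b\<in>BB. p * \<tau> b * p = \<sigma> (P b)))"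

lemma chain_step:
  fixes S :: "nat \<Rightarrow> ('x, complex) l2 bop" and c :: "'f bop \<times> 'x \<Rightarrow> 'x"
  assumes S: "\<And>k l. adj (S k) * S l = (if k = l then 1 else 0)" and c: "inj c" and inv: "chain_inv S n st"
  shows "\<exists>st'. chain_inv S (Suc n) st' \<and> (\<exists>\<tau>. chain_rel st st' \<tau>)"
proof -
  obtain p \<sigma> where st: "st = (p, \<sigma>)" by (cases st)
  have p: "adj p = p" "p * p = p" and \<sigma>: "star_hom_on E \<sigma>" and \<sigma>p: "\<And>x. x \<in> E \<Longrightarrow> \<sigma> x * p = \<sigma> x"
    and nd: "\<And>\<xi>. ((\<lambda>i. op_apply (\<sigma> (j (e i))) \<xi>) \<longlongrightarrow> op_apply p \<xi>) \<F>" and pS: "\<And>k. k > n \<Longrightarrow> p * S k = 0"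
    using inv by (auto simp: chain_inv_def st)
  have s: "adj (S (Suc n)) * S (Suc n) = 1" "p * S (Suc n) = 0" by (simp_all add: S pS)
  show ?thesis
  proof (rule nested_step[where \<sigma>=\<sigma> and p=p and c=c and s="S (Suc n)", OF \<sigma> p \<sigma>p nd c s])
    fix p' and \<tau> :: "'r bop \<Rightarrow> ('x, complex) l2 bop"
    assume p': "adj p' = p'" "p' * p' = p'" and \<tau>: "star_hom_on R \<tau>" and \<tau>0: "\<And>y. y \<in> R \<Longrightarrow> q y = 0 \<Longrightarrow> \<tau> y = 0"
      and \<tau>p: "\<And>y. y \<in> R \<Longrightarrow> \<tau> y * p' = \<tau> y"
      and nd': "\<And>\<xi>. ((\<lambda>i. op_apply (\<tau> (\<pi> (j (e i)))) \<xi>) \<longlongrightarrow> op_apply p' \<xi>) \<F>" and p'p: "p' * p = p"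
      and comp: "\<And>b. b \<in> BB \<Longrightarrow> p * \<tau> b * p = \<sigma> (P b)"
      and p'0: "\<And>r. p * r = 0 \<Longrightarrow> adj (S (Suc n)) * r = 0 \<Longrightarrow> p' * r = 0"
    have \<sigma>': "star_hom_on E (\<lambda>x. \<tau> (\<pi> x))" by (rule star_hom_compose[OF \<pi>(1) \<tau> \<pi>(2)])
    have "p' * S k = 0" if "k > Suc n" for k by (rule p'0) (use that pS S in simp_all)
    hence "chain_inv S (Suc n) (p', \<lambda>x. \<tau> (\<pi> x))"
      unfolding chain_inv_def using p' \<sigma>' \<tau>p \<pi>R nd' by simp
    moreover have "chain_rel st (p', \<lambda>x. \<tau> (\<pi> x)) \<tau>"
      unfolding chain_rel_def st using p'p \<tau> \<tau>0 comp by simp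
    ultimately show ?thesis by blast
  qed
qed

lemma chain_exists:
  fixes S :: "nat \<Rightarrow> ('x, complex) l2 bop" and c :: "'f bop \<times> 'x \<Rightarrow> 'x"
  assumes S: "\<And>k l. adj (S k) * S l = (if k = l then 1 else 0)" and c: "inj c" and inv: "chain_inv S 0 (p0, \<sigma>0)"
  obtains p \<sigma> \<tau> where "p 0 = p0" "\<sigma> 0 = \<sigma>0" "\<And>n. chain_inv S n (p n, \<sigma> n)"
    "\<And>n. chain_rel (p n, \<sigma> n) (p (Suc n), \<sigma> (Suc n)) (\<tau> n)"
proof -
  have "\<exists>f. \<forall>n. (chain_inv S n (f n) \<and> (n = 0 \<longrightarrow> f n = (p0, \<sigma>0))) \<and> (\<exists>\<tau>. chain_rel (f n) (f (Suc n)) \<tau>)"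
  proof (rule dependent_nat_choice)
    show "\<exists>x. chain_inv S 0 x \<and> (0 = 0 \<longrightarrow> x = (p0, \<sigma>0))" using inv by blast
    show "\<exists>y. (chain_inv S (Suc n) y \<and> (Suc n = 0 \<longrightarrow> y = (p0, \<sigma>0))) \<and> (\<exists>\<tau>. chain_rel x y \<tau>)"
      if "chain_inv S n x \<and> (n = 0 \<longrightarrow> x = (p0, \<sigma>0))" for x n
      using chain_step[OF S c, of n x] that by simp
  qed
  then obtain f where f: "\<And>n. chain_inv S n (f n)" "f 0 = (p0, \<sigma>0)" "\<And>n. \<exists>\<tau>. chain_rel (f n) (f (Suc n)) \<tau>" by blast
  define \<tau> where "\<tau> n = (SOME t. chain_rel (f n) (f (Suc n)) t)" for n
  have "chain_rel (f n) (f (Suc n)) (\<tau> n)" for n unfolding \<tau>_def using f(3) by (rule someI_ex)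
  thus ?thesis
    using that[of "\<lambda>n. fst (f n)" "\<lambda>n. snd (f n)" \<tau>] f(1,2) by simp
qed

text \<open>The operators \<sigma> n (j a) are compressions of one another, so they converge
  strongly, and with them \<sigma> n on all of \<open>E\<close>. For a product \<pi> x * b the
  factor \<pi> x is moved to the other side, where it acts through \<sigma> (n + 1); replacing this
  by \<sigma> n costs nothing in the limit, and on the range of p n the compression of \<tau> n b is
  \<sigma> n (P b). Thus \<tau> n tends weakly to \<rho> P, while every \<tau> n kills the kernel of
  q.\<close>

lemma chain_limit:
  fixes S :: "nat \<Rightarrow> ('x, complex) l2 bop"
  assumes inv: "\<And>n. chain_inv S n (p n, \<sigma> n)" and rel: "\<And>n. chain_rel (p n, \<sigma> n) (p (Suc n), \<sigma> (Suc n)) (\<tau> n)"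
  obtains \<rho> :: "'e bop \<Rightarrow> ('x, complex) l2 bop" where "star_hom_on E \<rho>"
    "\<And>a. a \<in> A \<Longrightarrow> p 0 * \<rho> (j a) * p 0 = \<sigma> 0 (j a)" "\<And>y. y \<in> R \<Longrightarrow> q y = 0 \<Longrightarrow> \<rho> (P y) = 0"
proof -
  have p: "adj (p n) = p n" "p n * p n = p n" and \<sigma>: "star_hom_on E (\<sigma> n)"
    and \<sigma>p: "x \<in> E \<Longrightarrow> \<sigma> n x * p n = \<sigma> n x" for n x
    using inv[of n] by (auto simp: chain_inv_def)
  have pp: "p (Suc n) * p n = p n" and \<tau>: "star_hom_on R (\<tau> n)" and \<tau>0: "y \<in> R \<Longrightarrow> q y = 0 \<Longrightarrow> \<tau> n y = 0"
    and \<sigma>\<tau>: "x \<in> E \<Longrightarrow> \<sigma> (Suc n) x = \<tau> n (\<pi> x)" and comp: "b \<in> BB \<Longrightarrow> p n * \<tau> n b * p n = \<sigma> n (P b)" for n x y b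
    using rel[of n] by (auto simp: chain_rel_def)
  note \<sigma>h = star_homD[OF \<sigma> cover(1)]
  note \<sigma>a = star_hom_onD(2)[OF \<sigma>]
  note \<tau>h = star_homD[OF \<tau> R]
  have \<sigma>n: "norm (\<sigma> n x) \<le> norm x" if "x \<in> E" for n x by (rule star_hom_contractive[OF cover(1) \<sigma> that])
  have \<tau>n: "norm (\<tau> n y) \<le> norm y" if "y \<in> R" for n y by (rule star_hom_contractive[OF R \<tau> that])
  have p\<sigma>: "p n * \<sigma> n x = \<sigma> n x" if "x \<in> E" for n x
  proof -
    have "adj (\<sigma> n (adj x) * p n) = adj (\<sigma> n (adj x))" using \<sigma>p[OF Ea[OF that]] by simp
    thus ?thesis using that by (simp add: p(1) \<sigma>a)
  qed
  have mono: "p m * p n = p n" if "n \<le> m" for m n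
    using that
  proof (induction m rule: dec_induct)
    case (step m)
    have "p (Suc m) * p n = (p (Suc m) * p m) * p n" by (simp only: mult.assoc step.IH)
    thus ?case by (simp add: pp step.IH)
  qed (rule p)
  have mono': "p n * p m = p n" if "n \<le> m" for m n
    using arg_cong[OF mono[OF that], of adj] by (simp add: p)
  have compr: "p n * \<sigma> m (j a) * p n = \<sigma> n (j a)" if a: "a \<in> A" and nm: "n \<le> m" for a n m
    using nm
  proof (induction m rule: dec_induct)
    case base show ?case using \<sigma>p[OF jE[OF a]] p\<sigma>[OF jE[OF a]] by simp
  next
    case (step m)
    have "p n * \<sigma> (Suc m) (j a) * p n = (p n * p m) * \<sigma> (Suc m) (j a) * (p m * p n)"
      using step.hyps by (simp add: mono mono')
    also have "\<dots> = p n * (p m * \<sigma> (Suc m) (j a) * p m) * p n" by (simp only: mult.assoc)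
    also have "p m * \<sigma> (Suc m) (j a) * p m = \<sigma> m (P (\<pi> (j a)))"
      unfolding \<sigma>\<tau>[OF jE[OF a]] by (rule comp[OF \<pi>(3)[OF a]])
    finally show ?case using step.IH by (simp add: P_\<pi> jE a)
  qed
  \<comment> \<open>Both the generators and their adjoints give increasing compressions, which is
    the symmetric condition for a strong limit homomorphism.\<close>
  obtain \<rho> where \<rho>: "star_hom_on E \<rho>"
    and \<rho>_lim: "\<And>x \<xi>. x \<in> E \<Longrightarrow> (\<lambda>n. op_apply (\<sigma> n x) \<xi>) \<longlonglongrightarrow> op_apply (\<rho> x) \<xi>"
  proof (rule strong_limit_star_hom[OF cover(1,4) \<sigma>])
    fix x \<xi> assume "x \<in> j ` A"
    then obtain a where a: "a \<in> A" "x = j a" by blast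
    show "convergent (\<lambda>n. op_apply (\<sigma> n x) \<xi>)"
      unfolding a(2) by (rule convergent_compression_operators[OF p mono compr[OF a(1)] \<sigma>n[OF jE[OF a(1)]]])
    have 2: "p n * \<sigma> m (adj (j a)) * p n = \<sigma> n (adj (j a))" if "n \<le> m" for m n
      using arg_cong[OF compr[OF a(1) that], of adj] jE[OF a(1)] by (simp add: \<sigma>a p mult.assoc)
    show "convergent (\<lambda>n. op_apply (\<sigma> n (adj x)) \<xi>)"
      unfolding a(2) by (rule convergent_compression_operators[OF p mono 2 \<sigma>n[OF Ea[OF jE[OF a(1)]]]])
  qed (rule that)
  note \<rho>h = star_homD[OF \<rho> cover(1)]
  have comp0: "p 0 * \<rho> (j a) * p 0 = \<sigma> 0 (j a)" if a: "a \<in> A" for a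
  proof (rule bop_eqI)
    fix \<xi>
    have "(\<lambda>n. op_apply (p 0) (op_apply (\<sigma> n (j a)) (op_apply (p 0) \<xi>))) \<longlonglongrightarrow> op_apply (p 0) (op_apply (\<rho> (j a)) (op_apply (p 0) \<xi>))"
      by (intro tendsto_op_apply \<rho>_lim jE a)
    moreover have "op_apply (p 0) (op_apply (\<sigma> n (j a)) (op_apply (p 0) \<xi>)) = op_apply (\<sigma> 0 (j a)) \<xi>" for n
      using compr[OF a, of 0 n] by (metis op_apply_times le0)
    ultimately show "op_apply (p 0 * \<rho> (j a) * p 0) \<xi> = op_apply (\<sigma> 0 (j a)) \<xi>"
      by (simp add: LIMSEQ_const_iff)
  qed
  \<comment> \<open>Vectors in the range of some p k are considered because the compression identity
    for \<tau> n is available only under p n.\<close>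
  have key: "(\<lambda>n. cinner (op_apply (\<tau> n y) \<xi>) \<eta>) \<longlonglongrightarrow> cinner (op_apply (\<rho> (P y)) \<xi>) \<eta>"
    if y: "y \<in> R" and \<xi>: "op_apply (p k) \<xi> = \<xi>" and \<eta>: "op_apply (p k) \<eta> = \<eta>" for y k \<xi> \<eta>
  proof -
    define Z where "Z = {y\<in>R. (\<lambda>n. cinner (op_apply (\<tau> n y) \<xi>) \<eta>) \<longlonglongrightarrow> cinner (op_apply (\<rho> (P y)) \<xi>) \<eta>}"
    have cin: "dist (cinner (op_apply U \<xi>) \<eta>) (cinner (op_apply V \<xi>) \<eta>) \<le> (norm \<xi> * norm \<eta>) * d"
      if d: "dist U V \<le> d" for U V :: "('x, complex) l2 bop" and d
    proof -
      have "cmod (cinner (op_apply (U - V) \<xi>) \<eta>) \<le> norm (op_apply (U - V) \<xi>) * norm \<eta>" by (rule norm_cinner_le)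
      also have "\<dots> \<le> (norm (U - V) * norm \<xi>) * norm \<eta>" by (intro mult_right_mono norm_op_apply_le) simp
      also have "\<dots> \<le> (d * norm \<xi>) * norm \<eta>" using d by (intro mult_right_mono) (auto simp: dist_norm)
      finally show ?thesis by (simp add: dist_norm op_apply_minus cinner_diff_left mult_ac)
    qed
    have Rsub: "R \<subseteq> Z"
    proof (rule total)
      have "dist (\<rho> (P x)) (\<rho> (P y)) \<le> dist x y" if "x \<in> R" "y \<in> R" for x y
        using star_hom_dist_le[OF cover(1) \<rho> P_E[OF that(1)] P_E[OF that(2)]] P_norm[of "x - y"]
        by (simp add: dist_norm P_diff)
      thus "closed Z"
        unfolding Z_def by (intro closed_tendsto_on[where K="norm \<xi> * norm \<eta>"] Ri(1) cin star_hom_dist_le[OF R \<tau>]) auto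
      fix x y assume "x \<in> Z" "y \<in> Z"
      thus "x + y \<in> Z" using tendsto_add
        by (auto simp: Z_def Ri \<tau>h op_apply_plus cinner_add_left P_plus \<rho>h P_E intro!: tendsto_add)
    next
      fix x b assume x: "x \<in> E" and b: "b \<in> BB"
      have Pb: "P b \<in> E" by (intro P_E BR b)
      have xa: "adj x \<in> E" by (rule Ea[OF x])
      let ?\<zeta> = "\<lambda>n. op_apply (\<sigma> n (adj x)) \<eta>"
      have \<zeta>: "?\<zeta> \<longlonglongrightarrow> op_apply (\<rho> (adj x)) \<eta>" by (rule \<rho>_lim[OF xa])
      \<comment> \<open>Strong convergence of \<sigma> n (adj x) makes consecutive vectors merge,
        while the \<tau> n b stay bounded.\<close>
      have "(\<lambda>n. cinner (op_apply (\<tau> n b) \<xi>) (?\<zeta> (Suc n) - ?\<zeta> n)) \<longlonglongrightarrow> 0"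
      proof (rule Lim_null_comparison)
        show "\<forall>\<^sub>F n in sequentially. norm (cinner (op_apply (\<tau> n b) \<xi>) (?\<zeta> (Suc n) - ?\<zeta> n))
            \<le> norm b * norm \<xi> * norm (?\<zeta> (Suc n) - ?\<zeta> n)"
        proof (intro always_eventually allI)
          fix n
          have "norm (op_apply (\<tau> n b) \<xi>) \<le> norm b * norm \<xi>"
            by (rule order_trans[OF norm_op_apply_le mult_right_mono[OF \<tau>n[OF BR[OF b]] norm_ge_zero]])
          thus "norm (cinner (op_apply (\<tau> n b) \<xi>) (?\<zeta> (Suc n) - ?\<zeta> n)) \<le> norm b * norm \<xi> * norm (?\<zeta> (Suc n) - ?\<zeta> n)"
            by (rule order_trans[OF norm_cinner_le mult_right_mono[OF _ norm_ge_zero]])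
        qed
        have "(\<lambda>n. ?\<zeta> (Suc n) - ?\<zeta> n) \<longlonglongrightarrow> op_apply (\<rho> (adj x)) \<eta> - op_apply (\<rho> (adj x)) \<eta>"
          by (intro tendsto_diff \<zeta> LIMSEQ_Suc)
        thus "(\<lambda>n. norm b * norm \<xi> * norm (?\<zeta> (Suc n) - ?\<zeta> n)) \<longlonglongrightarrow> 0"
          by (intro tendsto_mult_right_zero tendsto_norm_zero) simp
      qed
      moreover have "(\<lambda>n. cinner (op_apply (\<tau> n b) \<xi>) (?\<zeta> n)) \<longlonglongrightarrow> cinner (op_apply (\<rho> (P b)) \<xi>) (op_apply (\<rho> (adj x)) \<eta>)"
      proof (rule Lim_transform_eventually)
        show "(\<lambda>n. cinner (op_apply (\<sigma> n (P b)) \<xi>) (?\<zeta> n)) \<longlonglongrightarrow> cinner (op_apply (\<rho> (P b)) \<xi>) (op_apply (\<rho> (adj x)) \<eta>)"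
          by (intro tendsto_cinner \<zeta> \<rho>_lim Pb)
        show "\<forall>\<^sub>F n in sequentially. cinner (op_apply (\<sigma> n (P b)) \<xi>) (?\<zeta> n) = cinner (op_apply (\<tau> n b) \<xi>) (?\<zeta> n)"
        proof (rule eventually_sequentiallyI[of k])
          fix n assume n: "k \<le> n"
          have p\<xi>: "op_apply (p n) \<xi> = \<xi>" using mono[OF n] \<xi> by (metis op_apply_times)
          have p\<zeta>: "op_apply (p n) (?\<zeta> n) = ?\<zeta> n" using p\<sigma>[OF xa] by (metis op_apply_times)
          have "cinner (op_apply (\<sigma> n (P b)) \<xi>) (?\<zeta> n) = cinner (op_apply (p n) (op_apply (\<tau> n b) (op_apply (p n) \<xi>))) (?\<zeta> n)"
            using comp[OF b, of n] by (metis op_apply_times)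
          also have "\<dots> = cinner (op_apply (\<tau> n b) \<xi>) (?\<zeta> n)" by (subst cinner_adj) (simp add: p p\<xi> p\<zeta>)
          finally show "cinner (op_apply (\<sigma> n (P b)) \<xi>) (?\<zeta> n) = cinner (op_apply (\<tau> n b) \<xi>) (?\<zeta> n)" .
        qed
      qed
      ultimately have "(\<lambda>n. cinner (op_apply (\<tau> n b) \<xi>) (?\<zeta> (Suc n) - ?\<zeta> n) + cinner (op_apply (\<tau> n b) \<xi>) (?\<zeta> n))
          \<longlonglongrightarrow> 0 + cinner (op_apply (\<rho> (P b)) \<xi>) (op_apply (\<rho> (adj x)) \<eta>)" by (rule tendsto_add)
      moreover have "cinner (op_apply (\<tau> n b) \<xi>) (?\<zeta> (Suc n) - ?\<zeta> n) + cinner (op_apply (\<tau> n b) \<xi>) (?\<zeta> n)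
          = cinner (op_apply (\<tau> n (\<pi> x * b)) \<xi>) \<eta>" for n
      proof -
        have "?\<zeta> (Suc n) = op_apply (adj (\<tau> n (\<pi> x))) \<eta>"
          using x by (simp add: \<sigma>\<tau> xa star_hom_onD(2)[OF \<pi>(1)] star_hom_onD(2)[OF \<tau>] \<pi>R)
        thus ?thesis using x b by (simp add: cinner_diff_right \<tau>h \<pi>R BR flip: cinner_adj)
      qed
      moreover have "cinner (op_apply (\<rho> (P b)) \<xi>) (op_apply (\<rho> (adj x)) \<eta>) = cinner (op_apply (\<rho> (P (\<pi> x * b))) \<xi>) \<eta>"
        using x Pb b by (simp add: P_module BR \<rho>h star_hom_onD(2)[OF \<rho>] flip: cinner_adj)
      ultimately show "\<pi> x * b \<in> Z" using x b by (simp add: Z_def Ri \<pi>R BR)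
    qed
    thus ?thesis using y by (auto simp: Z_def)
  qed
  \<comment> \<open>Arbitrary vectors are replaced by the limits \<xi>' and \<eta>' of their
    projections: \<sigma> n (P y) is unchanged by p n on either side, so in the limit \<rho> (P y)
    has the same matrix coefficients on \<xi>', \<eta>' as on \<xi>, \<eta>.\<close>
  have final: "\<rho> (P y) = 0" if y: "y \<in> R" "q y = 0" for y
  proof (rule bop_eqI, rule cinner_eqI_left)
    fix \<xi> \<eta>
    have Py: "P y \<in> E" by (rule P_E[OF y(1)])
    have pconv: "convergent (\<lambda>n. op_apply (p n) \<xi>)" for \<xi>
    proof (rule convergent_compression_operators[OF p mono])
      show "p n * p m * p n = p n" if "n \<le> m" for n m using mono'[OF that] p by simp
      show "norm (p n) \<le> 1" for n by (rule projection_bop_norm_le[OF p])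
    qed
    obtain \<xi>' \<eta>' where lims: "(\<lambda>n. op_apply (p n) \<xi>) \<longlonglongrightarrow> \<xi>'" "(\<lambda>n. op_apply (p n) \<eta>) \<longlonglongrightarrow> \<eta>'"
      using pconv[of \<xi>] pconv[of \<eta>] unfolding convergent_def by blast
    have idem: "op_apply (p n) (op_apply (p n) \<zeta>) = op_apply (p n) \<zeta>" for n \<zeta> using p(2) by (metis op_apply_times)
    have "cinner (op_apply (\<rho> (P y)) (op_apply (p n) \<xi>)) (op_apply (p n) \<eta>) = 0" for n
      using key[OF y(1) idem[of n \<xi>] idem[of n \<eta>]] \<tau>0[OF y] by (simp add: LIMSEQ_const_iff)
    moreover have "(\<lambda>n. cinner (op_apply (\<rho> (P y)) (op_apply (p n) \<xi>)) (op_apply (p n) \<eta>)) \<longlonglongrightarrow> cinner (op_apply (\<rho> (P y)) \<xi>') \<eta>'"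
      by (intro tendsto_cinner tendsto_op_apply lims)
    ultimately have 0: "cinner (op_apply (\<rho> (P y)) \<xi>') \<eta>' = 0" by (simp add: LIMSEQ_const_iff)
    have "(\<lambda>n. cinner (op_apply (\<sigma> n (P y)) (op_apply (p n) \<xi>)) (op_apply (p n) \<eta>)) \<longlonglongrightarrow> cinner (op_apply (\<rho> (P y)) \<xi>') \<eta>'"
      by (intro tendsto_cinner lims strong_tendsto_apply[OF \<rho>_lim[OF Py] \<sigma>n[OF Py]])
    moreover have "cinner (op_apply (\<sigma> n (P y)) (op_apply (p n) \<xi>)) (op_apply (p n) \<eta>) = cinner (op_apply (\<sigma> n (P y)) \<xi>) \<eta>" for n
    proof -
      have "cinner (op_apply (\<sigma> n (P y)) (op_apply (p n) \<xi>)) (op_apply (p n) \<eta>)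
          = cinner (op_apply (\<sigma> n (P y) * p n) \<xi>) (op_apply (adj (p n)) \<eta>)" by (simp add: p)
      also have "\<dots> = cinner (op_apply (p n * \<sigma> n (P y)) \<xi>) \<eta>"
        unfolding \<sigma>p[OF Py] cinner_adj[symmetric] by simp
      finally show ?thesis unfolding p\<sigma>[OF Py] .
    qed
    moreover have "(\<lambda>n. cinner (op_apply (\<sigma> n (P y)) \<xi>) \<eta>) \<longlonglongrightarrow> cinner (op_apply (\<rho> (P y)) \<xi>) \<eta>"
      by (intro tendsto_cinner_left \<rho>_lim Py)
    ultimately have "cinner (op_apply (\<rho> (P y)) \<xi>) \<eta> = cinner (op_apply (\<rho> (P y)) \<xi>') \<eta>'"
      using LIMSEQ_unique by simp
    thus "cinner (op_apply (\<rho> (P y)) \<xi>) \<eta> = cinner (op_apply 0 \<xi>) \<eta>" using 0 by simp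
  qed
  show ?thesis by (rule that[OF \<rho> comp0 final])
qed

text \<open>The space of \<open>E\<close> is embedded by using its own vectors as indices, and the
  identity representation is conjugated into the range of S 0, which leaves the other isometries
  free. As \<open>E\<close> may act degenerately, the initial projection is that of its essential
  subspace. The lists in the index type make room for all later steps.\<close>

lemma faithful_start:
  obtains S :: "nat \<Rightarrow> ((nat \<times> 'f bop) list \<times> 'e, complex) l2 bop" and p0 \<sigma>0
  where "\<And>k l. adj (S k) * S l = (if k = l then 1 else 0)" "chain_inv S 0 (p0, \<sigma>0)"
    "\<And>x. x \<in> E \<Longrightarrow> norm (\<sigma>0 x) = norm x"
proof -
  let ?M = "cspan {op_apply x \<zeta> |x \<zeta>. x \<in> E}"
  note M = closed_csubspace_cspan[of "{op_apply x \<zeta> |x \<zeta>. x \<in> E}"]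
  define pE where "pE = cproj ?M"
  note pr = cproj[OF M, folded pE_def]
  have EM: "op_apply x \<zeta> \<in> ?M" if "x \<in> E" for x \<zeta> using that by (intro cspan_superset) blast
  have xp: "x * pE = x" if x: "x \<in> E" for x
  proof -
    have "pE * adj x = adj x" by (rule bop_eqI) (simp add: pr(4)[OF EM[OF Ea[OF x]]])
    from arg_cong[OF this, of adj] show ?thesis by (simp add: pr(1))
  qed
  have n: "norm (j (e i)) \<le> 1" for i by (rule norm_je)
  have n': "norm pE \<le> 1" by (rule projection_bop_norm_le[OF pr(1,2)])
  have ndM: "((\<lambda>i. op_apply (j (e i)) \<zeta>) \<longlongrightarrow> op_apply pE \<zeta>) \<F>" if "\<zeta> \<in> ?M" for \<zeta>
  proof -
    have "?M \<subseteq> {\<zeta>. ((\<lambda>i. op_apply (j (e i)) \<zeta>) \<longlongrightarrow> op_apply pE \<zeta>) \<F>}"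
    proof (intro cspan_subset closed_csubspace_tendsto[OF n n'], clarify)
      fix x \<zeta> assume x: "x \<in> E"
      have "((\<lambda>i. op_apply (j (e i) * x) \<zeta>) \<longlongrightarrow> op_apply x \<zeta>) \<F>" by (intro tendsto_apply_at e_E x)
      thus "((\<lambda>i. op_apply (j (e i)) (op_apply x \<zeta>)) \<longlongrightarrow> op_apply pE (op_apply x \<zeta>)) \<F>"
        using pr(4)[OF EM[OF x]] by simp
    qed
    thus ?thesis using that by blast
  qed
  have nd: "((\<lambda>i. op_apply (j (e i)) \<zeta>) \<longlongrightarrow> op_apply pE \<zeta>) \<F>" for \<zeta>
  proof -
    have "op_apply (j (e i)) \<zeta> = op_apply (j (e i)) (op_apply pE \<zeta>)" for i
      using xp[OF jE[OF e(1)]] by (metis op_apply_times)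
    moreover have "op_apply pE (op_apply pE \<zeta>) = op_apply pE \<zeta>" using pr(2) by (metis op_apply_times)
    ultimately show ?thesis using ndM[OF pr(3)[of \<zeta>]] by simp
  qed
  \<comment> \<open>Prepending the number k to the list gives injections with disjoint ranges; the
    operator component is a dummy here.\<close>
  define s where "s = (\<lambda>(k::nat) (l, \<zeta>). ((k, 0 :: 'f bop) # l, \<zeta> :: 'e))"
  have s_inj: "k = l \<and> x = y" if "s k x = s l y" for k l x y using that by (auto simp: s_def split: prod.splits)
  obtain S :: "nat \<Rightarrow> ((nat \<times> 'f bop) list \<times> 'e, complex) l2 bop" where
    S: "\<And>k l. adj (S k) * S l = (if k = l then 1 else 0)" by (rule isometry_family[of s, OF s_inj]) (assumption, rule that)
  have "inj (\<lambda>\<zeta>::'e. ([] :: (nat \<times> 'f bop) list, \<zeta>))" by (simp add: inj_def)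
  then obtain V :: "'e \<Rightarrow> ((nat \<times> 'f bop) list \<times> 'e, complex) l2" where V: "bounded_clinear V"
    "\<And>x. hadj V (V x) = op_apply (cproj (cspan (range (\<lambda>x. x)))) x"
    by (rule isometric_embedding[where \<omega>="\<lambda>x. x"]) (rule that)
  have VV: "hadj V (V x) = x" for x
    unfolding V(2) by (rule cproj(4)[OF closed_csubspace_cspan]) (simp add: cspan_superset)
  interpret partial_isometry V 1 by unfold_locales (use V(1) VV in auto)
  note tm = isometry_transport(2)[OF refl]
  have ta: "adj (transport V a) = transport V (adj a)" for a by (rule transport_adj[OF V(1)])
  have SS: "adj (S 0) * S 0 = 1" by (simp add: S)
  define t where "t x = S 0 * transport V x * adj (S 0)" for x
  have t_mult: "t x * t y = t (x * y)" for x y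
  proof -
    have "t x * t y = S 0 * transport V x * (adj (S 0) * S 0) * transport V y * adj (S 0)" by (simp add: t_def mult.assoc)
    thus ?thesis by (simp add: SS t_def tm mult.assoc)
  qed
  have t_adj: "adj (t x) = t (adj x)" for x by (simp add: t_def ta mult.assoc)
  have "chain_inv S 0 (t pE, t)"
    unfolding chain_inv_def
  proof (simp, intro conjI allI ballI impI)
    show "adj (t pE) = t pE" "t pE * t pE = t pE" by (simp_all add: t_adj t_mult pr)
    show "star_hom_on E t"
      unfolding star_hom_on_def algebra_hom_on_def
      by (simp add: t_mult t_adj) (simp add: t_def transport_plus[OF V(1)] transport_scaleC[OF V(1)] distrib_left distrib_right)
    show "t x * t pE = t x" if "x \<in> E" for x using xp[OF that] by (simp add: t_mult)
    show "((\<lambda>i. op_apply (t (j (e i))) \<xi>) \<longlongrightarrow> op_apply (t pE) \<xi>) \<F>" for \<xi>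
      unfolding t_def op_apply_times transport_apply[OF V(1)]
      by (intro tendsto_op_apply bounded_linear.tendsto[OF bounded_clinearD(1)[OF V(1)]] nd)
    show "t pE * S k = 0" if "0 < k" for k using that S[of 0 k] by (simp add: t_def mult.assoc)
  qed
  moreover have "norm (t x) = norm x" for x
  proof (rule antisym)
    have nS: "norm (S 0) \<le> 1"
    proof -
      have "(norm (S 0))\<^sup>2 = norm (1 :: ((nat \<times> 'f bop) list \<times> 'e, complex) l2 bop)"
        using norm_adj_times[of "S 0"] by (simp add: SS)
      also have "\<dots> \<le> 1\<^sup>2" by (simp add: norm_bop_le)
      finally show ?thesis by (rule power2_le_imp_le) simp
    qed
    have three: "norm (a * b * c) \<le> norm b" if "norm a \<le> 1" "norm c \<le> 1"
      for a b c :: "((nat \<times> 'f bop) list \<times> 'e, complex) l2 bop"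
    proof -
      have "norm (a * b * c) \<le> norm a * norm b * norm c"
        using norm_mult_ineq[of "a * b" c] mult_right_mono[OF norm_mult_ineq[of a b] norm_ge_zero[of c]] by linarith
      also have "\<dots> \<le> 1 * norm b * 1" using that by (intro mult_mono) auto
      finally show ?thesis by simp
    qed
    show "norm (t x) \<le> norm x"
      unfolding t_def using three[of "S 0" "adj (S 0)" "transport V x"] nS norm_transport_le[of x] by simp
    have "adj (S 0) * t x * S 0 = (adj (S 0) * S 0) * transport V x * (adj (S 0) * S 0)" by (simp add: t_def mult.assoc)
    hence 1: "norm (transport V x) \<le> norm (t x)"
      using three[of "adj (S 0)" "S 0" "t x"] nS by (simp add: SS)
    thus "norm x \<le> norm (t x)" by (simp add: isometry_transport(3))
  qed
  ultimately show ?thesis using that[OF S, of "t pE" t] by simp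
qed

text \<open>The representation \<rho> is completely isometric on \<open>A\<close> because its
  compression to p0 is the faithful \<sigma>0. The universal property of the envelope then yields
  \<phi> with \<phi> (\<rho> x) = x on \<open>E\<close>. Since \<rho> (P (adj y * y)) vanishes for y
  in the kernel of q, so does P (adj y * y), and \<open>P\<close> is faithful.\<close>

theorem boundary_injective:
  assumes y: "y \<in> R" "q y = 0"
  shows "y = 0"
proof -
  obtain S :: "nat \<Rightarrow> ((nat \<times> 'f bop) list \<times> 'e, complex) l2 bop" and p0 \<sigma>0
    where S: "\<And>k l. adj (S k) * S l = (if k = l then 1 else 0)" and start: "chain_inv S 0 (p0, \<sigma>0)"
      and iso: "\<And>x. x \<in> E \<Longrightarrow> norm (\<sigma>0 x) = norm x"
    by (rule faithful_start) (rule that)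
  \<comment> \<open>The index type absorbs a further operator by prepending it to the list, now with
    a dummy number; so the dilation vectors fit into the same space.\<close>
  define c where "c = (\<lambda>(f :: 'f bop, (l, \<zeta>)). ((0::nat, f) # l, \<zeta> :: 'e))"
  have c: "inj c" by (auto simp: inj_def c_def)
  obtain p \<sigma> \<tau> where init: "p 0 = p0" "\<sigma> 0 = \<sigma>0" and inv: "\<And>n. chain_inv S n (p n, \<sigma> n)"
    and rel: "\<And>n. chain_rel (p n, \<sigma> n) (p (Suc n), \<sigma> (Suc n)) (\<tau> n)"
    by (rule chain_exists[OF S c start]) (rule that)
  obtain \<rho> :: "'e bop \<Rightarrow> ((nat \<times> 'f bop) list \<times> 'e, complex) l2 bop" where \<rho>: "star_hom_on E \<rho>"
    and comp: "\<And>a. a \<in> A \<Longrightarrow> p 0 * \<rho> (j a) * p 0 = \<sigma> 0 (j a)"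
    and \<rho>0: "\<And>y. y \<in> R \<Longrightarrow> q y = 0 \<Longrightarrow> \<rho> (P y) = 0"
    by (rule chain_limit[OF inv rel]) (rule that)
  have \<sigma>0: "star_hom_on E \<sigma>0" and p0: "adj p0 = p0" "p0 * p0 = p0" using start by (auto simp: chain_inv_def)
  note \<rho>h = star_homD[OF \<rho> cover(1)]
  have hom: "algebra_hom_on A (\<lambda>a. \<rho> (j a))"
    using cover(2) jE by (simp add: algebra_hom_on_def \<rho>h)
  have ci: "completely_isometric_on A (\<lambda>a. \<rho> (j a))"
    unfolding completely_isometric_on_def
  proof (intro allI impI)
    fix n and T :: "nat \<Rightarrow> nat \<Rightarrow> 'h bop" assume T: "\<forall>i<n. \<forall>k<n. T i k \<in> A"
    have jT: "matrix_norm n (\<lambda>i k. j (T i k)) = matrix_norm n T"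
      using cover(3) T unfolding completely_isometric_on_def by simp
    show "matrix_norm n (\<lambda>i k. \<rho> (j (T i k))) = matrix_norm n T"
    proof (rule antisym)
      show "matrix_norm n (\<lambda>i k. \<rho> (j (T i k))) \<le> matrix_norm n T"
        using star_hom_completely_contractive[OF cover(1) \<rho>] T jE
        unfolding completely_contractive_on_def jT[symmetric] by simp
      have "matrix_norm n T = matrix_norm n (\<lambda>i k. \<sigma>0 (j (T i k)))"
        using isometric_star_hom_completely_isometric[OF cover(1) \<sigma>0 iso] T jE
        unfolding completely_isometric_on_def jT[symmetric] by simp
      also have "\<dots> = norm (block {..<n} (\<lambda>i k. p0 * \<rho> (j (T i k)) * p0))"
        unfolding matrix_norm_eq using comp T init by (intro arg_cong[where f=norm] block_cong) simp
      also have "\<dots> \<le> matrix_norm n (\<lambda>i k. \<rho> (j (T i k)))"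
        unfolding matrix_norm_eq by (rule norm_block_compress) (simp_all add: projection_norm_le[OF p0])
      finally show "matrix_norm n T \<le> matrix_norm n (\<lambda>i k. \<rho> (j (T i k)))" .
    qed
  qed
  obtain \<phi> where \<phi>: "star_hom_on (generated_cstar_algebra ((\<lambda>a. \<rho> (j a)) ` A)) \<phi>"
    and \<phi>j: "\<And>a. a \<in> A \<Longrightarrow> \<phi> (\<rho> (j a)) = j a"
    by (rule cstar_envelope_universal[OF A env hom ci]) (rule that)
  let ?C = "generated_cstar_algebra ((\<lambda>a. \<rho> (j a)) ` A)"
  have sub: "\<rho> ` E \<subseteq> ?C"
  proof -
    have "\<rho> ` generated_cstar_algebra (j ` A) \<subseteq> ?C"
      by (rule star_hom_generated_subset[OF cover(1) \<rho> _ cstar_algebra_generated])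
         (auto intro: jE generated_cstar_superset)
    thus ?thesis using cover(4) by simp
  qed
  have comp_hom: "star_hom_on E (\<lambda>x. \<phi> (\<rho> x))" by (rule star_hom_compose[OF \<rho> \<phi> sub])
  have id_hom: "star_hom_on E (\<lambda>x. x)" by (simp add: star_hom_on_def algebra_hom_on_def)
  have inj: "\<phi> (\<rho> x) = x" if x: "x \<in> E" for x
    by (rule star_hom_eq_on_generated[OF cover(1) comp_hom id_hom, of "j ` A"])
       (use x cover(4) jE \<phi>j in auto)
  have Ry: "adj y * y \<in> R" using y by (intro Ri Ra)
  have "q (adj y * y) = 0" using y by (simp add: qh Ra)
  hence "\<rho> (P (adj y * y)) = 0" by (rule \<rho>0[OF Ry])
  hence "P (adj y * y) = \<phi> 0" using inj[OF P_E[OF Ry]] by simp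
  also have "\<dots> = 0" using star_homD(5)[OF \<phi> cstar_algebra_generated] .
  finally show ?thesis by (rule P_faithful[OF y(1)])
qed

end

section \<open>Crossed products through their matrix entries, and independence of the cover\<close>

section \<open>Crossed products\<close>

subsection \<open>Operators with given matrix entries\<close>

lemma l2_restrict_projection: "adj (l2_restrict D) = l2_restrict D" "l2_restrict D * l2_restrict D = l2_restrict D"
proof -
  have e: "l2_entry (l2_restrict D) x y = (if x = y \<and> x \<in> D then 1 else 0)" for x y
    by (rule bop_eqI) (simp add: l2_entry_apply Rep_l2_restrict Rep_l2_single)
  show "adj (l2_restrict D) = l2_restrict D"
    by (rule l2_entry_eqI) (auto simp: l2_entry_adj e)
  show "l2_restrict D * l2_restrict D = l2_restrict D"
    by (rule bop_eqI, rule l2_eqI) (simp add: Rep_l2_restrict)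
qed

lemma l2_restrict_column: "finite D \<Longrightarrow> op_apply (l2_restrict D) f = column D (Rep_l2 f)"
  by (rule l2_eqI) (simp add: Rep_l2_restrict Rep_l2_column)

lemma l2_restrict_tendsto: "((\<lambda>D. op_apply (l2_restrict D) f) \<longlongrightarrow> f) (finite_subsets_at_top UNIV)"
proof -
  let ?F = "finite_subsets_at_top UNIV"
  have "((\<lambda>D. \<Sum>t\<in>D. (norm (Rep_l2 f t))\<^sup>2) \<longlongrightarrow> (norm f)\<^sup>2) ?F"
    using has_sum_infsum[OF Rep_l2_summable[of f]] unfolding norm_l2_square has_sum_def .
  moreover have "\<forall>\<^sub>F D in ?F. (\<Sum>t\<in>D. (norm (Rep_l2 f t))\<^sup>2) = (norm (op_apply (l2_restrict D) f))\<^sup>2"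
    by (rule eventually_finite_subsets_at_top_weakI) (simp add: l2_restrict_column norm_column)
  ultimately have "((\<lambda>D. (norm (op_apply (l2_restrict D) f))\<^sup>2) \<longlongrightarrow> (norm f)\<^sup>2) ?F" by (rule Lim_transform_eventually)
  from tendsto_diff[OF tendsto_const this, of "(norm f)\<^sup>2"]
  have "((\<lambda>D. (norm (f - op_apply (l2_restrict D) f))\<^sup>2) \<longlongrightarrow> 0) ?F"
    unfolding projection_Pythagoras[OF l2_restrict_projection] by simp
  from tendsto_real_sqrt[OF this] have "((\<lambda>D. norm (f - op_apply (l2_restrict D) f)) \<longlongrightarrow> 0) ?F" by simp
  hence "((\<lambda>D. f - op_apply (l2_restrict D) f) \<longlongrightarrow> 0) ?F" by (rule tendsto_norm_zero_cancel)
  from tendsto_diff[OF tendsto_const this, of f] show ?thesis by simp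
qed

lemma Rep_l2_column_apply:
  assumes "finite D"
  shows "Rep_l2 (op_apply T (column D \<eta>)) s = (\<Sum>t\<in>D. op_apply (l2_entry T s t) (\<eta> t))"
  unfolding column_def op_apply_sum_right Rep_l2_sum l2_entry_apply ..

lemma norm_restrict_columns:
  assumes D: "finite D"
  shows "(\<Sum>i\<in>N. (norm (op_apply (l2_restrict D) (\<Sum>j\<in>N. op_apply (T i j) (column D (\<eta> j)))))\<^sup>2)
    = (\<Sum>u\<in>N \<times> D. (norm (\<Sum>w\<in>N \<times> D. op_apply (l2_entry (T (fst u) (fst w)) (snd u) (snd w)) (\<eta> (fst w) (snd w))))\<^sup>2)"
  unfolding sum.cartesian_product' l2_restrict_column[OF D] norm_column[OF D] Rep_l2_sum Rep_l2_column_apply[OF D]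
  by simp

text \<open>Complete contractivity only speaks of finite matrices over \<open>X\<close>. Cutting all
  operators to a finite set D of coordinates produces such a matrix over N \<times> D, and the
  estimate survives as D grows. This compares two operators through their entries alone.\<close>

lemma norm_block_entries_le:
  fixes T :: "'n \<Rightarrow> 'n \<Rightarrow> ('x, 'h::complex_hilbert) l2 bop" and S :: "'n \<Rightarrow> 'n \<Rightarrow> ('x, 'k::complex_hilbert) l2 bop"
  assumes N: "finite N" and \<theta>: "completely_contractive_on X \<theta>"
    and T: "\<And>i j s t. i \<in> N \<Longrightarrow> j \<in> N \<Longrightarrow> l2_entry (T i j) s t \<in> X"
    and S: "\<And>i j s t. i \<in> N \<Longrightarrow> j \<in> N \<Longrightarrow> l2_entry (S i j) s t = \<theta> (l2_entry (T i j) s t)"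
  shows "norm (block N S) \<le> norm (block N T)"
proof -
  define K where "K = norm (block N T)"
  have K: "K \<ge> 0" by (simp add: K_def)
  let ?r = "\<lambda>D. op_apply (l2_restrict D)"
  let ?F = "finite_subsets_at_top UNIV"
  have fin: "(\<Sum>i\<in>N. (norm (?r D (\<Sum>j\<in>N. op_apply (S i j) (column D (\<eta> j)))))\<^sup>2)
      \<le> K\<^sup>2 * (\<Sum>j\<in>N. (norm (column D (\<eta> j)))\<^sup>2)" if D: "finite D" for D \<eta>
  proof -
    have ND: "finite (N \<times> D)" using N D by simp
    let ?eT = "\<lambda>u w. l2_entry (T (fst u) (fst w)) (snd u) (snd w)"
    have c: "(\<Sum>u\<in>N \<times> D. (norm (\<eta> (fst u) (snd u)))\<^sup>2) = (\<Sum>j\<in>N. (norm (column D (\<eta> j)))\<^sup>2)" for \<eta> :: "'n \<Rightarrow> 'x \<Rightarrow> 'z::complex_hilbert"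
      unfolding sum.cartesian_product' norm_column[OF D] by simp
    have S_block: "block (N \<times> D) (\<lambda>u w. \<theta> (?eT u w)) = block (N \<times> D) (\<lambda>u w. l2_entry (S (fst u) (fst w)) (snd u) (snd w))"
      by (rule block_cong) (auto simp: S)
    have "norm (block (N \<times> D) ?eT) \<le> K"
      unfolding norm_block_le_iff[OF ND K]
    proof
      fix \<xi> :: "'n \<times> 'x \<Rightarrow> 'h"
      define \<eta> where "\<eta> j t = \<xi> (j, t)" for j t
      have "(\<Sum>u\<in>N \<times> D. (norm (\<Sum>w\<in>N \<times> D. op_apply (?eT u w) (\<xi> w)))\<^sup>2)
          = (\<Sum>i\<in>N. (norm (?r D (\<Sum>j\<in>N. op_apply (T i j) (column D (\<eta> j)))))\<^sup>2)"
        unfolding norm_restrict_columns[OF D] by (simp add: \<eta>_def)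
      also have "\<dots> \<le> (\<Sum>i\<in>N. (norm (\<Sum>j\<in>N. op_apply (T i j) (column D (\<eta> j))))\<^sup>2)"
        by (intro sum_mono power_mono norm_l2_restrict_le norm_ge_zero)
      also have "\<dots> \<le> K\<^sup>2 * (\<Sum>j\<in>N. (norm (column D (\<eta> j)))\<^sup>2)"
        unfolding K_def by (rule norm_block_le_iff[OF N norm_ge_zero, THEN iffD1, OF order_refl, rule_format])
      finally show "(\<Sum>u\<in>N \<times> D. (norm (\<Sum>w\<in>N \<times> D. op_apply (?eT u w) (\<xi> w)))\<^sup>2) \<le> K\<^sup>2 * (\<Sum>u\<in>N \<times> D. (norm (\<xi> u))\<^sup>2)"
        unfolding c[symmetric] by (simp add: \<eta>_def)
    qed
    moreover have "norm (block (N \<times> D) (\<lambda>u w. \<theta> (?eT u w))) \<le> norm (block (N \<times> D) ?eT)"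
      by (rule completely_contractive_block[OF \<theta> ND]) (auto intro: T)
    ultimately have "norm (block (N \<times> D) (\<lambda>u w. l2_entry (S (fst u) (fst w)) (snd u) (snd w))) \<le> K"
      unfolding S_block by linarith
    from norm_block_le_iff[OF ND K, THEN iffD1, OF this, rule_format, of "\<lambda>u. \<eta> (fst u) (snd u)"]
    show ?thesis unfolding norm_restrict_columns[OF D] c .
  qed
  show ?thesis
    unfolding K_def[symmetric] norm_block_le_iff[OF N K]
  proof
    fix f :: "'n \<Rightarrow> ('x, 'k) l2"
    have lim: "((\<lambda>D. ?r D (\<Sum>j\<in>N. op_apply (S i j) (?r D (f j)))) \<longlongrightarrow> (\<Sum>j\<in>N. op_apply (S i j) (f j))) ?F" for i
    proof -
      let ?g = "\<Sum>j\<in>N. op_apply (S i j) (f j)" and ?h = "\<lambda>D. \<Sum>j\<in>N. op_apply (S i j) (?r D (f j))"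
      have "(?h \<longlongrightarrow> ?g) ?F" by (intro tendsto_sum tendsto_op_apply l2_restrict_tendsto)
      hence "((\<lambda>D. ?h D - ?g) \<longlongrightarrow> 0) ?F" by (rule LIM_zero)
      from tendsto_norm_zero[OF this] have "((\<lambda>D. ?r D (?h D - ?g)) \<longlongrightarrow> 0) ?F"
        by (rule Lim_null_comparison[rotated]) (simp add: norm_l2_restrict_le)
      from tendsto_add[OF this l2_restrict_tendsto[of ?g]] show ?thesis by (simp add: op_apply_diff)
    qed
    have "((\<lambda>D. \<Sum>i\<in>N. (norm (?r D (\<Sum>j\<in>N. op_apply (S i j) (?r D (f j)))))\<^sup>2)
        \<longlongrightarrow> (\<Sum>i\<in>N. (norm (\<Sum>j\<in>N. op_apply (S i j) (f j)))\<^sup>2)) ?F"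
      by (intro tendsto_sum tendsto_power tendsto_norm lim)
    moreover have "\<forall>\<^sub>F D in ?F. (\<Sum>i\<in>N. (norm (?r D (\<Sum>j\<in>N. op_apply (S i j) (?r D (f j)))))\<^sup>2) \<le> K\<^sup>2 * (\<Sum>j\<in>N. (norm (f j))\<^sup>2)"
    proof (rule eventually_finite_subsets_at_top_weakI)
      fix D :: "'x set" assume D: "finite D"
      have "(\<Sum>i\<in>N. (norm (?r D (\<Sum>j\<in>N. op_apply (S i j) (?r D (f j)))))\<^sup>2) \<le> K\<^sup>2 * (\<Sum>j\<in>N. (norm (?r D (f j)))\<^sup>2)"
        using fin[OF D, of "\<lambda>j. Rep_l2 (f j)"] by (simp add: l2_restrict_column[OF D])
      also have "\<dots> \<le> K\<^sup>2 * (\<Sum>j\<in>N. (norm (f j))\<^sup>2)"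
        by (intro mult_left_mono sum_mono power_mono norm_l2_restrict_le) auto
      finally show "(\<Sum>i\<in>N. (norm (?r D (\<Sum>j\<in>N. op_apply (S i j) (?r D (f j)))))\<^sup>2) \<le> K\<^sup>2 * (\<Sum>j\<in>N. (norm (f j))\<^sup>2)" .
    qed
    ultimately show "(\<Sum>i\<in>N. (norm (\<Sum>j\<in>N. op_apply (S i j) (f j)))\<^sup>2) \<le> K\<^sup>2 * (\<Sum>j\<in>N. (norm (f j))\<^sup>2)"
      by (rule tendsto_upperbound) simp
  qed
qed

subsection \<open>Algebras of crossed sums\<close>

lemma crossed_sumsI: "finite S \<Longrightarrow> (\<And>g. g \<in> S \<Longrightarrow> a g \<in> X) \<Longrightarrow> (\<Sum>g\<in>S. \<pi> (a g) * U g) \<in> crossed_sums X \<pi> U"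
  unfolding crossed_sums_def by blast

lemma crossed_sums_monomial: "x \<in> X \<Longrightarrow> \<pi> x * U g \<in> crossed_sums X \<pi> U"
  using crossed_sumsI[of "{g}" "\<lambda>_. x" X \<pi> U] by simp

lemma crossed_sums_induct [consumes 1, case_names zero plus]:
  assumes "y \<in> crossed_sums X \<pi> U" "Q 0" "\<And>x g y. x \<in> X \<Longrightarrow> y \<in> crossed_sums X \<pi> U \<Longrightarrow> Q y \<Longrightarrow> Q (\<pi> x * U g + y)"
  shows "Q y"
proof -
  obtain S a where S: "finite S" "\<forall>g\<in>S. a g \<in> X" "y = (\<Sum>g\<in>S. \<pi> (a g) * U g)"
    using assms(1) unfolding crossed_sums_def by blast
  have "Q (\<Sum>g\<in>S. \<pi> (a g) * U g)"
    using S(1,2) by (induction S) (auto intro: assms(2,3) crossed_sumsI)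
  thus ?thesis using S by simp
qed

locale covariant_system =
  fixes C :: "'k::complex_hilbert bop set" and \<gamma> :: "'g::group_add \<Rightarrow> 'k bop \<Rightarrow> 'k bop"
    and \<pi> :: "'k bop \<Rightarrow> 'u::complex_hilbert bop" and U :: "'g \<Rightarrow> 'u bop"
  assumes C: "cstar_algebra C" and \<gamma>: "cstar_action C \<gamma>" and cov: "covariant_rep C \<gamma> \<pi> U"
begin

lemmas Ci = cstarD[OF C]
lemmas Ca = cstar_algebraD(2)[OF C]

lemma \<pi>: "star_hom_on C \<pi>" using cov by (simp add: covariant_rep_def)
lemmas \<pi>h = star_homD[OF \<pi> C]
lemmas \<pi>a = star_hom_onD(2)[OF \<pi>]

lemma \<gamma>_hom: "star_hom_on C (\<gamma> s)" and \<gamma>_bij: "bij_betw (\<gamma> s) C C"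
  and \<gamma>_plus: "c \<in> C \<Longrightarrow> \<gamma> (s + t) c = \<gamma> s (\<gamma> t c)"
  using \<gamma> by (auto simp: cstar_action_def)
lemma \<gamma>C: "c \<in> C \<Longrightarrow> \<gamma> s c \<in> C" using \<gamma>_bij[of s] by (auto simp: bij_betw_def)
lemmas \<gamma>h = star_homD[OF \<gamma>_hom C]

lemma \<gamma>_zero: "c \<in> C \<Longrightarrow> \<gamma> 0 c = c"
  using \<gamma>_plus[of c 0 0] \<gamma>_bij[of 0] \<gamma>C[of c 0] by (auto simp: bij_betw_def inj_on_def)

lemma U_plus: "U (s + t) = U s * U t" and U_unitary: "U s * adj (U s) = 1" "adj (U s) * U s = 1"
  and U_cov: "c \<in> C \<Longrightarrow> U s * \<pi> c * adj (U s) = \<pi> (\<gamma> s c)"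
  using cov by (auto simp: covariant_rep_def unitary_def)

lemma U_zero: "U 0 = 1"
proof -
  have "U 0 * (U 0 * adj (U 0)) = U 0 * adj (U 0)" using U_plus[of 0 0] by (simp flip: mult.assoc)
  thus ?thesis by (simp add: U_unitary)
qed

lemma U_adj: "adj (U s) = U (- s)"
proof -
  have "adj (U s) = adj (U s) * (U s * U (- s))" using U_plus[of s "- s"] by (simp add: U_zero)
  thus ?thesis by (simp add: U_unitary flip: mult.assoc)
qed

lemma U_\<pi>: "c \<in> C \<Longrightarrow> U s * \<pi> c = \<pi> (\<gamma> s c) * U s"
  using U_cov[of c s, symmetric] by (simp add: mult.assoc U_unitary)

lemma monomial_times:
  assumes "a \<in> C" "b \<in> C"
  shows "(\<pi> a * U g) * (\<pi> b * U h) = \<pi> (a * \<gamma> g b) * U (g + h)"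
proof -
  have "(\<pi> a * U g) * (\<pi> b * U h) = \<pi> a * (U g * \<pi> b) * U h" by (simp add: mult.assoc)
  thus ?thesis using assms by (simp add: U_\<pi> \<pi>h \<gamma>C U_plus mult.assoc)
qed

lemma monomial_adj:
  assumes "a \<in> C"
  shows "adj (\<pi> a * U g) = \<pi> (\<gamma> (- g) (adj a)) * U (- g)"
  using assms by (simp add: U_adj U_\<pi> Ca flip: \<pi>a)

context
  fixes X assumes X: "X \<subseteq> C" "0 \<in> X" "\<And>a b. a \<in> X \<Longrightarrow> b \<in> X \<Longrightarrow> a + b \<in> X"
begin

lemma crossed_sums_zero: "0 \<in> crossed_sums X \<pi> U"
  using crossed_sumsI[of "{}" undefined X \<pi> U] by simp

lemma crossed_sums_plus:
  assumes "y \<in> crossed_sums X \<pi> U" "z \<in> crossed_sums X \<pi> U"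
  shows "y + z \<in> crossed_sums X \<pi> U"
proof -
  obtain S a where S: "finite S" "\<forall>g\<in>S. a g \<in> X" "y = (\<Sum>g\<in>S. \<pi> (a g) * U g)"
    using assms(1) unfolding crossed_sums_def by blast
  obtain S' a' where S': "finite S'" "\<forall>g\<in>S'. a' g \<in> X" "z = (\<Sum>g\<in>S'. \<pi> (a' g) * U g)"
    using assms(2) unfolding crossed_sums_def by blast
  let ?b = "\<lambda>g. (if g \<in> S then a g else 0)" let ?b' = "\<lambda>g. (if g \<in> S' then a' g else 0)"
  have b: "?b g \<in> X" "?b' g \<in> X" for g using S(2) S'(2) X(2) by auto
  have "y = (\<Sum>g\<in>S \<union> S'. \<pi> (?b g) * U g)" unfolding S(3) using S(1) S'(1)
    by (intro sum.mono_neutral_cong_left) (auto simp: \<pi>h)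
  moreover have "z = (\<Sum>g\<in>S \<union> S'. \<pi> (?b' g) * U g)" unfolding S'(3) using S(1) S'(1)
    by (intro sum.mono_neutral_cong_left) (auto simp: \<pi>h)
  ultimately have "y + z = (\<Sum>g\<in>S \<union> S'. \<pi> (?b g + ?b' g) * U g)"
    using b[THEN subsetD[OF X(1)]] by (simp only: \<pi>h(1) sum.distrib distrib_right)
  thus ?thesis using S(1) S'(1) b X(3) by (auto intro!: crossed_sumsI)
qed

lemma crossed_sums_times:
  assumes mult: "\<And>a b. a \<in> X \<Longrightarrow> b \<in> X \<Longrightarrow> a * b \<in> X" and inv: "\<And>g a. a \<in> X \<Longrightarrow> \<gamma> g a \<in> X"
    and y: "y \<in> crossed_sums X \<pi> U" and z: "z \<in> crossed_sums X \<pi> U"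
  shows "y * z \<in> crossed_sums X \<pi> U"
  using y
proof (induction y rule: crossed_sums_induct)
  case (plus a g y)
  have "\<pi> a * U g * z \<in> crossed_sums X \<pi> U"
    using z
  proof (induction z rule: crossed_sums_induct)
    case (plus b h z)
    have "\<pi> a * U g * (\<pi> b * U h) \<in> crossed_sums X \<pi> U"
      using plus(1) \<open>a \<in> X\<close> X(1) by (subst monomial_times) (auto intro!: crossed_sums_monomial mult inv)
    thus ?case using plus(3) by (simp add: distrib_left crossed_sums_plus)
  qed (simp add: crossed_sums_zero)
  thus ?case using plus by (simp add: distrib_right crossed_sums_plus)
qed (simp add: crossed_sums_zero)

lemma crossed_sums_scaleC:
  assumes "\<And>c a. a \<in> X \<Longrightarrow> c *\<^sub>C a \<in> X" "y \<in> crossed_sums X \<pi> U"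
  shows "c *\<^sub>C y \<in> crossed_sums X \<pi> U"
  using assms(2)
proof (induction y rule: crossed_sums_induct)
  case (plus a g y)
  have "c *\<^sub>C (\<pi> a * U g) = \<pi> (c *\<^sub>C a) * U g" using plus(1) X(1) by (simp add: \<pi>h subset_iff)
  thus ?case using plus assms(1) by (simp add: scaleC_add_right crossed_sums_plus crossed_sums_monomial)
qed (simp add: crossed_sums_zero)

lemma crossed_sums_adj:
  assumes "\<And>a. a \<in> X \<Longrightarrow> adj a \<in> X" "\<And>g a. a \<in> X \<Longrightarrow> \<gamma> g a \<in> X" "y \<in> crossed_sums X \<pi> U"
  shows "adj y \<in> crossed_sums X \<pi> U"
  using assms(3)
proof (induction y rule: crossed_sums_induct)
  case (plus a g y)
  have "adj (\<pi> a * U g) \<in> crossed_sums X \<pi> U"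
    using plus(1) X(1) by (subst monomial_adj) (auto intro!: crossed_sums_monomial assms)
  thus ?case using plus(3) by (simp only: adj_plus crossed_sums_plus)
qed (simp add: crossed_sums_zero)

end

lemma operator_algebra_crossed_product:
  assumes X: "operator_algebra X" "X \<subseteq> C" "\<And>g a. a \<in> X \<Longrightarrow> \<gamma> g a \<in> X"
  shows "operator_algebra (crossed_product X \<pi> U)"
  unfolding crossed_product_def
  by (intro operator_algebra_closure crossed_sums_zero crossed_sums_plus crossed_sums_times crossed_sums_scaleC
      operator_algebraD[OF X(1)] X(2,3))

text \<open>As \<open>X\<close> is invariant under the action, products of crossed sums are crossed
  sums, so the generated closed algebra is just their closure.\<close>

lemma generated_algebra_crossed_sums:
  assumes X: "operator_algebra X" "X \<subseteq> C" "\<And>g a. a \<in> X \<Longrightarrow> \<gamma> g a \<in> X"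
  shows "generated_algebra (crossed_sums X \<pi> U) = crossed_product X \<pi> U"
proof
  show "generated_algebra (crossed_sums X \<pi> U) \<subseteq> crossed_product X \<pi> U"
    by (rule generated_algebra_subset[OF operator_algebra_crossed_product[OF X]])
       (simp_all add: crossed_product_def closure_subset)
  show "crossed_product X \<pi> U \<subseteq> generated_algebra (crossed_sums X \<pi> U)"
    unfolding crossed_product_def
    by (intro closure_minimal operator_algebraD(1)[OF operator_algebra_generated])
       (auto intro: generated_algebra_superset)
qed

lemma cstar_algebra_crossed_product: "cstar_algebra (crossed_product C \<pi> U)"
  unfolding crossed_product_def
  by (intro cstar_algebra_closure crossed_sums_zero crossed_sums_plus crossed_sums_times crossed_sums_scaleC
      crossed_sums_adj Ci Ca \<gamma>C order_refl)

lemma \<gamma>_norm: "c \<in> C \<Longrightarrow> norm (\<gamma> s c) \<le> norm c" by (rule star_hom_contractive[OF C \<gamma>_hom])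
lemma \<pi>_norm: "c \<in> C \<Longrightarrow> norm (\<pi> c) \<le> norm c" by (rule star_hom_contractive[OF C \<pi>])

end

subsection \<open>The regular representation\<close>

lemma l2_shift_plus: "l2_shift (s + t) = l2_shift s * l2_shift t"
  by (rule bop_eqI, rule l2_eqI) (simp only: op_apply_times Rep_l2_shift minus_add add.assoc)

lemma l2_shift_zero: "l2_shift 0 = 1"
  by (rule bop_eqI, rule l2_eqI) (simp add: Rep_l2_shift)

lemma l2_entry_shift: "l2_entry (l2_shift g) s t = (if - g + s = t then 1 else 0)"
  by (rule bop_eqI) (simp add: l2_entry_apply Rep_l2_shift Rep_l2_single)

lemma l2_shift_adj: "adj (l2_shift s) = l2_shift (- s)"
proof (rule l2_entry_eqI)
  fix x y
  have "- s + y = x \<longleftrightarrow> s + x = y" by (metis add.assoc add.left_neutral left_minus right_minus)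
  thus "l2_entry (adj (l2_shift s)) x y = l2_entry (l2_shift (- s)) x y"
    by (simp add: l2_entry_adj l2_entry_shift)
qed

locale regular_system =
  fixes C :: "'k::complex_hilbert bop set" and \<gamma> :: "'g::group_add \<Rightarrow> 'k bop \<Rightarrow> 'k bop"
  assumes C': "cstar_algebra C" and \<gamma>': "cstar_action C \<gamma>"
begin

lemma regular_bounded: 
  assumes c: "c \<in> C"
  shows "bounded (range (\<lambda>t. \<gamma> (- t) c))"
proof (rule boundedI[where B="norm c"])
  fix x assume "x \<in> range (\<lambda>t. \<gamma> (- t) c)"
  thus "norm x \<le> norm c" using star_hom_contractive[OF C' _ c] \<gamma>' by (auto simp: cstar_action_def)
qed

lemma Rep_l2_regular: "c \<in> C \<Longrightarrow> Rep_l2 (op_apply (regular_rep \<gamma> c) f) t = op_apply (\<gamma> (- t) c) (Rep_l2 f t)"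
  unfolding regular_rep_def by (rule Rep_l2_diag[OF regular_bounded])

lemma l2_entry_regular: "c \<in> C \<Longrightarrow> l2_entry (regular_rep \<gamma> c) s t = (if s = t then \<gamma> (- s) c else 0)"
  by (rule bop_eqI) (simp add: l2_entry_apply Rep_l2_regular Rep_l2_single)

lemma l2_entry_regular_shift:
  "c \<in> C \<Longrightarrow> l2_entry (regular_rep \<gamma> c * l2_shift g) s t = (if - g + s = t then \<gamma> (- s) c else 0)"
  by (rule bop_eqI) (simp add: l2_entry_apply Rep_l2_regular Rep_l2_shift Rep_l2_single)

sublocale covariant_system C \<gamma> "regular_rep \<gamma>" l2_shift
proof
  note Ci = cstarD[OF C'] and Ca = cstar_algebraD(2)[OF C']
  have \<gamma>_hom: "star_hom_on C (\<gamma> s)" and \<gamma>C: "c \<in> C \<Longrightarrow> \<gamma> s c \<in> C" and \<gamma>_plus: "c \<in> C \<Longrightarrow> \<gamma> (s + t) c = \<gamma> s (\<gamma> t c)" for s t c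
    using \<gamma>' by (auto simp: cstar_action_def bij_betw_def)
  note \<gamma>h = star_homD[OF \<gamma>_hom C']
  have "star_hom_on C (regular_rep \<gamma>)"
    unfolding star_hom_on_def algebra_hom_on_def
  proof (intro conjI ballI allI)
    fix a b assume ab: "a \<in> C" "b \<in> C"
    show "regular_rep \<gamma> (a + b) = regular_rep \<gamma> a + regular_rep \<gamma> b"
      by (rule l2_entry_eqI) (simp add: l2_entry_plus l2_entry_regular ab Ci \<gamma>h)
    show "regular_rep \<gamma> (a * b) = regular_rep \<gamma> a * regular_rep \<gamma> b"
      by (rule bop_eqI, rule l2_eqI) (simp add: Rep_l2_regular ab Ci \<gamma>h)
  next
    fix c a assume a: "a \<in> C"
    show "regular_rep \<gamma> (c *\<^sub>C a) = c *\<^sub>C regular_rep \<gamma> a"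
      by (rule l2_entry_eqI) (simp add: l2_entry_scaleC l2_entry_regular a Ci \<gamma>h)
  next
    fix a assume a: "a \<in> C"
    show "regular_rep \<gamma> (adj a) = adj (regular_rep \<gamma> a)"
      by (rule l2_entry_eqI) (auto simp: l2_entry_adj l2_entry_regular a Ca star_hom_onD(2)[OF \<gamma>_hom])
  qed
  moreover have "l2_shift s * regular_rep \<gamma> c * adj (l2_shift s) = regular_rep \<gamma> (\<gamma> s c)" if c: "c \<in> C" for s c
  proof (rule bop_eqI, rule l2_eqI)
    fix f t
    have "\<gamma> (- (- s + t)) c = \<gamma> (- t) (\<gamma> s c)" using \<gamma>_plus[OF c, of "- t" s] by (simp add: minus_add)
    thus "Rep_l2 (op_apply (l2_shift s * regular_rep \<gamma> c * adj (l2_shift s)) f) t = Rep_l2 (op_apply (regular_rep \<gamma> (\<gamma> s c)) f) t"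
      using c by (simp add: l2_shift_adj Rep_l2_shift Rep_l2_regular \<gamma>C flip: add.assoc)
  qed
  moreover have "unitary (l2_shift s)" for s :: 'g
    by (simp add: unitary_def l2_shift_adj l2_shift_zero flip: l2_shift_plus)
  ultimately show "covariant_rep C \<gamma> (regular_rep \<gamma>) l2_shift"
    unfolding covariant_rep_def by (intro conjI allI ballI) (auto intro: l2_shift_plus)
qed (rule C' \<gamma>')+

end

subsection \<open>Approximate units\<close>

text \<open>Put \<eta> = adj a \<xi>. Contractivity of u bounds the squared norm of \<eta> - u
  \<eta> by twice the real part of the inner product of \<eta> with \<eta> - u \<eta>, and moving
  \<open>adj a\<close> across turns this into the inner product of \<xi> with (a - a u)
  \<eta>.\<close>

lemma approximate_unit_adj_estimate:
  assumes "norm u \<le> 1"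
  shows "(norm (u * adj a - adj a))\<^sup>2 \<le> 2 * norm a * norm (a * u - a)"
proof -
  define K where "K = 2 * norm a * norm (a * u - a)"
  have "norm (u * adj a - adj a) \<le> sqrt K"
  proof (rule norm_bop_le)
    fix \<xi>
    let ?\<eta> = "op_apply (adj a) \<xi>"
    have "norm (op_apply u ?\<eta>) \<le> 1 * norm ?\<eta>"
      using assms by (intro order_trans[OF norm_op_apply_le] mult_right_mono) auto
    hence "(norm (op_apply u ?\<eta>))\<^sup>2 \<le> (norm ?\<eta>)\<^sup>2" by (simp add: power_mono)
    hence "(norm (?\<eta> - op_apply u ?\<eta>))\<^sup>2 \<le> 2 * Re (cinner ?\<eta> ?\<eta>) - 2 * Re (cinner ?\<eta> (op_apply u ?\<eta>))"
      unfolding norm_minus_square Re_cinner_self by linarith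
    also have "\<dots> = 2 * Re (cinner \<xi> (op_apply (- (a * u - a)) ?\<eta>))"
      unfolding cinner_adj_left by (simp add: op_apply_simps cinner_diff_right)
    also have "\<dots> \<le> 2 * (norm \<xi> * norm (op_apply (- (a * u - a)) ?\<eta>))" using Re_cinner_le by simp
    also have "norm (op_apply (- (a * u - a)) ?\<eta>) \<le> norm (a * u - a) * (norm a * norm \<xi>)"
      by (intro order_trans[OF norm_op_apply_le] mult_mono order_trans[OF norm_op_apply_le[of "adj a"]])
        (auto simp: norm_minus_commute)
    finally have "(norm (op_apply (u * adj a - adj a) \<xi>))\<^sup>2 \<le> K * (norm \<xi>)\<^sup>2"
      by (simp add: op_apply_simps norm_minus_commute K_def power2_eq_square mult_right_mono mult_ac)
    from real_sqrt_le_mono[OF this] show "norm (op_apply (u * adj a - adj a) \<xi>) \<le> sqrt K * norm \<xi>"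
      by (simp add: real_sqrt_mult)
  qed (simp add: K_def)
  from power_mono[OF this norm_ge_zero, of 2] show ?thesis by (simp add: K_def)
qed

lemma approximate_unit_adj_tendsto:
  assumes "\<And>i. norm (u i) \<le> 1" "((\<lambda>i. a * u i) \<longlongrightarrow> a) F"
  shows "((\<lambda>i. u i * adj a) \<longlongrightarrow> adj a) F"
proof -
  have "((\<lambda>i. sqrt (2 * norm a * norm (a * u i - a))) \<longlongrightarrow> sqrt (2 * norm a * norm (a - a))) F"
    by (intro tendsto_intros assms(2))
  hence "((\<lambda>i. sqrt (2 * norm a * norm (a * u i - a))) \<longlongrightarrow> 0) F" by simp
  hence "((\<lambda>i. u i * adj a - adj a) \<longlongrightarrow> 0) F"
    by (rule Lim_null_comparison[OF always_eventually, rotated])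
       (intro allI real_le_rsqrt approximate_unit_adj_estimate assms(1))
  thus ?thesis by (rule LIM_zero_cancel)
qed

text \<open>The elements for which u is a two-sided unit, on themselves and on their adjoints, form
  a C*-algebra. It contains \<open>X\<close> because a right unit for a is a left unit for
  \<open>adj a\<close>; the remaining side follows by applying this to the adjoints of u and
  a.\<close>

lemma approximate_unit_generated:
  fixes u :: "'i \<Rightarrow> 'h::complex_hilbert bop"
  assumes u: "\<And>i. norm (u i) \<le> 1"
    and X: "\<And>a. a \<in> X \<Longrightarrow> ((\<lambda>i. u i * a) \<longlongrightarrow> a) F" "\<And>a. a \<in> X \<Longrightarrow> ((\<lambda>i. a * u i) \<longlongrightarrow> a) F"
    and x: "x \<in> generated_cstar_algebra X"
  shows "((\<lambda>i. u i * x) \<longlongrightarrow> x) F" "((\<lambda>i. x * u i) \<longlongrightarrow> x) F"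
proof -
  let ?L = "{x\<in>UNIV. ((\<lambda>i. u i * x) \<longlongrightarrow> x) F}" and ?L' = "{x\<in>UNIV. ((\<lambda>i. u i * adj x) \<longlongrightarrow> adj x) F}"
  let ?Z = "?L \<inter> ?L' \<inter> {x\<in>UNIV. ((\<lambda>i. x * u i) \<longlongrightarrow> x) F} \<inter> {x\<in>UNIV. ((\<lambda>i. adj x * u i) \<longlongrightarrow> adj x) F}"
  have ul: "norm (u i * y) \<le> norm y" for i y
    using mult_right_mono[OF u norm_ge_zero, of i y] norm_mult_ineq[of "u i" y] by linarith
  have ur: "norm (y * u i) \<le> norm y" for i y
    using mult_left_mono[OF u norm_ge_zero, of y i] norm_mult_ineq[of y "u i"] by linarith
  have da: "dist (adj x) (adj y) = dist x y" for x y :: "'h bop" by (simp only: dist_norm adj_minus[symmetric] norm_adj)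
  have "closed ?Z"
  proof (intro closed_Int closed_tendsto_on[where K=1] closed_UNIV)
    fix i and x y :: "'h bop"
    show "dist (u i * x) (u i * y) \<le> 1 * dist x y" using ul[of i "x - y"] by (simp add: dist_norm algebra_simps)
    show "dist (x * u i) (y * u i) \<le> 1 * dist x y" using ur[of "x - y" i] by (simp add: dist_norm algebra_simps)
    show "dist (u i * adj x) (u i * adj y) \<le> 1 * dist x y"
      using ul[of i "adj x - adj y"] da[of x y] by (simp add: dist_norm right_diff_distrib)
    show "dist (adj x * u i) (adj y * u i) \<le> 1 * dist x y"
      using ur[of "adj x - adj y" i] da[of x y] by (simp add: dist_norm left_diff_distrib)
  qed (simp_all add: da)
  have mult: "((\<lambda>i. u i * (a * b)) \<longlongrightarrow> a * b) F" "((\<lambda>i. b * a * u i) \<longlongrightarrow> b * a) F"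
    if "((\<lambda>i. u i * a) \<longlongrightarrow> a) F" "((\<lambda>i. a * u i) \<longlongrightarrow> a) F" for a b
    using tendsto_mult[OF that(1) tendsto_const, of b] tendsto_mult[OF tendsto_const that(2), of b]
    by (simp_all add: mult.assoc)
  have "cstar_algebra ?Z"
    unfolding cstar_algebra_def operator_algebra_def
  proof (intro conjI ballI allI)
    show "closed ?Z" by fact
    fix a assume a: "a \<in> ?Z"
    show "adj a \<in> ?Z" using a by simp
    show "c *\<^sub>C a \<in> ?Z" for c using a by (auto intro!: tendsto_scaleC_bop)
    fix b assume b: "b \<in> ?Z"
    show "a + b \<in> ?Z" using a b by (auto simp: distrib_left distrib_right intro!: tendsto_add)
    show "a * b \<in> ?Z" using a b by (auto intro: mult)
  qed simp
  moreover have "X \<subseteq> ?Z"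
  proof
    fix a assume a: "a \<in> X"
    have "((\<lambda>i. adj (u i) * adj (adj a)) \<longlongrightarrow> adj (adj a)) F"
      using u tendsto_adj[OF X(1)[OF a]] by (intro approximate_unit_adj_tendsto) simp_all
    from tendsto_adj[OF this] show "a \<in> ?Z"
      using X[OF a] by (simp add: approximate_unit_adj_tendsto[OF u])
  qed
  ultimately have "generated_cstar_algebra X \<subseteq> ?Z" by (rule generated_cstar_subset)
  thus "((\<lambda>i. u i * x) \<longlongrightarrow> x) F" "((\<lambda>i. x * u i) \<longlongrightarrow> x) F" using x by auto
qed


subsection \<open>The reduced crossed product of an admissible cover\<close>

context regular_system
begin

lemma closed_l2_entry: "closed X \<Longrightarrow> closed {y. l2_entry y s t \<in> X}"
  using closed_vimage[OF _ bounded_linear.continuous_on[OF bounded_linear_l2_entry continuous_on_id], of X s t]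
  by (simp add: vimage_def)

lemma l2_entry_crossed_product:
  assumes X: "operator_algebra X" "X \<subseteq> C" "\<And>g a. a \<in> X \<Longrightarrow> \<gamma> g a \<in> X"
    and y: "y \<in> crossed_product X (regular_rep \<gamma>) l2_shift"
  shows "l2_entry y s t \<in> X"
proof -
  have "l2_entry y s t \<in> X" if "y \<in> crossed_sums X (regular_rep \<gamma>) l2_shift" for y
    using that
  proof (induction y rule: crossed_sums_induct)
    case (plus x g y)
    hence "x \<in> C" using X(2) by blast
    thus ?case using plus(1,3) X(3)[OF plus(1)]
      by (auto simp: l2_entry_plus l2_entry_regular_shift intro!: operator_algebraD[OF X(1)])
  qed (simp add: operator_algebraD[OF X(1)])
  hence "crossed_product X (regular_rep \<gamma>) l2_shift \<subseteq> {y. l2_entry y s t \<in> X}"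
    unfolding crossed_product_def
    by (intro closure_minimal closed_l2_entry operator_algebraD(1)[OF X(1)]) auto
  thus ?thesis using y by blast
qed

lemma l2_entry_reduced: "y \<in> reduced_crossed_product C \<gamma> \<Longrightarrow> l2_entry y s t \<in> C"
  unfolding reduced_crossed_product_def
  by (rule l2_entry_crossed_product[OF cstar_algebraD(1)[OF C'] order_refl \<gamma>C])

text \<open>Monomials have this Toeplitz structure twisted by the action, and it passes to sums and
  limits. Consequently the column at 0 determines an element.\<close>

lemma l2_entry_translate:
  assumes y: "y \<in> reduced_crossed_product C \<gamma>"
  shows "l2_entry y (s + r) (t + r) = \<gamma> (- r) (l2_entry y s t)"
proof -
  note R = cstar_algebra_crossed_product[folded reduced_crossed_product_def]
  have "closed {y \<in> reduced_crossed_product C \<gamma>. l2_entry y (s + r) (t + r) = \<gamma> (- r) (l2_entry y s t)}" (is "closed ?Z")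
    unfolding closed_sequential_limits
  proof (intro allI impI, elim conjE)
    fix X l assume X: "\<forall>n. X n \<in> ?Z" and l: "X \<longlonglongrightarrow> l"
    have XR: "X n \<in> reduced_crossed_product C \<gamma>" for n using X by simp
    have lR: "l \<in> reduced_crossed_product C \<gamma>"
      by (rule closed_sequentially[OF cstarD(1)[OF R] XR l])
    note lim = bounded_linear.tendsto[OF bounded_linear_l2_entry l]
    have "(\<lambda>n. \<gamma> (- r) (l2_entry (X n) s t)) \<longlonglongrightarrow> \<gamma> (- r) (l2_entry l s t)"
      by (rule star_hom_tendsto[OF C' \<gamma>_hom l2_entry_reduced[OF XR] l2_entry_reduced[OF lR] lim])
    moreover have "(\<lambda>n. \<gamma> (- r) (l2_entry (X n) s t)) = (\<lambda>n. l2_entry (X n) (s + r) (t + r))" using X by auto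
    ultimately have "\<gamma> (- r) (l2_entry l s t) = l2_entry l (s + r) (t + r)"
      using lim[of "s + r" "t + r"] LIMSEQ_unique by metis
    thus "l \<in> ?Z" using lR by simp
  qed
  moreover have "crossed_sums C (regular_rep \<gamma>) l2_shift \<subseteq> ?Z"
  proof
    fix y assume y: "y \<in> crossed_sums C (regular_rep \<gamma>) l2_shift"
    hence yR: "y \<in> reduced_crossed_product C \<gamma>" if "y \<in> crossed_sums C (regular_rep \<gamma>) l2_shift" for y
      using that closure_subset unfolding reduced_crossed_product_def crossed_product_def by blast
    have "l2_entry y (s + r) (t + r) = \<gamma> (- r) (l2_entry y s t)"
      using y
    proof (induction y rule: crossed_sums_induct)
      case (plus x g y)
      have "\<gamma> (- (s + r)) x = \<gamma> (- r) (\<gamma> (- s) x)" using \<gamma>_plus[OF plus(1)] by (simp only: minus_add)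
      moreover have "- g + (s + r) = t + r \<longleftrightarrow> - g + s = t" by (simp only: add.assoc[symmetric] add_right_cancel)
      ultimately show ?case
        using plus l2_entry_reduced[OF yR[OF plus(2)]] by (simp add: l2_entry_plus l2_entry_regular_shift \<gamma>h \<gamma>C)
    qed (simp add: \<gamma>h)
    thus "y \<in> ?Z" using yR[OF y] by simp
  qed
  ultimately have "reduced_crossed_product C \<gamma> \<subseteq> ?Z"
    unfolding reduced_crossed_product_def[of C \<gamma>] crossed_product_def by (intro closure_minimal)
  thus ?thesis using y by blast
qed

text \<open>The entry at (0, 0) of \<open>adj y * y\<close> is the Gram form of the column of y at
  0. If it vanishes, so does this column, and all others are its translates.\<close>

lemma conditional_expectation_faithful:
  assumes y: "y \<in> reduced_crossed_product C \<gamma>" and 0: "l2_entry (adj y * y) 0 0 = 0"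
  shows "y = 0"
proof (rule l2_entry_eqI)
  have z: "op_apply y (l2_single 0 \<xi>) = 0" for \<xi>
  proof -
    have "cinner (op_apply (adj y * y) (l2_single 0 \<xi>)) (l2_single 0 \<xi>) = 0"
      using cinner_l2_entry[of "adj y * y" 0 0 \<xi> \<xi>] by (simp add: 0 del: cinner_l2_single_right)
    thus ?thesis by (simp add: cinner_adj_left cinner_self del: cinner_l2_single_right cinner_l2_single_left)
  qed
  fix s t
  have "l2_entry y (s - t) 0 = 0"
    by (rule bop_eqI) (simp add: l2_entry_apply z zero_l2.rep_eq)
  thus "l2_entry y s t = l2_entry 0 s t"
    using l2_entry_translate[OF y, of "s - t" t 0] by (simp add: \<gamma>h)
qed

end

lemma completely_contractive_l2_entry: "completely_contractive_on X (\<lambda>y. l2_entry y x x)"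
  unfolding completely_contractive_on_def matrix_norm_eq
proof (intro allI impI)
  fix n :: nat and T :: "nat \<Rightarrow> nat \<Rightarrow> ('a, 'b) l2 bop"
  let ?N = "{..<n}"
  show "norm (block ?N (\<lambda>i j. l2_entry (T i j) x x)) \<le> norm (block ?N T)"
    unfolding norm_block_le_iff[OF finite_lessThan norm_ge_zero]
  proof
    fix \<xi> :: "nat \<Rightarrow> 'b"
    have "(\<Sum>i\<in>?N. (norm (\<Sum>j\<in>?N. op_apply (l2_entry (T i j) x x) (\<xi> j)))\<^sup>2)
        = (\<Sum>i\<in>?N. (norm (Rep_l2 (\<Sum>j\<in>?N. op_apply (T i j) (l2_single x (\<xi> j))) x))\<^sup>2)"
      by (simp add: l2_entry_apply Rep_l2_sum)
    also have "\<dots> \<le> (\<Sum>i\<in>?N. (norm (\<Sum>j\<in>?N. op_apply (T i j) (l2_single x (\<xi> j))))\<^sup>2)"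
      by (intro sum_mono power_mono norm_Rep_l2_le norm_ge_zero)
    also have "\<dots> \<le> (norm (block ?N T))\<^sup>2 * (\<Sum>j\<in>?N. (norm (l2_single x (\<xi> j)))\<^sup>2)"
      by (rule norm_block_le_iff[OF finite_lessThan norm_ge_zero, THEN iffD1, OF order_refl, rule_format])
    finally show "(\<Sum>i\<in>?N. (norm (\<Sum>j\<in>?N. op_apply (l2_entry (T i j) x x) (\<xi> j)))\<^sup>2)
        \<le> (norm (block ?N T))\<^sup>2 * (\<Sum>j\<in>?N. (norm (\<xi> j))\<^sup>2)" by simp
  qed
qed

locale admissible_system =
  fixes A :: "'h::complex_hilbert bop set" and \<alpha> :: "'g::group_add \<Rightarrow> 'h bop \<Rightarrow> 'h bop"
    and C :: "'k::complex_hilbert bop set" and \<iota> :: "'h bop \<Rightarrow> 'k bop" and \<gamma> :: "'g \<Rightarrow> 'k bop \<Rightarrow> 'k bop"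
  assumes dyn: "dynamical_system A \<alpha>" and adm: "admissible_cover A \<alpha> C \<iota> \<gamma>"
begin

lemma A: "operator_algebra A" and \<alpha>A: "a \<in> A \<Longrightarrow> \<alpha> g a \<in> A"
  using dyn by (auto simp: dynamical_system_def bij_betw_def)

lemma cstarC: "cstar_algebra C" and \<iota>: "algebra_hom_on A \<iota>" "completely_isometric_on A \<iota>"
  and C_gen: "C = generated_cstar_algebra (\<iota> ` A)" and actC: "cstar_action C \<gamma>"
  and \<gamma>\<iota>: "a \<in> A \<Longrightarrow> \<gamma> g (\<iota> a) = \<iota> (\<alpha> g a)"
  using adm by (auto simp: admissible_cover_def cstar_cover_def)

lemmas Ai = operator_algebraD[OF A]
lemmas \<iota>h = algebra_hom_onD[OF \<iota>(1) A]
lemmas norm_\<iota> = completely_isometric_norm[OF \<iota>(2)]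

lemma \<iota>C: "a \<in> A \<Longrightarrow> \<iota> a \<in> C" unfolding C_gen by (intro generated_cstar_superset imageI)

lemma image: "operator_algebra (\<iota> ` A)" "\<iota> ` A \<subseteq> C" "x \<in> \<iota> ` A \<Longrightarrow> \<gamma> g x \<in> \<iota> ` A"
  using \<iota>C by (auto intro: operator_algebra_isometric_image[OF A \<iota>(1) norm_\<iota>] \<alpha>A simp: \<gamma>\<iota>)

sublocale regular_system C \<gamma>
  by unfold_locales (rule cstarC actC)+

lemma relative_crossed_product_eq:
  assumes "covariant_rep C \<gamma> \<pi> U"
  shows "relative_crossed_product A \<iota> \<pi> U = crossed_product (\<iota> ` A) \<pi> U"
proof -
  interpret V: covariant_system C \<gamma> \<pi> U by unfold_locales (rule cstarC actC assms)+
  show ?thesis unfolding relative_crossed_product_def by (rule V.generated_algebra_crossed_sums[OF image])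
qed

lemma relative_reduced_eq:
  "relative_reduced_crossed_product A \<iota> \<gamma> = crossed_product (\<iota> ` A) (regular_rep \<gamma>) l2_shift"
  unfolding relative_reduced_crossed_product_def by (rule relative_crossed_product_eq[OF cov])

lemma operator_algebra_relative_reduced: "operator_algebra (relative_reduced_crossed_product A \<iota> \<gamma>)"
  unfolding relative_reduced_eq by (rule operator_algebra_crossed_product[OF image])

end

lemma crossed_sums_mono: "X \<subseteq> Y \<Longrightarrow> crossed_sums X \<pi> U \<subseteq> crossed_sums Y \<pi> U"
proof
  assume XY: "X \<subseteq> Y"
  fix y assume "y \<in> crossed_sums X \<pi> U"
  then obtain S a where S: "finite S" "\<forall>g\<in>S. a g \<in> X" "y = (\<Sum>g\<in>S. \<pi> (a g) * U g)"
    unfolding crossed_sums_def by blast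
  show "y \<in> crossed_sums Y \<pi> U"
    unfolding S(3) using S(1,2) XY by (intro crossed_sumsI) auto
qed

subsection \<open>C*-envelopes of algebras isomorphic to the reduced crossed product\<close>

locale envelope_system = admissible_system A \<alpha> E j \<beta>
  for A :: "'h::complex_hilbert bop set" and \<alpha> :: "'g::group_add \<Rightarrow> 'h bop \<Rightarrow> 'h bop"
    and E :: "'e::complex_hilbert bop set" and j :: "'h bop \<Rightarrow> 'e bop" and \<beta> :: "'g \<Rightarrow> 'e bop \<Rightarrow> 'e bop" +
  fixes \<F> :: "'i filter" and e :: "'i \<Rightarrow> 'h bop"
  assumes env: "cstar_envelope A E j" and cau: "contractive_approximate_unit A \<F> e"
begin

abbreviation "\<Psi> \<equiv> regular_rep \<beta>"
abbreviation "\<Lambda> \<equiv> (l2_shift :: 'g \<Rightarrow> ('g, 'e) l2 bop)"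
abbreviation "R \<equiv> reduced_crossed_product E \<beta>"
abbreviation "BB \<equiv> relative_reduced_crossed_product A j \<beta>"

lemma e: "\<F> \<noteq> bot" "e i \<in> A" "norm (e i) \<le> 1" "a \<in> A \<Longrightarrow> ((\<lambda>i. e i * a) \<longlongrightarrow> a) \<F>" "a \<in> A \<Longrightarrow> ((\<lambda>i. a * e i) \<longlongrightarrow> a) \<F>"
  using cau by (auto simp: contractive_approximate_unit_def)

lemma norm_je: "norm (j (e i)) \<le> 1" using norm_\<iota>[OF e(2)] e(3) by simp

lemma tendsto_j:
  assumes "\<And>i. f i \<in> A" "a \<in> A" "(f \<longlongrightarrow> a) \<F>"
  shows "((\<lambda>i. j (f i)) \<longlongrightarrow> j a) \<F>"
proof -
  have "dist (j (f i)) (j a) = dist (f i) a" for i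
    using norm_\<iota>[of "f i - a"] assms(1)[of i] assms(2) by (simp add: dist_norm \<iota>h Ai)
  thus ?thesis using assms(3) by (simp add: tendsto_iff)
qed

lemma e_E: "x \<in> E \<Longrightarrow> ((\<lambda>i. j (e i) * x) \<longlongrightarrow> x) \<F>" "x \<in> E \<Longrightarrow> ((\<lambda>i. x * j (e i)) \<longlongrightarrow> x) \<F>"
proof -
  have "((\<lambda>i. j (e i) * y) \<longlongrightarrow> y) \<F>" "((\<lambda>i. y * j (e i)) \<longlongrightarrow> y) \<F>" if y: "y \<in> j ` A" for y
  proof -
    obtain a where a: "a \<in> A" "y = j a" using y by blast
    show "((\<lambda>i. j (e i) * y) \<longlongrightarrow> y) \<F>" "((\<lambda>i. y * j (e i)) \<longlongrightarrow> y) \<F>"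
      using tendsto_j[OF _ a(1) e(4)[OF a(1)]] tendsto_j[OF _ a(1) e(5)[OF a(1)]] a e(2) by (simp_all add: \<iota>h Ai)
  qed
  note * = approximate_unit_generated[of "\<lambda>i. j (e i)", OF norm_je this]
  show "x \<in> E \<Longrightarrow> ((\<lambda>i. j (e i) * x) \<longlongrightarrow> x) \<F>" "x \<in> E \<Longrightarrow> ((\<lambda>i. x * j (e i)) \<longlongrightarrow> x) \<F>"
    unfolding C_gen by (rule *; assumption)+
qed

lemma cstarR: "cstar_algebra R"
  unfolding reduced_crossed_product_def by (rule cstar_algebra_crossed_product)

lemma monomial_R: "x \<in> E \<Longrightarrow> \<Psi> x * \<Lambda> g \<in> R"
  unfolding reduced_crossed_product_def crossed_product_def by (rule subsetD[OF closure_subset crossed_sums_monomial])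
lemma monomial_BB: "a \<in> A \<Longrightarrow> \<Psi> (j a) * \<Lambda> g \<in> BB"
  unfolding relative_reduced_eq crossed_product_def by (intro subsetD[OF closure_subset crossed_sums_monomial] imageI)
lemma \<Psi>_R: "x \<in> E \<Longrightarrow> \<Psi> x \<in> R" using monomial_R[of x 0] by (simp add: l2_shift_zero)

lemma BB_R: "BB \<subseteq> R"
  unfolding relative_reduced_eq reduced_crossed_product_def crossed_product_def
  by (rule closure_mono[OF crossed_sums_mono[OF image(2)]])

text \<open>The monomial \<Psi> x * \<Lambda> g is the limit of \<Psi> x * (\<Psi> (j (e i)) *
  \<Lambda> g), whose second factor lies in \<open>BB\<close>; here j (e i) serves as a right
  approximate unit of \<open>E\<close>.\<close>

lemma reduced_total:
  assumes S: "closed S" "\<And>x y. x \<in> S \<Longrightarrow> y \<in> S \<Longrightarrow> x + y \<in> S" "\<And>x b. x \<in> E \<Longrightarrow> b \<in> BB \<Longrightarrow> \<Psi> x * b \<in> S"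
  shows "R \<subseteq> S"
proof -
  have 0: "0 \<in> S" using S(3)[OF Ci(2) operator_algebraD(2)[OF operator_algebra_relative_reduced]] by simp
  have mono: "\<Psi> x * \<Lambda> g \<in> S" if x: "x \<in> E" for x g
  proof -
    have "((\<lambda>i. \<Psi> (x * j (e i))) \<longlongrightarrow> \<Psi> x) \<F>"
      by (rule star_hom_tendsto[OF cstarC \<pi> _ x e_E(2)[OF x]]) (intro Ci x \<iota>C e)
    from tendsto_mult[OF this tendsto_const, of "\<Lambda> g"]
    have "((\<lambda>i. \<Psi> x * (\<Psi> (j (e i)) * \<Lambda> g)) \<longlongrightarrow> \<Psi> x * \<Lambda> g) \<F>"
      by (simp add: \<pi>h x \<iota>C e mult.assoc)
    thus ?thesis
      by (rule Lim_in_closed_set[OF S(1) always_eventually e(1), rotated]) (intro allI S(3) x monomial_BB e)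
  qed
  have "crossed_sums E \<Psi> \<Lambda> \<subseteq> S"
  proof
    fix y assume "y \<in> crossed_sums E \<Psi> \<Lambda>"
    thus "y \<in> S" by (induction y rule: crossed_sums_induct) (auto intro: 0 S(2) mono)
  qed
  thus ?thesis unfolding reduced_crossed_product_def crossed_product_def by (intro closure_minimal S(1))
qed

lemma R_generated: "R = generated_cstar_algebra BB"
proof
  let ?G = "generated_cstar_algebra BB"
  note Gi = cstarD[OF cstar_algebra_generated]
  show "?G \<subseteq> R" by (rule generated_cstar_subset[OF cstarR BB_R])
  have "\<Psi> ` E \<subseteq> ?G"
    unfolding C_gen[symmetric] using star_hom_generated_subset[OF cstarC \<pi> image(2) cstar_algebra_generated, of BB]
      monomial_BB[of _ 0] by (auto simp: C_gen[symmetric] l2_shift_zero intro: generated_cstar_superset)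
  thus "R \<subseteq> ?G" by (intro reduced_total Gi) (auto intro: generated_cstar_superset)
qed

lemma reduced_unit: "y \<in> R \<Longrightarrow> ((\<lambda>i. \<Psi> (j (e i)) * y) \<longlongrightarrow> y) \<F>"
proof -
  let ?S = "{y\<in>UNIV. ((\<lambda>i. \<Psi> (j (e i)) * y) \<longlongrightarrow> y) \<F>}"
  have c: "norm (\<Psi> (j (e i)) * y) \<le> norm y" for i y
  proof -
    have "norm (\<Psi> (j (e i))) \<le> 1" by (rule order_trans[OF \<pi>_norm[OF \<iota>C[OF e(2)]] norm_je])
    from mult_right_mono[OF this norm_ge_zero, of y] norm_mult_ineq[of "\<Psi> (j (e i))" y] show ?thesis by simp
  qed
  have "R \<subseteq> ?S"
  proof (rule reduced_total)
    show "closed ?S"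
    proof (rule closed_tendsto_on[where K=1])
      show "dist (\<Psi> (j (e i)) * x) (\<Psi> (j (e i)) * y) \<le> 1 * dist x y" for i x y
        using c[of i "x - y"] by (simp add: dist_norm right_diff_distrib)
    qed simp_all
    show "x + y \<in> ?S" if "x \<in> ?S" "y \<in> ?S" for x y
      using that by (auto simp: distrib_left intro: tendsto_add)
    fix x b assume x: "x \<in> E" and b: "b \<in> BB"
    have "((\<lambda>i. \<Psi> (j (e i) * x)) \<longlongrightarrow> \<Psi> x) \<F>"
      by (rule star_hom_tendsto[OF cstarC \<pi> _ x e_E(1)[OF x]]) (intro Ci x \<iota>C e)
    from tendsto_mult[OF this tendsto_const, of b] show "\<Psi> x * b \<in> ?S"
      by (simp add: \<pi>h x \<iota>C e mult.assoc)
  qed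
  thus "y \<in> R \<Longrightarrow> ((\<lambda>i. \<Psi> (j (e i)) * y) \<longlongrightarrow> y) \<F>" by blast
qed

text \<open>The algebra B is an arbitrary completely isometric copy of \<open>BB\<close>, so that
  the result serves other covers as well as full crossed products. The universal property of F gives
  a surjection q from \<open>R\<close>; it is completely isometric on \<open>BB\<close> since there
  it agrees with the embedding k of B. Injectivity is the boundary theorem.\<close>

theorem envelope_isomorphic:
  fixes B :: "'b::complex_hilbert bop set" and F :: "'f::complex_hilbert bop set"
  assumes B: "operator_algebra B" and \<kappa>: "algebra_hom_on B \<kappa>" "completely_isometric_on B \<kappa>" "\<kappa> ` B = BB"
    and F: "cstar_envelope B F k"
  shows "star_isomorphic F R"
proof -
  obtain q where hq: "star_hom_on R q" "q ` R = F" "\<And>b. b \<in> B \<Longrightarrow> q (\<kappa> b) = k b"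
    using cstar_envelope_universal[OF B F \<kappa>(1,2)] unfolding \<kappa>(3) R_generated[symmetric] by blast
  have q_iso: "completely_isometric_on BB q"
    unfolding completely_isometric_on_def matrix_norm_eq
  proof (intro allI impI)
    fix n and T :: "nat \<Rightarrow> nat \<Rightarrow> ('g, 'e) l2 bop" assume T: "\<forall>i<n. \<forall>j<n. T i j \<in> BB"
    define b where "b i l = inv_into B \<kappa> (T i l)" for i l
    have b: "b i l \<in> B" "\<kappa> (b i l) = T i l" if "i < n" "l < n" for i l
      using T that unfolding b_def \<kappa>(3)[symmetric] by (auto intro: inv_into_into f_inv_into_f)
    have k: "completely_isometric_on B k" using F by (simp add: cstar_envelope_def cstar_cover_def)
    have "block {..<n} (\<lambda>i l. q (T i l)) = block {..<n} (\<lambda>i l. k (b i l))"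
      by (rule block_cong) (use b hq(3) in force)
    moreover have "block {..<n} T = block {..<n} (\<lambda>i l. \<kappa> (b i l))" by (rule block_cong) (simp add: b)
    ultimately show "norm (block {..<n} (\<lambda>i l. q (T i l))) = norm (block {..<n} T)"
      using completely_isometric_block[OF k, of "{..<n}" b] completely_isometric_block[OF \<kappa>(2), of "{..<n}" b] b(1) by simp
  qed
  \<comment> \<open>The diagonal entry at the neutral element plays the conditional
    expectation.\<close>
  interpret boundary_setup A E j R BB \<Psi> "\<lambda>y. l2_entry y 0 0" q \<F> e
  proof
    show "operator_algebra A" "cstar_envelope A E j" "cstar_algebra R" "operator_algebra BB" "BB \<subseteq> R"
      "star_hom_on E \<Psi>" "star_hom_on R q" "completely_isometric_on BB q" "\<F> \<noteq> bot"
      by (rule A env cstarR operator_algebra_relative_reduced BB_R \<pi> hq(1) q_iso e)+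
    show "\<Psi> ` E \<subseteq> R" using \<Psi>_R by blast
    show "\<Psi> (j a) \<in> BB" if "a \<in> A" for a using monomial_BB[OF that, of 0] by (simp add: l2_shift_zero)
    show "l2_entry b 0 0 \<in> j ` A" if "b \<in> BB" for b
      by (rule l2_entry_crossed_product[OF image(1,2) _ that[unfolded relative_reduced_eq]]) (rule image(3))
    show "l2_entry (\<Psi> x * y) 0 0 = x * l2_entry y 0 0" if "x \<in> E" "y \<in> R" for x y
      using that(1) by (intro bop_eqI) (simp add: l2_entry_apply Rep_l2_regular \<gamma>_zero)
    show "l2_entry (\<Psi> x) 0 0 = x" if "x \<in> E" for x using that by (simp add: l2_entry_regular \<gamma>_zero)
    show "R \<subseteq> S" if "closed S" "\<And>x y. x \<in> S \<Longrightarrow> y \<in> S \<Longrightarrow> x + y \<in> S" "\<And>x b. x \<in> E \<Longrightarrow> b \<in> BB \<Longrightarrow> \<Psi> x * b \<in> S" for S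
      using that by (rule reduced_total)
  qed (auto intro: e e_E reduced_unit conditional_expectation_faithful l2_entry_reduced
      simp: l2_entry_plus l2_entry_scaleC norm_l2_entry_le completely_contractive_l2_entry)
  have "inj_on q R"
  proof (rule inj_onI)
    fix x y assume xy: "x \<in> R" "y \<in> R" "q x = q y"
    hence "x - y = 0" by (intro boundary_injective) (simp_all add: qh Ri)
    thus "x = y" by simp
  qed
  hence "star_hom_on F (inv_into R q)" "bij_betw (inv_into R q) F R"
    using inv_star_hom[OF cstarR hq(1)] bij_betw_inv_into[of q R F] hq(2) by (auto simp: bij_betw_def)
  thus ?thesis unfolding star_isomorphic_def by blast
qed

end

subsection \<open>Isometric isomorphisms between closures\<close>

text \<open>Homomorphisms between crossed products are built as graphs: an operator may be a crossed
  sum in several ways, and it is the equality of norms that makes the relation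
  single-valued.\<close>

definition isometric_graph :: "('a::complex_hilbert bop \<times> 'b::complex_hilbert bop) set \<Rightarrow> bool"
  where "isometric_graph G \<longleftrightarrow> (0, 0) \<in> G \<and> (\<forall>p\<in>G. norm (snd p) = norm (fst p)) \<and>
    (\<forall>p\<in>G. \<forall>q\<in>G. (fst p + fst q, snd p + snd q) \<in> G \<and> (fst p * fst q, snd p * snd q) \<in> G) \<and>
    (\<forall>c. \<forall>p\<in>G. (c *\<^sub>C fst p, c *\<^sub>C snd p) \<in> G)"

lemma isometric_graphD:
  assumes "isometric_graph G"
  shows "(0, 0) \<in> G" "p \<in> G \<Longrightarrow> norm (snd p) = norm (fst p)"
    "p \<in> G \<Longrightarrow> q \<in> G \<Longrightarrow> (fst p + fst q, snd p + snd q) \<in> G" "p \<in> G \<Longrightarrow> q \<in> G \<Longrightarrow> (fst p * fst q, snd p * snd q) \<in> G"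
    "p \<in> G \<Longrightarrow> (c *\<^sub>C fst p, c *\<^sub>C snd p) \<in> G" "p \<in> G \<Longrightarrow> q \<in> G \<Longrightarrow> (fst p - fst q, snd p - snd q) \<in> G"
proof -
  show *: "(0, 0) \<in> G" "p \<in> G \<Longrightarrow> norm (snd p) = norm (fst p)"
    "p \<in> G \<Longrightarrow> q \<in> G \<Longrightarrow> (fst p + fst q, snd p + snd q) \<in> G" "p \<in> G \<Longrightarrow> q \<in> G \<Longrightarrow> (fst p * fst q, snd p * snd q) \<in> G"
    "p \<in> G \<Longrightarrow> (c *\<^sub>C fst p, c *\<^sub>C snd p) \<in> G" for p q c
    using assms by (auto simp: isometric_graph_def)
  show "p \<in> G \<Longrightarrow> q \<in> G \<Longrightarrow> (fst p - fst q, snd p - snd q) \<in> G"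
    using *(3)[of p "(- 1 *\<^sub>C fst q, - 1 *\<^sub>C snd q)"] *(5)[of q "- 1"] by simp
qed

lemma isometric_graph_closure:
  fixes G :: "('a::complex_hilbert bop \<times> 'b::complex_hilbert bop) set"
  assumes G: "isometric_graph G"
  shows "isometric_graph (closure G)"
  unfolding isometric_graph_def
proof (intro conjI ballI allI)
  note Gi = isometric_graphD[OF G]
  show "(0, 0) \<in> closure G" using Gi(1) closure_subset by blast
  have "closed {p :: 'a bop \<times> 'b bop. norm (snd p) = norm (fst p)}" by (intro closed_Collect_eq continuous_intros)
  hence "closure G \<subseteq> {p. norm (snd p) = norm (fst p)}" using Gi(2) by (intro closure_minimal) auto
  thus "norm (snd p) = norm (fst p)" if "p \<in> closure G" for p using that by blast
  show "(c *\<^sub>C fst p, c *\<^sub>C snd p) \<in> closure G" if "p \<in> closure G" for c p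
    by (rule closure_map[OF _ Gi(5) that]) (intro continuous_intros)
  fix p q assume p: "p \<in> closure G" and q: "q \<in> closure G"
  show "(fst p + fst q, snd p + snd q) \<in> closure G"
    by (rule closure_map2[where f="\<lambda>p q. (fst p + fst q, snd p + snd q)", OF _ Gi(3) p q]) (intro continuous_intros)
  show "(fst p * fst q, snd p * snd q) \<in> closure G"
    by (rule closure_map2[where f="\<lambda>p q. (fst p * fst q, snd p * snd q)", OF _ Gi(4) p q]) (intro continuous_intros)
qed

lemma isometric_graph_converse: "isometric_graph G \<Longrightarrow> isometric_graph (prod.swap ` G)"
  by (auto simp: isometric_graph_def)

text \<open>Partners of a convergent sequence form a Cauchy sequence by the norm condition for
  differences, and completeness supplies a partner for the limit.\<close>

lemma isometric_graph_domain:
  assumes G: "isometric_graph G" and y: "y \<in> closure (fst ` G)"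
  shows "\<exists>z. (y, z) \<in> closure G"
proof -
  obtain Y where Y: "\<forall>n. Y n \<in> fst ` G" "Y \<longlonglongrightarrow> y" using y unfolding closure_sequential by (elim exE conjE)
  hence "\<forall>n. \<exists>z. (Y n, z) \<in> G" by force
  then obtain Z where Z: "\<And>n. (Y n, Z n) \<in> G" using choice by meson
  have d: "dist (Z m) (Z n) = dist (Y m) (Y n)" for m n
    using isometric_graphD(2)[OF G isometric_graphD(6)[OF G Z Z]] by (simp add: dist_norm)
  have "Cauchy Z" using LIMSEQ_imp_Cauchy[OF Y(2)] unfolding Cauchy_def d .
  then obtain z where "Z \<longlonglongrightarrow> z" using Cauchy_convergent convergent_def by blast
  with Y(2) have "(\<lambda>n. (Y n, Z n)) \<longlonglongrightarrow> (y, z)" by (rule tendsto_Pair)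
  thus ?thesis
    unfolding closure_sequential using Z by (intro exI[of _ z] exI[of _ "\<lambda>n. (Y n, Z n)"]) simp
qed

text \<open>The closure of the graph is again isometric, hence the graph of a map, and it is defined
  on the whole closure of the domain. Surjectivity is the same statement for the converse
  graph.\<close>

lemma isometric_extension:
  assumes G: "isometric_graph G"
  obtains \<kappa> where "algebra_hom_on (closure (fst ` G)) \<kappa>" "\<And>y z. (y, z) \<in> closure G \<Longrightarrow> y \<in> closure (fst ` G) \<and> \<kappa> y = z"
    "\<And>y. y \<in> closure (fst ` G) \<Longrightarrow> (y, \<kappa> y) \<in> closure G" "\<And>y. y \<in> closure (fst ` G) \<Longrightarrow> norm (\<kappa> y) = norm y"
    "\<kappa> ` closure (fst ` G) = closure (snd ` G)"
proof -
  let ?X = "closure (fst ` G)"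
  note Ci = isometric_graphD[OF isometric_graph_closure[OF G]]
  define \<kappa> where "\<kappa> y = (SOME z. (y, z) \<in> closure G)" for y
  have \<kappa>: "(y, \<kappa> y) \<in> closure G" if "y \<in> ?X" for y
    unfolding \<kappa>_def by (rule someI_ex[OF isometric_graph_domain[OF G that]])
  have uniq: "z = w" if "(y, z) \<in> closure G" "(y, w) \<in> closure G" for y z w
    using Ci(2)[OF Ci(6)[OF that]] by simp
  have proj: "fst p \<in> ?X" "snd p \<in> closure (snd ` G)" if "p \<in> closure G" for p
    using image_closure_subset[of G fst ?X] image_closure_subset[of G snd "closure (snd ` G)"] that
      closure_subset[of "fst ` G"] closure_subset[of "snd ` G"] by (auto simp: continuous_on_fst continuous_on_snd)
  have dom: "y \<in> ?X" and val: "\<kappa> y = z" if "(y, z) \<in> closure G" for y z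
    using proj(1)[OF that] uniq[OF \<kappa> that] by auto
  have "algebra_hom_on ?X \<kappa>"
    unfolding algebra_hom_on_def
    using Ci(3)[OF \<kappa> \<kappa>] Ci(4)[OF \<kappa> \<kappa>] Ci(5)[OF \<kappa>] by (auto intro!: val)
  moreover have "\<kappa> ` ?X = closure (snd ` G)"
  proof
    show "\<kappa> ` ?X \<subseteq> closure (snd ` G)" using proj(2)[OF \<kappa>] by auto
    show "closure (snd ` G) \<subseteq> \<kappa> ` ?X"
    proof
      fix z assume "z \<in> closure (snd ` G)"
      hence "z \<in> closure (fst ` prod.swap ` G)" by (simp add: image_image)
      then obtain y where y: "(z, y) \<in> closure (prod.swap ` G)"
        using isometric_graph_domain[OF isometric_graph_converse[OF G]] by blast
      have "prod.swap (z, y) \<in> closure G" by (rule closure_map[OF _ _ y]) (auto intro: continuous_on_swap)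
      hence "(y, z) \<in> closure G" by simp
      thus "z \<in> \<kappa> ` ?X" using dom val by blast
    qed
  qed
  ultimately show ?thesis using that \<kappa> dom val Ci(2)[OF \<kappa>] by simp
qed

text \<open>Two realisations of the same formal sum. The group elements of the summands may repeat,
  so that addition is concatenation and no coefficients have to be collected.\<close>

inductive_set crossed_pairs ::
    "'h bop set \<Rightarrow> ('h::complex_hilbert bop \<Rightarrow> 'u::complex_hilbert bop) \<Rightarrow> ('g \<Rightarrow> 'u bop) \<Rightarrow>
      ('h bop \<Rightarrow> 'v::complex_hilbert bop) \<Rightarrow> ('g \<Rightarrow> 'v bop) \<Rightarrow> ('u bop \<times> 'v bop) set"
  for A \<pi> U \<rho> V where
  zero: "(0, 0) \<in> crossed_pairs A \<pi> U \<rho> V"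
| plus: "a \<in> A \<Longrightarrow> (y, z) \<in> crossed_pairs A \<pi> U \<rho> V \<Longrightarrow>
    (\<pi> a * U g + y, \<rho> a * V g + z) \<in> crossed_pairs A \<pi> U \<rho> V"

lemma crossed_pairs_add:
  "(y, z) \<in> crossed_pairs A \<pi> U \<rho> V \<Longrightarrow> (y', z') \<in> crossed_pairs A \<pi> U \<rho> V \<Longrightarrow>
    (y + y', z + z') \<in> crossed_pairs A \<pi> U \<rho> V"
  by (induction y z rule: crossed_pairs.induct) (auto simp: add.assoc intro: crossed_pairs.intros)

lemma crossed_pairs_monomial: "a \<in> A \<Longrightarrow> (\<pi> a * U g, \<rho> a * V g) \<in> crossed_pairs A \<pi> U \<rho> V"
  using crossed_pairs.plus[OF _ crossed_pairs.zero, of a A \<pi> U g \<rho> V] by simp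

lemma crossed_pairs_swap: "(y, z) \<in> crossed_pairs A \<pi> U \<rho> V \<Longrightarrow> (z, y) \<in> crossed_pairs A \<rho> V \<pi> U"
  by (induction y z rule: crossed_pairs.induct) (auto intro: crossed_pairs.intros)

lemma snd_crossed_pairs: "snd ` crossed_pairs A \<pi> U \<rho> V = fst ` crossed_pairs A \<rho> V \<pi> U"
  by (auto simp: image_iff) (metis crossed_pairs_swap fst_conv snd_conv)+

lemma fst_crossed_pairs:
  assumes "covariant_system C \<gamma> \<pi> U" "operator_algebra A" "algebra_hom_on A \<iota>" "\<iota> ` A \<subseteq> C"
  shows "fst ` crossed_pairs A (\<lambda>a. \<pi> (\<iota> a)) U \<rho> V = crossed_sums (\<iota> ` A) \<pi> U"
proof -
  interpret covariant_system C \<gamma> \<pi> U by fact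
  note Ai = operator_algebraD[OF assms(2)] and \<iota>h = algebra_hom_onD[OF assms(3,2)]
  have 0: "0 \<in> \<iota> ` A" using \<iota>h(5) Ai(2) by (metis imageI)
  have p: "a + b \<in> \<iota> ` A" if "a \<in> \<iota> ` A" "b \<in> \<iota> ` A" for a b
    using that by (auto simp: \<iota>h(1)[symmetric] intro!: imageI Ai)
  show ?thesis
  proof (intro equalityI subsetI)
    fix y assume "y \<in> fst ` crossed_pairs A (\<lambda>a. \<pi> (\<iota> a)) U \<rho> V"
    then obtain z where "(y, z) \<in> crossed_pairs A (\<lambda>a. \<pi> (\<iota> a)) U \<rho> V" by auto
    thus "y \<in> crossed_sums (\<iota> ` A) \<pi> U"
      by (induction y z rule: crossed_pairs.induct)
        (auto intro!: crossed_sums_plus[OF assms(4) 0 p] crossed_sums_monomial crossed_sums_zero[OF assms(4) 0 p])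
  next
    fix y assume "y \<in> crossed_sums (\<iota> ` A) \<pi> U"
    thus "y \<in> fst ` crossed_pairs A (\<lambda>a. \<pi> (\<iota> a)) U \<rho> V"
    proof (induction y rule: crossed_sums_induct)
      case zero show ?case using crossed_pairs.zero by force
    next
      case (plus x g y)
      obtain a z where "a \<in> A" "x = \<iota> a" "(y, z) \<in> crossed_pairs A (\<lambda>a. \<pi> (\<iota> a)) U \<rho> V" using plus(1,3) by auto
      thus ?case using crossed_pairs.plus[of a A y z "\<lambda>a. \<pi> (\<iota> a)" U \<rho> V g] by force
    qed
  qed
qed

text \<open>Both realisations multiply monomials by the same rule, with coefficient
  \<open>a * \<alpha> g b\<close> at g + h. What remains to be supplied for a given pair is the
  equality of norms.\<close>

lemma isometric_graph_crossed_pairs: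
  assumes C: "covariant_system C \<gamma> \<pi> U" "algebra_hom_on A \<iota>" "\<iota> ` A \<subseteq> C" "\<And>g a. a \<in> A \<Longrightarrow> \<gamma> g (\<iota> a) = \<iota> (\<alpha> g a)"
    and D: "covariant_system D \<delta> \<rho> V" "algebra_hom_on A j" "j ` A \<subseteq> D" "\<And>g a. a \<in> A \<Longrightarrow> \<delta> g (j a) = j (\<alpha> g a)"
    and A: "operator_algebra A" "\<And>g a. a \<in> A \<Longrightarrow> \<alpha> g a \<in> A"
  defines "G \<equiv> crossed_pairs A (\<lambda>a. \<pi> (\<iota> a)) U (\<lambda>a. \<rho> (j a)) V"
  assumes norm: "\<And>y z. (y, z) \<in> G \<Longrightarrow> norm z = norm y"
  shows "isometric_graph G"
  unfolding isometric_graph_def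
proof (intro conjI ballI allI)
  interpret C: covariant_system C \<gamma> \<pi> U by (rule C(1))
  interpret D: covariant_system D \<delta> \<rho> V by (rule D(1))
  note Ai = operator_algebraD[OF A(1)] and \<iota>h = algebra_hom_onD[OF C(2) A(1)] and jh = algebra_hom_onD[OF D(2) A(1)]
  have AC: "\<iota> a \<in> C" and AD: "j a \<in> D" if "a \<in> A" for a using that C(3) D(3) by auto
  note Gp = crossed_pairs_add[where A=A and \<pi>="\<lambda>a. \<pi> (\<iota> a)" and U=U and \<rho>="\<lambda>a. \<rho> (j a)" and V=V, folded G_def]
  note Gm = crossed_pairs_monomial[where A=A and \<pi>="\<lambda>a. \<pi> (\<iota> a)" and U=U and \<rho>="\<lambda>a. \<rho> (j a)" and V=V, folded G_def]
  show 0: "(0, 0) \<in> G" unfolding G_def by (rule crossed_pairs.zero)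
  fix p assume p: "p \<in> G"
  show "norm (snd p) = norm (fst p)" using norm[of "fst p" "snd p"] p by simp
  show "(c *\<^sub>C fst p, c *\<^sub>C snd p) \<in> G" for c
  proof -
    have "(fst p, snd p) \<in> G" using p by simp
    thus ?thesis unfolding G_def
    proof (induction "fst p" "snd p" arbitrary: p rule: crossed_pairs.induct)
      case (plus a y z g)
      have "(c *\<^sub>C (\<pi> (\<iota> a) * U g), c *\<^sub>C (\<rho> (j a) * V g)) \<in> G"
        using Gm[OF Ai(5)[OF plus(1), of c], of g] plus(1) by (simp add: \<iota>h jh C.\<pi>h D.\<pi>h AC AD)
      from Gp[OF this plus(3)[of "(y, z)", folded G_def]] show ?case by (simp add: plus(4,5)[symmetric] scaleC_add_right G_def)
    qed (use 0 in \<open>simp add: G_def\<close>)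
  qed
  fix q assume q: "q \<in> G"
  show "(fst p + fst q, snd p + snd q) \<in> G" using Gp p q by simp
  show "(fst p * fst q, snd p * snd q) \<in> G"
  proof -
    have mono: "(\<pi> (\<iota> a) * U g * y, \<rho> (j a) * V g * z) \<in> G" if a: "a \<in> A" and yz: "(y, z) \<in> G" for a g y z
      using yz unfolding G_def
    proof (induction y z rule: crossed_pairs.induct)
      case (plus b y z h)
      have "(\<pi> (\<iota> a) * U g * (\<pi> (\<iota> b) * U h), \<rho> (j a) * V g * (\<rho> (j b) * V h)) \<in> G"
        using Gm[OF Ai(4)[OF a A(2)[OF plus(1)]], of g "g + h"] a plus(1)
        by (simp add: C.monomial_times D.monomial_times AC AD C(4) D(4) A(2) \<iota>h jh)
      from Gp[OF this plus(3)[folded G_def]] show ?case by (simp add: distrib_left G_def)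
    qed (use 0 in \<open>simp add: G_def\<close>)
    have "(y * fst q, z * snd q) \<in> G" if "(y, z) \<in> G" for y z
      using that unfolding G_def
    proof (induction y z rule: crossed_pairs.induct)
      case (plus a y z g)
      from Gp[OF mono[OF plus(1), of "fst q" "snd q" g] plus(3)[folded G_def]] q show ?case by (simp add: distrib_right G_def)
    qed (use 0 in \<open>simp add: G_def\<close>)
    thus ?thesis using p by simp
  qed
qed


subsection \<open>Independence of the reduced crossed product of the cover\<close>

abbreviation reduced_pairs ::
    "'h bop set \<Rightarrow> ('h::complex_hilbert bop \<Rightarrow> 'k::complex_hilbert bop) \<Rightarrow> ('g::group_add \<Rightarrow> 'k bop \<Rightarrow> 'k bop) \<Rightarrow>
      ('h bop \<Rightarrow> 'l::complex_hilbert bop) \<Rightarrow> ('g \<Rightarrow> 'l bop \<Rightarrow> 'l bop) \<Rightarrow> (('g, 'k) l2 bop \<times> ('g, 'l) l2 bop) set"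
  where "reduced_pairs A \<iota> \<gamma> j \<delta> \<equiv> crossed_pairs A (\<lambda>a. regular_rep \<gamma> (\<iota> a)) l2_shift (\<lambda>a. regular_rep \<delta> (j a)) l2_shift"

text \<open>Entries of the two operators are images of the same element of \<open>A\<close> under
  \<iota> and j, hence related by a completely isometric map \<theta>. This holds for finite sums
  and passes to limits; then \<open>norm_block_entries_le\<close> applies.\<close>

lemma norm_reduced_pairs_le:
  fixes \<gamma> :: "'g::group_add \<Rightarrow> 'k::complex_hilbert bop \<Rightarrow> 'k bop" and \<delta> :: "'g \<Rightarrow> 'l::complex_hilbert bop \<Rightarrow> 'l bop"
  assumes "admissible_system A \<alpha> C \<iota> \<gamma>" "admissible_system A \<alpha> D j \<delta>" and N: "finite N"
    and TS: "\<And>i l. i \<in> N \<Longrightarrow> l \<in> N \<Longrightarrow> (T i l, S i l) \<in> closure (reduced_pairs A \<iota> \<gamma> j \<delta>)"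
  shows "norm (block N S) \<le> norm (block N T)"
proof -
  interpret C: admissible_system A \<alpha> C \<iota> \<gamma> by fact
  interpret D: admissible_system A \<alpha> D j \<delta> by fact
  let ?G = "reduced_pairs A \<iota> \<gamma> j \<delta>"
  define \<theta> where "\<theta> x = j (inv_into A \<iota> x)" for x
  have inj: "inj_on \<iota> A"
  proof (rule inj_onI)
    fix a b assume "a \<in> A" "b \<in> A" "\<iota> a = \<iota> b"
    thus "a = b" using C.norm_\<iota>[of "a - b"] by (simp add: C.\<iota>h C.Ai)
  qed
  have \<theta>: "\<theta> (\<iota> a) = j a" if "a \<in> A" for a using inj that by (simp add: \<theta>_def)
  have \<theta>_dist: "dist (\<theta> x) (\<theta> y) = dist x y" if xy: "x \<in> \<iota> ` A" "y \<in> \<iota> ` A" for x y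
  proof -
    obtain a b where ab: "a \<in> A" "b \<in> A" "x = \<iota> a" "y = \<iota> b" using xy by blast
    thus ?thesis using D.norm_\<iota>[of "a - b"] C.norm_\<iota>[of "a - b"]
      by (simp add: dist_norm \<theta> C.\<iota>h D.\<iota>h C.Ai)
  qed
  have \<theta>_cc: "completely_contractive_on (\<iota> ` A) \<theta>"
    unfolding completely_contractive_on_def matrix_norm_eq
  proof (intro allI impI)
    fix n and T :: "nat \<Rightarrow> nat \<Rightarrow> 'k bop" assume T: "\<forall>i<n. \<forall>l<n. T i l \<in> \<iota> ` A"
    define a where "a i l = inv_into A \<iota> (T i l)" for i l
    have a: "a i l \<in> A" "\<iota> (a i l) = T i l" if "i < n" "l < n" for i l
      using T that unfolding a_def by (auto intro: inv_into_into f_inv_into_f)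
    have "block {..<n} (\<lambda>i l. \<theta> (T i l)) = block {..<n} (\<lambda>i l. j (a i l))"
      by (rule block_cong) (simp add: \<theta>_def a_def)
    moreover have "block {..<n} T = block {..<n} (\<lambda>i l. \<iota> (a i l))" by (rule block_cong) (simp add: a)
    ultimately show "norm (block {..<n} (\<lambda>i l. \<theta> (T i l))) \<le> norm (block {..<n} T)"
      using completely_isometric_block[OF C.\<iota>(2), of "{..<n}" a] completely_isometric_block[OF D.\<iota>(2), of "{..<n}" a] a(1) by simp
  qed
  have G: "l2_entry y s t \<in> \<iota> ` A \<and> l2_entry z s t = \<theta> (l2_entry y s t)" if "(y, z) \<in> ?G" for y z s t
    using that
  proof (induction y z rule: crossed_pairs.induct)
    case zero show ?case using C.\<iota>h(5) D.\<iota>h(5) \<theta>[OF C.Ai(2)] C.Ai(2) by (simp add: image_iff) metis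
  next
    case (plus a y z g)
    obtain b where b: "b \<in> A" "l2_entry y s t = \<iota> b" using plus(3) by blast
    have a: "\<alpha> (- s) a \<in> A" by (rule C.\<alpha>A[OF plus(1)])
    have "\<iota> (\<alpha> (- s) a) + \<iota> b = \<iota> (\<alpha> (- s) a + b)" "\<theta> (\<iota> (\<alpha> (- s) a + b)) = j (\<alpha> (- s) a) + j b"
      by (simp_all only: C.\<iota>h(1)[OF a b(1)]) (simp only: C.\<iota>h(1)[OF a b(1), symmetric] \<theta>[OF C.Ai(3)[OF a b(1)]] D.\<iota>h(1)[OF a b(1)])
    moreover have "\<iota> (\<alpha> (- s) a + b) \<in> \<iota> ` A" by (intro imageI C.Ai a b)
    ultimately show ?case using plus b(1)
      by (simp add: l2_entry_plus C.l2_entry_regular_shift D.l2_entry_regular_shift C.\<iota>C D.\<iota>C C.\<gamma>\<iota> D.\<gamma>\<iota> b(2) \<theta>)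
  qed
  have cG: "l2_entry y s t \<in> \<iota> ` A" "l2_entry z s t = \<theta> (l2_entry y s t)" if yz: "(y, z) \<in> closure ?G" for y z s t
  proof -
    obtain u where u: "\<forall>n. u n \<in> ?G" "u \<longlonglongrightarrow> (y, z)" using yz unfolding closure_sequential by (elim exE conjE)
    have uG: "l2_entry (fst (u n)) s t \<in> \<iota> ` A" "l2_entry (snd (u n)) s t = \<theta> (l2_entry (fst (u n)) s t)" for n
      using G[of "fst (u n)" "snd (u n)" s t] u(1) by simp_all
    have lim: "(\<lambda>n. l2_entry (fst (u n)) s t) \<longlonglongrightarrow> l2_entry y s t" "(\<lambda>n. l2_entry (snd (u n)) s t) \<longlonglongrightarrow> l2_entry z s t"
      using bounded_linear.tendsto[OF bounded_linear_l2_entry tendsto_fst[OF u(2)]]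
        bounded_linear.tendsto[OF bounded_linear_l2_entry tendsto_snd[OF u(2)]] by simp_all
    show y: "l2_entry y s t \<in> \<iota> ` A"
      by (rule closed_sequentially[OF operator_algebraD(1)[OF C.image(1)] uG(1) lim(1)])
    have "(\<lambda>n. l2_entry (snd (u n)) s t) \<longlonglongrightarrow> \<theta> (l2_entry y s t)"
      using lim(1) unfolding tendsto_iff uG(2) \<theta>_dist[OF uG(1) y] .
    with lim(2) show "l2_entry z s t = \<theta> (l2_entry y s t)" by (rule LIMSEQ_unique)
  qed
  show ?thesis by (rule norm_block_entries_le[OF N \<theta>_cc]) (rule cG[OF TS]; assumption)+
qed

theorem reduced_crossed_product_cover_independent:
  fixes \<gamma> :: "'g::group_add \<Rightarrow> 'k::complex_hilbert bop \<Rightarrow> 'k bop" and \<delta> :: "'g \<Rightarrow> 'l::complex_hilbert bop \<Rightarrow> 'l bop"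
  assumes C: "admissible_system A \<alpha> C \<iota> \<gamma>" and D: "admissible_system A \<alpha> D j \<delta>"
  obtains \<kappa> where "algebra_hom_on (relative_reduced_crossed_product A \<iota> \<gamma>) \<kappa>"
    "completely_isometric_on (relative_reduced_crossed_product A \<iota> \<gamma>) \<kappa>"
    "\<kappa> ` relative_reduced_crossed_product A \<iota> \<gamma> = relative_reduced_crossed_product A j \<delta>"
proof -
  interpret C: admissible_system A \<alpha> C \<iota> \<gamma> by fact
  interpret D: admissible_system A \<alpha> D j \<delta> by fact
  let ?G = "reduced_pairs A \<iota> \<gamma> j \<delta>" and ?H = "reduced_pairs A j \<delta> \<iota> \<gamma>"
  have swap: "(z, y) \<in> closure ?H" if yz: "(y, z) \<in> closure ?G" for y z
  proof -
    have "prod.swap (y, z) \<in> closure ?H"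
      by (rule closure_map[OF continuous_on_swap _ yz]) (auto intro: crossed_pairs_swap)
    thus ?thesis by simp
  qed
  have block: "norm (block N S) = norm (block N T)"
    if "finite N" "\<And>i l. i \<in> N \<Longrightarrow> l \<in> N \<Longrightarrow> (T i l, S i l) \<in> closure ?G" for N :: "nat set" and S T
    using that by (intro antisym norm_reduced_pairs_le[OF C D] norm_reduced_pairs_le[OF D C] swap)
  have G: "isometric_graph ?G"
  proof (rule isometric_graph_crossed_pairs[OF C.covariant_system_axioms C.\<iota>(1) C.image(2) C.\<gamma>\<iota>
        D.covariant_system_axioms D.\<iota>(1) D.image(2) D.\<gamma>\<iota> C.A C.\<alpha>A])
    fix y z assume "(y, z) \<in> ?G"
    hence "(y, z) \<in> closure ?G" using closure_subset by blast
    thus "norm z = norm y" using block[of "{0}" "\<lambda>_ _. y" "\<lambda>_ _. z"] by (simp add: norm_block_single)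
  qed
  have fst: "closure (fst ` ?G) = relative_reduced_crossed_product A \<iota> \<gamma>"
    unfolding C.relative_reduced_eq crossed_product_def
    by (simp only: fst_crossed_pairs[OF C.covariant_system_axioms C.A C.\<iota>(1) C.image(2)])
  have snd: "closure (snd ` ?G) = relative_reduced_crossed_product A j \<delta>"
    unfolding D.relative_reduced_eq crossed_product_def snd_crossed_pairs
    by (simp only: fst_crossed_pairs[OF D.covariant_system_axioms C.A D.\<iota>(1) D.image(2)])
  obtain \<kappa> where \<kappa>: "algebra_hom_on (relative_reduced_crossed_product A \<iota> \<gamma>) \<kappa>"
    "\<And>y. y \<in> relative_reduced_crossed_product A \<iota> \<gamma> \<Longrightarrow> (y, \<kappa> y) \<in> closure ?G"
    "\<kappa> ` relative_reduced_crossed_product A \<iota> \<gamma> = relative_reduced_crossed_product A j \<delta>"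
    by (rule isometric_extension[OF G]) (unfold fst snd, rule that)
  have "completely_isometric_on (relative_reduced_crossed_product A \<iota> \<gamma>) \<kappa>"
    unfolding completely_isometric_on_def matrix_norm_eq by (intro allI impI block \<kappa>(2)) simp_all
  with \<kappa> show ?thesis using that by simp
qed

section \<open>Reiter's condition and the comparison of full and reduced crossed products\<close>

section \<open>Amenable groups\<close>

subsection \<open>Almost invariant vectors\<close>

lemma indicator_sum:
  "(\<lambda>s. if s = t then 1 else (0::real)) summable_on UNIV" "infsum (\<lambda>s. if s = t then 1 else (0::real)) UNIV = 1"
  using has_sum_finite_neutralI[of "{t}" UNIV "\<lambda>s. if s = t then 1 else (0::real)" 1] infsumI has_sum_imp_summable by force+

text \<open>Day's argument by contradiction. If every probability density is moved by at least
  \<epsilon> by some g in S, separation yields bounded functions \<phi> g such that the sum over S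
  of \<phi> g (g + t) - \<phi> g t is at least \<epsilon> for every t. An invariant mean sends this
  sum to 0.\<close>

lemma amenable_Reiter:
  fixes S :: "'g::group_add set"
  assumes am: "amenable TYPE('g)" and S: "finite S" and \<epsilon>: "\<epsilon> > 0"
  shows "\<exists>k :: 'g \<Rightarrow> real. (\<forall>t. 0 \<le> k t) \<and> k summable_on UNIV \<and> infsum k UNIV = 1 \<and>
    (\<forall>g\<in>S. infsum (\<lambda>t. \<bar>k (- g + t) - k t\<bar>) UNIV < \<epsilon>)"
proof (rule ccontr)
  assume no: "\<not> ?thesis"
  have contra: "\<exists>g\<in>S. infsum (\<lambda>t. \<bar>k (- g + t) - k t\<bar>) UNIV \<ge> \<epsilon>"
    if "\<And>t. 0 \<le> k t" "k summable_on UNIV" "infsum k UNIV = 1" for k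
    using that no by (meson not_le)
  \<comment> \<open>Homogeneity extends the assumption from probability densities to all nonnegative
    summable functions.\<close>
  have lower: "\<epsilon> * infsum k UNIV \<le> (\<Sum>g\<in>S. infsum (\<lambda>t. \<bar>k (- g + t) - k t\<bar>) UNIV)"
    if k: "\<And>t. 0 \<le> k t" "k summable_on UNIV" for k
  proof (cases "infsum k UNIV = 0")
    case True thus ?thesis by (auto intro!: sum_nonneg infsum_nonneg)
  next
    case False
    define c where "c = infsum k UNIV"
    have c: "c > 0" using False infsum_nonneg[of UNIV k] k(1) by (simp add: c_def order_less_le)
    have cdiv: "infsum (\<lambda>t. l t / c) UNIV = infsum l UNIV / c" for l :: "'g \<Rightarrow> real"
      by (simp add: divide_inverse infsum_cmult_left')
    have "(\<lambda>t. k t / c) summable_on UNIV"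
      using summable_on_cmult_left[OF k(2), of "inverse c"] by (simp add: divide_inverse)
    then obtain g where g: "g \<in> S" "infsum (\<lambda>t. \<bar>k (- g + t) / c - k t / c\<bar>) UNIV \<ge> \<epsilon>"
      using contra[of "\<lambda>t. k t / c"] k(1) c by (auto simp: cdiv c_def[symmetric])
    have "infsum (\<lambda>t. \<bar>k (- g + t) / c - k t / c\<bar>) UNIV = infsum (\<lambda>t. \<bar>k (- g + t) - k t\<bar>) UNIV / c"
      using c by (simp add: diff_divide_distrib[symmetric] abs_divide cdiv)
    with g(2) have "\<epsilon> \<le> infsum (\<lambda>t. \<bar>k (- g + t) - k t\<bar>) UNIV / c" by (simp only:)
    hence "\<epsilon> * c \<le> infsum (\<lambda>t. \<bar>k (- g + t) - k t\<bar>) UNIV" using c by (simp only: pos_le_divide_eq)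
    also have "\<dots> \<le> (\<Sum>g\<in>S. infsum (\<lambda>t. \<bar>k (- g + t) - k t\<bar>) UNIV)"
      using S g(1) by (intro member_le_sum infsum_nonneg) auto
    finally show ?thesis by (simp add: c_def)
  qed
  \<comment> \<open>The absolutely summable families with their norm \<open>N\<close>, realised
    inside the square summable ones, where the vector space structure is available.\<close>
  define W where "W = {h :: ('g \<times> 'g, complex) l2. (\<lambda>u. norm (Rep_l2 h u)) summable_on UNIV}"
  define N where "N h = infsum (\<lambda>u. norm (Rep_l2 h u)) UNIV" for h :: "('g \<times> 'g, complex) l2"
  have W_add: "h + h' \<in> W" "N (h + h') \<le> N h + N h'" if "h \<in> W" "h' \<in> W" for h h'
  proof -
    have s: "(\<lambda>u. norm (Rep_l2 h u) + norm (Rep_l2 h' u)) summable_on UNIV" using that by (auto simp: W_def intro: summable_on_add)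
    show W: "h + h' \<in> W" unfolding W_def
      by (auto simp: Rep_l2_simps intro!: summable_on_comparison_test[OF s] norm_triangle_ineq)
    have "N (h + h') \<le> infsum (\<lambda>u. norm (Rep_l2 h u) + norm (Rep_l2 h' u)) UNIV"
      unfolding N_def using W s by (intro infsum_mono) (auto simp: W_def Rep_l2_simps norm_triangle_ineq)
    also have "\<dots> = N h + N h'" unfolding N_def using that by (intro infsum_add) (auto simp: W_def)
    finally show "N (h + h') \<le> N h + N h'" .
  qed
  have W_scale: "c *\<^sub>R h \<in> W" "N (c *\<^sub>R h) = \<bar>c\<bar> * N h" if "h \<in> W" for c h
    using that summable_on_cmult_right[of "\<lambda>u. norm (Rep_l2 h u)" UNIV "\<bar>c\<bar>"] by (auto simp: W_def N_def Rep_l2_simps infsum_cmult_right')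
  have W0: "0 \<in> W" by (simp add: W_def Rep_l2_simps)
  have W: "subspace W" by (auto simp: subspace_def W0 W_add W_scale)
  have N: "sublinear_on W N" by (simp add: sublinear_on_def W_add W_scale)
  have single: "l2_single u 1 \<in> W" "N (l2_single u 1) = 1" for u
  proof -
    have "(\<lambda>v. norm (Rep_l2 (l2_single u (1::complex)) v)) = (\<lambda>v. if v = u then 1 else 0)" by (auto simp: Rep_l2_single)
    thus "l2_single u 1 \<in> W" "N (l2_single u 1) = 1" 
      unfolding W_def N_def by (simp_all add: indicator_sum)
  qed
  define K where "K = {(x, r). x \<in> W \<and> (\<exists>k::'g \<Rightarrow> real. (\<forall>t. 0 \<le> k t) \<and> k summable_on UNIV \<and> r = \<epsilon> * infsum k UNIV \<and>
    (\<forall>g t. Rep_l2 x (g, t) = (if g \<in> S then of_real (k (- g + t) - k t) else 0)))}"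
  obtain f where f: "\<And>x y. x \<in> W \<Longrightarrow> y \<in> W \<Longrightarrow> f (x + y) = f x + f y"
    "\<And>t x. x \<in> W \<Longrightarrow> f (t *\<^sub>R x) = t * f x" "\<And>x. x \<in> W \<Longrightarrow> f x \<le> N x" "\<And>x r. (x, r) \<in> K \<Longrightarrow> r \<le> f x"
  proof (rule cone_separation[OF W N])
    show "(0, 0) \<in> K" by (auto simp: K_def W0 Rep_l2_simps intro!: exI[of _ "\<lambda>_. 0"])
    show "(x + y, r + s) \<in> K" if x: "(x, r) \<in> K" and y: "(y, s) \<in> K" for x r y s
    proof -
      obtain k where k: "\<forall>t. 0 \<le> k t" "k summable_on UNIV" "r = \<epsilon> * infsum k UNIV"
        "\<forall>g t. Rep_l2 x (g, t) = (if g \<in> S then of_real (k (- g + t) - k t) else 0)" using x unfolding K_def by blast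
      obtain l where l: "\<forall>t. 0 \<le> l t" "l summable_on UNIV" "s = \<epsilon> * infsum l UNIV"
        "\<forall>g t. Rep_l2 y (g, t) = (if g \<in> S then of_real (l (- g + t) - l t) else 0)" using y unfolding K_def by blast
      have "x + y \<in> W" using x y by (intro W_add) (auto simp: K_def)
      thus ?thesis unfolding K_def using k l
        by (auto simp: Rep_l2_simps infsum_add distrib_left intro!: exI[of _ "\<lambda>t. k t + l t"] summable_on_add)
    qed
    show "(c *\<^sub>R x, c * r) \<in> K" if c: "c > 0" and x: "(x, r) \<in> K" for c x r
    proof -
      obtain k where k: "\<forall>t. 0 \<le> k t" "k summable_on UNIV" "r = \<epsilon> * infsum k UNIV"
        "\<forall>g t. Rep_l2 x (g, t) = (if g \<in> S then of_real (k (- g + t) - k t) else 0)" using x unfolding K_def by blast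
      have "c *\<^sub>R x \<in> W" using x by (intro W_scale) (auto simp: K_def)
      thus ?thesis unfolding K_def using k c
        by (auto simp: Rep_l2_simps infsum_cmult_right' scaleR_conv_of_real right_diff_distrib intro!: exI[of _ "\<lambda>t. c * k t"] summable_on_cmult_right)
    qed
    show "x \<in> W \<and> r \<le> N x" if x: "(x, r) \<in> K" for x r
    proof -
      obtain k where k: "\<And>t. 0 \<le> k t" "k summable_on UNIV" "r = \<epsilon> * infsum k UNIV"
        "\<And>g t. Rep_l2 x (g, t) = (if g \<in> S then of_real (k (- g + t) - k t) else 0)" using x unfolding K_def by blast
      have xW: "x \<in> W" using x by (auto simp: K_def)
      have s: "(\<lambda>(g, t). norm (Rep_l2 x (g, t))) summable_on S \<times> UNIV"
        using xW by (auto simp: W_def case_prod_unfold intro: summable_on_subset_banach)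
      have "r \<le> (\<Sum>g\<in>S. infsum (\<lambda>t. \<bar>k (- g + t) - k t\<bar>) UNIV)" unfolding k(3) by (rule lower[OF k(1,2)])
      also have "\<dots> = (\<Sum>g\<in>S. infsum (\<lambda>t. norm (Rep_l2 x (g, t))) UNIV)"
        by (intro sum.cong) (simp_all add: k(4) del: of_real_diff)
      also have "\<dots> = infsum (\<lambda>(g, t). norm (Rep_l2 x (g, t))) (S \<times> UNIV)"
        using infsum_Sigma'_banach[OF s] S by simp
      also have "\<dots> \<le> N x"
        unfolding N_def using s xW by (intro infsum_mono_neutral) (auto simp: W_def)
      finally show ?thesis using xW by simp
    qed
  qed (rule that)
  \<comment> \<open>The separating functional evaluated at unit masses; \<phi> g is the bounded
    function that represents it on the copy of the group labelled g.\<close>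
  define \<phi> where "\<phi> g t = f (l2_single (g, t) 1)" for g t
  have \<phi>1: "\<bar>\<phi> g t\<bar> \<le> 1" for g t
    using f(3)[OF single(1), of "(g, t)"] f(3)[OF W_scale(1)[OF single(1)], of "- 1" "(g, t)"]
      f(2)[OF single(1), of "- 1" "(g, t)"] W_scale(2)[OF single(1), of "- 1" "(g, t)"] single(2)[of "(g, t)"]
    by (simp add: \<phi>_def abs_le_iff)
  have ineq: "\<epsilon> \<le> (\<Sum>g\<in>S. \<phi> g (g + t) - \<phi> g t)" for t
  proof -
    define d where "d g = l2_single (g, g + t) (1::complex) + (- 1) *\<^sub>R l2_single (g, t) 1" for g
    have d: "d g \<in> W" "f (d g) = \<phi> g (g + t) - \<phi> g t" for g
    proof -
      show "d g \<in> W" unfolding d_def by (intro W_add W_scale single)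
      show "f (d g) = \<phi> g (g + t) - \<phi> g t"
        unfolding d_def \<phi>_def f(1)[OF single(1) W_scale(1)[OF single(1)]] f(2)[OF single(1)] by simp
    qed
    have sum: "sum d T \<in> W \<and> f (sum d T) = (\<Sum>g\<in>T. \<phi> g (g + t) - \<phi> g t)" if "finite T" for T
      using that
    proof (induction T)
      case empty show ?case using f(2)[OF W0, of 0] W0 by simp
    next
      case (insert g T) thus ?case using f(1)[OF d(1), of "sum d T" g] d by (simp add: W_add)
    qed
    \<comment> \<open>The density behind this pair is the point mass at t.\<close>
    have "(sum d S, \<epsilon>) \<in> K"
      unfolding K_def
    proof (intro CollectI case_prodI conjI exI[of _ "\<lambda>s. if s = t then 1 else 0"] allI)
      show "sum d S \<in> W" using sum[OF S] by simp
      show "(\<lambda>s. if s = t then 1 else (0::real)) summable_on UNIV" "\<epsilon> = \<epsilon> * infsum (\<lambda>s. if s = t then 1 else 0) UNIV"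
        by (simp_all add: indicator_sum)
      fix g s
      have "- g + s = t \<longleftrightarrow> s = g + t" by (metis add.assoc add.left_neutral left_minus right_minus)
      hence *: "Rep_l2 (d h) (g, s) = (if h = g then of_real ((if - g + s = t then 1 else 0) - (if s = t then 1 else 0)) else 0)" for h
        by (auto simp: d_def Rep_l2_simps Rep_l2_single)
      show "Rep_l2 (sum d S) (g, s) = (if g \<in> S then of_real ((if - g + s = t then 1 else 0) - (if s = t then 1 else 0)) else 0)"
        unfolding Rep_l2_sum * sum.delta[OF S] ..
    qed simp
    from f(4)[OF this] sum[OF S] show ?thesis by simp
  qed
  from am[unfolded amenable_def] obtain m :: "('g \<Rightarrow> real) \<Rightarrow> real" where m0: "m (\<lambda>_. 1) = 1"
    "\<forall>f. bounded (range f) \<longrightarrow> (\<forall>t. 0 \<le> f t) \<longrightarrow> 0 \<le> m f"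
    "\<forall>f h. bounded (range f) \<longrightarrow> bounded (range h) \<longrightarrow> m (\<lambda>t. f t + h t) = m f + m h"
    "\<forall>c f. bounded (range f) \<longrightarrow> m (\<lambda>t. c * f t) = c * m f"
    "\<forall>s f. bounded (range f) \<longrightarrow> m (\<lambda>t. f (s + t)) = m f"
    by (elim exE conjE) (rule that)
  note m = m0(1) m0(2-)[rule_format]
  have bnd: "bounded (range (\<phi> g))" "bounded (range (\<lambda>t. \<phi> g (s + t)))" for g s
    using \<phi>1 by (auto intro!: boundedI[where B=1])
  have m_diff: "bounded (range (\<lambda>t. \<phi> g (g + t) - \<phi> g t)) \<and> m (\<lambda>t. \<phi> g (g + t) - \<phi> g t) = 0" for g
  proof -
    have b: "bounded (range (\<lambda>t. - 1 * \<phi> g t))" using bnd(1)[of g] \<phi>1 by (auto intro!: boundedI[where B=1])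
    have "\<bar>\<phi> g (g + t) - \<phi> g t\<bar> \<le> 2" for t using \<phi>1[of g "g + t"] \<phi>1[of g t] by linarith
    hence "bounded (range (\<lambda>t. \<phi> g (g + t) - \<phi> g t))" by (auto intro!: boundedI[where B=2])
    thus ?thesis using m(3)[OF bnd(2)[of g g] b] m(4)[OF bnd(1)[of g], of "- 1"] m(5)[OF bnd(1)[of g], of g] by simp
  qed
  have const: "bounded (range (\<lambda>_::'g. c))" "m (\<lambda>_. c) = c" for c :: real
    using m(4)[of "\<lambda>_. 1" c] m(1) by (auto intro!: boundedI[where B="\<bar>c\<bar>"])
  have m_sum: "bounded (range (\<lambda>t. \<Sum>g\<in>T. \<phi> g (g + t) - \<phi> g t)) \<and> m (\<lambda>t. \<Sum>g\<in>T. \<phi> g (g + t) - \<phi> g t) = 0" if "finite T" for T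
    using that
  proof (induction T)
    case empty show ?case using const[of 0] by simp
  next
    case (insert g T)
    thus ?case using m_diff[of g] m(3)[of "\<lambda>t. \<phi> g (g + t) - \<phi> g t" "\<lambda>t. \<Sum>g\<in>T. \<phi> g (g + t) - \<phi> g t"]
      bounded_plus_comp[of "\<lambda>t. \<phi> g (g + t) - \<phi> g t" UNIV "\<lambda>t. \<Sum>g\<in>T. \<phi> g (g + t) - \<phi> g t"] by simp
  qed
  \<comment> \<open>The sum minus \<epsilon> is nonnegative pointwise, yet its mean is - \<epsilon>
    by invariance.\<close>
  have "0 \<le> m (\<lambda>t. (\<Sum>g\<in>S. \<phi> g (g + t) - \<phi> g t) + - \<epsilon>)"
    using ineq m_sum[OF S] const(1)[of "- \<epsilon>"]
    by (intro m(2) bounded_plus_comp) auto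
  also have "\<dots> = - \<epsilon>" using m(3)[of "\<lambda>t. \<Sum>g\<in>S. \<phi> g (g + t) - \<phi> g t" "\<lambda>_. - \<epsilon>"] m_sum[OF S] const[of "- \<epsilon>"] by simp
  finally show False using \<epsilon> by simp
qed

text \<open>The square root of a Reiter function is taken: (sqrt a - sqrt b)^2 \<le> |a - b| turns
  an estimate by \<epsilon>^2 of absolute sums into one by \<epsilon> of square sums.\<close>

lemma amenable_almost_invariant_vector:
  fixes S :: "'g::group_add set"
  assumes am: "amenable TYPE('g)" and S: "finite S" and \<epsilon>: "\<epsilon> > 0"
  obtains f :: "('g, complex) l2" where "norm f = 1" "\<And>g. g \<in> S \<Longrightarrow> norm (op_apply (l2_shift g) f - f) < \<epsilon>"
proof -
  from amenable_Reiter[OF am S zero_less_power[OF \<epsilon>, of 2]] obtain k :: "'g \<Rightarrow> real" where k: "\<forall>t. 0 \<le> k t" "k summable_on UNIV" "infsum k UNIV = 1"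
    "\<forall>g\<in>S. infsum (\<lambda>t. \<bar>k (- g + t) - k t\<bar>) UNIV < \<epsilon>\<^sup>2"
    by (elim exE conjE) (rule that)
  define f :: "('g, complex) l2" where "f = Abs_l2 (\<lambda>t. of_real (sqrt (k t)))"
  have f: "Rep_l2 f t = of_real (sqrt (k t))" for t
    unfolding f_def using k(1,2) by (subst Abs_l2_inverse) auto
  have "(norm f)\<^sup>2 = 1" unfolding norm_l2_square using k(1,3) by (simp add: f)
  hence "norm f = 1" by (simp add: power2_eq_1_iff) (use norm_ge_zero[of f] in linarith)
  moreover have "norm (op_apply (l2_shift g) f - f) < \<epsilon>" if g: "g \<in> S" for g
  proof -
    have "bij (\<lambda>t. - g + t)" by (rule bijI') (auto intro: exI[of _ "g + y" for y] simp: add.assoc[symmetric])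
    hence "(\<lambda>t. k (- g + t)) summable_on UNIV"
      using k(2) summable_on_reindex_bij_betw[of "\<lambda>t. - g + t" UNIV UNIV k] by simp
    hence s: "(\<lambda>t. \<bar>k (- g + t) - k t\<bar>) summable_on UNIV"
      by (rule summable_on_comparison_test[OF summable_on_add[OF _ k(2)]]) (use k(1) in \<open>auto simp: abs_le_iff\<close>)
    have le: "(sqrt a - sqrt b)\<^sup>2 \<le> \<bar>a - b\<bar>" if "0 \<le> a" "0 \<le> b" for a b :: real
    proof -
      have "(sqrt a - sqrt b)\<^sup>2 = \<bar>sqrt a - sqrt b\<bar> * \<bar>sqrt a - sqrt b\<bar>" by (simp add: power2_eq_square)
      also have "\<dots> \<le> \<bar>sqrt a - sqrt b\<bar> * \<bar>sqrt a + sqrt b\<bar>"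
      proof (rule mult_left_mono)
        show "\<bar>sqrt a - sqrt b\<bar> \<le> \<bar>sqrt a + sqrt b\<bar>"
          using real_sqrt_ge_zero[OF that(1)] real_sqrt_ge_zero[OF that(2)] by linarith
      qed simp
      also have "\<dots> = \<bar>(sqrt a - sqrt b) * (sqrt a + sqrt b)\<bar>" by (rule abs_mult[symmetric])
      also have "(sqrt a - sqrt b) * (sqrt a + sqrt b) = a - b" using that by (simp add: algebra_simps)
      finally show ?thesis .
    qed
    have "(norm (op_apply (l2_shift g) f - f))\<^sup>2 = infsum (\<lambda>t. (sqrt (k (- g + t)) - sqrt (k t))\<^sup>2) UNIV"
      unfolding norm_l2_square by (simp add: Rep_l2_simps Rep_l2_shift f flip: of_real_diff)
    also have "\<dots> \<le> infsum (\<lambda>t. \<bar>k (- g + t) - k t\<bar>) UNIV"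
      using k(1) le by (intro infsum_mono s summable_on_comparison_test[OF s]) auto
    also have "\<dots> < \<epsilon>\<^sup>2" using k(4) g by blast
    finally show ?thesis using \<epsilon> by (simp add: power_less_imp_less_base)
  qed
  ultimately show ?thesis by (rule that)
qed

subsection \<open>The regular representation dominates\<close>

context covariant_system
begin

text \<open>The function \<open>t \<mapsto> f(t) U\<^sub>t\<^sup>* \<xi>\<close>, on which the regular representation acts almost as
  \<open>\<pi>\<close> and \<open>U\<close> act on \<open>\<xi>\<close> when \<open>f\<close> is almost invariant.\<close>

definition spread :: "('g, complex) l2 \<Rightarrow> 'u \<Rightarrow> ('g, 'u) l2"
  where "spread f \<xi> = Abs_l2 (\<lambda>t. Rep_l2 f t *\<^sub>C op_apply (U (- t)) \<xi>)"

lemma norm_U: "norm (op_apply (U s) \<xi>) = norm \<xi>"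
proof -
  have "cinner (op_apply (U s) \<xi>) (op_apply (U s) \<xi>) = cinner \<xi> (op_apply (adj (U s) * U s) \<xi>)"
    by (simp only: op_apply_times cinner_adj)
  hence "(norm (op_apply (U s) \<xi>))\<^sup>2 = (norm \<xi>)\<^sup>2" by (simp add: U_unitary Re_cinner_self[symmetric])
  thus ?thesis by simp
qed

lemma Rep_l2_spread: "Rep_l2 (spread f \<xi>) t = Rep_l2 f t *\<^sub>C op_apply (U (- t)) \<xi>"
  unfolding spread_def using square_summable_bound[OF Rep_l2_summable[of f], of "\<lambda>t. Rep_l2 f t *\<^sub>C op_apply (U (- t)) \<xi>" "norm \<xi>"]
  by (subst Abs_l2_inverse) (auto simp: norm_scaleC norm_U mult.commute)

lemma norm_spread: "norm (spread f \<xi>) = norm f * norm \<xi>"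
proof -
  have "(norm (spread f \<xi>))\<^sup>2 = (norm f * norm \<xi>)\<^sup>2"
    unfolding norm_l2_square power_mult_distrib
    by (simp add: Rep_l2_spread norm_scaleC norm_U power_mult_distrib infsum_cmult_left')
  thus ?thesis by simp
qed

lemma spread_linear: "spread (f - f') \<xi> = spread f \<xi> - spread f' \<xi>" "spread f (\<xi> + \<xi>') = spread f \<xi> + spread f \<xi>'" "spread f 0 = 0"
  by (rule l2_eqI; simp add: Rep_l2_spread Rep_l2_simps scaleC_add_right op_apply_add
      diff_conv_add_uminus scaleC_add_left del: add_uminus_conv_diff)+

text \<open>The regular representation with \<pi> applied to every entry. It acts on families of
  vectors of the space of U.\<close>

definition covariant_diag :: "'k bop \<Rightarrow> ('g, 'u) l2 bop"
  where "covariant_diag a = l2_diag (\<lambda>t. \<pi> (\<gamma> (- t) a))"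

lemma Rep_l2_covariant_diag:
  assumes a: "a \<in> C"
  shows "Rep_l2 (op_apply (covariant_diag a) f) t = op_apply (\<pi> (\<gamma> (- t) a)) (Rep_l2 f t)"
  unfolding covariant_diag_def
proof (intro Rep_l2_diag boundedI[where B="norm a"])
  fix x assume "x \<in> range (\<lambda>t. \<pi> (\<gamma> (- t) a))"
  then obtain t where "x = \<pi> (\<gamma> (- t) a)" by blast
  thus "norm x \<le> norm a" using order_trans[OF \<pi>_norm[OF \<gamma>C[OF a]] \<gamma>_norm[OF a]] by simp
qed

lemma covariant_diag_spread:
  assumes a: "a \<in> C"
  shows "op_apply (covariant_diag a * l2_shift g) (spread f \<xi>) = spread (op_apply (l2_shift g) f) (op_apply (\<pi> a * U g) \<xi>)"
proof (rule l2_eqI)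
  fix t
  have "\<pi> (\<gamma> (- t) a) * U (- (- g + t)) = \<pi> (\<gamma> (- t) a) * U (- t) * U g"
    by (simp add: minus_add U_plus[symmetric] mult.assoc)
  also have "\<dots> = U (- t) * \<pi> a * U g" by (simp only: U_\<pi>[OF a])
  finally have "op_apply (\<pi> (\<gamma> (- t) a)) (op_apply (U (- (- g + t))) \<xi>) = op_apply (U (- t)) (op_apply (\<pi> a * U g) \<xi>)"
    by (metis op_apply_times)
  thus "Rep_l2 (op_apply (covariant_diag a * l2_shift g) (spread f \<xi>)) t
      = Rep_l2 (spread (op_apply (l2_shift g) f) (op_apply (\<pi> a * U g) \<xi>)) t"
    using a by (simp add: Rep_l2_covariant_diag Rep_l2_shift Rep_l2_spread op_apply_scaleC)
qed

text \<open>Let z' arise from z by applying \<pi> to every entry; its norm is at most that of z. By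
  \<open>covariant_diag_spread\<close>, z' acts on \<open>spread f \<xi>\<close> as y acts on \<xi>,
  up to an error governed by how far f is moved by the finitely many group elements involved. Almost
  invariant unit vectors make the error arbitrarily small.\<close>

lemma amenable_regular_dominates:
  assumes am: "amenable TYPE('g)" and yz: "(y, z) \<in> crossed_pairs C \<pi> U (regular_rep \<gamma>) l2_shift"
  shows "norm y \<le> norm z"
proof -
  interpret reg: regular_system C \<gamma> by unfold_locales (rule C \<gamma>)+
  obtain z' S c where z': "\<And>s t. l2_entry z s t \<in> C \<and> l2_entry z' s t = \<pi> (l2_entry z s t)"
    and S: "finite S" and c: "c \<ge> 0"
    and approx: "\<And>(f :: ('g, complex) l2) \<epsilon> \<xi>. (\<And>g. g \<in> S \<Longrightarrow> norm (op_apply (l2_shift g) f - f) \<le> \<epsilon>) \<Longrightarrow> \<epsilon> \<ge> 0 \<Longrightarrow>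
      norm (op_apply z' (spread f \<xi>) - spread f (op_apply y \<xi>)) \<le> c * \<epsilon> * norm \<xi>"
  proof -
    \<comment> \<open>The set S collects the group elements that occur and c sums the norms of the
      coefficients; neither depends on f, \<epsilon> or \<xi>.\<close>
    have "\<exists>z' S c. (\<forall>s t. l2_entry z s t \<in> C \<and> l2_entry z' s t = \<pi> (l2_entry z s t)) \<and> finite S \<and> c \<ge> 0 \<and>
      (\<forall>(f :: ('g, complex) l2) \<epsilon> \<xi>. (\<forall>g\<in>S. norm (op_apply (l2_shift g) f - f) \<le> \<epsilon>) \<longrightarrow> \<epsilon> \<ge> 0 \<longrightarrow>
      norm (op_apply z' (spread f \<xi>) - spread f (op_apply y \<xi>)) \<le> c * \<epsilon> * norm \<xi>)"
      using yz
    proof (induction y z rule: crossed_pairs.induct)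
      case zero
      show ?case by (rule exI[of _ 0], rule exI[of _ "{}"], rule exI[of _ 0]) (simp add: Ci \<pi>h spread_linear)
    next
      case (plus a y z g)
      then obtain z' S c where z': "\<forall>s t. l2_entry z s t \<in> C \<and> l2_entry z' s t = \<pi> (l2_entry z s t)" and S: "finite S" "c \<ge> 0"
        and approx: "\<forall>(f :: ('g, complex) l2) \<epsilon> \<xi>. (\<forall>g\<in>S. norm (op_apply (l2_shift g) f - f) \<le> \<epsilon>) \<longrightarrow> \<epsilon> \<ge> 0 \<longrightarrow>
          norm (op_apply z' (spread f \<xi>) - spread f (op_apply y \<xi>)) \<le> c * \<epsilon> * norm \<xi>" by (elim exE conjE) (rule that)
      let ?D = "covariant_diag a * l2_shift g"
      have D: "l2_entry ?D s t = (if - g + s = t then \<pi> (\<gamma> (- s) a) else 0)" for s t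
        by (rule bop_eqI) (simp add: l2_entry_apply Rep_l2_covariant_diag[OF plus(1)] Rep_l2_shift Rep_l2_single)
      show ?case
      proof (intro exI conjI allI impI)
        fix s t
        show "l2_entry (regular_rep \<gamma> a * l2_shift g + z) s t \<in> C"
          using z' by (auto simp: l2_entry_plus reg.l2_entry_regular_shift[OF plus(1)] intro!: Ci \<gamma>C plus(1))
        show "l2_entry (?D + z') s t = \<pi> (l2_entry (regular_rep \<gamma> a * l2_shift g + z) s t)"
          using z' \<gamma>C[OF plus(1)] by (simp add: l2_entry_plus reg.l2_entry_regular_shift[OF plus(1)] D \<pi>h)
      next
        show "finite (insert g S)" "norm a + c \<ge> 0" using S by simp_all
        fix f :: "('g, complex) l2" and \<epsilon> \<xi> assume f: "\<forall>g\<in>insert g S. norm (op_apply (l2_shift g) f - f) \<le> \<epsilon>" and \<epsilon>: "\<epsilon> \<ge> 0"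
        have "norm (op_apply (\<pi> a * U g) \<xi>) \<le> norm (\<pi> a) * norm (op_apply (U g) \<xi>)" by (simp add: norm_op_apply_le)
        also have "\<dots> \<le> norm a * norm \<xi>" unfolding norm_U by (intro mult_right_mono \<pi>_norm plus(1)) simp
        finally have n: "norm (op_apply (\<pi> a * U g) \<xi>) \<le> norm a * norm \<xi>" .
        have "norm (op_apply ?D (spread f \<xi>) - spread f (op_apply (\<pi> a * U g) \<xi>))
            = norm (op_apply (l2_shift g) f - f) * norm (op_apply (\<pi> a * U g) \<xi>)"
          unfolding covariant_diag_spread[OF plus(1)] spread_linear(1)[symmetric] norm_spread ..
        also have "\<dots> \<le> \<epsilon> * (norm a * norm \<xi>)" using f \<epsilon> by (intro mult_mono n) auto
        finally have 1: "norm (op_apply ?D (spread f \<xi>) - spread f (op_apply (\<pi> a * U g) \<xi>)) \<le> \<epsilon> * (norm a * norm \<xi>)" .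
        have 2: "norm (op_apply z' (spread f \<xi>) - spread f (op_apply y \<xi>)) \<le> c * \<epsilon> * norm \<xi>"
          using approx[rule_format, of f \<epsilon> \<xi>] f \<epsilon> by blast
        have "op_apply (?D + z') (spread f \<xi>) - spread f (op_apply (\<pi> a * U g + y) \<xi>)
            = (op_apply ?D (spread f \<xi>) - spread f (op_apply (\<pi> a * U g) \<xi>)) + (op_apply z' (spread f \<xi>) - spread f (op_apply y \<xi>))"
          unfolding op_apply_plus spread_linear(2) by simp
        hence "norm (op_apply (?D + z') (spread f \<xi>) - spread f (op_apply (\<pi> a * U g + y) \<xi>)) \<le> \<epsilon> * (norm a * norm \<xi>) + c * \<epsilon> * norm \<xi>"
          using norm_triangle_mono[OF 1 2] by (simp only:)
        thus "norm (op_apply (?D + z') (spread f \<xi>) - spread f (op_apply (\<pi> a * U g + y) \<xi>)) \<le> (norm a + c) * \<epsilon> * norm \<xi>"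
          by (simp add: algebra_simps)
      qed
    qed
    thus ?thesis by (elim exE conjE) (rule that; blast)
  qed
  have "norm (block {()} (\<lambda>_ _. z')) \<le> norm (block {()} (\<lambda>_ _. z))"
    by (rule norm_block_entries_le[OF _ star_hom_completely_contractive[OF C \<pi>]]) (simp_all add: z')
  hence n: "norm z' \<le> norm z" by (simp add: norm_block_single)
  show ?thesis
  proof (rule norm_bop_le[OF _ norm_ge_zero])
    fix \<xi>
    show "norm (op_apply y \<xi>) \<le> norm z * norm \<xi>"
    proof (rule field_le_epsilon)
      fix d :: real assume d: "d > 0"
      \<comment> \<open>Chosen so that the error c \<epsilon> times the norm of \<xi> is at most d;
        the summand 1 excludes division by zero.\<close>
      define \<epsilon> where "\<epsilon> = d / (c * norm \<xi> + 1)"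
      have \<epsilon>: "\<epsilon> > 0" using d c by (simp add: \<epsilon>_def add_nonneg_pos)
      obtain f :: "('g, complex) l2" where f: "norm f = 1" "\<And>g. g \<in> S \<Longrightarrow> norm (op_apply (l2_shift g) f - f) < \<epsilon>"
        by (rule amenable_almost_invariant_vector[OF am S \<epsilon>]) (rule that)
      have "norm (op_apply y \<xi>) = norm (spread f (op_apply y \<xi>))" by (simp add: norm_spread f)
      also have "\<dots> \<le> norm (op_apply z' (spread f \<xi>)) + norm (op_apply z' (spread f \<xi>) - spread f (op_apply y \<xi>))"
        using norm_triangle_ineq4[of "op_apply z' (spread f \<xi>)" "op_apply z' (spread f \<xi>) - spread f (op_apply y \<xi>)"] by simp
      also have "norm (op_apply z' (spread f \<xi>)) \<le> norm z * norm (spread f \<xi>)"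
        by (intro order_trans[OF norm_op_apply_le] mult_right_mono n norm_ge_zero)
      also have "norm (op_apply z' (spread f \<xi>) - spread f (op_apply y \<xi>)) \<le> c * \<epsilon> * norm \<xi>"
        using f(2) \<epsilon> by (intro approx) (auto intro: less_imp_le)
      also have "c * \<epsilon> * norm \<xi> \<le> \<epsilon> * (c * norm \<xi> + 1)" using \<epsilon> by (simp add: algebra_simps)
      also have "\<dots> = d" using c by (simp add: \<epsilon>_def add_nonneg_eq_0_iff)
      finally show "norm (op_apply y \<xi>) \<le> norm z * norm \<xi> + d" by (simp add: norm_spread f)
    qed
  qed
qed

end


subsection \<open>The full crossed product of an amenable group\<close>

text \<open>Rank one operators with a fixed nonzero functional recover the vector. So the vectors of
  a space can be indexed by its operators, as the test space for universality demands.\<close>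

lemma inj_into_bop: "\<exists>b :: 'k::complex_hilbert \<Rightarrow> 'k bop. inj b"
proof (cases "\<forall>\<xi>::'k. \<xi> = 0")
  case True
  hence "inj (\<lambda>_::'k. 0 :: 'k bop)" by (metis injI)
  thus ?thesis by blast
next
  case False
  then obtain \<zeta> :: 'k where \<zeta>: "\<zeta> \<noteq> 0" by blast
  have c: "bounded_clinear (\<lambda>y. cinner y \<zeta> *\<^sub>C \<xi>)" for \<xi> :: 'k
  proof (rule bounded_clinear_intro[where K="norm \<zeta> * norm \<xi>"])
    fix x :: 'k
    have "cmod (cinner x \<zeta>) * norm \<xi> \<le> norm x * norm \<zeta> * norm \<xi>"
      by (intro mult_right_mono norm_cinner_le norm_ge_zero)
    thus "norm (cinner x \<zeta> *\<^sub>C \<xi>) \<le> norm \<zeta> * norm \<xi> * norm x" by (simp add: norm_scaleC mult_ac)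
  qed (simp_all add: cinner_add_left scaleC_add_left cinner_scaleC_left scaleC_scaleC)
  have "inj (\<lambda>\<xi>. Bop (\<lambda>y. cinner y \<zeta> *\<^sub>C \<xi>))"
  proof (rule injI)
    fix \<xi> \<eta> :: 'k assume "Bop (\<lambda>y. cinner y \<zeta> *\<^sub>C \<xi>) = Bop (\<lambda>y. cinner y \<zeta> *\<^sub>C \<eta>)"
    hence "op_apply (Bop (\<lambda>y. cinner y \<zeta> *\<^sub>C \<xi>)) \<zeta> = op_apply (Bop (\<lambda>y. cinner y \<zeta> *\<^sub>C \<eta>)) \<zeta>" by simp
    hence "inverse (cinner \<zeta> \<zeta>) *\<^sub>C cinner \<zeta> \<zeta> *\<^sub>C \<xi> = inverse (cinner \<zeta> \<zeta>) *\<^sub>C cinner \<zeta> \<zeta> *\<^sub>C \<eta>"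
      by (simp add: op_apply_Bop[OF c])
    thus "\<xi> = \<eta>" using \<zeta> by (simp add: scaleC_scaleC cinner_self)
  qed
  thus ?thesis by blast
qed

lemma isometry_to_test_space:
  obtains V :: "('g, 'k::complex_hilbert) l2 \<Rightarrow> ('k bop \<times> 'g, complex) l2" where "partial_isometry V 1"
proof -
  obtain b :: "'k \<Rightarrow> 'k bop" where b: "inj b" using inj_into_bop by blast
  let ?\<omega> = "\<lambda>(\<xi>, g). l2_single g \<xi> :: ('g, 'k) l2"
  obtain V :: "('g, 'k) l2 \<Rightarrow> ('k bop \<times> 'g, complex) l2"
    where V: "bounded_clinear V" "\<And>x. hadj V (V x) = op_apply (cproj (cspan (range ?\<omega>))) x"
    by (rule isometric_embedding[OF inj_map_prod[OF b inj_on_id2[of UNIV]], of ?\<omega>]) (rule that)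
  have "range ?\<omega> = {l2_single g \<xi> |g \<xi>. True}" by auto
  hence "cspan (range ?\<omega>) = UNIV" by (simp only: l2_singles_total)
  hence "hadj V (V x) = x" for x using V(2)[of x] cproj(4)[OF closed_csubspace_cspan, of x "range ?\<omega>"] by simp
  hence "partial_isometry V 1" using V(1) by unfold_locales simp_all
  thus ?thesis by (rule that)
qed

text \<open>Acting as the identity on the complement of the range of \<open>V\<close> makes the
  transported unitaries unitary on the larger space. Covariance is not disturbed, since the
  transported \<pi> vanishes there.\<close>

lemma (in partial_isometry) covariant_rep_transport:
  assumes p1: "p = 1" and cov: "covariant_rep C \<gamma> \<pi> U"
  shows "covariant_rep C \<gamma> (\<lambda>c. transport V (\<pi> c)) (\<lambda>s. transport V (U s) + (1 - transport V 1))"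
proof -
  note t = isometry_transport(2)[OF p1]
  let ?Q = "transport V 1"
  have Q: "transport V S * (1 - ?Q) = 0" "(1 - ?Q) * transport V S = 0" "(1 - ?Q) * (1 - ?Q) = 1 - ?Q" for S
    by (simp_all add: right_diff_distrib left_diff_distrib t[symmetric])
  have W: "(transport V S + (1 - ?Q)) * (transport V T + (1 - ?Q)) = transport V (S * T) + (1 - ?Q)" for S T
    unfolding distrib_left distrib_right Q t by simp
  have adjW: "adj (transport V S + (1 - ?Q)) = transport V (adj S) + (1 - ?Q)" for S
    by (simp add: transport_adj[OF V])
  show ?thesis
    unfolding covariant_rep_def
  proof (intro conjI allI ballI)
    show "star_hom_on C (\<lambda>c. transport V (\<pi> c))"
      by (rule star_hom_compose[OF _ isometry_transport(1)[OF p1]]) (use cov in \<open>auto simp: covariant_rep_def\<close>)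
    fix s
    have "unitary (U s)" using cov by (simp add: covariant_rep_def)
    thus "unitary (transport V (U s) + (1 - ?Q))" unfolding unitary_def adjW W by simp
    show "transport V (U (s + t)) + (1 - ?Q) = (transport V (U s) + (1 - ?Q)) * (transport V (U t) + (1 - ?Q))" for t
      unfolding W using cov by (simp add: covariant_rep_def)
    fix c assume "c \<in> C"
    hence c: "U s * \<pi> c * adj (U s) = \<pi> (\<gamma> s c)" using cov by (simp add: covariant_rep_def)
    have "(transport V (U s) + (1 - ?Q)) * transport V (\<pi> c) * adj (transport V (U s) + (1 - ?Q))
        = transport V (U s) * transport V (\<pi> c) * (transport V (adj (U s)) + (1 - ?Q))"
      unfolding adjW distrib_right[of _ _ "transport V (\<pi> c)"] Q by simp
    also have "\<dots> = transport V (U s) * transport V (\<pi> c) * transport V (adj (U s)) + transport V (U s) * (transport V (\<pi> c) * (1 - ?Q))"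
      by (simp only: distrib_left mult.assoc)
    finally show "(transport V (U s) + (1 - ?Q)) * transport V (\<pi> c) * adj (transport V (U s) + (1 - ?Q)) = transport V (\<pi> (\<gamma> s c))"
      unfolding Q by (simp add: c flip: t)
  qed
qed

context covariant_system
begin

text \<open>Universality is formulated for representations on the test space, so the regular
  representation is first moved there by an isometry. The homomorphism \<Phi> then obtained is
  contractive, and transport preserves the norm of z.\<close>

lemma universal_dominates_regular:
  assumes univ: "universal_covariant_rep C \<gamma> \<pi> U" and yz: "(y, z) \<in> crossed_pairs C \<pi> U (regular_rep \<gamma>) l2_shift"
  shows "norm z \<le> norm y"
proof -
  interpret reg: regular_system C \<gamma> by unfold_locales (rule C \<gamma>)+
  obtain V :: "('g, 'k) l2 \<Rightarrow> ('k bop \<times> 'g, complex) l2" where "partial_isometry V 1"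
    by (rule isometry_to_test_space)
  then interpret V: partial_isometry V 1 .
  obtain \<Phi> where \<Phi>: "star_hom_on (crossed_product C \<pi> U) \<Phi>"
    "\<forall>c\<in>C. \<forall>s. \<Phi> (\<pi> c * U s) = transport V (regular_rep \<gamma> c) * (transport V (l2_shift s) + (1 - transport V 1))"
    using univ[unfolded universal_covariant_rep_def, THEN conjunct2, rule_format, OF V.covariant_rep_transport[OF refl reg.cov]] by blast
  note t = V.isometry_transport(2)[OF refl, symmetric]
  have mono: "\<Phi> (\<pi> c * U s) = transport V (regular_rep \<gamma> c * l2_shift s)" if "c \<in> C" for c s
    using \<Phi>(2) that by (simp add: distrib_left right_diff_distrib t)
  note CP = cstar_algebra_crossed_product
  note \<Phi>h = star_homD[OF \<Phi>(1) CP]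
  have sub: "y \<in> crossed_sums C \<pi> U \<Longrightarrow> y \<in> crossed_product C \<pi> U" for y
    unfolding crossed_product_def by (rule subsetD[OF closure_subset])
  have "y \<in> crossed_sums C \<pi> U \<and> \<Phi> y = transport V z"
    using yz
  proof (induction y z rule: crossed_pairs.induct)
    case zero show ?case using crossed_sums_zero[OF order_refl Ci(2,3)] by (simp add: \<Phi>h transport_scaleR[OF V.V, of 0 0, simplified])
  next
    case (plus a y z g)
    have m: "\<pi> a * U g \<in> crossed_sums C \<pi> U" by (rule crossed_sums_monomial[OF plus(1)])
    thus ?case using plus crossed_sums_plus[OF order_refl Ci(2,3) m]
      by (simp add: \<Phi>h(1)[OF sub[OF m] sub] mono transport_plus[OF V.V])
  qed
  hence y: "y \<in> crossed_product C \<pi> U" "\<Phi> y = transport V z" using sub by simp_all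
  have "norm z = norm (transport V z)" by (simp add: V.isometry_transport(3))
  also have "\<dots> \<le> norm y" using star_hom_contractive[OF CP \<Phi>(1) y(1)] y(2) by simp
  finally show ?thesis .
qed

text \<open>The two dominations make the graph of corresponding sums isometric. The graph is
  invariant under adjoints, so the isomorphism of closures is a *-isomorphism.\<close>

theorem amenable_full_reduced:
  assumes am: "amenable TYPE('g)" and univ: "universal_covariant_rep C \<gamma> \<pi> U"
  obtains \<kappa> where "star_hom_on (crossed_product C \<pi> U) \<kappa>" "\<And>y. y \<in> crossed_product C \<pi> U \<Longrightarrow> norm (\<kappa> y) = norm y"
    "\<kappa> ` crossed_product C \<pi> U = reduced_crossed_product C \<gamma>"
    "\<And>c s. c \<in> C \<Longrightarrow> \<kappa> (\<pi> c * U s) = regular_rep \<gamma> c * l2_shift s"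
proof -
  interpret reg: regular_system C \<gamma> by unfold_locales (rule C \<gamma>)+
  let ?G = "crossed_pairs C \<pi> U (regular_rep \<gamma>) l2_shift"
  have id: "algebra_hom_on C (\<lambda>c. c)" by (simp add: algebra_hom_on_def)
  note OC = cstar_algebraD(1)[OF C]
  have G: "isometric_graph ?G"
  proof (rule isometric_graph_crossed_pairs[OF covariant_system_axioms id _ _ reg.covariant_system_axioms id _ _ OC \<gamma>C])
    fix y z assume "(y, z) \<in> ?G"
    thus "norm z = norm y" by (intro antisym universal_dominates_regular[OF univ] amenable_regular_dominates[OF am])
  qed simp_all
  have fst: "closure (fst ` ?G) = crossed_product C \<pi> U"
    by (simp add: crossed_product_def fst_crossed_pairs[OF covariant_system_axioms OC id, simplified])
  have snd: "closure (snd ` ?G) = reduced_crossed_product C \<gamma>"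
    by (simp add: snd_crossed_pairs crossed_product_def reduced_crossed_product_def fst_crossed_pairs[OF reg.covariant_system_axioms OC id, simplified])
  obtain \<kappa> where \<kappa>: "algebra_hom_on (crossed_product C \<pi> U) \<kappa>"
    "\<And>y z. (y, z) \<in> closure ?G \<Longrightarrow> y \<in> crossed_product C \<pi> U \<and> \<kappa> y = z"
    "\<And>y. y \<in> crossed_product C \<pi> U \<Longrightarrow> (y, \<kappa> y) \<in> closure ?G"
    "\<And>y. y \<in> crossed_product C \<pi> U \<Longrightarrow> norm (\<kappa> y) = norm y"
    "\<kappa> ` crossed_product C \<pi> U = reduced_crossed_product C \<gamma>"
    by (rule isometric_extension[OF G]) (unfold fst snd, rule that)
  have adjG: "(adj y, adj z) \<in> ?G" if "(y, z) \<in> ?G" for y z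
    using that
  proof (induction y z rule: crossed_pairs.induct)
    case zero show ?case by (simp add: crossed_pairs.zero)
  next
    case (plus a y z g)
    have "\<gamma> (- g) (adj a) \<in> C" by (intro \<gamma>C Ca plus(1))
    from crossed_pairs.plus[OF this plus(3), of "- g"] show ?case
      by (simp only: adj_plus monomial_adj[OF plus(1)] reg.monomial_adj[OF plus(1)])
  qed
  have "\<kappa> (adj y) = adj (\<kappa> y)" if y: "y \<in> crossed_product C \<pi> U" for y
  proof -
    have "(adj (fst (y, \<kappa> y)), adj (snd (y, \<kappa> y))) \<in> closure ?G"
      by (rule closure_map[where f="\<lambda>p. (adj (fst p), adj (snd p))", OF _ _ \<kappa>(3)[OF y]]) (auto simp: adjG intro!: continuous_intros)
    hence "(adj y, adj (\<kappa> y)) \<in> closure ?G" by simp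
    thus ?thesis using \<kappa>(2) by blast
  qed
  hence "star_hom_on (crossed_product C \<pi> U) \<kappa>" using \<kappa>(1) by (simp add: star_hom_on_def)
  moreover have "\<kappa> (\<pi> c * U s) = regular_rep \<gamma> c * l2_shift s" if "c \<in> C" for c s
    using \<kappa>(2)[OF subsetD[OF closure_subset crossed_pairs_monomial[OF that]]] by blast
  ultimately show ?thesis using \<kappa>(4,5) that by blast
qed

end

lemma star_isomorphic_sym:
  assumes C: "cstar_algebra C" and "star_isomorphic C D"
  shows "star_isomorphic D C"
proof -
  obtain \<phi> where \<phi>: "star_hom_on C \<phi>" "bij_betw \<phi> C D" using assms(2) unfolding star_isomorphic_def by blast
  have "star_hom_on D (inv_into C \<phi>)"
    using inv_star_hom[OF C \<phi>(1)] \<phi>(2) by (simp add: bij_betw_def)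
  thus ?thesis using bij_betw_inv_into[OF \<phi>(2)] unfolding star_isomorphic_def by blast
qed

lemma star_isomorphic_trans:
  assumes "star_isomorphic B C" "star_isomorphic C D"
  shows "star_isomorphic B D"
proof -
  obtain \<phi> \<psi> where \<phi>: "star_hom_on B \<phi>" "bij_betw \<phi> B C" and \<psi>: "star_hom_on C \<psi>" "bij_betw \<psi> C D"
    using assms unfolding star_isomorphic_def by blast
  have "star_hom_on B (\<lambda>x. \<psi> (\<phi> x))" using \<phi> \<psi> by (intro star_hom_compose[OF \<phi>(1) \<psi>(1)]) (simp add: bij_betw_def)
  moreover have "bij_betw (\<lambda>x. \<psi> (\<phi> x)) B D" using bij_betw_trans[OF \<phi>(2) \<psi>(2)] by (simp add: comp_def)
  ultimately show ?thesis unfolding star_isomorphic_def by blast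
qed

lemma (in covariant_system) crossed_product_image:
  assumes \<kappa>: "star_hom_on (crossed_product C \<pi> U) \<kappa>" "\<And>y. y \<in> crossed_product C \<pi> U \<Longrightarrow> norm (\<kappa> y) = norm y"
      "\<And>c s. c \<in> C \<Longrightarrow> \<kappa> (\<pi> c * U s) = \<rho> c * V s"
    and X: "operator_algebra X" "X \<subseteq> C" "\<And>g a. a \<in> X \<Longrightarrow> \<gamma> g a \<in> X"
  shows "crossed_product X \<pi> U \<subseteq> crossed_product C \<pi> U" "\<kappa> ` crossed_product X \<pi> U = crossed_product X \<rho> V"
proof -
  note CP = cstar_algebra_crossed_product and XP = operator_algebra_crossed_product[OF X(1,2)]
  note \<kappa>h = star_homD[OF \<kappa>(1) CP]
  show sub: "crossed_product X \<pi> U \<subseteq> crossed_product C \<pi> U"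
    unfolding crossed_product_def by (rule closure_mono[OF crossed_sums_mono[OF X(2)]])
  have sum: "\<kappa> (\<Sum>g\<in>S. \<pi> (a g) * U g) = (\<Sum>g\<in>S. \<rho> (a g) * V g)" if a: "\<And>g. g \<in> S \<Longrightarrow> a g \<in> X" for S a
  proof -
    have aC: "a g \<in> C" if "g \<in> S" for g using a[OF that] X(2) by blast
    have P: "\<pi> (a g) * U g \<in> crossed_product C \<pi> U" if "g \<in> S" for g
      unfolding crossed_product_def by (rule subsetD[OF closure_subset crossed_sums_monomial[OF aC[OF that]]])
    have "\<kappa> (\<Sum>g\<in>S. \<pi> (a g) * U g) = (\<Sum>g\<in>S. \<kappa> (\<pi> (a g) * U g))" by (rule \<kappa>h(8)[OF P])
    also have "\<dots> = (\<Sum>g\<in>S. \<rho> (a g) * V g)" by (rule sum.cong[OF refl \<kappa>(3)[OF aC]])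
    finally show ?thesis .
  qed
  have "\<kappa> ` crossed_product X \<pi> U \<subseteq> crossed_product X \<rho> V"
  proof
    fix w assume "w \<in> \<kappa> ` crossed_product X \<pi> U"
    then obtain y where y: "y \<in> crossed_product X \<pi> U" "w = \<kappa> y" by blast
    obtain u where u: "\<forall>n. u n \<in> crossed_sums X \<pi> U" "u \<longlonglongrightarrow> y"
      using y(1) unfolding crossed_product_def closure_sequential by (elim exE conjE)
    have uC: "u n \<in> crossed_product C \<pi> U" for n
      using sub u(1) closure_subset[of "crossed_sums X \<pi> U"] unfolding crossed_product_def by blast
    have "\<kappa> (u n) \<in> crossed_sums X \<rho> V" for n
    proof -
      obtain S a where S: "finite S" "\<forall>g\<in>S. a g \<in> X" "u n = (\<Sum>g\<in>S. \<pi> (a g) * U g)"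
        using u(1)[rule_format, of n] unfolding crossed_sums_def by blast
      show ?thesis unfolding S(3) using S(1,2) by (subst sum) (auto intro: crossed_sumsI)
    qed
    moreover have "(\<lambda>n. \<kappa> (u n)) \<longlonglongrightarrow> w"
      unfolding y(2) by (rule star_hom_tendsto[OF CP \<kappa>(1) uC subsetD[OF sub y(1)] u(2)])
    ultimately show "w \<in> crossed_product X \<rho> V"
      unfolding crossed_product_def closure_sequential by (intro exI[of _ "\<lambda>n. \<kappa> (u n)"]) simp
  qed
  moreover have "crossed_product X \<rho> V \<subseteq> \<kappa> ` crossed_product X \<pi> U"
    unfolding crossed_product_def[of X \<rho> V]
  proof (rule closure_minimal)
    have "algebra_hom_on (crossed_product X \<pi> U) \<kappa>"
      using star_hom_on_subset[OF \<kappa>(1) sub] by (rule star_hom_onD(1))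
    thus "closed (\<kappa> ` crossed_product X \<pi> U)"
      by (intro operator_algebraD(1) operator_algebra_isometric_image XP X(3) \<kappa>(2) subsetD[OF sub])
    show "crossed_sums X \<rho> V \<subseteq> \<kappa> ` crossed_product X \<pi> U"
    proof
      fix w assume "w \<in> crossed_sums X \<rho> V"
      then obtain S a where S: "finite S" "\<forall>g\<in>S. a g \<in> X" "w = (\<Sum>g\<in>S. \<rho> (a g) * V g)"
        unfolding crossed_sums_def by blast
      have "(\<Sum>g\<in>S. \<pi> (a g) * U g) \<in> crossed_product X \<pi> U"
        unfolding crossed_product_def using S by (intro subsetD[OF closure_subset] crossed_sumsI) auto
      thus "w \<in> \<kappa> ` crossed_product X \<pi> U" using sum[of S a] S by force
    qed
  qed
  ultimately show "\<kappa> ` crossed_product X \<pi> U = crossed_product X \<rho> V" by blast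
qed

section \<open>Envelopes of the reduced and of the full relative crossed product\<close>

context envelope_system
begin

lemma envelope_reduced:
  fixes F :: "'f::complex_hilbert bop set"
  assumes "admissible_cover A \<alpha> C \<iota> \<gamma>" and F: "cstar_envelope (relative_reduced_crossed_product A \<iota> \<gamma>) F k"
  shows "star_isomorphic F (reduced_crossed_product E \<beta>)"
proof -
  interpret C: admissible_system A \<alpha> C \<iota> \<gamma> by unfold_locales (rule dyn assms)+
  obtain \<kappa> where "algebra_hom_on (relative_reduced_crossed_product A \<iota> \<gamma>) \<kappa>"
    "completely_isometric_on (relative_reduced_crossed_product A \<iota> \<gamma>) \<kappa>"
    "\<kappa> ` relative_reduced_crossed_product A \<iota> \<gamma> = relative_reduced_crossed_product A j \<beta>"
    by (rule reduced_crossed_product_cover_independent[OF C.admissible_system_axioms admissible_system_axioms]) (rule that)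
  thus ?thesis by (rule envelope_isomorphic[OF C.operator_algebra_relative_reduced _ _ _ F])
qed

text \<open>For the cover M amenability identifies the full with the reduced crossed product and
  carries the relative crossed product of A along; independence of the cover then leads from M to E,
  so that \<open>envelope_isomorphic\<close> applies. On the other side, amenability identifies the
  two crossed products of E itself.\<close>

lemma envelope_full:
  fixes F :: "'f::complex_hilbert bop set"
  assumes am: "amenable TYPE('g)" and M: "admissible_cover A \<alpha> M m \<mu>"
    and univM: "universal_covariant_rep M \<mu> \<pi>\<^sub>M U\<^sub>M" and univE: "universal_covariant_rep E \<beta> \<pi>\<^sub>E U\<^sub>E"
    and F: "cstar_envelope (relative_crossed_product A m \<pi>\<^sub>M U\<^sub>M) F k"
  shows "star_isomorphic F (crossed_product E \<pi>\<^sub>E U\<^sub>E)"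
proof -
  interpret M: admissible_system A \<alpha> M m \<mu> by unfold_locales (rule dyn M)+
  have covM: "covariant_rep M \<mu> \<pi>\<^sub>M U\<^sub>M" and covE: "covariant_rep E \<beta> \<pi>\<^sub>E U\<^sub>E"
    using univM univE by (simp_all add: universal_covariant_rep_def)
  interpret FM: covariant_system M \<mu> \<pi>\<^sub>M U\<^sub>M by unfold_locales (rule M.cstarC M.actC covM)+
  interpret FE: covariant_system E \<beta> \<pi>\<^sub>E U\<^sub>E by unfold_locales (rule cstarC actC covE)+
  let ?B = "crossed_product (m ` A) \<pi>\<^sub>M U\<^sub>M"
  obtain \<theta> where \<theta>: "star_hom_on (crossed_product M \<pi>\<^sub>M U\<^sub>M) \<theta>"
    "\<And>y. y \<in> crossed_product M \<pi>\<^sub>M U\<^sub>M \<Longrightarrow> norm (\<theta> y) = norm y"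
    "\<And>c s. c \<in> M \<Longrightarrow> \<theta> (\<pi>\<^sub>M c * U\<^sub>M s) = regular_rep \<mu> c * l2_shift s"
    by (rule FM.amenable_full_reduced[OF am univM]) (rule that)
  note img = FM.crossed_product_image[OF \<theta> M.image, folded M.relative_reduced_eq]
  have \<theta>_ci: "completely_isometric_on (crossed_product M \<pi>\<^sub>M U\<^sub>M) \<theta>"
    by (rule isometric_star_hom_completely_isometric[OF FM.cstar_algebra_crossed_product \<theta>(1,2)])
  obtain \<kappa> where \<kappa>: "algebra_hom_on (relative_reduced_crossed_product A m \<mu>) \<kappa>"
    "completely_isometric_on (relative_reduced_crossed_product A m \<mu>) \<kappa>"
    "\<kappa> ` relative_reduced_crossed_product A m \<mu> = relative_reduced_crossed_product A j \<beta>"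
    by (rule reduced_crossed_product_cover_independent[OF M.admissible_system_axioms admissible_system_axioms]) (rule that)
  have B: "\<theta> b \<in> relative_reduced_crossed_product A m \<mu>" "b \<in> crossed_product M \<pi>\<^sub>M U\<^sub>M" if "b \<in> ?B" for b
    using img that by auto
  have "star_isomorphic F R"
  proof (rule envelope_isomorphic)
    show "operator_algebra ?B" by (rule FM.operator_algebra_crossed_product[OF M.image])
    show "cstar_envelope ?B F k" using F unfolding M.relative_crossed_product_eq[OF covM] .
    show "algebra_hom_on ?B (\<lambda>b. \<kappa> (\<theta> b))"
      using \<kappa>(1) star_hom_onD(1)[OF \<theta>(1)] B unfolding algebra_hom_on_def by simp
    show "completely_isometric_on ?B (\<lambda>b. \<kappa> (\<theta> b))"
      using \<kappa>(2) \<theta>_ci B unfolding completely_isometric_on_def by simp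
    show "(\<lambda>b. \<kappa> (\<theta> b)) ` ?B = BB" using \<kappa>(3) img(2) by (simp flip: image_image)
  qed
  moreover have "star_isomorphic (crossed_product E \<pi>\<^sub>E U\<^sub>E) R"
  proof -
    obtain \<eta> where \<eta>: "star_hom_on (crossed_product E \<pi>\<^sub>E U\<^sub>E) \<eta>" "\<And>y. y \<in> crossed_product E \<pi>\<^sub>E U\<^sub>E \<Longrightarrow> norm (\<eta> y) = norm y"
      "\<eta> ` crossed_product E \<pi>\<^sub>E U\<^sub>E = R"
      by (rule FE.amenable_full_reduced[OF am univE]) (rule that)
    have "bij_betw \<eta> (crossed_product E \<pi>\<^sub>E U\<^sub>E) R"
      using isometric_imp_inj_on[OF FE.cstar_algebra_crossed_product \<eta>(1,2)] \<eta>(3) by (simp add: bij_betw_def)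
    thus ?thesis unfolding star_isomorphic_def using \<eta>(1) by blast
  qed
  ultimately show ?thesis
    using star_isomorphic_trans star_isomorphic_sym[OF FE.cstar_algebra_crossed_product] by blast
qed

end

theorem theorem2p5:
  fixes A :: "'h::complex_hilbert bop set"
    and \<alpha> :: "'g::group_add \<Rightarrow> 'h bop \<Rightarrow> 'h bop"
    and \<F> :: "'i filter"
    and e :: "'i \<Rightarrow> 'h bop"
    and E :: "'e::complex_hilbert bop set"
    and j :: "'h bop \<Rightarrow> 'e bop"
    and \<beta> :: "'g \<Rightarrow> 'e bop \<Rightarrow> 'e bop"
  assumes "dynamical_system A \<alpha>"
    and "contractive_approximate_unit A \<F> e"
    and "\<And>i. adj (e i) = e i"
    and "cstar_envelope A E j"
    and "admissible_cover A \<alpha> E j \<beta>"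
  shows "(\<forall>(C :: 'c::complex_hilbert bop set) \<iota> \<gamma> (F :: 'f::complex_hilbert bop set) k.
            admissible_cover A \<alpha> C \<iota> \<gamma> \<longrightarrow>
            cstar_envelope (relative_reduced_crossed_product A \<iota> \<gamma>) F k \<longrightarrow>
            star_isomorphic F (reduced_crossed_product E \<beta>))
       \<and> (amenable TYPE('g) \<longrightarrow>
          (\<forall>(M :: 'm::complex_hilbert bop set) m \<mu>
             (\<pi>\<^sub>M :: 'm bop \<Rightarrow> 'u::complex_hilbert bop) U\<^sub>M
             (\<pi>\<^sub>E :: 'e bop \<Rightarrow> 'v::complex_hilbert bop) U\<^sub>E
             (F :: 'n::complex_hilbert bop set) k.
            cstar_maximal A M m \<longrightarrow> admissible_cover A \<alpha> M m \<mu> \<longrightarrow>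
            universal_covariant_rep M \<mu> \<pi>\<^sub>M U\<^sub>M \<longrightarrow>
            universal_covariant_rep E \<beta> \<pi>\<^sub>E U\<^sub>E \<longrightarrow>
            cstar_envelope (relative_crossed_product A m \<pi>\<^sub>M U\<^sub>M) F k \<longrightarrow>
            star_isomorphic F (crossed_product E \<pi>\<^sub>E U\<^sub>E)))"
proof -
  interpret envelope_system A \<alpha> E j \<beta> \<F> e
    by unfold_locales (rule assms)+
  show ?thesis using envelope_reduced envelope_full by blast
qed

end
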